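(* Let $\rho$ be a critical radius function on $\mathbb{R}^d$ and let $T$ be a linear operator with associated kernel $K$. Suppose that for some $s>1$, $K$ satisfies the following estimates. (a) For each $N>0$ there exists $C_N$ such that $$\left(\int_{R<|x_0-x|<2R}|K(x,y)|^s\,dx\right)^{1/s}\le C_N R^{-d/s'}\left(1+\frac{R}{\rho(x_0)}\right)^{-N}$$ whenever $|y-x_0|<R/2$. (b) There exists a Calderón-Zygmund operator $T_0$ with kernel $K_0$ such that, for some $C$ and $\delta>0$, $$\left(\int_{R<|x_0-x|<2R}|K(x,y)-K_0(x,y)|^s\,dx\right)^{1/s}\le C R^{-d/s'}\left(\frac{R}{\rho(x_0)}\right)^{\delta}$$ whenever $|y-x_0|<R/2$ with $R\le\rho(x_0)$. Then, for each $\theta\ge 0$, the operator $T$ and its adjoint $T^\star$ satisfy the following inequalities for any weight $w$: (i) $$\int |Tf|^p\,w\le C_\theta\int |f|^p\,M_r^\theta w$$ for $1<p<s$ and $r=(s/p)'$; (ii) $$\int |T^\star f|^p\,w\le C_\theta\int|f|^p\,(M_A^{\mathrm{loc}}+M^\theta)w$$ for $s'<p<\infty$ and any Young function $A\in\mathcal{D}_p$.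
   Context: For an exponent $t$, $t'$ is the conjugate exponent. A weight is a function $w\ge0$ in $L^1_{\mathrm{loc}}(\mathbb{R}^d)$. $C_\theta$ denotes a constant that may depend on $\theta$ but not on $f$ or $w$. A critical radius function is a function $\rho:\mathbb{R}^d\to(0,\infty)$ for which there are constants $C_0$ and $N_0\ge1$ such that for all $x,y$ $$C_0^{-1}\rho(x)\left(1+\tfrac{|x-y|}{\rho(x)}\right)^{-N_0}\le\rho(y)\le C_0\,\rho(x)\left(1+\tfrac{|x-y|}{\rho(x)}\right)^{\frac{N_0}{N_0+1}}.$$ A Young function is a continuous, convex, increasing $A:[0,\infty)\to[0,\infty)$ with $A(0)=0$. For a ball $B$, $\|f\|_{A,B}=\inf\{\lambda>0:\frac1{|B|}\int_B A(|f|/\lambda)\le1\}$. For $1<p<\infty$, $\mathcal{D}_p$ is the class of Young functions $A$ such that $\int_c^\infty (t/A(t))^{p'-1}\frac{dt}{t}<\infty$ for some $c>0$. Maximal operators: $M_A^{\mathrm{loc}}f(x)=\sup\|f\|_{A,B}$, the supremum over balls $B=B(x_0,r_0)\ni x$ with $r_0\le\rho(x_0)$; and for $\theta\ge0$, $M_A^\theta f(x)=\sup_{B(x_0,r_0)\ni x}\left(1+\frac{r_0}{\rho(x_0)}\right)^{-\theta}\|f\|_{A,B(x_0,r_0)}$. When $A(t)=t^r$ write $M_r^{\mathrm{loc}}$ and $M_r^\theta$; $M^\theta=M_1^\theta$. Calderón-Zygmund operators are understood in the standard sense.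
   Formalization: T is additionally assumed bounded on L^q for some 1<q<∞, with f in L^q in (i) and in L^{q'} in (ii); without a bound, Tf(x)=|x|f(x) has kernel K=0, satisfies (a) and (b) with T_0=0, and violates (i) for w=1. *)

theory Defs
  imports "HOL-Analysis.Analysis"
begin

definition conj_exp :: "real \<Rightarrow> real" where
  "conj_exp t = t / (t - 1)"

definition critical_radius_function :: "('a::euclidean_space \<Rightarrow> real) \<Rightarrow> bool" where
  "critical_radius_function \<rho> \<longleftrightarrow>
     (\<forall>x. 0 < \<rho> x) \<and>
     (\<exists>C0 N0. 0 < C0 \<and> 1 \<le> N0 \<and>
       (\<forall>x y. inverse C0 * \<rho> x * (1 + norm (x - y) / \<rho> x) powr (- N0) \<le> \<rho> y \<and>
              \<rho> y \<le> C0 * \<rho> x * (1 + norm (x - y) / \<rho> x) powr (N0 / (N0 + 1))))"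

definition weight :: "('a::euclidean_space \<Rightarrow> real) \<Rightarrow> bool" where
  "weight w \<longleftrightarrow> (\<forall>x. 0 \<le> w x) \<and> (\<forall>S. compact S \<longrightarrow> w absolutely_integrable_on S)"

text \<open>Only the values of \<open>A\<close> on \<open>{0..}\<close> are relevant; non-negativity there follows from
  monotonicity and \<open>A 0 = 0\<close>.\<close>

definition young_function :: "(real \<Rightarrow> real) \<Rightarrow> bool" where
  "young_function A \<longleftrightarrow>
     continuous_on {0..} A \<and> convex_on {0..} A \<and> mono_on {0..} A \<and> A 0 = 0"

text \<open>The positivity clause is needed because \<open>t / 0 = 0\<close>: without it the integral
  would converge for \<open>A = 0\<close>, where it should diverge.\<close>

definition class_D :: "real \<Rightarrow> (real \<Rightarrow> real) set" where
  "class_D p = {A. young_function A \<and>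
     (\<exists>c>0. (\<forall>t>c. 0 < A t) \<and>
        set_integrable lebesgue {c<..} (\<lambda>t. (t / A t) powr (conj_exp p - 1) / t))}"

text \<open>Extended values: the infimum of the empty set is \<open>\<infinity>\<close>.\<close>

definition luxemburg ::
    "(real \<Rightarrow> real) \<Rightarrow> 'a::euclidean_space set \<Rightarrow> ('a \<Rightarrow> real) \<Rightarrow> ennreal" where
  "luxemburg A B f = Inf {ennreal l | l. 0 < l \<and>
     (\<integral>\<^sup>+x\<in>B. ennreal (A (\<bar>f x\<bar> / l)) \<partial>lebesgue) / emeasure lebesgue B \<le> 1}"

definition max_loc ::
    "('a::euclidean_space \<Rightarrow> real) \<Rightarrow> (real \<Rightarrow> real) \<Rightarrow> ('a \<Rightarrow> real) \<Rightarrow> 'a \<Rightarrow> ennreal" where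
  "max_loc \<rho> A f x =
     (SUP (x0, r0) \<in> {(x0, r0). 0 < r0 \<and> r0 \<le> \<rho> x0 \<and> x \<in> ball x0 r0}.
        luxemburg A (ball x0 r0) f)"

definition max_theta ::
    "('a::euclidean_space \<Rightarrow> real) \<Rightarrow> real \<Rightarrow> (real \<Rightarrow> real) \<Rightarrow> ('a \<Rightarrow> real) \<Rightarrow> 'a \<Rightarrow> ennreal" where
  "max_theta \<rho> \<theta> A f x =
     (SUP (x0, r0) \<in> {(x0, r0). 0 < r0 \<and> x \<in> ball x0 r0}.
        ennreal ((1 + r0 / \<rho> x0) powr (- \<theta>)) * luxemburg A (ball x0 r0) f)"

definition max_theta_pow ::
    "('a::euclidean_space \<Rightarrow> real) \<Rightarrow> real \<Rightarrow> real \<Rightarrow> ('a \<Rightarrow> real) \<Rightarrow> 'a \<Rightarrow> ennreal" where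
  "max_theta_pow \<rho> \<theta> r = max_theta \<rho> \<theta> (\<lambda>t. t powr r)"

definition Lp :: "real \<Rightarrow> 'a::euclidean_space set \<Rightarrow> ('a \<Rightarrow> complex) set" where
  "Lp p S = {f \<in> borel_measurable (lebesgue_on S).
     integrable (lebesgue_on S) (\<lambda>x. norm (f x) powr p)}"

definition Lp_norm :: "real \<Rightarrow> 'a::euclidean_space set \<Rightarrow> ('a \<Rightarrow> complex) \<Rightarrow> real" where
  "Lp_norm p S f = (\<integral>x. norm (f x) powr p \<partial>lebesgue_on S) powr (1 / p)"

text \<open>Elements of \<open>L\<^sup>q\<close> are represented by functions, so linearity holds almost everywhere.
  Compatibility with almost-everywhere equality follows from linearity and boundedness.\<close>

definition bounded_operator ::
    "real \<Rightarrow> (('a::euclidean_space \<Rightarrow> complex) \<Rightarrow> ('a \<Rightarrow> complex)) \<Rightarrow> bool" where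
  "bounded_operator q T \<longleftrightarrow>
     (\<forall>f\<in>Lp q UNIV. T f \<in> Lp q UNIV) \<and>
     (\<forall>f\<in>Lp q UNIV. \<forall>g\<in>Lp q UNIV.
        AE x in lebesgue. T (\<lambda>y. f y + g y) x = T f x + T g x) \<and>
     (\<forall>c. \<forall>f\<in>Lp q UNIV. AE x in lebesgue. T (\<lambda>y. c * f y) x = c * T f x) \<and>
     (\<exists>C. \<forall>f\<in>Lp q UNIV. Lp_norm q UNIV (T f) \<le> C * Lp_norm q UNIV f)"

definition is_adjoint ::
    "real \<Rightarrow> (('a::euclidean_space \<Rightarrow> complex) \<Rightarrow> ('a \<Rightarrow> complex))
       \<Rightarrow> (('a \<Rightarrow> complex) \<Rightarrow> ('a \<Rightarrow> complex)) \<Rightarrow> bool" where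
  "is_adjoint q T Tstar \<longleftrightarrow>
     (\<forall>g\<in>Lp (conj_exp q) UNIV. Tstar g \<in> Lp (conj_exp q) UNIV) \<and>
     (\<forall>f\<in>Lp q UNIV. \<forall>g\<in>Lp (conj_exp q) UNIV.
        (\<integral>x. T f x * cnj (g x) \<partial>lebesgue) = (\<integral>x. f x * cnj (Tstar g x) \<partial>lebesgue))"

text \<open>The kernel represents the operator off the support, for bounded measurable functions
  with compact support. It may be arbitrary on the diagonal.
  Multiplication operators have kernel \<open>0\<close> in this sense, so this notion is only used
  together with an a priori bound on some \<open>L\<^sup>q\<close>.\<close>

definition has_kernel ::
    "(('a::euclidean_space \<Rightarrow> complex) \<Rightarrow> ('a \<Rightarrow> complex)) \<Rightarrow> ('a \<Rightarrow> 'a \<Rightarrow> complex) \<Rightarrow> bool" where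
  "has_kernel T K \<longleftrightarrow>
     (\<lambda>(x, y). K x y) \<in> borel_measurable lebesgue \<and>
     (\<forall>f. f \<in> borel_measurable lebesgue \<and> bounded (range f) \<and> compact (closure {y. f y \<noteq> 0}) \<longrightarrow>
        (AE x in lebesgue. x \<notin> closure {y. f y \<noteq> 0} \<longrightarrow>
           integrable lebesgue (\<lambda>y. K x y * f y) \<and>
           T f x = (\<integral>y. K x y * f y \<partial>lebesgue)))"

definition standard_kernel :: "('a::euclidean_space \<Rightarrow> 'a \<Rightarrow> complex) \<Rightarrow> bool" where
  "standard_kernel K \<longleftrightarrow>
     (\<exists>C \<epsilon>. 0 < \<epsilon> \<and> \<epsilon> \<le> 1 \<and>
       (\<forall>x y. x \<noteq> y \<longrightarrow> norm (K x y) \<le> C / norm (x - y) ^ DIM('a)) \<and>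
       (\<forall>x x' y. x \<noteq> y \<and> norm (x - x') \<le> norm (x - y) / 2 \<longrightarrow>
          norm (K x y - K x' y) \<le> C * norm (x - x') powr \<epsilon> / norm (x - y) powr (real DIM('a) + \<epsilon>)) \<and>
       (\<forall>x y y'. x \<noteq> y \<and> norm (y - y') \<le> norm (x - y) / 2 \<longrightarrow>
          norm (K x y - K x y') \<le> C * norm (y - y') powr \<epsilon> / norm (x - y) powr (real DIM('a) + \<epsilon>)))"

definition calderon_zygmund ::
    "(('a::euclidean_space \<Rightarrow> complex) \<Rightarrow> ('a \<Rightarrow> complex)) \<Rightarrow> ('a \<Rightarrow> 'a \<Rightarrow> complex) \<Rightarrow> bool" where
  "calderon_zygmund T K \<longleftrightarrow> bounded_operator 2 T \<and> standard_kernel K \<and> has_kernel T K"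

definition annulus :: "'a::euclidean_space \<Rightarrow> real \<Rightarrow> 'a set" where
  "annulus x0 R = {x. R < norm (x0 - x) \<and> norm (x0 - x) < 2 * R}"

definition kernel_decay ::
    "('a::euclidean_space \<Rightarrow> real) \<Rightarrow> real \<Rightarrow> ('a \<Rightarrow> 'a \<Rightarrow> complex) \<Rightarrow> bool" where
  "kernel_decay \<rho> s K \<longleftrightarrow>
     (\<forall>N>0. \<exists>C. \<forall>x0 y R. 0 < R \<and> norm (y - x0) < R / 2 \<longrightarrow>
        (\<lambda>x. K x y) \<in> Lp s (annulus x0 R) \<and>
        Lp_norm s (annulus x0 R) (\<lambda>x. K x y)
          \<le> C * R powr (- (real DIM('a) / conj_exp s)) * (1 + R / \<rho> x0) powr (- N))"

definition kernel_close ::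
    "('a::euclidean_space \<Rightarrow> real) \<Rightarrow> real \<Rightarrow> ('a \<Rightarrow> 'a \<Rightarrow> complex) \<Rightarrow> ('a \<Rightarrow> 'a \<Rightarrow> complex) \<Rightarrow> bool"
  where
  "kernel_close \<rho> s K K0 \<longleftrightarrow>
     (\<exists>C \<delta>. 0 < \<delta> \<and>
       (\<forall>x0 y R. 0 < R \<and> norm (y - x0) < R / 2 \<and> R \<le> \<rho> x0 \<longrightarrow>
          (\<lambda>x. K x y - K0 x y) \<in> Lp s (annulus x0 R) \<and>
          Lp_norm s (annulus x0 R) (\<lambda>x. K x y - K0 x y)
            \<le> C * R powr (- (real DIM('a) / conj_exp s)) * (R / \<rho> x0) powr \<delta>))"

end

theory Submission
 imports Defs
begin

text \<open>Both inequalities follow by duality from an additive bilinear estimate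
 \<open>\<integral> |T f| g \<le> C (\<integral> |f|\<^sup>p W + \<integral> h\<^sup>q)\<close> with \<open>g = h w\<^bsup>1/p\<^esup>\<close>, \<open>q = p'\<close> and \<open>W\<close> the maximal function of \<open>w\<close>;
 for the adjoint, \<open>f\<close> and \<open>g\<close> exchange their roles. The space is divided into dyadic cubes
 \<open>P\<close> whose side is comparable to a small multiple of \<open>\<rho>\<close>. For \<open>x \<in> P\<close> the part of \<open>f\<close> away from \<open>P\<close>
 is handled by the decay of the kernel: on each annulus one uses Hoelder's inequality with
 exponent \<open>s\<close>, and the polynomial growth of \<open>\<rho>\<close> is beaten by the factor \<open>(1 + R / \<rho>)\<^bsup>-N\<^esup>\<close>. On the part
 of \<open>f\<close> near \<open>P\<close> the operator equals \<open>T\<^sub>0\<close> up to the kernel \<open>K - K\<^sub>0\<close>, summed over shrinking annuli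
 thanks to the factor \<open>(R / \<rho>)\<^bsup>\<delta>\<^esup>\<close>, and up to a multiplication operator. Finally \<open>T\<^sub>0\<close> is dominated by averages
 over a sparse family of subcubes of \<open>P\<close>; there only balls with radius at most \<open>\<rho>\<close> occur,
 and products of averages of \<open>f\<close> and \<open>g\<close> are controlled by a two-weight maximal estimate
 based on the condition \<open>A \<in> D\<^sub>p\<close>.\<close>

text \<open>The kernel \<open>K\<close> is controlled only through \<open>L^s\<close> means over
  annuli in its first variable and has no smoothness of its own. Everything that needs cancellation
  is therefore left to \<open>T0\<close>, of which only an \<open>L^2\<close> bound and a standard
  kernel are known. The asymmetry between the variables is the source of two different results:
  Hoelder's inequality in \<open>x\<close> with exponent \<open>s / t\<close> puts the power
  \<open>s / (s - t)\<close>, that is \<open>(s / t)'\<close>, on a weight in \<open>x\<close>,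
  whereas a weight in \<open>y\<close> enters through plain means. One bilinear estimate with
  \<open>t < s\<close> serves both cases, with \<open>t = p\<close> for \<open>T\<close> and
  \<open>t = p'\<close> for the adjoint. A kernel does not see the diagonal, so
  \<open>T - T0\<close> may contain multiplication by a bounded function. The term
  \<open>\<integral> |f| g\<close> that it causes is the reason why \<open>w\<close> has to be
  bounded almost everywhere by a multiple of its maximal function. The estimates are kept additive
  because contributions of cubes, annuli and the diagonal can then be summed; homogeneity is
  exploited only in the duality step.\<close>

abbreviation measurable_functions ("\<M>") where "\<M> \<equiv> borel_measurable lebesgue"
abbreviation measurable_sets ("\<L>") where "\<L> \<equiv> sets lebesgue"
abbreviation volume ("\<mu>") where "\<mu> \<equiv> emeasure lebesgue"

syntax
 "_I" :: "pttrn \<Rightarrow> ennreal \<Rightarrow> ennreal" ("NN _./ _" [0, 10] 10)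
 "_Ion" :: "pttrn \<Rightarrow> 'a set \<Rightarrow> ennreal \<Rightarrow> ennreal" ("NN _\<in>_./ _" [0, 0, 10] 10)
 "_J" :: "pttrn \<Rightarrow> real \<Rightarrow> ennreal" ("NR _./ _" [0, 10] 10)
 "_Jon" :: "pttrn \<Rightarrow> 'a set \<Rightarrow> real \<Rightarrow> ennreal" ("NR _\<in>_./ _" [0, 0, 10] 10)
translations
 "NN x. f" \<rightharpoonup> "CONST nn_integral (CONST lebesgue) (\<lambda>x. f)"
 "NN x\<in>A. f" \<rightharpoonup> "CONST set_nn_integral (CONST lebesgue) A (\<lambda>x. f)"
 "NR x. f" \<rightharpoonup> "NN x. CONST ennreal f"
 "NR x\<in>A. f" \<rightharpoonup> "NN x\<in>A. CONST ennreal f"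

section \<open>Iterated integrals and dyadic cubes\<close>

text \<open>A set measurable for the completion is a measurable set together with a subset of a null
  set, and such subsets pull back to subsets of null sets. Applied to the two projections, this lets
  functions of one variable be read as functions on the product.\<close>

lemma measurable_completion_completion:
 assumes f: "f \<in> M \<rightarrow>\<^sub>M N" and null: "\<And>A. A \<in> null_sets N \<Longrightarrow> f -` A \<inter> space M \<in> null_sets M"
 shows "f \<in> completion M \<rightarrow>\<^sub>M completion N"
proof (rule measurableI)
 fix x assume "x \<in> space (completion M)" then show "f x \<in> space (completion N)"
  using measurable_space[OF f] by simp
next
 fix A assume "A \<in> sets (completion N)"
 then obtain S N1 N' where A: "A = S \<union> N1" "N1 \<subseteq> N'" "N' \<in> null_sets N" "S \<in> sets N"
  by (auto elim!: sets_completionE)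
 have "f -` A \<inter> space M = (f -` S \<inter> space M) \<union> (f -` N1 \<inter> space M)" using A by auto
 moreover have "f -` S \<inter> space M \<in> sets M" using f A(4) by (rule measurable_sets)
 ultimately show "f -` A \<inter> space (completion M) \<in> sets (completion M)"
  using null[OF A(3)] A(2) by (auto intro!: sets_completionI[of _ "f -` S \<inter> space M" "f -` N1 \<inter> space M" "f -` N' \<inter> space M"])
qed

lemma measurable_completion_AE:
 assumes f: "f \<in> completion M \<rightarrow>\<^sub>M N" and ae: "AE x in M. f x = g x"
  and sp: "\<And>x. x \<in> space M \<Longrightarrow> g x \<in> space N"
 shows "g \<in> completion M \<rightarrow>\<^sub>M N"
proof (rule measurableI)
 fix A assume A: "A \<in> sets N"
 obtain N0 where N0: "N0 \<in> null_sets M" "{x \<in> space M. f x \<noteq> g x} \<subseteq> N0"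
  using ae by (auto elim!: AE_E simp: null_sets_def)
 have "g -` A \<inter> space (completion M) = ((f -` A \<inter> space (completion M)) - N0) \<union> ((g -` A \<inter> space M) \<inter> N0)"
  using N0 by auto
 moreover have "(g -` A \<inter> space M) \<inter> N0 \<in> sets (completion M)"
  using N0(1) by (intro sets_completionI[of _ "{}" "(g -` A \<inter> space M) \<inter> N0" N0]) auto
 moreover have "f -` A \<inter> space (completion M) \<in> sets (completion M)" "N0 \<in> sets (completion M)"
  using measurable_sets[OF f A] N0(1) by (auto intro: sets_completionI_sets)
 ultimately show "g -` A \<inter> space (completion M) \<in> sets (completion M)"
  by (metis sets.Un sets.Diff)
qed (use sp in auto)

section \<open>Tonelli's theorem for the completed Lebesgue measure\<close>

lemma measurable_lebesgue_fst [measurable]: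
 "fst \<in> (lebesgue :: ('a::euclidean_space \<times> 'b::euclidean_space) measure) \<rightarrow>\<^sub>M lebesgue"
proof (rule measurable_completion_completion)
 fix A :: "'a set" assume A: "A \<in> null_sets lborel"
 then have "(A \<times> (UNIV::'b set)) \<in> null_sets (lborel \<Otimes>\<^sub>M lborel)"
  using null_setsD1[OF A] null_setsD2[OF A]
  by (intro null_setsI) (auto simp del: lborel_prod simp: lborel.emeasure_pair_measure_Times)
 then show "fst -` A \<inter> space lborel \<in> null_sets (lborel :: ('a \<times> 'b) measure)"
  by (simp add: lborel_prod vimage_fst)
qed (simp add: lborel_prod[symmetric])

lemma measurable_lebesgue_snd [measurable]:
 "snd \<in> (lebesgue :: ('a::euclidean_space \<times> 'b::euclidean_space) measure) \<rightarrow>\<^sub>M lebesgue"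
proof (rule measurable_completion_completion)
 fix A :: "'b set" assume A: "A \<in> null_sets lborel"
 then have "((UNIV::'a set) \<times> A) \<in> null_sets (lborel \<Otimes>\<^sub>M lborel)"
  using null_setsD1[OF A] null_setsD2[OF A]
  by (intro null_setsI) (auto simp del: lborel_prod simp: lborel.emeasure_pair_measure_Times)
 then show "snd -` A \<inter> space lborel \<in> null_sets (lborel :: ('a \<times> 'b) measure)"
  by (simp add: lborel_prod vimage_snd)
qed (simp add: lborel_prod[symmetric])

text \<open>Lebesgue measure on the product is the completion of the product of the Borel measures,
  not a product of completions, so Tonelli's theorem does not apply to it directly. A Borel
  representative agrees with \<open>F\<close> off a null set, and almost every section of a null
  set, in either direction, is null.\<close>

lemma lebesgue_section_borel:
 fixes F :: "'a::euclidean_space \<times> 'b::euclidean_space \<Rightarrow> ennreal"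
 assumes "F \<in> \<M>"
 obtains F' where "F' \<in> borel_measurable (lborel \<Otimes>\<^sub>M lborel)"
  "AE x in lborel. AE y in lborel. F (x, y) = F' (x, y)"
  "AE y in lborel. AE x in lborel. F (x, y) = F' (x, y)"
proof -
 obtain F' where F': "F' \<in> borel_measurable lborel" and ae: "AE z in lborel. F z = F' z"
  using completion_ex_borel_measurable[OF assms] by blast
 have ae: "AE z in lborel \<Otimes>\<^sub>M lborel. F z = F' z" using ae unfolding lborel_prod .
 then obtain N where N: "N \<in> null_sets (lborel \<Otimes>\<^sub>M lborel)" "{z. F z \<noteq> F' z} \<subseteq> N"
  by (auto elim!: AE_E simp: null_sets_def space_pair_measure)
 have aeN: "AE z in lborel \<Otimes>\<^sub>M lborel. z \<notin> N" using N(1) by (rule AE_not_in)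
 have 1: "AE x in lborel. AE y in lborel. (x, y) \<notin> N" using lborel_pair.AE_pair[OF aeN] .
 have "AE y in lborel. AE x in lborel. (x, y) \<notin> N"
 proof (subst lborel_pair.AE_commute[symmetric])
  have "{x \<in> space (lborel \<Otimes>\<^sub>M lborel). (fst x, snd x) \<notin> N} = space (lborel \<Otimes>\<^sub>M lborel) - N" by auto
  then show "{x \<in> space (lborel \<Otimes>\<^sub>M lborel). (fst x, snd x) \<notin> N} \<in> sets (lborel \<Otimes>\<^sub>M lborel)"
   using null_setsD2[OF N(1)] by (metis sets.compl_sets)
 qed (rule 1)
 note 2 = this
 show thesis
 proof (rule that[of F'])
  show "F' \<in> borel_measurable (lborel \<Otimes>\<^sub>M lborel)" using F' by (simp add: lborel_prod)
  show "AE x in lborel. AE y in lborel. F (x, y) = F' (x, y)" using 1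
  proof eventually_elim
   case (elim x)
   then show ?case by eventually_elim (use N(2) in auto)
  qed
  show "AE y in lborel. AE x in lborel. F (x, y) = F' (x, y)" using 2
  proof eventually_elim
   case (elim y)
   then show ?case by eventually_elim (use N(2) in auto)
  qed
 qed
qed

text \<open>For almost every parameter the sections of \<open>F\<close> and of its Borel
  representative agree almost everywhere, so both iterated integrals may be computed with the
  representative. The inner integral then equals a Borel function almost everywhere, which gives
  measurability for the completion.\<close>

lemma lebesgue_Tonelli:
 fixes F :: "'a::euclidean_space \<times> 'b::euclidean_space \<Rightarrow> ennreal"
 assumes "F \<in> \<M>"
 shows "(NN x. NN y. F (x, y)) = (NN y. NN x. F (x, y))"
  and "(\<lambda>x. NN y. F (x, y)) \<in> \<M>"
proof -
 obtain F' where F'[measurable]: "F' \<in> borel_measurable (lborel \<Otimes>\<^sub>M lborel)"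
  and 1: "AE x in lborel. AE y in lborel. F (x, y) = F' (x, y)"
  and 2: "AE y in lborel. AE x in lborel. F (x, y) = F' (x, y)"
  using lebesgue_section_borel[OF assms] .
 have 3: "AE x in lborel. (\<integral>\<^sup>+y. F (x, y) \<partial>lborel) = (\<integral>\<^sup>+y. F' (x, y) \<partial>lborel)"
  using 1 by eventually_elim (rule nn_integral_cong_AE)
 have 4: "AE y in lborel. (\<integral>\<^sup>+x. F (x, y) \<partial>lborel) = (\<integral>\<^sup>+x. F' (x, y) \<partial>lborel)"
  using 2 by eventually_elim (rule nn_integral_cong_AE)
 have F'2[measurable]: "(\<lambda>(x,y). F' (x, y)) \<in> borel_measurable (lborel \<Otimes>\<^sub>M lborel)" by simp
 show "(NN x. NN y. F (x, y)) = (NN y. NN x. F (x, y))"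
  unfolding nn_integral_completion nn_integral_cong_AE[OF 3] nn_integral_cong_AE[OF 4]
  using lborel_pair.Fubini'[OF F'2] by simp
 have "(\<lambda>x. \<integral>\<^sup>+y. F' (x, y) \<partial>lborel) \<in> \<M>"
  by (rule measurable_completion) measurable
 then show "(\<lambda>x. NN y. F (x, y)) \<in> \<M>"
  unfolding nn_integral_completion using 3
  by (rule_tac measurable_completion_AE[of "\<lambda>x. \<integral>\<^sup>+y. F' (x, y) \<partial>lborel"]) auto
qed

text \<open>Additivity of the integral needs measurable integrands, and the sections of
  \<open>F\<close> can fail this for exceptional \<open>x\<close>. The statement is inserted
  wherever an inner integral is split or a factor is moved through it.\<close>

lemma lebesgue_sections_measurable:
 fixes F :: "'a::euclidean_space \<times> 'b::euclidean_space \<Rightarrow> ennreal"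
 assumes "F \<in> \<M>"
 shows "AE x in lebesgue. (\<lambda>y. F (x, y)) \<in> \<M>"
proof -
 obtain F' where F'[measurable]: "F' \<in> borel_measurable (lborel \<Otimes>\<^sub>M lborel)"
  and 1: "AE x in lborel. AE y in lborel. F (x, y) = F' (x, y)"
  using lebesgue_section_borel[OF assms] .
 have "AE x in lborel. (\<lambda>y. F (x, y)) \<in> \<M>"
  using 1
 proof eventually_elim
  case (elim x)
  have "(\<lambda>y. F' (x, y)) \<in> \<M>" by (rule measurable_completion) measurable
  then show ?case using elim by (rule_tac measurable_completion_AE[of "\<lambda>y. F' (x, y)"]) auto
 qed
 then show ?thesis by (rule AE_completion)
qed

lemma emeasure_lebesgue_ball:
 "0 \<le> r \<Longrightarrow> \<mu> (ball (c::'a::euclidean_space) r) = ennreal (unit_ball_vol (DIM('a)) * r ^ DIM('a))"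
 by (simp add: emeasure_ball)

lemma Holder_nn_integral:
 fixes f g :: "'a \<Rightarrow> real"
 assumes p: "1 < p" "1 / p + 1 / q = 1"
  and [measurable]: "f \<in> borel_measurable M" "g \<in> borel_measurable M"
  and f0: "\<And>x. 0 \<le> f x" and g0: "\<And>x. 0 \<le> g x"
  and X: "(\<integral>\<^sup>+x. ennreal (f x powr p) \<partial>M) \<le> ennreal X" "0 \<le> X"
  and Y: "(\<integral>\<^sup>+x. ennreal (g x powr q) \<partial>M) \<le> ennreal Y" "0 \<le> Y"
 shows "(\<integral>\<^sup>+x. ennreal (f x * g x) \<partial>M) \<le> ennreal (X powr (1/p) * Y powr (1/q))"
proof -
 have q: "1 < q" using p by (smt (verit) divide_eq_0_iff divide_less_eq_1 less_divide_eq_1_pos zero_less_divide_iff divide_pos_pos le_divide_eq_1)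
 consider "X = 0" | "Y = 0" | "0 < X" "0 < Y" using X Y by fastforce
 then show ?thesis
 proof cases
  case 1
  then have "(\<integral>\<^sup>+x. ennreal (f x powr p) \<partial>M) = 0" using X by simp
  then have "AE x in M. f x = 0" by (subst (asm) nn_integral_0_iff_AE) (auto simp: p q)
  then have "(\<integral>\<^sup>+x. ennreal (f x * g x) \<partial>M) = 0" by (subst nn_integral_0_iff_AE) auto
  then show ?thesis by simp
 next
  case 2
  then have "(\<integral>\<^sup>+x. ennreal (g x powr q) \<partial>M) = 0" using Y by simp
  then have "AE x in M. g x = 0" by (subst (asm) nn_integral_0_iff_AE) (auto simp: p q)
  then have "(\<integral>\<^sup>+x. ennreal (f x * g x) \<partial>M) = 0" by (subst nn_integral_0_iff_AE) auto
  then show ?thesis by simp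
 next
  case 3
  \<comment> \<open>After division by \<open>a\<close> and \<open>b\<close> the \<open>p\<close>-th
    and \<open>q\<close>-th powers have integrals at most 1; Young's inequality is integrated and
    the two parts add up to \<open>1 / p + 1 / q = 1\<close>.\<close>
  define a b where "a = X powr (1/p)" and "b = Y powr (1/q)"
  have ab: "0 < a" "0 < b" using 3 by (auto simp: a_def b_def)
  have ap: "a powr p = X" "b powr q = Y" using 3 p q by (auto simp: a_def b_def powr_powr)
  have *: "f x * g x \<le> a * b / (p * X) * f x powr p + a * b / (q * Y) * g x powr q" for x
  proof -
   have "f x / a * (g x / b) \<le> (f x / a) powr p / p + (g x / b) powr q / q"
    using p q f0[of x] g0[of x] ab by (intro Youngs_inequality) auto
   then have "f x / a * (g x / b) \<le> f x powr p / X / p + g x powr q / Y / q"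
    using f0[of x] g0[of x] ab ap by (simp add: powr_divide)
   then have "(a * b) * (f x / a * (g x / b)) \<le> (a * b) * (f x powr p / X / p + g x powr q / Y / q)"
    using ab by (intro mult_left_mono) auto
   then show ?thesis using ab by (simp add: field_simps)
  qed
  have "(\<integral>\<^sup>+x. ennreal (f x * g x) \<partial>M)
    \<le> (\<integral>\<^sup>+x. ennreal (a * b / (p * X)) * ennreal (f x powr p) + ennreal (a * b / (q * Y)) * ennreal (g x powr q) \<partial>M)"
   using ab 3 p q f0 g0 *
   by (intro nn_integral_mono) (auto simp: ennreal_mult[symmetric] ennreal_plus[symmetric] simp del: ennreal_plus intro!: ennreal_leI)
  also have "\<dots> = ennreal (a * b / (p * X)) * (\<integral>\<^sup>+x. ennreal (f x powr p) \<partial>M) + ennreal (a * b / (q * Y)) * (\<integral>\<^sup>+x. ennreal (g x powr q) \<partial>M)"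
   by (simp add: nn_integral_add nn_integral_cmult)
  also have "\<dots> \<le> ennreal (a * b / (p * X)) * ennreal X + ennreal (a * b / (q * Y)) * ennreal Y"
   using X Y by (intro add_mono mult_left_mono) auto
  also have "\<dots> = ennreal (a * b / (p * X) * X + a * b / (q * Y) * Y)"
   using ab 3 p q by (simp add: ennreal_mult[symmetric] ennreal_plus[symmetric] del: ennreal_plus)
  also have "a * b / (p * X) * X + a * b / (q * Y) * Y = a * b * (1/p + 1/q)"
   using 3 p q by (simp add: field_simps)
  finally show ?thesis using p by (simp add: a_def b_def)
 qed
qed

section \<open>Half-open dyadic cubes\<close>

definition dcube :: "int \<Rightarrow> 'a::euclidean_space \<Rightarrow> 'a set" where
 "dcube n x = {y. \<forall>i\<in>Basis. \<lfloor>2 powr n * (y \<bullet> i)\<rfloor> = \<lfloor>2 powr n * (x \<bullet> i)\<rfloor>}"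

definition dside :: "int \<Rightarrow> real" where
 "dside n = 2 powr (- n)"

lemma dside_pos [simp]: "0 < dside n" and dside_nonneg [simp]: "0 \<le> dside n"
 by (auto simp: dside_def)

lemma dside_Suc: "dside (n - 1) = 2 * dside n"
 by (simp add: dside_def powr_diff powr_add powr_minus field_simps)

lemma dside_antimono: "m \<le> n \<Longrightarrow> dside n \<le> dside m"
 by (simp add: dside_def)

lemma dcube_self [simp]: "x \<in> dcube n x"
 by (simp add: dcube_def)

lemma dcube_eq: "y \<in> dcube n x \<Longrightarrow> dcube n y = dcube n x"
 by (auto simp: dcube_def)

lemma dcube_sym: "y \<in> dcube n x \<Longrightarrow> x \<in> dcube n y"
 by (auto simp: dcube_def)

text \<open>Cubes are coded by the integer parts of the scaled coordinates, and passing to a coarser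
  generation divides these integers by a power of 2, so equal codes stay equal.\<close>

lemma dcube_mono: "m \<le> n \<Longrightarrow> dcube n x \<subseteq> dcube m (x::'a::euclidean_space)"
proof -
 assume mn: "m \<le> n"
 define k where "k = nat (n - m)"
 have e: "\<lfloor>2 powr m * t\<rfloor> = \<lfloor>2 powr n * t\<rfloor> div 2 ^ k" for t :: real
 proof -
  have "real_of_int m = real_of_int n - real k" using mn by (simp add: k_def)
  then have "2 powr m * t = (2 powr n * t) / real_of_int (2 ^ k)"
   by (simp add: powr_diff powr_realpow)
  then show ?thesis using floor_divide_real_eq_div[of "2 ^ k" "2 powr n * t"] by simp
 qed
 show ?thesis by (auto simp: dcube_def e)
qed

text \<open>The diameter is estimated by the sum of the coordinates. The resulting factor
  \<open>DIM('a)\<close>, rather than its square root, is the one that occurs in all later dilation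
  constants.\<close>

lemma dcube_norm_diff:
 assumes "y \<in> dcube n x" "z \<in> dcube n (x::'a::euclidean_space)"
 shows "norm (y - z) \<le> real DIM('a) * dside n"
proof -
 have "\<bar>(y - z) \<bullet> i\<bar> \<le> dside n" if "i \<in> Basis" for i
 proof -
  have "\<lfloor>2 powr n * (y \<bullet> i)\<rfloor> = \<lfloor>2 powr n * (z \<bullet> i)\<rfloor>" using assms that by (auto simp: dcube_def)
  then have "\<bar>2 powr n * (y \<bullet> i) - 2 powr n * (z \<bullet> i)\<bar> \<le> 1" by linarith
  then have "2 powr n * \<bar>(y - z) \<bullet> i\<bar> \<le> 1"
   by (simp add: inner_diff_left right_diff_distrib[symmetric] abs_mult)
  then show ?thesis by (simp add: dside_def powr_minus field_simps)
 qed
 then have "(\<Sum>i\<in>Basis. \<bar>(y - z) \<bullet> i\<bar>) \<le> real DIM('a) * dside n"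
  by (rule sum_bounded_above)
 then show ?thesis using norm_le_l1[of "y - z"] by linarith
qed

lemma dcube_sets_borel [measurable]: "dcube n x \<in> sets borel"
proof -
 have "dcube n x = (\<Inter>i\<in>Basis. {y. real_of_int \<lfloor>2 powr n * (x \<bullet> i)\<rfloor> \<le> 2 powr n * (y \<bullet> i) \<and>
   2 powr n * (y \<bullet> i) < real_of_int \<lfloor>2 powr n * (x \<bullet> i)\<rfloor> + 1})"
  by (auto simp: dcube_def floor_eq_iff)
 also have "\<dots> \<in> sets borel"
  by (intro sets.countable_INT'' countable_finite) (auto simp del: Collect_conj_eq)
 finally show ?thesis .
qed

lemma dcube_sets_lebesgue [measurable]: "dcube n x \<in> \<L>"
 using dcube_sets_borel by auto

lemma dcube_between:
 fixes x :: "'a::euclidean_space"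
 obtains c where "box c (c + dside n *\<^sub>R One) \<subseteq> dcube n x" "dcube n x \<subseteq> cbox c (c + dside n *\<^sub>R One)"
proof
 define c where "c = (\<Sum>i\<in>Basis. (real_of_int \<lfloor>2 powr n * (x \<bullet> i)\<rfloor> * dside n) *\<^sub>R i :: 'a)"
 have ci: "c \<bullet> i = real_of_int \<lfloor>2 powr n * (x \<bullet> i)\<rfloor> * dside n" if "i \<in> Basis" for i
  using that by (simp add: c_def)
 have d: "dside n * 2 powr n = 1" by (simp add: dside_def powr_minus)
 have e: "(real_of_int k * dside n < t) \<longleftrightarrow> real_of_int k < 2 powr n * t"
  "(t < real_of_int k * dside n + dside n) \<longleftrightarrow> 2 powr n * t < real_of_int k + 1"
  "(real_of_int k * dside n \<le> t) \<longleftrightarrow> real_of_int k \<le> 2 powr n * t"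
  "(t \<le> real_of_int k * dside n + dside n) \<longleftrightarrow> 2 powr n * t \<le> real_of_int k + 1" for k t
  by (auto simp: dside_def powr_minus field_simps)
 show "box c (c + dside n *\<^sub>R One) \<subseteq> dcube n x"
  by (auto simp: mem_box ci inner_add_left dcube_def floor_eq_iff e intro: less_imp_le)
 show "dcube n x \<subseteq> cbox c (c + dside n *\<^sub>R One)"
  by (auto simp: mem_box ci inner_add_left dcube_def floor_eq_iff e less_imp_le)
qed

lemma emeasure_dcube: "\<mu> (dcube n (x::'a::euclidean_space)) = ennreal (dside n ^ DIM('a))"
proof -
 obtain c :: 'a where c: "box c (c + dside n *\<^sub>R One) \<subseteq> dcube n x" "dcube n x \<subseteq> cbox c (c + dside n *\<^sub>R One)"
  using dcube_between .
 have "emeasure lborel (box c (c + dside n *\<^sub>R One)) = ennreal (dside n ^ DIM('a))"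
  by (subst emeasure_lborel_box) (auto simp: inner_add_left)
 moreover have "emeasure lborel (cbox c (c + dside n *\<^sub>R One)) = ennreal (dside n ^ DIM('a))"
  by (subst emeasure_lborel_cbox) (auto simp: inner_add_left)
 moreover have "emeasure lborel (box c (c + dside n *\<^sub>R One)) \<le> emeasure lborel (dcube n x)"
  using c by (intro emeasure_mono) auto
 moreover have "emeasure lborel (dcube n x) \<le> emeasure lborel (cbox c (c + dside n *\<^sub>R One))"
  using c by (intro emeasure_mono) auto
 ultimately show ?thesis by (simp add: antisym)
qed

text \<open>Every cube contains an open box and hence a point of a countable dense set, and a cube
  is determined by its generation and any of its points.\<close>

lemma countable_dcubes: "countable (range (\<lambda>(n, x::'a::euclidean_space). dcube n x))"
proof -
 obtain X :: "'a set" where X: "countable X" "\<And>U. open U \<Longrightarrow> U \<noteq> {} \<Longrightarrow> \<exists>x\<in>X. x \<in> U"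
  using countable_dense_exists by blast
 have "dcube n x \<in> (\<lambda>(n, x). dcube n x) ` (UNIV \<times> X)" for n and x :: 'a
 proof -
  obtain c :: 'a where c: "box c (c + dside n *\<^sub>R One) \<subseteq> dcube n x"
   using dcube_between .
  have "box c (c + dside n *\<^sub>R One) \<noteq> {}" by (simp add: box_ne_empty inner_add_left)
  then obtain q where "q \<in> X" "q \<in> dcube n x" using X(2)[of "box c (c + dside n *\<^sub>R One)"] c by auto
  then show ?thesis using dcube_eq[of q n x] by (metis SigmaI UNIV_I case_prod_conv image_eqI)
 qed
 then have sub: "range (\<lambda>(n, x::'a). dcube n x) \<subseteq> (\<lambda>(n, x). dcube n x) ` (UNIV \<times> X)" by auto
 have "countable ((\<lambda>(n, x). dcube n x) ` ((UNIV :: int set) \<times> X))"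
  using X(1) by (intro countable_image countable_SIGMA) auto
 with sub show ?thesis by (rule countable_subset)
qed

lemma dcube_saturated_borel:
 assumes "\<And>x. x \<in> A \<Longrightarrow> dcube n x \<subseteq> A"
 shows "A \<in> sets borel"
proof -
 have "A = \<Union>((\<lambda>x. dcube n x) ` A)" using assms by auto
 also have "\<dots> \<in> sets borel"
  by (rule sets.countable_Union[OF countable_subset[OF _ countable_dcubes]]) auto
 finally show ?thesis .
qed

section \<open>Stopping generations and maximal cubes\<close>

lemma dyadic_stopping_time:
 fixes S :: "int \<Rightarrow> 'a::euclidean_space \<Rightarrow> bool"
 assumes inv: "\<And>n x y. S n x \<Longrightarrow> y \<in> dcube n x \<Longrightarrow> S n y"
  and bdd: "\<And>x. \<exists>N. \<forall>n<N. \<not> S n x"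
 obtains \<tau> :: "'a \<Rightarrow> int" where "\<And>x n. S n x \<Longrightarrow> S (\<tau> x) x"
  "\<And>x m n. m < \<tau> x \<Longrightarrow> S n x \<Longrightarrow> \<not> S m x"
  "\<And>x y n. S n x \<Longrightarrow> y \<in> dcube (\<tau> x) x \<Longrightarrow> \<tau> y = \<tau> x"
proof -
 have ex: "\<exists>n. S n x \<and> (\<forall>m<n. \<not> S m x)" if "S k x" for k x
 proof -
  obtain N where N: "\<forall>n<N. \<not> S n x" using bdd by blast
  \<comment> \<open>Generations below \<open>N\<close> are excluded, so the coarsest admissible one
    is found by counting upwards from \<open>N\<close> with natural numbers.\<close>
  define j where "j = (LEAST j::nat. S (N + int j) x)"
  have "S (N + int (nat (k - N))) x" using N that by (cases "k < N") auto
  then have 1: "S (N + int j) x" unfolding j_def by (rule LeastI)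
  moreover have "\<not> S m x" if "m < N + int j" for m
  proof
   assume m: "S m x"
   then have "N \<le> m" using N by force
   then have "S (N + int (nat (m - N))) x" using m by simp
   then have "j \<le> nat (m - N)" unfolding j_def by (rule Least_le)
   then show False using that \<open>N \<le> m\<close> by linarith
  qed
  ultimately show ?thesis by blast
 qed
 define \<tau> where "\<tau> x = (SOME n. S n x \<and> (\<forall>m<n. \<not> S m x))" for x
 have t: "S (\<tau> x) x \<and> (\<forall>m<\<tau> x. \<not> S m x)" if "S k x" for k x
  unfolding \<tau>_def using ex[OF that] by (rule someI_ex)
 show thesis
 proof (rule that[of \<tau>])
  fix x y n assume S: "S n x" and y: "y \<in> dcube (\<tau> x) x"
  have Sy: "S (\<tau> x) y" using t[OF S] y inv by blast
  \<comment> \<open>A coarser stop at \<open>y\<close> would stop a larger cube around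
    \<open>y\<close>, which also contains \<open>x\<close>, against the minimality of
    \<open>\<tau> x\<close>.\<close>
  have "\<not> S m y" if "m < \<tau> x" for m
   using t[OF S] that inv[of m y x] dcube_mono[of m "\<tau> x" x] y dcube_sym by fastforce
  then show "\<tau> y = \<tau> x" using Sy t[OF Sy] by (meson linorder_neqE)
 next
  show "S (\<tau> x) x" if "S n x" for x n using t[OF that] by simp
  show "\<not> S m x" if "m < \<tau> x" "S n x" for x m n using t[OF that(2)] that(1) by simp
 qed
qed

text \<open>Two stopping cubes that meet have the same stopping generation as a common point, so
  they coincide. This selection yields the Calderon-Zygmund cubes, the sparse cubes, the dyadic
  decomposition of open sets and the cubes of critical size.\<close>

lemma dyadic_stopping:
 fixes S :: "int \<Rightarrow> 'a::euclidean_space \<Rightarrow> bool"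
 assumes inv: "\<And>n x y. S n x \<Longrightarrow> y \<in> dcube n x \<Longrightarrow> S n y"
  and bdd: "\<And>x. \<exists>N. \<forall>n<N. \<not> S n x"
 obtains \<Q> where "countable \<Q>" "disjoint \<Q>" "\<Union>\<Q> = {x. \<exists>n. S n x}"
  "\<And>Q. Q \<in> \<Q> \<Longrightarrow> \<exists>n x. Q = dcube n x \<and> S n x \<and> (\<forall>m<n. \<not> S m x)"
proof -
 obtain \<tau> :: "'a \<Rightarrow> int" where t: "\<And>x n. S n x \<Longrightarrow> S (\<tau> x) x"
  "\<And>x m n. m < \<tau> x \<Longrightarrow> S n x \<Longrightarrow> \<not> S m x"
  "\<And>x y n. S n x \<Longrightarrow> y \<in> dcube (\<tau> x) x \<Longrightarrow> \<tau> y = \<tau> x"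
  by (rule dyadic_stopping_time[of S]) (erule inv, assumption, rule bdd, rule that)
 define \<Q> where "\<Q> = (\<lambda>x. dcube (\<tau> x) x) ` {x. \<exists>n. S n x}"
 show thesis
 proof (rule that[of \<Q>])
  show "countable \<Q>" unfolding \<Q>_def by (rule countable_subset[OF _ countable_dcubes]) auto
  show "disjoint \<Q>"
  proof (rule disjointI)
   fix P Q assume "P \<in> \<Q>" "Q \<in> \<Q>" "P \<noteq> Q"
   then obtain x y m n where x: "P = dcube (\<tau> x) x" "S m x" and y: "Q = dcube (\<tau> y) y" "S n y"
    by (auto simp: \<Q>_def)
   show "P \<inter> Q = {}"
   proof (rule ccontr)
    assume "P \<inter> Q \<noteq> {}"
    then obtain z where z: "z \<in> P" "z \<in> Q" by auto
    then have "\<tau> z = \<tau> x" "\<tau> z = \<tau> y"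
     using t(3)[OF x(2), of z] t(3)[OF y(2), of z] x(1) y(1) by simp_all
    moreover have "dcube (\<tau> x) z = P" "dcube (\<tau> y) z = Q"
     using dcube_eq[of z "\<tau> x" x] dcube_eq[of z "\<tau> y" y] z x(1) y(1) by simp_all
    ultimately have "P = Q" by simp
    then show False using \<open>P \<noteq> Q\<close> by simp
   qed
  qed
  show "\<Union>\<Q> = {x. \<exists>n. S n x}"
  proof
   show "\<Union>\<Q> \<subseteq> {x. \<exists>n. S n x}" using t(1) inv unfolding \<Q>_def by blast
   show "{x. \<exists>n. S n x} \<subseteq> \<Union>\<Q>" unfolding \<Q>_def using dcube_self by blast
  qed
  show "\<exists>n x. Q = dcube n x \<and> S n x \<and> (\<forall>m<n. \<not> S m x)" if "Q \<in> \<Q>" for Q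
   using that t unfolding \<Q>_def by blast
 qed
qed

lemma nn_integral_countable_Union:
 assumes "countable \<Q>" "disjoint \<Q>" "\<And>Q. Q \<in> \<Q> \<Longrightarrow> Q \<in> sets M"
  and [measurable]: "f \<in> borel_measurable M"
 shows "(\<integral>\<^sup>+x\<in>\<Union>\<Q>. f x \<partial>M) = (\<integral>\<^sup>+Q. (\<integral>\<^sup>+x\<in>Q. f x \<partial>M) \<partial>count_space \<Q>)"
proof -
 have "emeasure (density M f) (\<Union>Q\<in>\<Q>. Q) = (\<integral>\<^sup>+Q. emeasure (density M f) Q \<partial>count_space \<Q>)"
  using assms by (intro emeasure_UN_countable) (auto simp: disjoint_family_on_def disjoint_def)
 moreover have "emeasure (density M f) (\<Union>\<Q>) = (\<integral>\<^sup>+x\<in>\<Union>\<Q>. f x \<partial>M)"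
  using assms by (intro emeasure_density sets.countable_Union) auto
 moreover have "(\<integral>\<^sup>+Q. emeasure (density M f) Q \<partial>count_space \<Q>) = (\<integral>\<^sup>+Q. (\<integral>\<^sup>+x\<in>Q. f x \<partial>M) \<partial>count_space \<Q>)"
  using assms by (intro nn_integral_cong emeasure_density) auto
 ultimately show ?thesis by simp
qed

section \<open>Maximal functions of Orlicz type\<close>

lemma borel_measurable_lebesgue_fst [measurable]:
 "(fst :: 'a::euclidean_space \<times> 'b::euclidean_space \<Rightarrow> 'a) \<in> \<M>"
 and borel_measurable_lebesgue_snd [measurable]:
 "(snd :: 'a::euclidean_space \<times> 'b::euclidean_space \<Rightarrow> 'b) \<in> \<M>"
 by (intro measurable_completion; auto intro!: borel_measurable_continuous_onI continuous_intros)+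

lemma ball_sets_lebesgue [measurable]: "ball c r \<in> \<L>"
 by simp

section \<open>Weak type estimates for maximal functions\<close>

lemma emeasure_countable_UN_le:
 assumes I: "countable I" and [measurable]: "\<And>i. i \<in> I \<Longrightarrow> X i \<in> sets M"
 shows "emeasure M (\<Union>i\<in>I. X i) \<le> (\<integral>\<^sup>+i. emeasure M (X i) \<partial>count_space I)"
proof -
 have U: "(\<Union>i\<in>I. X i) \<in> sets M" using assms by blast
 have "emeasure M (\<Union>i\<in>I. X i) = (\<integral>\<^sup>+x. indicator (\<Union>i\<in>I. X i) x \<partial>M)" using U by simp
 also have "\<dots> \<le> (\<integral>\<^sup>+x. \<integral>\<^sup>+i. indicator (X i) x \<partial>count_space I \<partial>M)"
 proof (rule nn_integral_mono)
  fix x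
  show "indicator (\<Union>i\<in>I. X i) x \<le> (\<integral>\<^sup>+i. indicator (X i) x \<partial>count_space I)"
  proof (cases "x \<in> (\<Union>i\<in>I. X i)")
   case True
   then obtain j where j: "j \<in> I" "x \<in> X j" by auto
   have "1 = (\<integral>\<^sup>+i. indicator {j} i \<partial>count_space I)" using j by (simp add: one_ennreal_def)
   also have "\<dots> \<le> (\<integral>\<^sup>+i. indicator (X i) x \<partial>count_space I)"
    using j by (intro nn_integral_mono) (auto simp: indicator_def)
   finally show ?thesis using True by simp
  qed simp
 qed
 also have "\<dots> = (\<integral>\<^sup>+i. \<integral>\<^sup>+x. indicator (X i) x \<partial>M \<partial>count_space I)"
  using I by (intro nn_integral_count_space_nn_integral) auto
 also have "\<dots> = (\<integral>\<^sup>+i. emeasure M (X i) \<partial>count_space I)"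
  by (intro nn_integral_cong) auto
 finally show ?thesis .
qed

lemma nn_integral_disjoint_le:
 assumes "countable I" "disjoint_family_on X I" "\<And>i. i \<in> I \<Longrightarrow> X i \<in> sets M"
  and [measurable]: "f \<in> borel_measurable M"
 shows "(\<integral>\<^sup>+i. (\<integral>\<^sup>+x\<in>X i. f x \<partial>M) \<partial>count_space I) \<le> (\<integral>\<^sup>+x. f x \<partial>M)"
proof -
 have "(\<integral>\<^sup>+i. (\<integral>\<^sup>+x\<in>X i. f x \<partial>M) \<partial>count_space I) = (\<integral>\<^sup>+i. emeasure (density M f) (X i) \<partial>count_space I)"
  using assms by (intro nn_integral_cong) (auto simp: emeasure_density)
 also have "\<dots> = emeasure (density M f) (\<Union>i\<in>I. X i)"
  using assms by (intro emeasure_UN_countable[symmetric]) auto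
 also have "\<dots> \<le> emeasure (density M f) (space (density M f))"
  by (rule emeasure_space)
 also have "\<dots> = (\<integral>\<^sup>+x. f x \<partial>M)"
  by (subst emeasure_density) (auto intro!: nn_integral_cong)
 finally show ?thesis .
qed

text \<open>A Young function given by its layers. It replaces the complementary function of
 \<open>v \<mapsto> A (v\<^sup>p)\<close> and lets the strong type estimate be integrated from weak type estimates.\<close>

definition orlicz_phi :: "(real \<Rightarrow> ennreal) \<Rightarrow> (real \<Rightarrow> real) \<Rightarrow> real \<Rightarrow> ennreal" where
 "orlicz_phi m \<alpha> u = ennreal u * (\<integral>\<^sup>+v. m v * indicator {v. \<alpha> v \<le> u} v \<partial>lborel)"

lemma orlicz_phi_mono: "u \<le> u' \<Longrightarrow> orlicz_phi m \<alpha> u \<le> orlicz_phi m \<alpha> u'"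
 unfolding orlicz_phi_def
 by (intro mult_mono nn_integral_mono ennreal_leI) (auto simp: indicator_def)

lemma orlicz_phi_measurable [measurable]:
 assumes [measurable]: "m \<in> borel_measurable borel" "\<alpha> \<in> borel_measurable borel"
 shows "orlicz_phi m \<alpha> \<in> borel_measurable borel"
 unfolding orlicz_phi_def[abs_def] indicator_def by measurable

text \<open>For \<open>\<Phi>\<close> the identity this is the set where the uncentred maximal
  function exceeds \<open>t\<close>; in general it takes the part of a superlevel set of an Orlicz
  maximal function. As a union of balls it is open, so no question of measurability arises.\<close>

definition exceptional_set :: "(real \<Rightarrow> ennreal) \<Rightarrow> ('a::euclidean_space \<Rightarrow> real) \<Rightarrow> real \<Rightarrow> 'a set" where
 "exceptional_set \<Phi> h t = \<Union>{ball c r |c r. 0 < r \<and>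
   \<mu> (ball c r) < (NN x\<in>ball c r. \<Phi> (h x / t))}"

lemma open_exceptional_set: "open (exceptional_set \<Phi> h t)"
 unfolding exceptional_set_def by auto

text \<open>On each ball the points with \<open>h \<le> \<kappa> t\<close> contribute at most half
  of its measure to the integral, because \<open>\<Phi> \<kappa> \<le> 1 / 2\<close>; this half is
  absorbed and only large values of \<open>h\<close> remain. The Vitali covering lemma selects
  disjoint balls at the price of \<open>5 ^ DIM('a)\<close>.\<close>

lemma exceptional_set_weak_type:
 fixes h :: "'a::euclidean_space \<Rightarrow> real"
 assumes [measurable]: "h \<in> \<M>" "\<Phi> \<in> borel_measurable borel"
  and mono: "\<And>u v. u \<le> v \<Longrightarrow> \<Phi> u \<le> \<Phi> v" and \<kappa>: "\<Phi> \<kappa> \<le> 1 / 2" and t: "0 < t"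
 shows "\<mu> (exceptional_set \<Phi> h t)
  \<le> ennreal (2 * 5 ^ DIM('a)) * (NN x. \<Phi> (h x / t) * indicator {x. \<kappa> * t < h x} x)"
  (is "_ \<le> _ * ?J")
proof -
 have "{x \<in> space lebesgue. \<kappa> * t < h x} \<in> \<L>" by measurable
 then have [measurable]: "{x. \<kappa> * t < h x} \<in> \<L>" by simp
 \<comment> \<open>The covering lemma requires bounded radii; the bound \<open>n\<close> is removed
   at the end by continuity from below.\<close>
 define K where "K n = {(c::'a, r). 0 < r \<and> r \<le> real n \<and>
   \<mu> (ball c r) < (NN x\<in>ball c r. \<Phi> (h x / t))}" for n
 define U where "U n = (\<Union>i\<in>K n. ball (fst i) (snd i))" for n
 have bound: "\<mu> (U n) \<le> ennreal (2 * 5 ^ DIM('a)) * ?J" for n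
 proof -
  obtain C where C: "countable C" "C \<subseteq> K n"
   "pairwise (\<lambda>i j. disjnt (ball (fst i) (snd i)) (ball (fst j) (snd j))) C"
   "U n \<subseteq> (\<Union>i\<in>C. ball (fst i) (5 * snd i))"
  proof (rule Vitali_covering_lemma_balls[where S="U n" and K="K n" and a=fst and r=snd and B="real n"])
   show "U n \<subseteq> (\<Union>i\<in>K n. ball (fst i) (snd i))" by (simp add: U_def)
   show "0 < snd i \<and> snd i \<le> real n" if "i \<in> K n" for i using that by (auto simp: K_def)
  qed (rule that)
  have one: "\<mu> (ball (fst i) (5 * snd i))
    \<le> ennreal (2 * 5 ^ DIM('a)) * (NN x\<in>ball (fst i) (snd i). \<Phi> (h x / t) * indicator {x. \<kappa> * t < h x} x)"
   if "i \<in> C" for i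
  proof -
   let ?B = "ball (fst i) (snd i)"
   let ?b = "\<mu> ?B"
   let ?I = "(NN x\<in>?B. \<Phi> (h x / t) * indicator {x. \<kappa> * t < h x} x)"
   have r: "0 < snd i" and less: "?b < (NN x\<in>?B. \<Phi> (h x / t))"
    using that C(2) by (auto simp: K_def)
   have fin: "?b = ennreal (unit_ball_vol (DIM('a)) * snd i ^ DIM('a))"
    using r emeasure_lebesgue_ball by (metis less_imp_le)
   have "(NN x\<in>?B. \<Phi> (h x / t)) \<le>
     (NN x. \<Phi> (h x / t) * indicator {x. \<kappa> * t < h x} x * indicator ?B x + 1 / 2 * indicator ?B x)"
   proof (rule nn_integral_mono)
    fix x
    have "\<Phi> (h x / t) \<le> 1 / 2" if "\<not> \<kappa> * t < h x"
    proof -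
     have "h x / t \<le> \<kappa>" using that t by (simp add: field_simps)
     then show ?thesis using mono \<kappa> order_trans by blast
    qed
    then show "\<Phi> (h x / t) * indicator ?B x \<le>
      \<Phi> (h x / t) * indicator {x. \<kappa> * t < h x} x * indicator ?B x + 1 / 2 * indicator ?B x"
     by (auto simp: indicator_def)
   qed
   also have "\<dots> = ?I + 1 / 2 * ?b"
    by (subst nn_integral_add) (simp_all add: nn_integral_cmult_indicator del: emeasure_completion)
   finally have le: "?b \<le> ?I + 1 / 2 * ?b" using less by simp
   have "?b \<le> 2 * ?I"
   proof (cases ?I)
    case (real s)
    define b where "b = unit_ball_vol (DIM('a)) * snd i ^ DIM('a)"
    have b0: "0 \<le> b" using r by (simp add: b_def)
    have half: "ennreal (1/2) = 1/2" using divide_ennreal[of 1 2] by simp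
    have "ennreal b \<le> ennreal s + ennreal (1 / 2) * ennreal b"
     using le real unfolding fin b_def[symmetric] half by simp
    also have "\<dots> = ennreal s + ennreal (1 / 2 * b)"
     by (subst ennreal_mult[of "1/2" b]) (use b0 in auto)
    also have "\<dots> = ennreal (s + 1 / 2 * b)"
     by (subst ennreal_plus) (use real b0 in auto)
    finally have "ennreal b \<le> ennreal (s + 1 / 2 * b)" .
    then have "b \<le> 2 * s" by (subst (asm) ennreal_le_iff) (use real b0 in auto)
    then have "ennreal b \<le> ennreal (2 * s)" by (rule ennreal_leI)
    then show ?thesis using real unfolding fin b_def[symmetric] by (simp add: ennreal_mult)
   qed (simp add: ennreal_mult_top)
   moreover have "\<mu> (ball (fst i) (5 * snd i)) = ennreal (5 ^ DIM('a)) * ?b"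
    using r emeasure_lebesgue_ball[of "5 * snd i" "fst i"] unfolding fin
    by (simp add: ennreal_mult[symmetric] power_mult_distrib mult_ac)
   ultimately have "\<mu> (ball (fst i) (5 * snd i)) \<le> ennreal (5 ^ DIM('a)) * (2 * ?I)"
    by (simp add: mult_left_mono)
   then show ?thesis by (simp add: ennreal_mult mult_ac)
  qed
  have "\<mu> (U n) \<le> \<mu> (\<Union>i\<in>C. ball (fst i) (5 * snd i))"
   using C by (intro emeasure_mono sets.countable_UN') auto
  also have "\<dots> \<le> (\<integral>\<^sup>+i. \<mu> (ball (fst i) (5 * snd i)) \<partial>count_space C)"
   using C by (intro emeasure_countable_UN_le) auto
  also have "\<dots> \<le> (\<integral>\<^sup>+i. ennreal (2 * 5 ^ DIM('a)) * (NN x\<in>ball (fst i) (snd i). \<Phi> (h x / t) * indicator {x. \<kappa> * t < h x} x) \<partial>count_space C)"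
   using one by (intro nn_integral_mono) auto
  also have "\<dots> = ennreal (2 * 5 ^ DIM('a)) * (\<integral>\<^sup>+i. (NN x\<in>ball (fst i) (snd i). \<Phi> (h x / t) * indicator {x. \<kappa> * t < h x} x) \<partial>count_space C)"
   by (simp add: nn_integral_cmult)
  also have "\<dots> \<le> ennreal (2 * 5 ^ DIM('a)) * ?J"
   using C by (intro mult_left_mono nn_integral_disjoint_le)
    (auto simp: disjoint_family_on_def pairwise_def disjnt_def)
  finally show ?thesis .
 qed
 have "exceptional_set \<Phi> h t = (\<Union>n. U n)"
 proof
  show "(\<Union>n. U n) \<subseteq> exceptional_set \<Phi> h t"
  proof
   fix x assume "x \<in> (\<Union>n. U n)"
   then obtain n c r where "x \<in> ball c r" "(c, r) \<in> K n" unfolding U_def by force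
   then have "x \<in> ball c r" "0 < r" "\<mu> (ball c r) < (NN x\<in>ball c r. \<Phi> (h x / t))"
    unfolding K_def by auto
   then show "x \<in> exceptional_set \<Phi> h t" unfolding exceptional_set_def by blast
  qed
  show "exceptional_set \<Phi> h t \<subseteq> (\<Union>n. U n)"
  proof
   fix x assume "x \<in> exceptional_set \<Phi> h t"
   then obtain c r where cr: "x \<in> ball c r" "0 < r" "\<mu> (ball c r) < (NN x\<in>ball c r. \<Phi> (h x / t))"
    unfolding exceptional_set_def by blast
   obtain n where "r \<le> real n" using real_arch_simple by blast
   then have "(c, r) \<in> K n" using cr by (simp add: K_def)
   then show "x \<in> (\<Union>n. U n)" using cr(1) unfolding U_def by (intro UN_I[of n] UN_I[of "(c, r)"]) auto
  qed
 qed
 moreover have "\<mu> (\<Union>n. U n) = (SUP n. \<mu> (U n))"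
 proof (rule SUP_emeasure_incseq[symmetric])
  have "open (U n)" for n unfolding U_def by auto
  then show "range U \<subseteq> \<L>" by auto
  show "incseq U"
  proof (rule monoI)
   fix i j :: nat assume "i \<le> j"
   then have "K i \<subseteq> K j" unfolding K_def by auto
   then show "U i \<le> U j" unfolding U_def by blast
  qed
 qed
 ultimately show ?thesis using bound by (simp add: SUP_le_iff)
qed

section \<open>From weak type to strong type\<close>

lemma nn_integral_powr_0:
 assumes "-1 < e" "0 \<le> X"
 shows "(\<integral>\<^sup>+t. ennreal (t powr e) * indicator {0..X} t \<partial>lborel) = ennreal (X powr (e + 1) / (e + 1))"
 by (rule nn_integral_has_integral_lebesgue'[OF _ has_integral_powr_from_0]) (use assms in auto)

text \<open>The weak type bound is multiplied by \<open>q t powr (q - 1)\<close> and integrated over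
  \<open>t\<close>. With \<open>\<Phi>\<close> written by layers, the layer \<open>v\<close> is
  active only for \<open>t \<le> h / max \<kappa> (\<alpha> v)\<close>, and the integral of
  \<open>t powr (q - 2)\<close> up to that point produces \<open>h powr q\<close> times the
  integrand of the hypothesis on \<open>B\<close>. The conclusion is phrased with a measurable
  majorant \<open>S\<close> of the \<open>q\<close>-th power of the maximal function, the form in
  which it is applied.\<close>

lemma maximal_bound:
 fixes m :: "real \<Rightarrow> ennreal" and \<alpha> :: "real \<Rightarrow> real"
 assumes [measurable]: "m \<in> borel_measurable borel" "\<alpha> \<in> borel_measurable borel"
  and q: "1 < q" and \<kappa>: "0 < \<kappa>" "orlicz_phi m \<alpha> \<kappa> \<le> 1 / 2"
  and B: "(\<integral>\<^sup>+v. m v * ennreal (max \<kappa> (\<alpha> v) powr (1 - q)) \<partial>lborel) \<le> ennreal B" "0 \<le> B"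
 shows "\<exists>C\<ge>0. \<forall>h::'a::euclidean_space \<Rightarrow> real. h \<in> \<M> \<longrightarrow> (\<forall>x. 0 \<le> h x) \<longrightarrow>
  (\<exists>S\<in>\<M>.
   (NN x. S x) \<le> ennreal C * (NR x. h x powr q) \<and>
   (\<forall>x y. 0 \<le> y \<longrightarrow> (\<forall>t. 0 < t \<longrightarrow> t < y \<longrightarrow> (\<exists>r>0. \<mu> (ball x r)
     < (NN z\<in>ball x r. orlicz_phi m \<alpha> (h z / t)))) \<longrightarrow> ennreal (y powr q) \<le> S x))"
proof (intro exI[of _ "2 * 5 ^ DIM('a) * (q / (q - 1) * B)"] conjI allI impI)
 show "0 \<le> 2 * 5 ^ DIM('a) * (q / (q - 1) * B)" using q B by simp
 fix h :: "'a \<Rightarrow> real"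
 assume [measurable]: "h \<in> \<M>" and h0: "\<forall>x. 0 \<le> h x"
 define \<Phi> where "\<Phi> = orlicz_phi m \<alpha>"
 have [measurable]: "\<Phi> \<in> borel_measurable borel" unfolding \<Phi>_def by measurable
 define E where "E t = exceptional_set \<Phi> h t" for t
 \<comment> \<open>The maximal function, recovered from its superlevel sets. Below, \<open>S\<close>
   is its \<open>q\<close>-th power in layer cake form.\<close>
 define mx where "mx x = Sup {ennreal t |t. 0 < t \<and> x \<in> E t}" for x
 have [measurable]: "mx \<in> \<M>"
 proof (rule borel_measurableI_greater)
  fix a
  have "{x \<in> space lebesgue. a < mx x} = (\<Union>t\<in>{t. 0 < t \<and> a < ennreal t}. E t)"
   by (auto simp: mx_def less_Sup_iff)
  moreover have "open (\<Union>t\<in>{t. 0 < t \<and> a < ennreal t}. E t)"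
   unfolding E_def using open_exceptional_set by blast
  ultimately show "{x \<in> space lebesgue. a < mx x} \<in> \<L>" by simp
 qed
 define F where "F = (\<lambda>z::'a \<times> real. if 0 < snd z \<and> ennreal (snd z) < mx (fst z)
   then ennreal (q * snd z powr (q - 1)) else 0)"
 have F[measurable]: "F \<in> \<M>" unfolding F_def by measurable
 define G where "G = (\<lambda>z::'a \<times> real. if 0 < snd z \<and> \<kappa> * snd z < h (fst z)
   then ennreal (q * snd z powr (q - 1)) * \<Phi> (h (fst z) / snd z) else 0)"
 have G[measurable]: "G \<in> \<M>" unfolding G_def by measurable
 define S where "S x = (NN t. F (x, t))" for x
 have Sm: "S \<in> \<M>" unfolding S_def[abs_def] using lebesgue_Tonelli(2)[OF F] .
 define A where "A = ennreal (2 * 5 ^ DIM('a))"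
 have inner: "(NN t. G (x, t)) \<le> ennreal (q / (q - 1) * B) * ennreal (h x powr q)" for x
 proof (cases "h x = 0")
  case True
  then have "G (x, t) = 0" for t using \<kappa> by (auto simp: G_def mult_less_0_iff)
  then show ?thesis by simp
 next
  case False
  with h0 have hx: "0 < h x" by (metis less_eq_real_def)
  define X where "X v = h x / max \<kappa> (\<alpha> v)" for v
  have X0: "0 \<le> X v" for v unfolding X_def using hx \<kappa> by simp
  have [measurable]: "X \<in> borel_measurable borel" unfolding X_def[abs_def] by measurable
  define H where "H t v = m v * (ennreal (q * h x) * (ennreal (t powr (q - 2)) * indicator {0..X v} t))" for t v
  have GH: "G (x, t) \<le> (\<integral>\<^sup>+v. H t v \<partial>lborel)" for t
  proof (cases "0 < t \<and> \<kappa> * t < h x")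
   case True
   then have t: "0 < t" "\<kappa> * t < h x" by auto
   have e: "q * t powr (q - 1) * (h x / t) = q * h x * t powr (q - 2)"
    using t by (simp add: powr_diff field_simps power2_eq_square)
   have "G (x, t) = ennreal (q * t powr (q - 1)) * ennreal (h x / t) * (\<integral>\<^sup>+v. m v * indicator {v. \<alpha> v \<le> h x / t} v \<partial>lborel)"
    using t by (simp add: G_def \<Phi>_def orlicz_phi_def mult.assoc)
   also have "\<dots> = ennreal (q * h x * t powr (q - 2)) * (\<integral>\<^sup>+v. m v * indicator {v. \<alpha> v \<le> h x / t} v \<partial>lborel)"
    using q t hx ennreal_mult[of "q * t powr (q - 1)" "h x / t"] by (simp only: e[symmetric]) simp
   also have "\<dots> = (\<integral>\<^sup>+v. ennreal (q * h x * t powr (q - 2)) * (m v * indicator {v. \<alpha> v \<le> h x / t} v) \<partial>lborel)"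
    by (rule nn_integral_cmult[symmetric]) (simp add: indicator_def)
   also have "\<dots> \<le> (\<integral>\<^sup>+v. H t v \<partial>lborel)"
   proof (rule nn_integral_mono)
    fix v
    have "t \<le> X v" if "\<alpha> v \<le> h x / t"
    proof -
     have "max \<kappa> (\<alpha> v) * t \<le> h x" using that t by (auto simp: max_def field_simps)
     then show ?thesis unfolding X_def using \<kappa> by (simp add: field_simps)
    qed
    then show "ennreal (q * h x * t powr (q - 2)) * (m v * indicator {v. \<alpha> v \<le> h x / t} v) \<le> H t v"
     using q hx t by (auto simp: H_def ennreal_mult mult_ac indicator_def)
   qed
   finally show ?thesis .
  next
   case False
   then have "G (x, t) = 0" by (auto simp: G_def)
   then show ?thesis by simp
  qed
  have Hm: "(\<lambda>z. H (fst z) (snd z)) \<in> borel_measurable (lborel \<Otimes>\<^sub>M lborel)"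
   unfolding H_def indicator_def atLeastAtMost_iff by measurable
  have "(NN t. G (x, t)) \<le> (\<integral>\<^sup>+t. \<integral>\<^sup>+v. H t v \<partial>lborel \<partial>lborel)"
   unfolding nn_integral_completion by (intro nn_integral_mono GH)
  also have "\<dots> = (\<integral>\<^sup>+v. \<integral>\<^sup>+t. H t v \<partial>lborel \<partial>lborel)"
   using Hm by (intro lborel_pair.Fubini'[symmetric]) (simp add: split_beta')
  also have "\<dots> = (\<integral>\<^sup>+v. m v * (ennreal (q * h x) * ennreal (X v powr (q - 1) / (q - 1))) \<partial>lborel)"
  proof (rule nn_integral_cong)
   fix v
   have "(\<integral>\<^sup>+t. H t v \<partial>lborel) = m v * (ennreal (q * h x) * (\<integral>\<^sup>+t. ennreal (t powr (q - 2)) * indicator {0..X v} t \<partial>lborel))"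
    unfolding H_def by (simp add: nn_integral_cmult)
   also have "(\<integral>\<^sup>+t. ennreal (t powr (q - 2)) * indicator {0..X v} t \<partial>lborel) = ennreal (X v powr (q - 1) / (q - 1))"
    using nn_integral_powr_0[of "q - 2" "X v"] q X0 by simp
   finally show "(\<integral>\<^sup>+t. H t v \<partial>lborel) = m v * (ennreal (q * h x) * ennreal (X v powr (q - 1) / (q - 1)))" .
  qed
  also have "\<dots> = (\<integral>\<^sup>+v. ennreal (q / (q - 1) * h x powr q) * (m v * ennreal (max \<kappa> (\<alpha> v) powr (1 - q))) \<partial>lborel)"
  proof (rule nn_integral_cong)
   fix v
   have "q * h x * (X v powr (q - 1) / (q - 1)) = q / (q - 1) * h x powr q * max \<kappa> (\<alpha> v) powr (1 - q)"
   proof -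
    define M where "M = max \<kappa> (\<alpha> v)"
    have M: "0 < M" using \<kappa> by (simp add: M_def)
    have "M powr (1 - q) = 1 / M powr (q - 1)" using powr_minus_divide[of M "q - 1"] by simp
    then have 1: "X v powr (q - 1) = h x powr (q - 1) * M powr (1 - q)"
     using hx M by (simp add: X_def M_def[symmetric] powr_divide)
    have 2: "h x powr q = h x * h x powr (q - 1)" using hx by (simp add: powr_mult_base)
    show ?thesis unfolding 1 2 M_def[symmetric] by simp
   qed
   then have e: "ennreal (q * h x) * ennreal (X v powr (q - 1) / (q - 1)) = ennreal (q / (q - 1) * h x powr q) * ennreal (max \<kappa> (\<alpha> v) powr (1 - q))"
    using q hx by (simp add: ennreal_mult[symmetric])
   then show "m v * (ennreal (q * h x) * ennreal (X v powr (q - 1) / (q - 1))) =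
     ennreal (q / (q - 1) * h x powr q) * (m v * ennreal (max \<kappa> (\<alpha> v) powr (1 - q)))"
    by (simp only: e) (simp add: mult_ac)
  qed
  also have "\<dots> = ennreal (q / (q - 1) * h x powr q) * (\<integral>\<^sup>+v. m v * ennreal (max \<kappa> (\<alpha> v) powr (1 - q)) \<partial>lborel)"
   by (rule nn_integral_cmult) measurable
  also have "\<dots> \<le> ennreal (q / (q - 1) * h x powr q) * ennreal B"
   by (intro mult_left_mono B) auto
  also have "\<dots> = ennreal (q / (q - 1) * B) * ennreal (h x powr q)"
   using q B by (simp add: ennreal_mult[symmetric] mult_ac)
  finally show ?thesis .
 qed
 have "(NN x. S x) = (NN t. NN x. F (x, t))"
  unfolding S_def using lebesgue_Tonelli(1)[OF F] .
 also have "\<dots> \<le> (NN t. A * (NN x. G (x, t)))"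
 proof (rule nn_integral_mono)
  fix t :: real
  show "(NN x. F (x, t)) \<le> A * (NN x. G (x, t))"
  proof (cases "0 < t")
   case False then show ?thesis by (simp add: F_def)
  next
   case True
   have [measurable]: "E t \<in> \<L>" unfolding E_def using open_exceptional_set[of \<Phi> h t] by simp
   \<comment> \<open>The sets \<open>E t\<close> decrease in \<open>t\<close> because
     \<open>\<Phi>\<close> is monotone, so a level above \<open>t\<close> that witnesses the
     supremum also puts \<open>x\<close> into \<open>E t\<close>.\<close>
   have sub: "x \<in> E t" if "ennreal t < mx x" for x
   proof -
    have "\<exists>y\<in>{ennreal t |t. 0 < t \<and> x \<in> E t}. ennreal t < y"
     using that unfolding mx_def less_Sup_iff .
    then obtain y where y: "y \<in> {ennreal t |t. 0 < t \<and> x \<in> E t}" "ennreal t < y"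
     by (rule bexE)
    then obtain t' where "y = ennreal t'" "x \<in> E t'" by blast
    with y True have t': "t < t'" "x \<in> E t'" by (auto simp: ennreal_less_iff)
    have le: "(NN z\<in>Q. \<Phi> (h z / t')) \<le> (NN z\<in>Q. \<Phi> (h z / t))" for Q
     unfolding \<Phi>_def using t' True h0
     by (intro nn_integral_mono mult_right_mono orlicz_phi_mono divide_left_mono) auto
    obtain c r where cr: "x \<in> ball c r" "0 < r"
     "\<mu> (ball c r) < (NN z\<in>ball c r. \<Phi> (h z / t'))"
     using t'(2) unfolding E_def exceptional_set_def by blast
    then have "\<mu> (ball c r) < (NN z\<in>ball c r. \<Phi> (h z / t))"
     using le[of "ball c r"] by (rule_tac less_le_trans)
    then show ?thesis using cr(1,2) unfolding E_def exceptional_set_def by blast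
   qed
   have "(NN x. F (x, t)) \<le> (NN x. ennreal (q * t powr (q - 1)) * indicator (E t) x)"
    using sub by (intro nn_integral_mono) (auto simp: F_def indicator_def)
   also have "\<dots> = ennreal (q * t powr (q - 1)) * \<mu> (E t)"
    by (simp add: nn_integral_cmult)
   also have "\<dots> \<le> ennreal (q * t powr (q - 1)) * (A * (NN x. \<Phi> (h x / t) * indicator {x. \<kappa> * t < h x} x))"
    unfolding A_def E_def using \<kappa> True orlicz_phi_mono[of _ _ m \<alpha>]
    by (intro mult_left_mono exceptional_set_weak_type) (auto simp: \<Phi>_def)
   also have "\<dots> = A * (NN x. ennreal (q * t powr (q - 1)) * (\<Phi> (h x / t) * indicator {x. \<kappa> * t < h x} x))"
    by (subst nn_integral_cmult) (auto simp: indicator_def mult_ac)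
   also have "\<dots> = A * (NN x. G (x, t))"
    using True by (intro arg_cong[where f="\<lambda>u. A * u"] nn_integral_cong) (auto simp: G_def indicator_def)
   finally show ?thesis .
  qed
 qed
 also have "\<dots> = A * (NN t. (NN x. G (x, t)))"
 proof (rule nn_integral_cmult)
  have "(\<lambda>z. G (snd z, fst z)) \<in> borel_measurable (lebesgue :: (real \<times> 'a) measure)"
   unfolding G_def fst_conv snd_conv by measurable
  then show "(\<lambda>t. NN x. G (x, t)) \<in> \<M>"
   using lebesgue_Tonelli(2) by fastforce
 qed
 also have "\<dots> = A * (NN x. (NN t. G (x, t)))"
  using lebesgue_Tonelli(1)[OF G] by simp
 also have "\<dots> \<le> A * (NN x. ennreal (q / (q - 1) * B) * ennreal (h x powr q))"
  by (intro mult_left_mono nn_integral_mono inner) auto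
 also have "\<dots> = A * (ennreal (q / (q - 1) * B) * (NR x. h x powr q))"
  by (subst nn_integral_cmult) auto
 also have "\<dots> = ennreal (2 * 5 ^ DIM('a) * (q / (q - 1) * B)) * (NR x. h x powr q)"
 proof -
  have "ennreal (2 * 5 ^ DIM('a) * (q / (q - 1) * B)) = A * ennreal (q / (q - 1) * B)"
   unfolding A_def using q B by (intro ennreal_mult) auto
  then show ?thesis by (simp only: mult.assoc)
 qed
 finally have S1: "(NN x. S x) \<le> \<dots>" .
 have S2: "ennreal (y powr q) \<le> S x" if y: "0 \<le> y"
  and ex: "\<forall>t. 0 < t \<longrightarrow> t < y \<longrightarrow> (\<exists>r>0. \<mu> (ball x r) < (NN z\<in>ball x r. orlicz_phi m \<alpha> (h z / t)))" for x y
 proof -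
  have lt: "ennreal t < mx x" if t: "0 < t" "t < y" for t
  proof -
   \<comment> \<open>An intermediate level makes the inequality with the supremum strict, as the
     definition of \<open>F\<close> demands.\<close>
   obtain t' where t': "t < t'" "t' < y" using t dense by blast
   obtain r where "0 < r" "\<mu> (ball x r) < (NN z\<in>ball x r. \<Phi> (h z / t'))"
    using ex[rule_format, of t'] t t' by (auto simp: \<Phi>_def)
   moreover have "x \<in> ball x r" using \<open>0 < r\<close> by simp
   ultimately have "x \<in> E t'" unfolding E_def exceptional_set_def by blast
   then have "ennreal t' \<le> mx x" unfolding mx_def using t t' by (intro Sup_upper) auto
   moreover have "ennreal t < ennreal t'" using t t' by (simp add: ennreal_less_iff)
   ultimately show ?thesis by (rule less_le_trans[rotated])
  qed
  have "ennreal (y powr q) = ennreal q * ennreal (y powr (q - 1 + 1) / (q - 1 + 1))"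
   using q by (simp add: ennreal_mult[symmetric])
  also have "\<dots> = ennreal q * (\<integral>\<^sup>+t. ennreal (t powr (q - 1)) * indicator {0..y} t \<partial>lborel)"
   using q y by (subst nn_integral_powr_0) auto
  also have "\<dots> = (\<integral>\<^sup>+t. ennreal q * (ennreal (t powr (q - 1)) * indicator {0..y} t) \<partial>lborel)"
   by (rule nn_integral_cmult[symmetric]) measurable
  also have "\<dots> \<le> (\<integral>\<^sup>+t. F (x, t) \<partial>lborel)"
  proof (rule nn_integral_mono_AE)
   have "AE t in lborel. t \<noteq> y" by (rule AE_lborel_singleton)
   then show "AE t in lborel. ennreal q * (ennreal (t powr (q - 1)) * indicator {0..y} t) \<le> F (x, t)"
   proof eventually_elim
    case (elim t)
    then show ?case using lt[of t] q by (auto simp: F_def indicator_def ennreal_mult)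
   qed
  qed
  finally show ?thesis unfolding S_def nn_integral_completion .
 qed
 show "\<exists>S\<in>\<M>.
   (NN x. S x) \<le> ennreal (2 * 5 ^ DIM('a) * (q / (q - 1) * B)) * (NR x. h x powr q) \<and>
   (\<forall>x y. 0 \<le> y \<longrightarrow> (\<forall>t. 0 < t \<longrightarrow> t < y \<longrightarrow> (\<exists>r>0. \<mu> (ball x r)
     < (NN z\<in>ball x r. orlicz_phi m \<alpha> (h z / t)))) \<longrightarrow> ennreal (y powr q) \<le> S x)"
  using Sm S1 S2 by blast
qed

text \<open>Layers of total mass 1 that are all active from 0 on give the identity. The
  Hardy-Littlewood theorem thereby becomes the case \<open>\<kappa> = 1 / 2\<close> of the Orlicz
  bound.\<close>

lemma orlicz_phi_identity:
 "orlicz_phi (indicator {0..1}) (\<lambda>_. 0) u = ennreal u"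
proof (cases "0 \<le> u")
 case True
 then have "(\<integral>\<^sup>+v. indicator {0..1} v * indicator {v::real. 0 \<le> u} v \<partial>lborel) = (\<integral>\<^sup>+v. indicator {0..1::real} v \<partial>lborel)"
  by (intro nn_integral_cong) (simp add: indicator_def)
 then show ?thesis by (simp add: orlicz_phi_def)
next
 case False
 then show ?thesis by (simp add: orlicz_phi_def ennreal_neg)
qed

lemma Hardy_Littlewood_maximal:
 assumes p: "1 < p"
 shows "\<exists>C\<ge>0. \<forall>h::'a::euclidean_space \<Rightarrow> real. h \<in> \<M> \<longrightarrow> (\<forall>x. 0 \<le> h x) \<longrightarrow>
  (\<exists>S\<in>\<M>.
   (NN x. S x) \<le> ennreal C * (NR x. h x powr p) \<and>
   (\<forall>x y r. 0 \<le> y \<longrightarrow> 0 < r \<longrightarrow> ennreal y * \<mu> (ball x r) \<le> (NR z\<in>ball x r. h z)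
     \<longrightarrow> ennreal (y powr p) \<le> S x))"
proof -
 have "(\<integral>\<^sup>+v. indicator {0..1::real} v * ennreal (max (1/2) 0 powr (1 - p)) \<partial>lborel) = (\<integral>\<^sup>+v. ennreal ((1/2) powr (1 - p)) * indicator {0..1::real} v \<partial>lborel)"
  by (intro nn_integral_cong) (simp add: mult.commute)
 also have "\<dots> = ennreal ((1/2) powr (1 - p))" by (simp add: nn_integral_cmult)
 finally have B: "(\<integral>\<^sup>+v. indicator {0..1::real} v * ennreal (max (1/2) 0 powr (1 - p)) \<partial>lborel) \<le> ennreal ((1/2) powr (1 - p))"
  by simp
 have half: "orlicz_phi (indicator {0..1}) (\<lambda>_. 0) (1/2) \<le> 1 / 2"
  unfolding orlicz_phi_identity using divide_ennreal[of 1 2] by simp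
 obtain C where C: "0 \<le> C" and max: "\<And>h::'a \<Rightarrow> real. h \<in> \<M> \<Longrightarrow> (\<forall>x. 0 \<le> h x) \<Longrightarrow>
  (\<exists>S\<in>\<M>.
   (NN x. S x) \<le> ennreal C * (NR x. h x powr p) \<and>
   (\<forall>x y. 0 \<le> y \<longrightarrow> (\<forall>t. 0 < t \<longrightarrow> t < y \<longrightarrow> (\<exists>r>0. \<mu> (ball x r)
     < (NR z\<in>ball x r. h z / t))) \<longrightarrow> ennreal (y powr p) \<le> S x))"
  using maximal_bound[where 'a='a, OF _ _ p _ half B] unfolding orlicz_phi_identity by auto
 show ?thesis
 proof (intro exI[of _ C] conjI allI impI C)
  fix h :: "'a \<Rightarrow> real" assume hm[measurable]: "h \<in> \<M>" and h0: "\<forall>x. 0 \<le> h x"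
  obtain S where S: "S \<in> \<M>"
   "(NN x. S x) \<le> ennreal C * (NR x. h x powr p)"
   "\<And>x y. 0 \<le> y \<Longrightarrow> (\<forall>t. 0 < t \<longrightarrow> t < y \<longrightarrow> (\<exists>r>0. \<mu> (ball x r)
     < (NR z\<in>ball x r. h z / t))) \<Longrightarrow> ennreal (y powr p) \<le> S x"
   using max[OF hm h0] by blast
  have "ennreal (y powr p) \<le> S x" if y: "0 \<le> y" and r: "0 < r"
   and le: "ennreal y * \<mu> (ball x r) \<le> (NR z\<in>ball x r. h z)" for x y r
  proof (rule S(3)[OF y], intro allI impI exI[of _ r] conjI r)
   fix t assume t: "0 < t" "t < y"
   define b where "b = unit_ball_vol (DIM('a)) * r ^ DIM('a)"
   have b: "0 < b" "\<mu> (ball x r) = ennreal b"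
    using r emeasure_lebesgue_ball[of r x] by (auto simp: b_def)
   have "(NR z\<in>ball x r. h z / t) = (NN z. ennreal (1 / t) * (ennreal (h z) * indicator (ball x r) z))"
    using t h0 by (intro nn_integral_cong) (auto simp: indicator_def ennreal_mult[symmetric])
   also have "\<dots> = ennreal (1 / t) * (NR z\<in>ball x r. h z)"
    by (rule nn_integral_cmult) measurable
   also have "\<dots> \<ge> ennreal (1 / t) * (ennreal y * ennreal b)" using le b by (intro mult_left_mono) auto
   finally have "ennreal (y / t * b) \<le> (NR z\<in>ball x r. h z / t)"
    using t y b by (simp add: ennreal_mult[symmetric])
   moreover have "ennreal b < ennreal (y / t * b)" using t y b by (simp add: ennreal_less_iff field_simps)
   ultimately show "\<mu> (ball x r) < (NR z\<in>ball x r. h z / t)"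
    unfolding b by (rule less_le_trans[rotated])
  qed
  with S(1,2) show "\<exists>S\<in>\<M>.
   (NN x. S x) \<le> ennreal C * (NR x. h x powr p) \<and>
   (\<forall>x y r. 0 \<le> y \<longrightarrow> 0 < r \<longrightarrow> ennreal y * \<mu> (ball x r) \<le> (NR z\<in>ball x r. h z)
     \<longrightarrow> ennreal (y powr p) \<le> S x)" by blast
 qed
qed

lemma maximal_weak_type:
 fixes h :: "'a::euclidean_space \<Rightarrow> real"
 assumes [measurable]: "h \<in> \<M>" and h0: "\<And>x. 0 \<le> h x" and t: "0 < t"
 shows "\<mu> (exceptional_set ennreal h t) \<le> ennreal (2 * 5 ^ DIM('a) / t) * (NR x. h x)"
proof -
 have "\<mu> (exceptional_set ennreal h t)
  \<le> ennreal (2 * 5 ^ DIM('a)) * (NN x. ennreal (h x / t) * indicator {x. 1 / 2 * t < h x} x)"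
  using divide_ennreal[of 1 2] t by (intro exceptional_set_weak_type) (auto intro: ennreal_leI)
 also have "\<dots> \<le> ennreal (2 * 5 ^ DIM('a)) * (NN x. ennreal (1 / t) * ennreal (h x))"
  using t h0 by (intro mult_left_mono nn_integral_mono) (auto simp: indicator_def ennreal_mult[symmetric])
 also have "\<dots> = ennreal (2 * 5 ^ DIM('a)) * (ennreal (1 / t) * (NR x. h x))"
  by (subst nn_integral_cmult) auto
 also have "\<dots> = ennreal (2 * 5 ^ DIM('a) / t) * (NR x. h x)"
  using t by (simp add: mult.assoc[symmetric] ennreal_mult[symmetric] divide_inverse)
 finally show ?thesis .
qed

section \<open>Dyadic differentiation of integrals\<close>

lemma dcube_in_open:
 fixes x :: "'a::euclidean_space"
 assumes "open U" "x \<in> U"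
 obtains n where "N \<le> n" "dcube n x \<subseteq> U"
proof -
 obtain e where e: "0 < e" "ball x e \<subseteq> U" using assms openE by blast
 define k where "k = max N \<lceil>log 2 (DIM('a) / e) + 1\<rceil>"
 have "log 2 (DIM('a) / e) < k" unfolding k_def by linarith
 then have "DIM('a) / e < 2 powr k" using e by (subst (asm) log_less_iff) auto
 then have "DIM('a) * dside k < e" using e by (simp add: dside_def powr_minus field_simps)
 then have "dcube k x \<subseteq> ball x e" using dcube_norm_diff[of x k x] by (force simp: dist_norm)
 then show thesis using e that[of k] by (auto simp: k_def)
qed

text \<open>Suppose \<open>f\<close> exceeds \<open>lam + \<epsilon>\<close> on a set
  \<open>F\<close> of finite measure. An open \<open>U\<close> slightly larger than \<open>F\<close>
  is divided into maximal dyadic cubes of generation at least \<open>N\<close>; those that meet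
  \<open>F\<close> have means at most \<open>lam\<close>, so
  \<open>(lam + \<epsilon>) |F| \<le> lam |U|\<close>, and letting \<open>U\<close> shrink to
  \<open>F\<close> gives \<open>|F| = 0\<close>.\<close>

lemma dyadic_differentiation:
 fixes f :: "'a::euclidean_space \<Rightarrow> ennreal"
 assumes [measurable]: "f \<in> \<M>" "E \<in> \<L>" and lam: "0 \<le> lam"
  and avg: "\<And>x n. x \<in> E \<Longrightarrow> N \<le> n \<Longrightarrow> (NN y\<in>dcube n x. f y) \<le> ennreal lam * \<mu> (dcube n x)"
 shows "AE x in lebesgue. x \<in> E \<longrightarrow> f x \<le> ennreal lam"
proof -
 have null: "\<mu> F = 0"
  if F: "F \<in> \<L>" "F \<subseteq> E" "F \<subseteq> ball 0 (real k)" "\<And>x. x \<in> F \<Longrightarrow> ennreal (lam + \<epsilon>) < f x" "0 < \<epsilon>" for F k \<epsilon>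
 proof -
  have [measurable]: "F \<in> \<L>" by fact
  have "\<mu> F \<le> \<mu> (ball (0::'a) (real k))" using F by (intro emeasure_mono) auto
  also have "\<dots> < \<infinity>" using emeasure_lebesgue_ball[of "real k" "0::'a"] by simp
  finally have fin: "\<mu> F < \<infinity>" .
  define m where "m = measure lebesgue F"
  have m: "\<mu> F = ennreal m" "0 \<le> m"
   using fin by (auto simp: m_def emeasure_eq_ennreal_measure)
  have "m \<le> lam * \<eta> / \<epsilon>" if \<eta>: "0 < \<eta>" for \<eta>
  proof -
   obtain U where U: "open U" "F \<subseteq> U" "U - F \<in> lmeasurable" "\<mu> (U - F) < ennreal \<eta>"
    using sets_lebesgue_outer_open[OF F(1) \<eta>] by blast
   have [measurable]: "U \<in> \<L>" using U by auto
   have inv: "\<And>n x y. N \<le> n \<and> dcube n x \<subseteq> U \<Longrightarrow> y \<in> dcube n x \<Longrightarrow> N \<le> n \<and> dcube n y \<subseteq> U"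
    using dcube_eq by blast
   have bdd: "\<And>x. \<exists>M. \<forall>n<M. \<not> (N \<le> n \<and> dcube n x \<subseteq> U)" by (intro exI[of _ N]) auto
   obtain \<Q> where Q: "countable \<Q>" "disjoint \<Q>" "\<Union>\<Q> = {x. \<exists>n. N \<le> n \<and> dcube n x \<subseteq> U}"
    "\<And>Q. Q \<in> \<Q> \<Longrightarrow> \<exists>n x. Q = dcube n x \<and> (N \<le> n \<and> dcube n x \<subseteq> U) \<and> (\<forall>m<n. \<not> (N \<le> m \<and> dcube m x \<subseteq> U))"
    by (rule dyadic_stopping[of "\<lambda>n x. N \<le> n \<and> dcube n x \<subseteq> U"]) (erule inv, assumption, rule bdd, rule that)
   have UQ: "\<Union>\<Q> = U"
   proof
    show "\<Union>\<Q> \<subseteq> U" unfolding Q(3) using dcube_self by blast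
    show "U \<subseteq> \<Union>\<Q>" unfolding Q(3) using dcube_in_open[OF U(1)] by blast
   qed
   have Qs: "Q \<in> \<L>" if "Q \<in> \<Q>" for Q using Q(4)[OF that] by auto
   have "ennreal (lam + \<epsilon>) * \<mu> F = (NN x. ennreal (lam + \<epsilon>) * indicator F x)"
    by (simp add: nn_integral_cmult)
   also have "\<dots> \<le> (NN x\<in>\<Union>\<Q>. f x * indicator F x)"
    using U(2) F(4) unfolding UQ by (intro nn_integral_mono) (auto simp: indicator_def less_imp_le)
   also have "\<dots> = (\<integral>\<^sup>+Q. (NN x\<in>Q. f x * indicator F x) \<partial>count_space \<Q>)"
    using Q Qs by (intro nn_integral_countable_Union) auto
   also have "\<dots> \<le> (\<integral>\<^sup>+Q. ennreal lam * \<mu> Q \<partial>count_space \<Q>)"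
   proof (rule nn_integral_mono)
    fix Q assume "Q \<in> space (count_space \<Q>)"
    then obtain n x where n: "Q = dcube n x" "N \<le> n" using Q(4) by fastforce
    show "(NN x\<in>Q. f x * indicator F x) \<le> ennreal lam * \<mu> Q"
    proof (cases "Q \<inter> F = {}")
     case True
     then have "(NN x\<in>Q. f x * indicator F x) = (\<integral>\<^sup>+x. 0 \<partial>(lebesgue :: 'a measure))"
      by (intro nn_integral_cong) (auto simp: indicator_def)
     then show ?thesis by simp
    next
     case False
     then obtain z where z: "z \<in> Q" "z \<in> F" by auto
     then have Qz: "Q = dcube n z" using n dcube_eq by metis
     have "(NN x\<in>Q. f x * indicator F x) \<le> (NN x\<in>Q. f x)"
      by (intro nn_integral_mono) (auto simp: indicator_def)
     also have "\<dots> \<le> ennreal lam * \<mu> Q" unfolding Qz using z F(2) n by (intro avg) auto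
     finally show ?thesis .
    qed
   qed
   also have "\<dots> = ennreal lam * (\<integral>\<^sup>+Q. \<mu> Q \<partial>count_space \<Q>)" by (simp add: nn_integral_cmult)
   also have "(\<integral>\<^sup>+Q. \<mu> Q \<partial>count_space \<Q>) = \<mu> (\<Union>Q\<in>\<Q>. Q)"
    using Q Qs by (intro emeasure_UN_countable[symmetric]) (auto simp: disjoint_family_on_def disjoint_def)
   also have "(\<Union>Q\<in>\<Q>. Q) = F \<union> (U - F)" using UQ U(2) by auto
   also have "\<mu> (F \<union> (U - F)) = \<mu> F + \<mu> (U - F)"
    by (rule plus_emeasure[symmetric]) auto
   also have "ennreal lam * (\<mu> F + \<mu> (U - F)) \<le> ennreal lam * (ennreal m + ennreal \<eta>)"
    using U(4) unfolding m by (intro mult_left_mono add_left_mono) auto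
   finally have "ennreal ((lam + \<epsilon>) * m) \<le> ennreal (lam * (m + \<eta>))"
    unfolding m(1) using m lam F(5) \<eta> by (simp only: ennreal_mult[symmetric] ennreal_plus[symmetric])
   then have "(lam + \<epsilon>) * m \<le> lam * (m + \<eta>)"
    by (subst (asm) ennreal_le_iff) (use m lam \<eta> in auto)
   then show ?thesis using F(5) by (simp add: field_simps)
  qed
  note le = this
  have "m \<le> 0 + e" if "0 < e" for e
  proof -
   have "m \<le> lam * (e * \<epsilon> / (lam + 1)) / \<epsilon>" using le[of "e * \<epsilon> / (lam + 1)"] that F(5) lam by simp
   also have "\<dots> = e * (lam / (lam + 1))" using F(5) by simp
   also have "\<dots> \<le> e * 1" using that lam by (intro mult_left_mono) auto
   finally show ?thesis by simp
  qed
  then have "m \<le> 0" by (rule field_le_epsilon)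
  then show ?thesis using m by simp
 qed
 define F where "F k = {x \<in> space lebesgue. x \<in> E \<and> x \<in> ball 0 (real k) \<and> ennreal (lam + 1 / Suc k) < f x}" for k
 have Fm: "F k \<in> \<L>" for k unfolding F_def by measurable
 have "F k \<in> null_sets lebesgue" for k
 proof (rule null_setsI[OF null[of "F k" k "1 / Suc k"] Fm])
  show "F k \<in> \<L>" by (rule Fm)
 qed (auto simp: F_def)
 then have "(\<Union>k. F k) \<in> null_sets lebesgue" by (rule null_sets_UN)
 moreover have "{x \<in> space lebesgue. \<not> (x \<in> E \<longrightarrow> f x \<le> ennreal lam)} \<subseteq> (\<Union>k. F k)"
 proof
  fix x assume "x \<in> {x \<in> space lebesgue. \<not> (x \<in> E \<longrightarrow> f x \<le> ennreal lam)}"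
  then have x: "x \<in> E" "ennreal lam < f x" by auto
  obtain z where z: "ennreal lam < z" "z < f x" using x dense by blast
  then obtain z' where z': "z = ennreal z'" "0 \<le> z'" by (cases z) auto
  have lz: "lam < z'" using z z' lam by (simp add: ennreal_less_iff)
  obtain k1 where k1: "1 / Suc k1 < z' - lam" using reals_Archimedean[of "z' - lam"] lz by (auto simp: inverse_eq_divide)
  obtain k2 where k2: "norm x < real k2" using reals_Archimedean2 by blast
  define k where "k = max k1 k2"
  have "1 / Suc k \<le> 1 / Suc k1" by (simp add: k_def frac_le)
  then have "lam + 1 / Suc k \<le> z'" using k1 by linarith
  then have "ennreal (lam + 1 / Suc k) < f x" using z z' by (metis ennreal_leI order_le_less_trans)
  moreover have "norm x < real k" using k2 by (simp add: k_def)
  ultimately show "x \<in> (\<Union>k. F k)" using x(1) by (auto simp: F_def)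
 qed
 ultimately show ?thesis by (rule AE_I')
qed

section \<open>Calderon-Zygmund operators on test functions\<close>

text \<open>Bounded functions with bounded support: on these a kernel represents its operator, and
  they lie in every \<open>L^q\<close>, so that operators bounded for different exponents can be
  compared on them.\<close>

definition bcs :: "('a::euclidean_space \<Rightarrow> complex) set" where
 "bcs = {f. f \<in> \<M> \<and> bounded (range f) \<and> bounded {x. f x \<noteq> 0}}"

abbreviation cut :: "'a set \<Rightarrow> ('a \<Rightarrow> 'b::zero) \<Rightarrow> 'a \<Rightarrow> 'b" where
 "cut A f \<equiv> \<lambda>x. if x \<in> A then f x else 0"

lemma bcs_measurable: "f \<in> bcs \<Longrightarrow> f \<in> \<M>"
 by (simp add: bcs_def)

lemma bcs_bounds:
 assumes "f \<in> bcs"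
 obtains M R where "0 \<le> M" "\<And>x. norm (f x) \<le> M" "0 \<le> R" "\<And>x. R < norm x \<Longrightarrow> f x = 0"
proof -
 obtain M where M: "\<forall>x\<in>range f. norm x \<le> M" using assms by (auto simp: bcs_def bounded_iff)
 obtain R where R: "\<forall>x\<in>{x. f x \<noteq> 0}. norm x \<le> R" using assms by (auto simp: bcs_def bounded_iff)
 show thesis
 proof (rule that[of "\<bar>M\<bar>" "\<bar>R\<bar>"])
  show "norm (f x) \<le> \<bar>M\<bar>" for x using M[rule_format, of "f x"] by simp
  show "f x = 0" if "\<bar>R\<bar> < norm x" for x using R[rule_format, of x] that by force
 qed auto
qed

lemma bcsI:
 assumes "f \<in> \<M>" "\<And>x. norm (f x) \<le> M" "\<And>x. R < norm x \<Longrightarrow> f x = 0"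
 shows "f \<in> bcs"
proof -
 have "norm x \<le> R" if "f x \<noteq> 0" for x using assms(3)[of x] that by force
 then show ?thesis using assms(1,2) by (auto simp: bcs_def bounded_iff)
qed

lemma bcs_compact: "f \<in> bcs \<Longrightarrow> compact (closure {x. f x \<noteq> 0})"
 by (simp add: bcs_def compact_closure)

lemma bcs_cut: "f \<in> bcs \<Longrightarrow> A \<in> \<L> \<Longrightarrow> cut A f \<in> bcs"
proof -
 assume f: "f \<in> bcs" and A[measurable]: "A \<in> \<L>"
 have [measurable]: "f \<in> \<M>" using f by (rule bcs_measurable)
 obtain M R where "0 \<le> M" "\<And>x. norm (f x) \<le> M" "\<And>x. R < norm x \<Longrightarrow> f x = 0"
  using bcs_bounds[OF f] by metis
 moreover have "cut A f \<in> \<M>" by measurable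
 ultimately show ?thesis by (intro bcsI[of _ M R]) auto
qed

lemma bcs_cut_const: "bounded A \<Longrightarrow> A \<in> \<L> \<Longrightarrow> cut A (\<lambda>_. c) \<in> bcs"
proof -
 assume A: "bounded A" and [measurable]: "A \<in> \<L>"
 obtain R where "\<forall>x\<in>A. norm x \<le> R" using A by (auto simp: bounded_iff)
 then have "R < norm x \<Longrightarrow> x \<notin> A" for x by force
 moreover have "cut A (\<lambda>_. c) \<in> \<M>" by measurable
 ultimately show ?thesis by (intro bcsI[of _ "norm c" R]) auto
qed

lemma bcs_add: "f \<in> bcs \<Longrightarrow> g \<in> bcs \<Longrightarrow> (\<lambda>x. f x + g x) \<in> bcs"
proof -
 assume f: "f \<in> bcs" and g: "g \<in> bcs"
 have [measurable]: "f \<in> \<M>" "g \<in> \<M>"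
  using f g by (auto intro: bcs_measurable)
 obtain M R where 1: "\<And>x. norm (f x) \<le> M" "\<And>x. R < norm x \<Longrightarrow> f x = 0"
  using bcs_bounds[OF f] by metis
 obtain M' R' where 2: "\<And>x. norm (g x) \<le> M'" "\<And>x. R' < norm x \<Longrightarrow> g x = 0"
  using bcs_bounds[OF g] by metis
 show ?thesis
 proof (rule bcsI[of _ "M + M'" "max R R'"])
  show "norm (f x + g x) \<le> M + M'" for x using 1(1) 2(1) by (rule norm_triangle_mono)
 qed (use 1 2 in auto)
qed

lemma bcs_cmult: "f \<in> bcs \<Longrightarrow> (\<lambda>x. c * f x) \<in> bcs"
proof -
 assume f: "f \<in> bcs"
 have [measurable]: "f \<in> \<M>"
  using f by (auto intro: bcs_measurable)
 obtain M R where 1: "\<And>x. norm (f x) \<le> M" "\<And>x. R < norm x \<Longrightarrow> f x = 0"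
  using bcs_bounds[OF f] by metis
 show ?thesis
  by (rule bcsI[of _ "norm c * M" R]) (use 1 in \<open>auto simp: norm_mult intro: mult_left_mono\<close>)
qed

lemma bcs_diff: "f \<in> bcs \<Longrightarrow> g \<in> bcs \<Longrightarrow> (\<lambda>x. f x - g x) \<in> bcs"
 using bcs_add[of f "\<lambda>x. (- 1) * g x"] bcs_cmult[of g "- 1"] by simp

lemma bcs_zero: "(\<lambda>x. 0) \<in> bcs"
 by (rule bcsI[of _ 0 0]) auto

lemma bcs_sum: "finite I \<Longrightarrow> (\<And>i. i \<in> I \<Longrightarrow> f i \<in> bcs) \<Longrightarrow> (\<lambda>x. \<Sum>i\<in>I. f i x) \<in> bcs"
 by (induction I rule: finite_induct) (auto intro: bcs_zero bcs_add)

lemma bcs_norm_powr_integrable: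
 assumes "f \<in> bcs" "0 < p"
 shows "integrable lebesgue (\<lambda>x. norm (f x) powr p)"
proof -
 have [measurable]: "f \<in> \<M>" using assms(1) by (rule bcs_measurable)
 obtain M R where MR: "0 \<le> M" "\<And>x. norm (f x) \<le> M" "0 \<le> R" "\<And>x. R < norm x \<Longrightarrow> f x = 0"
  using bcs_bounds[OF assms(1)] by metis
 show ?thesis
 proof (rule Bochner_Integration.integrable_bound)
  show "integrable lebesgue (\<lambda>x. M powr p * indicator (cball 0 R) x :: real)"
   by (intro integrable_mult_right) (auto simp: emeasure_cball MR)
  show "AE x in lebesgue. norm (norm (f x) powr p) \<le> norm (M powr p * indicator (cball 0 R) x :: real)"
   using MR assms(2) by (intro AE_I2) (auto simp: indicator_def powr_mono2 not_le)
 qed measurable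
qed

lemma bcs_integrable: "f \<in> bcs \<Longrightarrow> integrable lebesgue f"
 using bcs_norm_powr_integrable[of f 1] bcs_measurable[of f]
 by (simp add: integrable_norm_iff)

lemma bcs_Lp: "f \<in> bcs \<Longrightarrow> 0 < p \<Longrightarrow> f \<in> Lp p UNIV"
 using bcs_norm_powr_integrable bcs_measurable by (auto simp: Lp_def lebesgue_on_UNIV_eq)

lemma bcs_nn_integral_finite: "f \<in> bcs \<Longrightarrow> (NR x. norm (f x)) < \<infinity>"
 using bcs_integrable by (auto simp: integrable_iff_bounded)

section \<open>Bounded operators on test functions\<close>

lemma Lp_nn_integral:
 assumes "f \<in> Lp p S" "0 < p"
 shows "(\<integral>\<^sup>+x. ennreal (norm (f x) powr p) \<partial>lebesgue_on S) = ennreal (Lp_norm p S f powr p)"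
proof -
 have "(\<integral>\<^sup>+x. ennreal (norm (f x) powr p) \<partial>lebesgue_on S) = ennreal (\<integral>x. norm (f x) powr p \<partial>lebesgue_on S)"
  using assms by (intro nn_integral_eq_integral) (auto simp: Lp_def)
 moreover have "Lp_norm p S f powr p = (\<integral>x. norm (f x) powr p \<partial>lebesgue_on S)"
  using assms by (simp add: Lp_norm_def powr_powr integral_nonneg_AE)
 ultimately show ?thesis by simp
qed

lemma Lp_measurable: "f \<in> Lp q UNIV \<Longrightarrow> f \<in> \<M>"
 by (simp add: Lp_def lebesgue_on_UNIV_eq)

lemma bounded_operator_nn:
 assumes "bounded_operator q T" "0 < q"
 shows "\<exists>A\<ge>0. \<forall>f\<in>Lp q UNIV. (NR x. norm (T f x) powr q) \<le> ennreal A * (NR x. norm (f x) powr q)"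
proof -
 obtain C where C: "\<And>f. f \<in> Lp q UNIV \<Longrightarrow> Lp_norm q UNIV (T f) \<le> C * Lp_norm q UNIV f"
  and T: "\<And>f. f \<in> Lp q UNIV \<Longrightarrow> T f \<in> Lp q UNIV"
  using assms unfolding bounded_operator_def by blast
 have "(NR x. norm (T f x) powr q) \<le> ennreal (\<bar>C\<bar> powr q) * (NR x. norm (f x) powr q)"
  if f: "f \<in> Lp q UNIV" for f
 proof -
  have n0: "0 \<le> Lp_norm q UNIV h" for h :: "'a \<Rightarrow> complex" by (simp add: Lp_norm_def)
  have "Lp_norm q UNIV (T f) \<le> \<bar>C\<bar> * Lp_norm q UNIV f"
   using C[OF f] mult_right_mono[OF abs_ge_self[of C] n0[of f]] by linarith
  then have "Lp_norm q UNIV (T f) powr q \<le> (\<bar>C\<bar> * Lp_norm q UNIV f) powr q"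
   using n0 assms(2) by (intro powr_mono2) auto
  also have "\<dots> = \<bar>C\<bar> powr q * Lp_norm q UNIV f powr q" using n0 by (simp add: powr_mult)
  finally have "ennreal (Lp_norm q UNIV (T f) powr q) \<le> ennreal (\<bar>C\<bar> powr q) * ennreal (Lp_norm q UNIV f powr q)"
   by (simp add: ennreal_mult[symmetric] ennreal_leI)
  then show ?thesis
   using Lp_nn_integral[OF f assms(2)] Lp_nn_integral[OF T[OF f] assms(2)] by (simp add: lebesgue_on_UNIV_eq)
 qed
 then show ?thesis by (intro exI[of _ "\<bar>C\<bar> powr q"]) auto
qed

lemma bounded_operator_add:
 "bounded_operator q T \<Longrightarrow> f \<in> Lp q UNIV \<Longrightarrow> g \<in> Lp q UNIV \<Longrightarrow> AE x in lebesgue. T (\<lambda>y. f y + g y) x = T f x + T g x"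
 unfolding bounded_operator_def by blast

lemma bounded_operator_measurable:
 "bounded_operator q T \<Longrightarrow> f \<in> Lp q UNIV \<Longrightarrow> T f \<in> \<M>"
 unfolding bounded_operator_def by (blast intro: Lp_measurable)

lemma bounded_operator_null:
 assumes "bounded_operator q T" "0 < q" "f \<in> Lp q UNIV" "AE x in lebesgue. f x = 0"
 shows "AE x in lebesgue. T f x = 0"
proof -
 obtain A where A: "(NR x. norm (T f x) powr q) \<le> ennreal A * (NR x. norm (f x) powr q)"
  using bounded_operator_nn[OF assms(1,2)] assms(3) by blast
 have [measurable]: "T f \<in> \<M>" using bounded_operator_measurable assms by blast
 have "(NR x. norm (f x) powr q) = (\<integral>\<^sup>+x. 0 \<partial>(lebesgue :: 'a measure))"
  using assms(4) by (intro nn_integral_cong_AE) auto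
 then have "(NR x. norm (T f x) powr q) = 0" using A by simp
 then have "AE x in lebesgue. ennreal (norm (T f x) powr q) = 0"
  by (subst (asm) nn_integral_0_iff_AE) auto
 then show ?thesis using assms(2) by simp
qed

lemma bounded_operator_diff:
 assumes T: "bounded_operator q T" "0 < q" and "f \<in> bcs" "g \<in> bcs"
 shows "AE x in lebesgue. T (\<lambda>y. f y - g y) x = T f x - T g x"
proof -
 have d: "(\<lambda>y. f y - g y) \<in> bcs" using assms by (intro bcs_diff)
 have "AE x in lebesgue. T (\<lambda>y. (f y - g y) + g y) x = T (\<lambda>y. f y - g y) x + T g x"
  using assms d by (intro bounded_operator_add[OF T(1)] bcs_Lp)
 then show ?thesis by eventually_elim simp
qed

lemma bounded_operator_sum:
 assumes T: "bounded_operator q T" "0 < q" and "finite I" "\<And>i. i \<in> I \<Longrightarrow> f i \<in> bcs"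
 shows "AE x in lebesgue. T (\<lambda>y. \<Sum>i\<in>I. f i y) x = (\<Sum>i\<in>I. T (f i) x)"
 using assms(3,4)
proof (induction I rule: finite_induct)
 case empty
 have "(\<lambda>y. 0) \<in> Lp q UNIV" using bcs_Lp[OF bcs_zero T(2)] .
 then show ?case using bounded_operator_null[OF T, of "\<lambda>_. 0"] by simp
next
 case (insert i I)
 have "AE x in lebesgue. T (\<lambda>y. f i y + (\<Sum>i\<in>I. f i y)) x = T (f i) x + T (\<lambda>y. \<Sum>i\<in>I. f i y) x"
  using insert by (intro bounded_operator_add[OF T(1)] bcs_Lp[OF _ T(2)] bcs_sum) auto
 moreover have "AE x in lebesgue. T (\<lambda>y. \<Sum>i\<in>I. f i y) x = (\<Sum>i\<in>I. T (f i) x)"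
  using insert by auto
 ultimately show ?case
 proof eventually_elim
  case (elim x)
  then show ?case using insert(1,2) by simp
 qed
qed

lemma has_kernel_bcs:
 assumes "has_kernel T K" "f \<in> bcs"
 shows "AE x in lebesgue. x \<notin> closure {y. f y \<noteq> 0} \<longrightarrow>
      integrable lebesgue (\<lambda>y. K x y * f y) \<and> T f x = (\<integral>y. K x y * f y \<partial>lebesgue)"
 using assms bcs_compact[OF assms(2)] unfolding has_kernel_def by (simp add: bcs_def)

text \<open>A function with mass at most \<open>V R^d\<close> on large balls is integrated against a
  kernel of decay \<open>d + e\<close> by summing over dyadic shells: the shell of radius
  \<open>2^j r\<close> contributes a multiple of \<open>2^(-e j) V\<close>. This is the common tail
  estimate behind the cancellation and the oscillation bounds.\<close>

lemma radial_tail: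
 fixes e :: real
 assumes e: "0 < e"
 shows "\<exists>C\<ge>0. \<forall>f (x0::'a::euclidean_space) r V. f \<in> \<M> \<longrightarrow> 0 < r \<longrightarrow> 0 \<le> V \<longrightarrow>
  (\<forall>R\<ge>r. (NN y\<in>ball x0 R. f y) \<le> ennreal (V * R ^ DIM('a))) \<longrightarrow>
  (NN y. f y * indicator (- ball x0 r) y * ennreal (r powr e / norm (x0 - y) powr (DIM('a) + e))) \<le> ennreal (C * V)"
proof (intro exI[of _ "2 ^ DIM('a) * (1 / (1 - 2 powr (- e)))"] conjI allI impI)
 have q: "0 < 2 powr (- e)" "2 powr (- e) < (1::real)" using e by (auto simp: powr_less_one)
 then show "0 \<le> 2 ^ DIM('a) * (1 / (1 - 2 powr (- e)))" by simp
 fix f :: "'a \<Rightarrow> ennreal" and x0 :: 'a and r V :: real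
 assume [measurable]: "f \<in> \<M>" and r: "0 < r" and V: "0 \<le> V"
  and bd: "\<forall>R\<ge>r. (NN y\<in>ball x0 R. f y) \<le> ennreal (V * R ^ DIM('a))"
 define w where "w j = r powr e / (2 ^ j * r) powr (DIM('a) + e)" for j :: nat
 have w0: "0 \<le> w j" for j by (simp add: w_def)
 have "(NN y. f y * indicator (- ball x0 r) y * ennreal (r powr e / norm (x0 - y) powr (DIM('a) + e)))
   \<le> (NN y. (\<Sum>j. ennreal (w j) * (f y * indicator (ball x0 (2 ^ (j + 1) * r)) y)))"
 proof (rule nn_integral_mono)
  fix y
  show "f y * indicator (- ball x0 r) y * ennreal (r powr e / norm (x0 - y) powr (DIM('a) + e))
    \<le> (\<Sum>j. ennreal (w j) * (f y * indicator (ball x0 (2 ^ (j + 1) * r)) y))"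
  proof (cases "y \<in> ball x0 r")
   case False
   define t where "t = norm (x0 - y) / r"
   have t: "1 \<le> t" using False r by (simp add: t_def dist_norm field_simps)
   \<comment> \<open>The number of the shell, determined by
     \<open>2 ^ j * r \<le> norm (x0 - y) < 2 ^ (j + 1) * r\<close>.\<close>
   define j where "j = nat \<lfloor>log 2 t\<rfloor>"
   have l: "0 \<le> log 2 t" using t by simp
   then have "real j \<le> log 2 t" "log 2 t < real j + 1" by (auto simp: j_def)
   then have "2 powr real j \<le> t" "t < 2 powr (real j + 1)"
    using t by (auto simp: le_log_iff log_less_iff)
   then have j: "2 ^ j * r \<le> norm (x0 - y)" "norm (x0 - y) < 2 ^ (j + 1) * r"
    using r by (auto simp: t_def field_simps powr_realpow powr_add)
   have "0 < 2 ^ j * r" using r by simp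
   then have pos: "0 < norm (x0 - y)" using j(1) by linarith
   have "r powr e / norm (x0 - y) powr (DIM('a) + e) \<le> w j"
    unfolding w_def using j pos r e by (intro divide_left_mono powr_mono2 mult_pos_pos) auto
   then have "f y * indicator (- ball x0 r) y * ennreal (r powr e / norm (x0 - y) powr (DIM('a) + e)) \<le> ennreal (w j) * (f y * indicator (ball x0 (2 ^ (j + 1) * r)) y)"
    using False j by (auto simp: dist_norm mult.commute intro!: mult_left_mono ennreal_leI)
   also have "\<dots> \<le> (\<Sum>j. ennreal (w j) * (f y * indicator (ball x0 (2 ^ (j + 1) * r)) y))"
    using sum_le_suminf[of "\<lambda>j. ennreal (w j) * (f y * indicator (ball x0 (2 ^ (j + 1) * r)) y)" "{j}"] by simp
   finally show ?thesis .
  qed simp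
 qed
 also have "\<dots> = (\<Sum>j. ennreal (w j) * (NN y\<in>ball x0 (2 ^ (j + 1) * r). f y))"
  by (subst nn_integral_suminf) (auto simp: nn_integral_cmult)
 also have "\<dots> \<le> (\<Sum>j. ennreal (2 ^ DIM('a) * V * (2 powr (- e)) ^ j))"
 proof (rule suminf_le)
  fix j :: nat
  have "1 * r \<le> 2 ^ (j + 1) * r" using r by (intro mult_right_mono) (auto simp del: power_Suc)
  then have "ennreal (w j) * (NN y\<in>ball x0 (2 ^ (j + 1) * r). f y) \<le> ennreal (w j) * ennreal (V * (2 ^ (j + 1) * r) ^ DIM('a))"
   using bd by (intro mult_left_mono) auto
  also have "\<dots> = ennreal (w j * (V * (2 ^ (j + 1) * r) ^ DIM('a)))"
   using w0 by (simp add: ennreal_mult')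
  also have "w j * (V * (2 ^ (j + 1) * r) ^ DIM('a)) = 2 ^ DIM('a) * V * (2 powr (- e)) ^ j"
  proof -
   define u where "u = (2::real) ^ j * r"
   have u: "0 < u" using r by (simp add: u_def)
   have "u powr e = 2 powr (e * j) * r powr e"
    using r by (simp add: u_def powr_mult powr_realpow[symmetric] powr_powr mult.commute)
   moreover have "(2 powr (- e)) ^ j = 2 powr (- e * j)"
    using q(1) by (simp only: powr_realpow[symmetric] powr_powr)
   then have "(2 powr (- e)) ^ j = 1 / 2 powr (e * j)"
    using powr_minus_divide[of 2 "e * j"] by simp
   moreover have "(2 ^ (j + 1) * r) ^ DIM('a) = 2 ^ DIM('a) * u ^ DIM('a)"
    by (simp add: u_def power_mult_distrib mult_ac)
   moreover have "w j = r powr e / (u ^ DIM('a) * u powr e)"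
    using u by (simp add: w_def u_def[symmetric] powr_add powr_realpow)
   ultimately show ?thesis using u r by simp
  qed
  finally show "ennreal (w j) * (NN y\<in>ball x0 (2 ^ (j + 1) * r). f y) \<le> ennreal (2 ^ DIM('a) * V * (2 powr (- e)) ^ j)" .
 qed auto
 also have "\<dots> = ennreal (\<Sum>j. 2 ^ DIM('a) * V * (2 powr (- e)) ^ j)"
  using q V by (intro suminf_ennreal2 summable_mult summable_geometric) auto
 also have "(\<Sum>j. 2 ^ DIM('a) * V * (2 powr (- e)) ^ j) = 2 ^ DIM('a) * (1 / (1 - 2 powr (- e))) * V"
  using q by (subst suminf_mult) (auto simp: suminf_geometric summable_geometric)
 finally show "(NN y. f y * indicator (- ball x0 r) y * ennreal (r powr e / norm (x0 - y) powr (DIM('a) + e))) \<le> ennreal (2 ^ DIM('a) * (1 / (1 - 2 powr (- e))) * V)" .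
qed

lemma borel_measurable_lebesgue_id [measurable]:
 "(\<lambda>x::'a::euclidean_space. x) \<in> \<M>"
 by (rule measurable_completion) simp

lemma dside_neq_0 [simp]: "dside n \<noteq> 0"
 using dside_pos[of n] by linarith

lemma standard_kernel_smooth:
 assumes "standard_kernel (K :: 'a::euclidean_space \<Rightarrow> 'a \<Rightarrow> complex)"
 obtains C e where "0 < e" "0 \<le> (C::real)"
  "\<And>x x' y. x \<noteq> y \<Longrightarrow> norm (x - x') \<le> norm (x - y) / 2 \<Longrightarrow>
   norm (K x y - K x' y) \<le> C * norm (x - x') powr e / norm (x - y) powr (real DIM('a) + e)"
  "\<And>x y y'. x \<noteq> y \<Longrightarrow> norm (y - y') \<le> norm (x - y) / 2 \<Longrightarrow>
   norm (K x y - K x y') \<le> C * norm (y - y') powr e / norm (x - y) powr (real DIM('a) + e)"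
proof -
 obtain C e where e: "0 < e" and
  1: "\<And>x x' y. x \<noteq> y \<and> norm (x - x') \<le> norm (x - y) / 2 \<Longrightarrow>
   norm (K x y - K x' y) \<le> C * norm (x - x') powr e / norm (x - y) powr (real DIM('a) + e)" and
  2: "\<And>x y y'. x \<noteq> y \<and> norm (y - y') \<le> norm (x - y) / 2 \<Longrightarrow>
   norm (K x y - K x y') \<le> C * norm (y - y') powr e / norm (x - y) powr (real DIM('a) + e)"
  using assms unfolding standard_kernel_def by blast
 have le: "C * a powr e / b powr t \<le> \<bar>C\<bar> * a powr e / b powr t" for a b t
  by (intro divide_right_mono mult_right_mono) auto
 show thesis
 proof (rule that[of e "\<bar>C\<bar>"])
  show "norm (K x y - K x' y) \<le> \<bar>C\<bar> * norm (x - x') powr e / norm (x - y) powr (real DIM('a) + e)"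
   if "x \<noteq> y" "norm (x - x') \<le> norm (x - y) / 2" for x x' y
   using 1[of x y x'] that le[of "norm (x - x')" "norm (x - y)" "real DIM('a) + e"] by linarith
  show "norm (K x y - K x y') \<le> \<bar>C\<bar> * norm (y - y') powr e / norm (x - y) powr (real DIM('a) + e)"
   if "x \<noteq> y" "norm (y - y') \<le> norm (x - y) / 2" for x y y'
   using 2[of x y y'] that le[of "norm (y - y')" "norm (x - y)" "real DIM('a) + e"] by linarith
 qed (use e in auto)
qed

section \<open>The weak type (1,1) inequality\<close>

lemma Chebyshev_powr:
 fixes h :: "'a \<Rightarrow> real"
 assumes [measurable]: "h \<in> borel_measurable M" and "0 < t" "0 < p"
 shows "emeasure M {x \<in> space M. t < h x} \<le> ennreal (1 / t powr p) * (\<integral>\<^sup>+x. ennreal (h x powr p) \<partial>M)"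
proof -
 have "emeasure M {x \<in> space M. t < h x} = (\<integral>\<^sup>+x. indicator {x \<in> space M. t < h x} x \<partial>M)" by simp
 also have "\<dots> \<le> (\<integral>\<^sup>+x. ennreal (1 / t powr p) * ennreal (h x powr p) \<partial>M)"
 proof (rule nn_integral_mono)
  fix x
  have "1 \<le> 1 / t powr p * h x powr p" if "t < h x"
   using that assms(2,3) by (simp add: powr_mono2 field_simps)
  then show "indicator {x \<in> space M. t < h x} x \<le> ennreal (1 / t powr p) * ennreal (h x powr p)"
   using assms by (auto simp: indicator_def ennreal_mult[symmetric] simp del: ennreal_1 simp: ennreal_1[symmetric] intro!: ennreal_leI)
 qed
 also have "\<dots> = ennreal (1 / t powr p) * (\<integral>\<^sup>+x. ennreal (h x powr p) \<partial>M)"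
  by (rule nn_integral_cmult) measurable
 finally show ?thesis .
qed

lemma dcube_bounded: "bounded (dcube n (x::'a::euclidean_space))"
 using dcube_norm_diff[of _ n x x] by (intro boundedI[of _ "norm x + real DIM('a) * dside n"]) (smt (verit) dcube_self norm_triangle_sub)

text \<open>As \<open>b\<close> has mean zero, \<open>K x c\<close> may be subtracted under the
  integral without changing \<open>T b x\<close>, and smoothness in the second variable leaves a
  tail that is summable over shells around \<open>c\<close>.\<close>

lemma cz_cancellation:
 assumes T: "calderon_zygmund T (K :: 'a::euclidean_space \<Rightarrow> 'a \<Rightarrow> complex)"
 shows "\<exists>C\<ge>0. \<forall>n c b. b \<in> bcs \<longrightarrow> (\<forall>x. x \<notin> dcube n c \<longrightarrow> b x = 0) \<longrightarrow> (\<integral>x. b x \<partial>lebesgue) = 0 \<longrightarrow>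
  (\<integral>\<^sup>+x\<in>- ball c (3 * real DIM('a) * dside n). ennreal (norm (T b x)) \<partial>lebesgue) \<le> ennreal C * (\<integral>\<^sup>+x. ennreal (norm (b x)) \<partial>lebesgue)"
proof -
 have hk: "has_kernel T K" and sk: "standard_kernel K" using T by (auto simp: calderon_zygmund_def)
 obtain C e where e: "0 < e" "0 \<le> (C::real)" and
  sm: "\<And>x y y'. x \<noteq> y \<Longrightarrow> norm (y - y') \<le> norm (x - y) / 2 \<Longrightarrow>
   norm (K x y - K x y') \<le> C * norm (y - y') powr e / norm (x - y) powr (real DIM('a) + e)"
  using standard_kernel_smooth[OF sk] by metis
 obtain Ct where Ct: "0 \<le> Ct" "\<And>f (x0::'a) r V. f \<in> \<M> \<Longrightarrow> 0 < r \<Longrightarrow> 0 \<le> V \<Longrightarrow>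
  (\<forall>R\<ge>r. (NN y\<in>ball x0 R. f y) \<le> ennreal (V * R ^ DIM('a))) \<Longrightarrow>
  (NN y. f y * indicator (- ball x0 r) y * ennreal (r powr e / norm (x0 - y) powr (DIM('a) + e))) \<le> ennreal (Ct * V)"
  using radial_tail[OF e(1), where 'a='a] by blast
 define v where "v = unit_ball_vol (DIM('a))"
 have v: "0 \<le> v" by (simp add: v_def)
 show ?thesis
 proof (intro exI[of _ "C * (Ct * v)"] conjI allI impI)
  show "0 \<le> C * (Ct * v)" using e Ct v by simp
  fix n :: int and c :: 'a and b :: "'a \<Rightarrow> complex"
  assume b: "b \<in> bcs" and supp: "\<forall>x. x \<notin> dcube n c \<longrightarrow> b x = 0" and b0: "(\<integral>x. b x \<partial>lebesgue) = 0"
  define dl where "dl = real DIM('a) * dside n"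
  \<comment> \<open>Outside the ball of this radius \<open>x\<close> is off the support, and
    \<open>norm (c - y)\<close> is at most half of \<open>norm (x - c)\<close>, as the smoothness
    condition requires.\<close>
  define r where "r = 3 * dl"
  have dl: "0 < dl" by (simp add: dl_def)
  have r: "0 < r" using dl by (simp add: r_def)
  have [measurable]: "b \<in> \<M>" using b by (rule bcs_measurable)
  have cl: "closure {y. b y \<noteq> 0} \<subseteq> cball c dl"
  proof (rule closure_minimal)
   show "{y. b y \<noteq> 0} \<subseteq> cball c dl"
    using supp dcube_norm_diff[of c n c] by (force simp: dist_norm dl_def)
  qed simp
  define I where "I = (NR x. norm (b x))"
  have AE1: "AE x in lebesgue. ennreal (norm (T b x)) * indicator (- ball c r) x
    \<le> (ennreal C * I) * (1 * indicator (- ball c r) x * ennreal (r powr e / norm (c - x) powr (DIM('a) + e)))"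
   using has_kernel_bcs[OF hk b]
  proof eventually_elim
   case (elim x)
   show ?case
   proof (cases "x \<in> ball c r")
    case False
    then have xr: "r \<le> norm (x - c)" by (simp add: dist_norm norm_minus_commute)
    have "x \<notin> cball c dl" using xr dl by (simp add: r_def dist_norm norm_minus_commute)
    then have "x \<notin> closure {y. b y \<noteq> 0}" using cl by blast
    with elim have int: "integrable lebesgue (\<lambda>y. K x y * b y)" and Tb: "T b x = (\<integral>y. K x y * b y \<partial>lebesgue)" by auto
    have intc: "integrable lebesgue (\<lambda>y. K x c * b y)" using bcs_integrable[OF b] by simp
    have int2: "integrable lebesgue (\<lambda>y. (K x y - K x c) * b y)"
     using Bochner_Integration.integrable_diff[OF int intc] by (simp add: left_diff_distrib)
    have "T b x = (\<integral>y. K x y * b y \<partial>lebesgue) - (\<integral>y. K x c * b y \<partial>lebesgue)" using b0 Tb by simp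
    also have "\<dots> = (\<integral>y. (K x y - K x c) * b y \<partial>lebesgue)"
     using Bochner_Integration.integral_diff[OF int intc] by (simp add: left_diff_distrib)
    finally have "ennreal (norm (T b x)) \<le> (NN y. norm ((K x y - K x c) * b y))"
     using integral_norm_bound_ennreal[OF int2] by simp
    also have "\<dots> \<le> (NN y. ennreal (C * (r powr e / norm (c - x) powr (DIM('a) + e))) * ennreal (norm (b y)))"
    proof (rule nn_integral_mono)
     fix y
     show "ennreal (norm ((K x y - K x c) * b y)) \<le> ennreal (C * (r powr e / norm (c - x) powr (DIM('a) + e))) * ennreal (norm (b y))"
     proof (cases "y \<in> dcube n c")
      case True
      then have cy: "norm (c - y) \<le> dl" using dcube_norm_diff[of c n c y] by (simp add: dl_def)
      have cy2: "norm (c - y) \<le> r" "norm (c - y) \<le> norm (x - c) / 2"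
       using cy xr dl by (auto simp: r_def)
      have "x \<noteq> c" using xr r by auto
      then have "norm (K x c - K x y) \<le> C * norm (c - y) powr e / norm (x - c) powr (real DIM('a) + e)"
       using cy2 by (intro sm) auto
      also have "\<dots> \<le> C * r powr e / norm (x - c) powr (real DIM('a) + e)"
       using cy2(1) e by (intro divide_right_mono mult_left_mono powr_mono2) auto
      finally have "norm (K x y - K x c) \<le> C * (r powr e / norm (c - x) powr (DIM('a) + e))"
       by (simp add: norm_minus_commute)
      then have "norm (K x y - K x c) * norm (b y) \<le> C * (r powr e / norm (c - x) powr (DIM('a) + e)) * norm (b y)"
       by (rule mult_right_mono) simp
      then show ?thesis using e by (simp add: norm_mult ennreal_mult[symmetric] ennreal_leI)
     qed (simp add: supp)
    qed
    also have "\<dots> = ennreal (C * (r powr e / norm (c - x) powr (DIM('a) + e))) * I"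
     unfolding I_def by (rule nn_integral_cmult) measurable
    also have "\<dots> = (ennreal C * I) * ennreal (r powr e / norm (c - x) powr (DIM('a) + e))"
     by (subst ennreal_mult') (use e in \<open>auto simp: mult_ac\<close>)
    finally show ?thesis using False by simp
   qed simp
  qed
  have "(NR x\<in>- ball c r. norm (T b x)) \<le>
    (NN x. (ennreal C * I) * (1 * indicator (- ball c r) x * ennreal (r powr e / norm (c - x) powr (DIM('a) + e))))"
   using AE1 by (rule nn_integral_mono_AE)
  also have "\<dots> = (ennreal C * I) * (NN x. 1 * indicator (- ball c r) x * ennreal (r powr e / norm (c - x) powr (DIM('a) + e)))"
   by (rule nn_integral_cmult) measurable
  also have "\<dots> \<le> (ennreal C * I) * ennreal (Ct * v)"
  proof (rule mult_left_mono)
   show "(NN x. 1 * indicator (- ball c r) x * ennreal (r powr e / norm (c - x) powr (DIM('a) + e))) \<le> ennreal (Ct * v)"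
   proof (rule Ct(2)[of "\<lambda>_. 1"])
    show "\<forall>R\<ge>r. (NN y\<in>ball c R. 1) \<le> ennreal (v * R ^ DIM('a))"
     using r emeasure_lebesgue_ball[of _ c] by (auto simp: v_def)
   qed (use r v in auto)
  qed simp
  also have "\<dots> = ennreal (C * (Ct * v)) * I" using e Ct v by (simp add: ennreal_mult mult_ac)
  finally show "(NR x\<in>- ball c (3 * real DIM('a) * dside n). norm (T b x)) \<le> ennreal (C * (Ct * v)) * (NR x. norm (b x))"
   unfolding I_def r_def dl_def mult.assoc[symmetric] .
 qed
qed

lemma emeasure_star_le:
 fixes c :: "'a::euclidean_space"
 shows "\<mu> (ball c (3 * real DIM('a) * dside n))
  = ennreal (unit_ball_vol (DIM('a)) * (3 * real DIM('a)) ^ DIM('a)) * \<mu> (dcube n c)"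
 using emeasure_lebesgue_ball[of "3 * real DIM('a) * dside n" c]
 by (simp add: emeasure_dcube ennreal_mult[symmetric] power_mult_distrib mult_ac del: emeasure_completion)

text \<open>The total integral is finite while the measure of large cubes is unbounded, so large
  cubes have small means. This supplies the bound on generations that a stopping argument
  needs.\<close>

lemma dyadic_density_bounded_below:
 fixes F :: "'a::euclidean_space \<Rightarrow> ennreal"
 assumes "(NN x. F x) < \<infinity>" "0 < lam"
 shows "\<exists>N. \<forall>n<N. \<not> ennreal lam * \<mu> (dcube n x) < (NN y\<in>dcube n x. F y)"
proof -
 obtain i where i: "0 \<le> i" "(NN x. F x) = ennreal i" using assms(1) by (cases "(NN x. F x)") auto
 obtain k :: nat where k: "i / lam < real k" using reals_Archimedean2 by blast
 have "\<not> ennreal lam * \<mu> (dcube n x) < (NN y\<in>dcube n x. F y)" if n: "n < - int k" for n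
 proof -
  have "real k < 2 ^ k" by (metis of_nat_less_two_power)
  also have "(2::real) ^ k = 2 powr real k" by (simp add: powr_realpow)
  also have "\<dots> \<le> dside n" unfolding dside_def using n by simp
  finally have kd: "real k < dside n" .
  have d1: "1 \<le> dside n" unfolding dside_def by (rule ge_one_powr_ge_zero) (use n in auto)
  have "dside n ^ 1 \<le> dside n ^ DIM('a)" using d1 by (intro power_increasing) (auto simp: Suc_leI)
  then have "i / lam \<le> dside n ^ DIM('a)" using kd k by simp
  then have "i \<le> lam * dside n ^ DIM('a)" using assms(2) by (simp add: field_simps)
  then have "ennreal i \<le> ennreal lam * \<mu> (dcube n x)"
   using assms(2) by (simp add: emeasure_dcube ennreal_mult[symmetric] ennreal_leI del: emeasure_completion)
  moreover have "(NN y\<in>dcube n x. F y) \<le> ennreal i"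
   unfolding i(2)[symmetric] by (intro nn_integral_mono) (auto simp: indicator_def)
  ultimately show ?thesis by (simp add: not_less)
 qed
 then show ?thesis by blast
qed

text \<open>The cubes are stopped at means above \<open>lam\<close>. The parent of a selected cube
  was not stopped and is \<open>2 ^ DIM('a)\<close> times as large, whence the upper bound; outside
  all cubes every dyadic mean is at most \<open>lam\<close>, and differentiation applies.\<close>

lemma CZ_decomposition:
 fixes f :: "'a::euclidean_space \<Rightarrow> complex"
 assumes f: "f \<in> bcs" and lam: "0 < lam"
 obtains \<Q> nn cc where "countable \<Q>" "disjoint \<Q>" "\<And>Q. Q \<in> \<Q> \<Longrightarrow> Q = dcube (nn Q) (cc Q)"
  "\<And>Q. Q \<in> \<Q> \<Longrightarrow> ennreal lam * \<mu> Q \<le> (NR x\<in>Q. norm (f x))"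
  "\<And>Q. Q \<in> \<Q> \<Longrightarrow> (NR x\<in>Q. norm (f x)) \<le> ennreal (2 ^ DIM('a) * lam) * \<mu> Q"
  "AE x in lebesgue. x \<notin> \<Union>\<Q> \<longrightarrow> norm (f x) \<le> lam"
proof -
 have [measurable]: "f \<in> \<M>" using f by (rule bcs_measurable)
 define F where "F x = ennreal (norm (f x))" for x
 have [measurable]: "F \<in> \<M>" unfolding F_def by measurable
 have fin: "(NN x. F x) < \<infinity>" unfolding F_def by (rule bcs_nn_integral_finite[OF f])
 define S where "S n x \<longleftrightarrow> ennreal lam * \<mu> (dcube n x) < (NN y\<in>dcube n x. F y)" for n x
 have inv: "S n y" if "S n x" "y \<in> dcube n x" for n x y using that(1) unfolding S_def dcube_eq[OF that(2)] .
 have bdd: "\<exists>N. \<forall>n<N. \<not> S n x" for x unfolding S_def using dyadic_density_bounded_below[OF fin lam] .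
 obtain \<Q> where Q: "countable \<Q>" "disjoint \<Q>" "\<Union>\<Q> = {x. \<exists>n. S n x}"
  "\<And>Q. Q \<in> \<Q> \<Longrightarrow> \<exists>n x. Q = dcube n x \<and> S n x \<and> (\<forall>m<n. \<not> S m x)"
  by (rule dyadic_stopping[of S]) (erule inv, assumption, rule bdd, rule that)
 obtain nn where "\<And>Q. Q \<in> \<Q> \<Longrightarrow> \<exists>x. Q = dcube (nn Q) x \<and> S (nn Q) x \<and> (\<forall>m<nn Q. \<not> S m x)"
  using Q(4) by metis
 then obtain cc where cc: "\<And>Q. Q \<in> \<Q> \<Longrightarrow> Q = dcube (nn Q) (cc Q) \<and> S (nn Q) (cc Q) \<and> (\<forall>m<nn Q. \<not> S m (cc Q))"
  by metis
 show thesis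
 proof (rule that[of \<Q> nn cc])
  fix Q assume QQ: "Q \<in> \<Q>"
  let ?n = "nn Q" and ?c = "cc Q"
  have Qe: "Q = dcube ?n ?c" and S1: "S ?n ?c" and S2: "\<not> S (?n - 1) ?c" using cc[OF QQ] by auto
  show "Q = dcube (nn Q) (cc Q)" by (rule Qe)
  show "ennreal lam * \<mu> Q \<le> (NR x\<in>Q. norm (f x))"
   using S1 unfolding S_def Qe[symmetric] F_def by (rule less_imp_le)
  have "(NN x\<in>Q. F x) \<le> (NN x\<in>dcube (?n - 1) ?c. F x)"
   using dcube_mono[of "?n - 1" ?n ?c] Qe by (intro nn_integral_mono) (auto simp: indicator_def)
  also have "\<dots> \<le> ennreal lam * \<mu> (dcube (?n - 1) ?c)"
   using S2 unfolding S_def by (simp add: not_less)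
  also have "\<mu> (dcube (?n - 1) ?c) = ennreal (2 ^ DIM('a)) * \<mu> Q"
   by (subst Qe) (simp add: emeasure_dcube dside_Suc power_mult_distrib ennreal_mult del: emeasure_completion)
  also have "ennreal lam * (ennreal (2 ^ DIM('a)) * \<mu> Q) = ennreal (2 ^ DIM('a) * lam) * \<mu> Q"
   using lam by (simp add: ennreal_mult' mult_ac del: emeasure_completion)
  finally show "(NR x\<in>Q. norm (f x)) \<le> ennreal (2 ^ DIM('a) * lam) * \<mu> Q"
   unfolding F_def .
 next
  have Qs: "Q \<in> \<L>" if "Q \<in> \<Q>" for Q using Q(4)[OF that] by auto
  have U: "\<Union>\<Q> \<in> \<L>" using Q(1) Qs by (intro sets.countable_Union) auto
  then have "- \<Union>\<Q> \<in> \<L>" by (rule Compl_in_sets_lebesgue[THEN iffD2])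
  then have "AE x in lebesgue. x \<in> - \<Union>\<Q> \<longrightarrow> F x \<le> ennreal lam"
  proof (rule dyadic_differentiation[rotated 1])
   fix x n assume "x \<in> - \<Union>\<Q>"
   then show "(NN y\<in>dcube n x. F y) \<le> ennreal lam * \<mu> (dcube n x)"
    unfolding Q(3) S_def by (auto simp: not_less)
  qed (use lam in auto)
  then show "AE x in lebesgue. x \<notin> \<Union>\<Q> \<longrightarrow> norm (f x) \<le> lam"
   by eventually_elim (use lam in \<open>auto simp: F_def\<close>)
 qed (use Q in auto)
qed

lemma cube_average_norm:
 fixes f :: "'a::euclidean_space \<Rightarrow> complex"
 assumes f: "f \<in> bcs" and Q: "Q = dcube n c"
 defines "a \<equiv> (\<integral>x. cut Q f x \<partial>lebesgue) / of_real (dside n ^ DIM('a))"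
 shows "(\<integral>x. cut Q f x - cut Q (\<lambda>_. a) x \<partial>lebesgue) = 0"
  "(\<lambda>x. cut Q f x - cut Q (\<lambda>_. a) x) \<in> bcs"
  "ennreal (norm a) * \<mu> Q \<le> (NR x\<in>Q. norm (f x))"
  "(NR x. norm (cut Q f x - cut Q (\<lambda>_. a) x)) \<le> 2 * (NR x\<in>Q. norm (f x))"
proof -
 have [measurable]: "f \<in> \<M>" using f by (rule bcs_measurable)
 have [measurable]: "Q \<in> \<L>" using Q by simp
 have eQ: "\<mu> Q = ennreal (dside n ^ DIM('a))" unfolding Q by (rule emeasure_dcube)
 have mQ: "measure lebesgue Q = dside n ^ DIM('a)" using eQ by (simp add: measure_def del: emeasure_completion)
 have b1: "cut Q f \<in> bcs" by (rule bcs_cut[OF f]) measurable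
 have b2: "cut Q (\<lambda>_. a) \<in> bcs" by (rule bcs_cut_const) (use Q dcube_bounded in auto)
 show "(\<lambda>x. cut Q f x - cut Q (\<lambda>_. a) x) \<in> bcs" using bcs_diff[OF b1 b2] .
 have "(\<integral>x. cut Q (\<lambda>_. a) x \<partial>lebesgue) = (\<integral>x. indicator Q x *\<^sub>R a \<partial>lebesgue)"
  by (intro Bochner_Integration.integral_cong) (auto simp: indicator_def)
 also have "\<dots> = measure lebesgue Q *\<^sub>R a" using eQ by (subst integral_scaleR_left) auto
 also have "\<dots> = (\<integral>x. cut Q f x \<partial>lebesgue)"
  unfolding a_def mQ using dside_pos[of n] by (simp add: scaleR_conv_of_real)
 finally show "(\<integral>x. cut Q f x - cut Q (\<lambda>_. a) x \<partial>lebesgue) = 0"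
  using Bochner_Integration.integral_diff[OF bcs_integrable[OF b1] bcs_integrable[OF b2]] by simp
 have nF: "(NR x. norm (cut Q f x)) = (NR x\<in>Q. norm (f x))"
  by (intro nn_integral_cong) (auto simp: indicator_def)
 have "norm a * dside n ^ DIM('a) = norm (\<integral>x. cut Q f x \<partial>lebesgue)"
  unfolding a_def using dside_pos[of n] by (simp add: norm_divide norm_power)
 then have "ennreal (norm a) * \<mu> Q = ennreal (norm (\<integral>x. cut Q f x \<partial>lebesgue))"
  unfolding eQ by (simp add: ennreal_mult[symmetric])
 also have "\<dots> \<le> (NR x. norm (cut Q f x))"
  by (rule integral_norm_bound_ennreal[OF bcs_integrable[OF b1]])
 finally show 3: "ennreal (norm a) * \<mu> Q \<le> (NR x\<in>Q. norm (f x))"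
  unfolding nF .
 have "(NR x. norm (cut Q f x - cut Q (\<lambda>_. a) x))
   \<le> (NN x. ennreal (norm (cut Q f x)) + ennreal (norm a) * indicator Q x)"
  by (intro nn_integral_mono) (auto simp: indicator_def ennreal_plus[symmetric] norm_triangle_ineq4 simp del: ennreal_plus intro!: ennreal_leI)
 also have "\<dots> = (NR x. norm (cut Q f x)) + ennreal (norm a) * \<mu> Q"
  by (subst nn_integral_add) (auto simp: nn_integral_cmult_indicator simp del: emeasure_completion)
 also have "\<dots> \<le> (NR x\<in>Q. norm (f x)) + (NR x\<in>Q. norm (f x))"
  unfolding nF using 3 by (intro add_left_mono)
 finally show "(NR x. norm (cut Q f x - cut Q (\<lambda>_. a) x)) \<le> 2 * (NR x\<in>Q. norm (f x))"
  by (simp add: mult_2)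
qed

text \<open>The good part is treated by the \<open>L^2\<close> bound and the bad part by
  cancellation off the dilated cubes. Since additivity of \<open>T\<close> is given for finite sums,
  only finitely many cubes are corrected at a time. On the rest
  \<open>\<Omega> - \<Omega>k k\<close> the good function is merely bounded by \<open>M\<close>, and
  this error vanishes as \<open>k\<close> grows, because \<open>\<Omega>\<close> has finite
  measure.\<close>

lemma weak_type_1_1:
 fixes K :: "'a::euclidean_space \<Rightarrow> 'a \<Rightarrow> complex"
 assumes cz: "calderon_zygmund T K"
 shows "\<exists>W\<ge>0. \<forall>f\<in>bcs. \<forall>lam>0. \<mu> {x. lam < norm (T f x)}
  \<le> ennreal (W / lam) * (NR x. norm (f x))"
proof -
 have T: "bounded_operator 2 T" using cz by (simp add: calderon_zygmund_def)
 obtain A where A: "0 \<le> A" "\<And>f. f \<in> Lp 2 UNIV \<Longrightarrow> (NR x. norm (T f x) powr 2) \<le> ennreal A * (NR x. norm (f x) powr 2)"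
  using bounded_operator_nn[OF T] by auto
 obtain Cf where Cf: "0 \<le> Cf" "\<And>n c b. b \<in> bcs \<Longrightarrow> (\<forall>x. x \<notin> dcube n c \<longrightarrow> b x = 0) \<Longrightarrow> (\<integral>x. b x \<partial>lebesgue) = 0 \<Longrightarrow>
  (\<integral>\<^sup>+x\<in>- ball c (3 * real DIM('a) * dside n). ennreal (norm (T b x)) \<partial>lebesgue) \<le> ennreal Cf * (\<integral>\<^sup>+x. ennreal (norm (b x)) \<partial>lebesgue)"
  using cz_cancellation[OF cz] by blast
 define \<kappa> where "\<kappa> = unit_ball_vol (DIM('a)) * (3 * real DIM('a)) ^ DIM('a)"
 have \<kappa>: "0 \<le> \<kappa>" by (simp add: \<kappa>_def)
 show ?thesis
 proof (intro exI[of _ "\<kappa> + 4 * Cf + 4 * A * (2 ^ DIM('a) + 1)"] conjI ballI allI impI)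
  show "0 \<le> \<kappa> + 4 * Cf + 4 * A * (2 ^ DIM('a) + 1)" using \<kappa> Cf A by simp
  fix f :: "'a \<Rightarrow> complex" and lam :: real assume f: "f \<in> bcs" and lam: "0 < lam"
  have [measurable]: "f \<in> \<M>" using f by (rule bcs_measurable)
  obtain \<Q> nn cc where Q: "countable \<Q>" "disjoint \<Q>" "\<And>Q. Q \<in> \<Q> \<Longrightarrow> Q = dcube (nn Q) (cc Q)"
   and Q1: "\<And>Q. Q \<in> \<Q> \<Longrightarrow> ennreal lam * \<mu> Q \<le> (NR x\<in>Q. norm (f x))"
   and Q2: "\<And>Q. Q \<in> \<Q> \<Longrightarrow> (NR x\<in>Q. norm (f x)) \<le> ennreal (2 ^ DIM('a) * lam) * \<mu> Q"
   and Q3: "AE x in lebesgue. x \<notin> \<Union>\<Q> \<longrightarrow> norm (f x) \<le> lam"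
   by (rule CZ_decomposition[OF f lam]) (rule that)
  define F where "F x = ennreal (norm (f x))" for x
  have [measurable]: "F \<in> \<M>" unfolding F_def by measurable
  define I where "I = (NN x. F x)"
  have Ifin: "I < \<infinity>" unfolding I_def F_def by (rule bcs_nn_integral_finite[OF f])
  obtain M where M: "0 \<le> M" "\<And>x. norm (f x) \<le> M" using bcs_bounds[OF f] by metis
  have Qs: "Q \<in> \<L>" if "Q \<in> \<Q>" for Q by (subst Q(3)[OF that]) measurable
  have dis: "disjoint_family_on (\<lambda>Q. Q) R" if "R \<subseteq> \<Q>" for R
   using Q(2) that by (auto simp: disjoint_family_on_def disjoint_def)
  have sumF: "(\<integral>\<^sup>+Q. (NN x\<in>Q. F x) \<partial>count_space R) \<le> I" if "R \<subseteq> \<Q>" for R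
   unfolding I_def using Q(1) Qs that
   by (intro nn_integral_disjoint_le dis countable_subset[OF that]) auto
  have sumQ: "(\<integral>\<^sup>+Q. \<mu> Q \<partial>count_space \<Q>) \<le> ennreal (1 / lam) * I"
  proof -
   have "(\<integral>\<^sup>+Q. \<mu> Q \<partial>count_space \<Q>) = (\<integral>\<^sup>+Q. ennreal (1 / lam) * (ennreal lam * \<mu> Q) \<partial>count_space \<Q>)"
    using lam by (intro nn_integral_cong) (simp add: mult.assoc[symmetric] ennreal_mult[symmetric] del: emeasure_completion)
   also have "\<dots> \<le> (\<integral>\<^sup>+Q. ennreal (1 / lam) * (NN x\<in>Q. F x) \<partial>count_space \<Q>)"
    using Q1 by (intro nn_integral_mono mult_left_mono) (auto simp: F_def simp del: emeasure_completion)
   also have "\<dots> \<le> ennreal (1 / lam) * I"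
    using sumF[of \<Q>] by (simp add: nn_integral_cmult mult_left_mono)
   finally show ?thesis .
  qed
  define \<Omega> where "\<Omega> = \<Union>\<Q>"
  have Om[measurable]: "\<Omega> \<in> \<L>" unfolding \<Omega>_def using Q(1) Qs by (intro sets.countable_Union) auto
  have "\<mu> (\<Union>Q\<in>\<Q>. Q) = (\<integral>\<^sup>+Q. \<mu> Q \<partial>count_space \<Q>)"
   using Q(1) Qs by (intro emeasure_UN_countable dis) auto
  then have Omfin: "\<mu> \<Omega> < \<infinity>"
   using sumQ Ifin unfolding \<Omega>_def by (auto simp: ennreal_mult_less_top order_le_less_trans simp del: emeasure_completion)
  define av where "av Q = (\<integral>x. cut Q f x \<partial>lebesgue) / of_real (dside (nn Q) ^ DIM('a))" for Q
  define bQ where "bQ Q = (\<lambda>x. cut Q f x - cut Q (\<lambda>_. av Q) x)" for Q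
  note ca = cube_average_norm[OF f Q(3), folded av_def, folded bQ_def]
  \<comment> \<open>The first cubes of an enumeration; the intersection covers an empty
    \<open>\<Q>\<close>, where the enumeration returns an arbitrary value.\<close>
  define Qk where "Qk k = \<Q> \<inter> from_nat_into \<Q> ` {..<k}" for k :: nat
  have Qk: "finite (Qk k)" "Qk k \<subseteq> \<Q>" for k by (auto simp: Qk_def)
  define \<Omega>k where "\<Omega>k k = \<Union>(Qk k)" for k
  have Omk[measurable]: "\<Omega>k k \<in> \<L>" for k
   unfolding \<Omega>k_def using Qk[of k] Qs by (intro sets.finite_Union) auto
  define bk where "bk k = (\<lambda>x. \<Sum>Q\<in>Qk k. bQ Q x)" for k
  define gk where "gk k = (\<lambda>x. f x - bk k x)" for k
  have bQbcs: "bQ Q \<in> bcs" if "Q \<in> \<Q>" for Q using ca(2)[OF that] .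
  have bkbcs: "bk k \<in> bcs" for k unfolding bk_def using Qk[of k] bQbcs by (intro bcs_sum) auto
  have gkbcs: "gk k \<in> bcs" for k unfolding gk_def by (intro bcs_diff f bkbcs)
  have gm[measurable]: "gk k \<in> \<M>" for k using gkbcs by (rule bcs_measurable)
  have g1: "gk k x = av Q" if "Q \<in> Qk k" "x \<in> Q" for k x Q
  proof -
   have "bQ Q' x = 0" if "Q' \<in> Qk k - {Q}" for Q'
   proof -
    have "Q' \<inter> Q = {}" using Q(2) that \<open>Q \<in> Qk k\<close> Qk[of k] by (auto simp: disjoint_def)
    then have "x \<notin> Q'" using \<open>x \<in> Q\<close> by auto
    then show ?thesis by (simp add: bQ_def)
   qed
   then have "bk k x = bQ Q x" unfolding bk_def using sum.remove[OF Qk(1) that(1), of "\<lambda>Q. bQ Q x"] by simp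
   then show ?thesis using that(2) by (simp add: gk_def bQ_def)
  qed
  have g2: "gk k x = f x" if "x \<notin> \<Omega>k k" for k x
  proof -
   have "bQ Q x = 0" if "Q \<in> Qk k" for Q using \<open>x \<notin> \<Omega>k k\<close> that by (auto simp: bQ_def \<Omega>k_def)
   then show ?thesis by (simp add: gk_def bk_def)
  qed
  \<comment> \<open>Three regions: on the corrected cubes \<open>gk k\<close> is a mean bounded by
    \<open>2 ^ DIM('a) * lam\<close>, off \<open>\<Omega>\<close> it equals \<open>f\<close> with
    values at most \<open>lam\<close>, and on the cubes not yet corrected only the crude bound
    \<open>M\<close> is available.\<close>
  have gint: "(NR x. norm (gk k x) powr 2) \<le> ennreal ((2 ^ DIM('a) + 1) * lam) * I + ennreal (M\<^sup>2) * \<mu> (\<Omega> - \<Omega>k k)" for k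
  proof -
   have "(NR x. norm (gk k x) powr 2) \<le>
    (NN x. ennreal (norm (gk k x) powr 2) * indicator (\<Union>(Qk k)) x + (ennreal lam * F x + ennreal (M\<^sup>2) * indicator (\<Omega> - \<Omega>k k) x))"
   proof (rule nn_integral_mono_AE)
    show "AE x in lebesgue. ennreal (norm (gk k x) powr 2) \<le> ennreal (norm (gk k x) powr 2) * indicator (\<Union>(Qk k)) x + (ennreal lam * F x + ennreal (M\<^sup>2) * indicator (\<Omega> - \<Omega>k k) x)"
     using Q3
    proof eventually_elim
     case (elim x)
     consider "x \<in> \<Union>(Qk k)" | "x \<in> \<Omega> - \<Omega>k k" | "x \<notin> \<Omega>" "x \<notin> \<Omega>k k"
      unfolding \<Omega>k_def by blast
     then show ?case
     proof cases
      case 1 then show ?thesis by simp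
     next
      case 2
      then have "norm (gk k x) powr 2 \<le> M\<^sup>2" using g2[of x k] M(2)[of x] by (simp add: power_mono)
      then have "ennreal (norm (gk k x) powr 2) \<le> ennreal (M\<^sup>2)" by (rule ennreal_leI)
      then show ?thesis using 2 by (simp add: add_increasing)
     next
      case 3
      then have "norm (f x) \<le> lam" using elim by (simp add: \<Omega>_def)
      then have "norm (gk k x) powr 2 \<le> lam * norm (f x)"
       using g2[of x k] 3 by (simp add: power2_eq_square mult_right_mono)
      then have "ennreal (norm (gk k x) powr 2) \<le> ennreal (lam * norm (f x))" by (rule ennreal_leI)
      also have "\<dots> = ennreal lam * F x" using lam by (simp add: F_def ennreal_mult)
      finally show ?thesis by (simp add: add_increasing add_increasing2)
     qed
    qed
   qed
   also have "\<dots> = (NR x\<in>\<Union>(Qk k). norm (gk k x) powr 2) + (ennreal lam * I + ennreal (M\<^sup>2) * \<mu> (\<Omega> - \<Omega>k k))"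
   proof -
    have [measurable]: "\<Union>(Qk k) \<in> \<L>" using Omk[of k] by (simp add: \<Omega>k_def)
    show ?thesis unfolding I_def
     by (simp add: nn_integral_add nn_integral_cmult nn_integral_cmult_indicator del: emeasure_completion)
   qed
   also have "(NR x\<in>\<Union>(Qk k). norm (gk k x) powr 2) = (\<integral>\<^sup>+Q. (NR x\<in>Q. norm (gk k x) powr 2) \<partial>count_space (Qk k))"
    using Qk[of k] Qs pairwise_subset[OF Q(2) Qk(2)[of k]] by (intro nn_integral_countable_Union) (auto intro: countable_finite)
   also have "\<dots> \<le> (\<integral>\<^sup>+Q. ennreal (2 ^ DIM('a) * lam) * (NN x\<in>Q. F x) \<partial>count_space (Qk k))"
   proof (rule nn_integral_mono)
    fix Q assume "Q \<in> space (count_space (Qk k))"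
    then have QQ: "Q \<in> Qk k" "Q \<in> \<Q>" using Qk[of k] by auto
    have qm: "\<mu> Q = ennreal (dside (nn Q) ^ DIM('a))" by (subst Q(3)[OF QQ(2)]) (rule emeasure_dcube)
    have a1: "ennreal (norm (av Q)) * \<mu> Q \<le> (NN x\<in>Q. F x)"
     unfolding F_def by (rule ca(3)[OF QQ(2)])
    also have "\<dots> \<le> ennreal (2 ^ DIM('a) * lam) * \<mu> Q" unfolding F_def by (rule Q2[OF QQ(2)])
    finally have "norm (av Q) * dside (nn Q) ^ DIM('a) \<le> (2 ^ DIM('a) * lam) * dside (nn Q) ^ DIM('a)"
     unfolding qm using lam by (simp add: ennreal_mult[symmetric] ennreal_le_iff)
    then have a2: "norm (av Q) \<le> 2 ^ DIM('a) * lam" by simp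
    have "(NR x\<in>Q. norm (gk k x) powr 2) = (NN x. ennreal (norm (av Q) powr 2) * indicator Q x)"
     using g1[OF QQ(1)] by (intro nn_integral_cong) (auto simp: indicator_def)
    also have "\<dots> = ennreal (norm (av Q)) * (ennreal (norm (av Q)) * \<mu> Q)"
     using Qs[OF QQ(2)] by (subst nn_integral_cmult_indicator) (auto simp: power2_eq_square ennreal_mult mult.assoc simp del: emeasure_completion)
    also have "\<dots> \<le> ennreal (2 ^ DIM('a) * lam) * (NN x\<in>Q. F x)"
     using a1 a2 by (intro mult_mono ennreal_leI) auto
    finally show "(NR x\<in>Q. norm (gk k x) powr 2) \<le> ennreal (2 ^ DIM('a) * lam) * (NN x\<in>Q. F x)" .
   qed
   also have "\<dots> \<le> ennreal (2 ^ DIM('a) * lam) * I"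
    using sumF[OF Qk(2)] by (simp add: nn_integral_cmult mult_left_mono)
   finally have "(NR x. norm (gk k x) powr 2) \<le> ennreal (2 ^ DIM('a) * lam) * I + (ennreal lam * I + ennreal (M\<^sup>2) * \<mu> (\<Omega> - \<Omega>k k))"
    by (simp add: add_right_mono)
   also have "\<dots> = ennreal ((2 ^ DIM('a) + 1) * lam) * I + ennreal (M\<^sup>2) * \<mu> (\<Omega> - \<Omega>k k)"
    using lam by (simp add: distrib_right ennreal_plus add.assoc del: emeasure_completion)
   finally show ?thesis .
  qed
  have Tm[measurable]: "T h \<in> \<M>" if "h \<in> bcs" for h
   using bounded_operator_measurable[OF T bcs_Lp[OF that]] by simp
  have gpart: "\<mu> {x. lam / 2 < norm (T (gk k) x)} \<le>
    ennreal (4 * A * (2 ^ DIM('a) + 1) / lam) * I + ennreal (4 * A * M\<^sup>2 / lam\<^sup>2) * \<mu> (\<Omega> - \<Omega>k k)" for k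
  proof -
   note [measurable] = Tm[OF gkbcs[of k]]
   have "\<mu> {x. lam / 2 < norm (T (gk k) x)} \<le> ennreal (1 / (lam / 2) powr 2) * (NR x. norm (T (gk k) x) powr 2)"
    using Chebyshev_powr[of "\<lambda>x. norm (T (gk k) x)" lebesgue "lam / 2" 2] lam by simp
   also have "\<dots> \<le> ennreal (4 / lam\<^sup>2) * (ennreal A * (ennreal ((2 ^ DIM('a) + 1) * lam) * I + ennreal (M\<^sup>2) * \<mu> (\<Omega> - \<Omega>k k)))"
   proof (rule mult_mono)
    have "(NR x. norm (T (gk k) x) powr 2) \<le> ennreal A * (NR x. norm (gk k x) powr 2)"
     by (intro A(2) bcs_Lp gkbcs) simp
    also have "\<dots> \<le> ennreal A * (ennreal ((2 ^ DIM('a) + 1) * lam) * I + ennreal (M\<^sup>2) * \<mu> (\<Omega> - \<Omega>k k))"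
     by (intro mult_left_mono gint) simp
    finally show "(NR x. norm (T (gk k) x) powr 2) \<le> \<dots>" .
   qed (use lam in \<open>auto simp: power_divide\<close>)
   also have "\<dots> = ennreal (4 / lam\<^sup>2 * A * ((2 ^ DIM('a) + 1) * lam)) * I + ennreal (4 / lam\<^sup>2 * A * M\<^sup>2) * \<mu> (\<Omega> - \<Omega>k k)"
   proof -
    have m3: "ennreal (a * b * c) = ennreal a * (ennreal b * ennreal c)" if "0 \<le> a" "0 \<le> b" "0 \<le> c" for a b c :: real
     using that by (simp add: ennreal_mult mult.assoc)
    have 1: "ennreal (4 / lam\<^sup>2 * A * ((2 ^ DIM('a) + 1) * lam)) = ennreal (4 / lam\<^sup>2) * (ennreal A * ennreal ((2 ^ DIM('a) + 1) * lam))"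
     using A(1) lam by (intro m3) auto
    have 2: "ennreal (4 / lam\<^sup>2 * A * M\<^sup>2) = ennreal (4 / lam\<^sup>2) * (ennreal A * ennreal (M\<^sup>2))"
     using A(1) by (intro m3) auto
    show ?thesis unfolding 1 2 by (simp only: distrib_left mult.assoc)
   qed
   also have "4 / lam\<^sup>2 * A * ((2 ^ DIM('a) + 1) * lam) = 4 * A * (2 ^ DIM('a) + 1) / lam"
    using lam by (simp add: power2_eq_square)
   also have "4 / lam\<^sup>2 * A * M\<^sup>2 = 4 * A * M\<^sup>2 / lam\<^sup>2" by simp
   finally show ?thesis .
  qed
  define B where "B Q = ball (cc Q) (3 * real DIM('a) * dside (nn Q))" for Q
  have [measurable]: "B Q \<in> \<L>" for Q by (simp add: B_def)
  define E where "E = (\<Union>Q\<in>\<Q>. B Q)"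
  have Em[measurable]: "E \<in> \<L>" unfolding E_def using Q(1) by (intro sets.countable_UN'') auto
  have Epart: "\<mu> E \<le> ennreal (\<kappa> / lam) * I"
  proof -
   have "\<mu> E \<le> (\<integral>\<^sup>+Q. \<mu> (B Q) \<partial>count_space \<Q>)"
    unfolding E_def using Q(1) by (intro emeasure_countable_UN_le) auto
   also have "\<dots> = (\<integral>\<^sup>+Q. ennreal \<kappa> * \<mu> Q \<partial>count_space \<Q>)"
   proof (rule nn_integral_cong)
    fix Q assume "Q \<in> space (count_space \<Q>)"
    then have "Q \<in> \<Q>" by simp
    from Q(3)[OF this] show "\<mu> (B Q) = ennreal \<kappa> * \<mu> Q"
     unfolding B_def \<kappa>_def using emeasure_star_le[of "cc Q" "nn Q"] by (simp del: emeasure_completion)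
   qed
   also have "\<dots> \<le> ennreal \<kappa> * (ennreal (1 / lam) * I)"
    using sumQ by (simp add: nn_integral_cmult mult_left_mono del: emeasure_completion)
   also have "\<dots> = ennreal (\<kappa> / lam) * I" using \<kappa> lam by (simp add: mult.assoc[symmetric] ennreal_mult[symmetric])
   finally show ?thesis .
  qed
  have bpart: "\<mu> {x. lam / 2 < norm (T (bk k) x) * indicator (- E) x} \<le> ennreal (4 * Cf / lam) * I" for k
  proof -
   note [measurable] = Tm[OF bkbcs[of k]]
   have "\<mu> {x. lam / 2 < norm (T (bk k) x) * indicator (- E) x} \<le> ennreal (1 / (lam / 2) powr 1) * (NR x. (norm (T (bk k) x) * indicator (- E) x) powr 1)"
    using Chebyshev_powr[of "\<lambda>x. norm (T (bk k) x) * indicator (- E) x" lebesgue "lam / 2" 1] lam by simp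
   also have "(NR x. (norm (T (bk k) x) * indicator (- E) x) powr 1) \<le> (NN x. (\<Sum>Q\<in>Qk k. ennreal (norm (T (bQ Q) x)) * indicator (- B Q) x))"
   proof (rule nn_integral_mono_AE)
    have "AE x in lebesgue. T (bk k) x = (\<Sum>Q\<in>Qk k. T (bQ Q) x)"
     unfolding bk_def using Qk[of k] bQbcs by (intro bounded_operator_sum[OF T]) auto
    then show "AE x in lebesgue. ennreal ((norm (T (bk k) x) * indicator (- E) x) powr 1) \<le> (\<Sum>Q\<in>Qk k. ennreal (norm (T (bQ Q) x)) * indicator (- B Q) x)"
    proof eventually_elim
     case (elim x)
     show ?case
     proof (cases "x \<in> E")
      case False
      then have "x \<notin> B Q" if "Q \<in> Qk k" for Q using that Qk(2)[of k] by (auto simp: E_def)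
      then have "(\<Sum>Q\<in>Qk k. ennreal (norm (T (bQ Q) x)) * indicator (- B Q) x) = ennreal (\<Sum>Q\<in>Qk k. norm (T (bQ Q) x))"
       by (subst sum_ennreal[symmetric]) auto
      moreover have "norm (T (bk k) x) \<le> (\<Sum>Q\<in>Qk k. norm (T (bQ Q) x))" unfolding elim by (rule norm_sum)
      ultimately show ?thesis using False by (simp add: ennreal_leI)
     qed simp
    qed
   qed
   also have "\<dots> = (\<Sum>Q\<in>Qk k. (NR x\<in>- B Q. norm (T (bQ Q) x)))"
   proof (rule nn_integral_sum)
    fix Q assume "Q \<in> Qk k"
    then have [measurable]: "T (bQ Q) \<in> \<M>" using Qk(2)[of k] by (intro Tm bQbcs) auto
    show "(\<lambda>x. ennreal (norm (T (bQ Q) x)) * indicator (- B Q) x) \<in> \<M>" by measurable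
   qed
   also have "\<dots> \<le> (\<Sum>Q\<in>Qk k. ennreal (2 * Cf) * (NN x\<in>Q. F x))"
   proof (rule sum_mono)
    fix Q assume "Q \<in> Qk k"
    then have QQ: "Q \<in> \<Q>" using Qk[of k] by auto
    have "(NR x\<in>- B Q. norm (T (bQ Q) x)) \<le> ennreal Cf * (NR x. norm (bQ Q x))"
     unfolding B_def
    proof (rule Cf(2))
     show "\<forall>x. x \<notin> dcube (nn Q) (cc Q) \<longrightarrow> bQ Q x = 0" using Q(3)[OF QQ] by (auto simp: bQ_def)
     show "(\<integral>x. bQ Q x \<partial>lebesgue) = 0" using ca(1)[OF QQ] by (simp add: bQ_def)
    qed (rule bQbcs[OF QQ])
    also have "\<dots> \<le> ennreal Cf * (2 * (NN x\<in>Q. F x))"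
     using ca(4)[OF QQ] by (intro mult_left_mono) (auto simp: F_def bQ_def)
    also have "\<dots> = ennreal (2 * Cf) * (NN x\<in>Q. F x)" using Cf(1) by (simp add: ennreal_mult mult_ac)
    finally show "(NR x\<in>- B Q. norm (T (bQ Q) x)) \<le> ennreal (2 * Cf) * (NN x\<in>Q. F x)" .
   qed
   also have "\<dots> = ennreal (2 * Cf) * (\<integral>\<^sup>+Q. (NN x\<in>Q. F x) \<partial>count_space (Qk k))"
    using Qk[of k] by (simp add: nn_integral_count_space_finite sum_distrib_left)
   also have "\<dots> \<le> ennreal (2 * Cf) * I" by (intro mult_left_mono sumF Qk) simp
   finally have "\<mu> {x. lam / 2 < norm (T (bk k) x) * indicator (- E) x} \<le> ennreal (1 / (lam / 2) powr 1) * (ennreal (2 * Cf) * I)"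
    by (simp add: mult_left_mono)
   also have "\<dots> = ennreal (1 / (lam / 2) powr 1 * (2 * Cf)) * I"
    using Cf lam by (simp add: mult.assoc[symmetric] ennreal_mult[symmetric])
   also have "1 / (lam / 2) powr 1 * (2 * Cf) = 4 * Cf / lam" using lam by simp
   finally show ?thesis .
  qed
  define X where "X = \<mu> {x. lam < norm (T f x)}"
  have Xk: "X \<le> ennreal ((\<kappa> + 4 * Cf + 4 * A * (2 ^ DIM('a) + 1)) / lam) * I + ennreal (4 * A * M\<^sup>2 / lam\<^sup>2) * \<mu> (\<Omega> - \<Omega>k k)" for k
  proof -
   note [measurable] = Tm[OF bkbcs[of k]] Tm[OF gkbcs[of k]] Tm[OF f]
   define G1 where "G1 = {x. lam / 2 < norm (T (bk k) x) * indicator (- E) x}"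
   define G2 where "G2 = {x. lam / 2 < norm (T (gk k) x)}"
   have Ge: "G1 = {x \<in> space lebesgue. lam / 2 < norm (T (bk k) x) * indicator (- E) x}" "G2 = {x \<in> space lebesgue. lam / 2 < norm (T (gk k) x)}"
    by (auto simp: G1_def G2_def)
   have [measurable]: "G1 \<in> \<L>" unfolding Ge(1) by measurable
   have [measurable]: "G2 \<in> \<L>" unfolding Ge(2) by measurable
   have "X \<le> \<mu> (E \<union> (G1 \<union> G2))"
    unfolding X_def
   proof (rule emeasure_mono_AE)
    have "AE x in lebesgue. T (gk k) x = T f x - T (bk k) x"
     unfolding gk_def by (rule bounded_operator_diff[OF T]) (use f bkbcs in auto)
    then show "AE x in lebesgue. x \<in> {x. lam < norm (T f x)} \<longrightarrow> x \<in> E \<union> (G1 \<union> G2)"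
    proof eventually_elim
     case (elim x)
     have "norm (T f x) \<le> norm (T (gk k) x) + norm (T (bk k) x)"
      using norm_triangle_ineq[of "T (gk k) x" "T (bk k) x"] elim by simp
     then show ?case by (auto simp: G1_def G2_def)
    qed
   qed measurable
   also have "\<dots> \<le> \<mu> E + \<mu> (G1 \<union> G2)"
    by (rule emeasure_subadditive) measurable
   also have "\<dots> \<le> \<mu> E + (\<mu> G1 + \<mu> G2)"
    by (intro add_left_mono emeasure_subadditive) measurable
   also have "\<dots> \<le> ennreal (\<kappa> / lam) * I + (ennreal (4 * Cf / lam) * I + (ennreal (4 * A * (2 ^ DIM('a) + 1) / lam) * I + ennreal (4 * A * M\<^sup>2 / lam\<^sup>2) * \<mu> (\<Omega> - \<Omega>k k)))"
    unfolding G1_def G2_def by (intro add_mono Epart bpart gpart)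
   also have "\<dots> = ennreal (\<kappa> / lam + 4 * Cf / lam + 4 * A * (2 ^ DIM('a) + 1) / lam) * I + ennreal (4 * A * M\<^sup>2 / lam\<^sup>2) * \<mu> (\<Omega> - \<Omega>k k)"
    using \<kappa> Cf A lam by (simp add: ennreal_plus distrib_right add.assoc del: emeasure_completion)
   finally show ?thesis by (simp add: add_divide_distrib)
  qed
  have lim: "(\<lambda>k. \<mu> (\<Omega> - \<Omega>k k)) \<longlonglongrightarrow> \<mu> (\<Inter>k. \<Omega> - \<Omega>k k)"
  proof (rule Lim_emeasure_decseq)
   show "range (\<lambda>k. \<Omega> - \<Omega>k k) \<subseteq> \<L>" by auto
   show "decseq (\<lambda>k. \<Omega> - \<Omega>k k)"
    unfolding decseq_def \<Omega>k_def Qk_def by (fastforce intro: less_le_trans)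
   show "\<mu> (\<Omega> - \<Omega>k k) \<noteq> \<infinity>" for k
    using emeasure_mono[of "\<Omega> - \<Omega>k k" \<Omega> lebesgue] Omfin Om by (metis Diff_subset infinity_ennreal_def not_le order_le_less_trans order_less_irrefl)
  qed
  have inter: "(\<Inter>k. \<Omega> - \<Omega>k k) = {}"
  proof -
   have "\<exists>k. x \<in> \<Omega>k k" if "x \<in> \<Omega>" for x
   proof -
    obtain Q where QQ: "Q \<in> \<Q>" "x \<in> Q" using \<open>x \<in> \<Omega>\<close> by (auto simp: \<Omega>_def)
    have "from_nat_into \<Q> (to_nat_on \<Q> Q) = Q" using Q(1) QQ(1) by simp
    then have "Q \<in> Qk (Suc (to_nat_on \<Q> Q))" using QQ(1) unfolding Qk_def by (metis IntI imageI lessI lessThan_iff)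
    then show ?thesis using QQ(2) unfolding \<Omega>k_def by blast
   qed
   then show ?thesis by blast
  qed
  have lim0: "(\<lambda>k. \<mu> (\<Omega> - \<Omega>k k)) \<longlonglongrightarrow> 0" using lim unfolding inter by (simp only: emeasure_empty)
  have "X \<le> ennreal ((\<kappa> + 4 * Cf + 4 * A * (2 ^ DIM('a) + 1)) / lam) * I"
  proof (rule ennreal_le_epsilon)
   fix e :: real assume e: "0 < e"
   define c where "c = 4 * A * M\<^sup>2 / lam\<^sup>2"
   have c: "0 \<le> c" using A by (simp add: c_def)
   have "\<forall>\<^sub>F k in sequentially. \<mu> (\<Omega> - \<Omega>k k) < ennreal (e / (c + 1))"
    using c e by (intro order_tendstoD(2)[OF lim0]) simp
   then obtain k where k: "\<mu> (\<Omega> - \<Omega>k k) < ennreal (e / (c + 1))"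
    by (auto simp: eventually_sequentially)
   have "ennreal c * \<mu> (\<Omega> - \<Omega>k k) \<le> ennreal c * ennreal (e / (c + 1))"
    using k by (intro mult_left_mono) auto
   also have "\<dots> = ennreal (c * (e / (c + 1)))" using c e by (simp add: ennreal_mult[symmetric])
   also have "\<dots> \<le> ennreal e" using c e by (intro ennreal_leI) (simp add: field_simps)
   finally show "X \<le> ennreal ((\<kappa> + 4 * Cf + 4 * A * (2 ^ DIM('a) + 1)) / lam) * I + ennreal e"
    using Xk[of k] unfolding c_def by (meson add_left_mono order_trans)
  qed
  then show "\<mu> {x. lam < norm (T f x)}
   \<le> ennreal ((\<kappa> + 4 * Cf + 4 * A * (2 ^ DIM('a) + 1)) / lam) * (NR x. norm (f x))"
   unfolding X_def I_def F_def .
 qed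
qed

section \<open>Sparse domination\<close>

text \<open>A union of balls over the cube instead of a single ball, so that the enlargement depends
  only on the cube and grows with it. The radius is twice the bound for the diameter: for two points
  of the cube and a third outside the star, the smoothness condition of a standard kernel is
  satisfied.\<close>

definition star :: "int \<Rightarrow> 'a::euclidean_space \<Rightarrow> 'a set" where
 "star n x = (\<Union>z\<in>dcube n x. ball z (2 * (real DIM('a) * dside n)))"

lemma open_star: "open (star n x)"
 unfolding star_def by auto

lemma star_sets_lebesgue [measurable]: "star n x \<in> \<L>"
 using open_star[of n x] by simp

lemma dcube_subset_star: "dcube n (x::'a::euclidean_space) \<subseteq> star n x"
proof
 fix z assume "z \<in> dcube n x"
 moreover have "z \<in> ball z (2 * (real DIM('a) * dside n))" by simp
 ultimately show "z \<in> star n x" unfolding star_def by blast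
qed

lemma star_subset_ball:
 assumes "y \<in> dcube n (x::'a::euclidean_space)"
 shows "star n x \<subseteq> ball y (3 * (real DIM('a) * dside n))"
proof
 fix w assume "w \<in> star n x"
 then obtain z where z: "z \<in> dcube n x" "dist z w < 2 * (real DIM('a) * dside n)" by (auto simp: star_def)
 then have "dist y z \<le> real DIM('a) * dside n" using dcube_norm_diff[OF assms z(1)] by (simp add: dist_norm)
 then show "w \<in> ball y (3 * (real DIM('a) * dside n))"
  using z(2) dist_triangle[of y w z] by simp
qed

lemma star_eq: "y \<in> dcube n x \<Longrightarrow> star n y = star n x"
 unfolding star_def using dcube_eq[of y n x] by simp

lemma star_mono:
 assumes "n \<le> m" "dcube m y \<subseteq> dcube n (x::'a::euclidean_space)"
 shows "star m y \<subseteq> star n x"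
proof
 fix w assume "w \<in> star m y"
 then obtain z where z: "z \<in> dcube m y" "dist z w < 2 * (real DIM('a) * dside m)" by (auto simp: star_def)
 have "2 * (real DIM('a) * dside m) \<le> 2 * (real DIM('a) * dside n)" using dside_antimono[OF assms(1)] by (intro mult_left_mono) auto
 then have "dist z w < 2 * (real DIM('a) * dside n)" using z(2) by linarith
 then show "w \<in> star n x" using z(1) assms(2) unfolding star_def by (intro UN_I[of z]) auto
qed

lemma not_in_star:
 assumes "z \<in> dcube n (x::'a::euclidean_space)" "w \<notin> star n x"
 shows "2 * (real DIM('a) * dside n) \<le> norm (z - w)"
proof -
 have "w \<notin> ball z (2 * (real DIM('a) * dside n))" using assms unfolding star_def by blast
 then show ?thesis by (simp add: dist_norm)
qed

text \<open>Since \<open>T f\<close> is meaningful only up to null sets, the oscillation is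
  controlled on a set \<open>G\<close> that contains almost all of the cube. Up to the volume of the
  unit ball, \<open>V\<close> bounds the means of \<open>f\<close> over all balls around one point
  of the cube, that is, the maximal function there.\<close>

definition oscillation_bound :: "(('a::euclidean_space \<Rightarrow> complex) \<Rightarrow> ('a \<Rightarrow> complex)) \<Rightarrow> real \<Rightarrow> bool" where
 "oscillation_bound T C \<longleftrightarrow> (\<forall>f\<in>bcs. \<forall>m y V \<xi>. 0 \<le> V \<longrightarrow> (\<forall>z\<in>star m y. f z = 0) \<longrightarrow> \<xi> \<in> dcube m y \<longrightarrow>
  (\<forall>R>0. (NR z\<in>ball \<xi> R. norm (f z)) \<le> ennreal (V * R ^ DIM('a))) \<longrightarrow>
  (\<exists>G. (AE x in lebesgue. x \<in> dcube m y \<longrightarrow> x \<in> G) \<and>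
   (\<forall>x\<in>G. \<forall>x'\<in>G. x \<in> dcube m y \<longrightarrow> x' \<in> dcube m y \<longrightarrow> norm (T f x - T f x') \<le> C * V)))"

text \<open>As \<open>f\<close> vanishes near the cube, both values are kernel integrals, and
  smoothness in the first variable leads to the integrand of the tail estimate. The factor
  \<open>2 ^ DIM('a)\<close> arises from replacing balls around \<open>x\<close> by balls of twice
  the radius around \<open>\<xi>\<close>.\<close>

lemma cz_oscillation:
 fixes K :: "'a::euclidean_space \<Rightarrow> 'a \<Rightarrow> complex"
 assumes cz: "calderon_zygmund T K"
 shows "\<exists>C\<ge>0. oscillation_bound T C"
proof -
 have hk: "has_kernel T K" and sk: "standard_kernel K" using cz by (auto simp: calderon_zygmund_def)
 obtain C e where e: "0 < e" "0 \<le> (C::real)" and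
  sm: "\<And>x x' y. x \<noteq> y \<Longrightarrow> norm (x - x') \<le> norm (x - y) / 2 \<Longrightarrow>
   norm (K x y - K x' y) \<le> C * norm (x - x') powr e / norm (x - y) powr (real DIM('a) + e)"
  using standard_kernel_smooth[OF sk] by metis
 obtain Ct where Ct: "0 \<le> Ct" "\<And>f (x0::'a) r V. f \<in> \<M> \<Longrightarrow> 0 < r \<Longrightarrow> 0 \<le> V \<Longrightarrow>
  (\<forall>R\<ge>r. (NN y\<in>ball x0 R. f y) \<le> ennreal (V * R ^ DIM('a))) \<Longrightarrow>
  (NN y. f y * indicator (- ball x0 r) y * ennreal (r powr e / norm (x0 - y) powr (DIM('a) + e))) \<le> ennreal (Ct * V)"
  using radial_tail[OF e(1), where 'a='a] by blast
 show ?thesis unfolding oscillation_bound_def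
 proof (intro exI[of _ "C * (Ct * 2 ^ DIM('a))"] conjI ballI allI impI)
  show "0 \<le> C * (Ct * 2 ^ DIM('a))" using e Ct by simp
  fix f :: "'a \<Rightarrow> complex" and m :: int and y :: 'a and V :: real and \<xi> :: 'a
  assume f: "f \<in> bcs" and V: "0 \<le> V" and f0: "\<forall>z\<in>star m y. f z = 0" and xi: "\<xi> \<in> dcube m y"
   and bd: "\<forall>R>0. (NR z\<in>ball \<xi> R. norm (f z)) \<le> ennreal (V * R ^ DIM('a))"
  have [measurable]: "f \<in> \<M>" using f by (rule bcs_measurable)
  define \<delta> where "\<delta> = real DIM('a) * dside m"
  have \<delta>: "0 < \<delta>" by (simp add: \<delta>_def)
  have "{z. f z \<noteq> 0} \<subseteq> - star m y" using f0 by auto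
  moreover have "closed (- star m y)" using open_star by (simp add: closed_def)
  ultimately have cl: "closure {z. f z \<noteq> 0} \<subseteq> - star m y" by (rule closure_minimal)
  define G where "G = {x. integrable lebesgue (\<lambda>z. K x z * f z) \<and> T f x = (\<integral>z. K x z * f z \<partial>lebesgue)}"
  have G1: "AE x in lebesgue. x \<in> dcube m y \<longrightarrow> x \<in> G"
   using has_kernel_bcs[OF hk f]
  proof eventually_elim
   case (elim x)
   then show ?case using cl dcube_subset_star[of m y] by (auto simp: G_def)
  qed
  have G2: "norm (T f x - T f x') \<le> C * (Ct * 2 ^ DIM('a)) * V"
   if "x \<in> G" "x' \<in> G" and x: "x \<in> dcube m y" "x' \<in> dcube m y" for x x'
  proof -
   have int: "integrable lebesgue (\<lambda>z. K x z * f z)" "integrable lebesgue (\<lambda>z. K x' z * f z)"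
    and Tf: "T f x = (\<integral>z. K x z * f z \<partial>lebesgue)" "T f x' = (\<integral>z. K x' z * f z \<partial>lebesgue)"
    using that by (auto simp: G_def)
   have int2: "integrable lebesgue (\<lambda>z. (K x z - K x' z) * f z)"
    using Bochner_Integration.integrable_diff[OF int] by (simp add: left_diff_distrib)
   have Te: "T f x - T f x' = (\<integral>z. (K x z - K x' z) * f z \<partial>lebesgue)"
    unfolding Tf using Bochner_Integration.integral_diff[OF int] by (simp add: left_diff_distrib)
   have "ennreal (norm (T f x - T f x')) \<le> (NN z. norm ((K x z - K x' z) * f z))"
    unfolding Te by (rule integral_norm_bound_ennreal[OF int2])
   also have "\<dots> \<le> (NN z. ennreal C * (ennreal (norm (f z)) * indicator (- ball x \<delta>) z * ennreal (\<delta> powr e / norm (x - z) powr (DIM('a) + e))))"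
   proof (rule nn_integral_mono)
    fix z
    show "ennreal (norm ((K x z - K x' z) * f z)) \<le> ennreal C * (ennreal (norm (f z)) * indicator (- ball x \<delta>) z * ennreal (\<delta> powr e / norm (x - z) powr (DIM('a) + e)))"
    proof (cases "z \<in> star m y")
     case False
     have xz: "2 * \<delta> \<le> norm (x - z)" using not_in_star[OF x(1) False] by (simp add: \<delta>_def)
     have xx: "norm (x - x') \<le> \<delta>" using dcube_norm_diff[OF x] by (simp add: \<delta>_def)
     have "norm (K x z - K x' z) \<le> C * norm (x - x') powr e / norm (x - z) powr (real DIM('a) + e)"
      using xz xx \<delta> by (intro sm) auto
     also have "\<dots> \<le> C * \<delta> powr e / norm (x - z) powr (real DIM('a) + e)"
      using xx e by (intro divide_right_mono mult_left_mono powr_mono2) auto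
     finally have "norm (K x z - K x' z) * norm (f z) \<le> (C * \<delta> powr e / norm (x - z) powr (real DIM('a) + e)) * norm (f z)"
      by (rule mult_right_mono) simp
     also have "\<dots> = C * (norm (f z) * (\<delta> powr e / norm (x - z) powr (DIM('a) + e)))" by simp
     finally have "ennreal (norm ((K x z - K x' z) * f z)) \<le> ennreal (C * (norm (f z) * (\<delta> powr e / norm (x - z) powr (DIM('a) + e))))"
      by (simp add: norm_mult ennreal_leI)
     also have "\<dots> = ennreal C * (ennreal (norm (f z)) * ennreal (\<delta> powr e / norm (x - z) powr (DIM('a) + e)))"
      by (simp only: ennreal_mult'[OF e(2)] ennreal_mult'[OF norm_ge_zero])
     finally show ?thesis using xz \<delta> by (simp add: dist_norm)
    qed (use f0 in simp)
   qed
   also have "\<dots> = ennreal C * (NN z. ennreal (norm (f z)) * indicator (- ball x \<delta>) z * ennreal (\<delta> powr e / norm (x - z) powr (DIM('a) + e)))"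
    by (rule nn_integral_cmult) measurable
   also have "\<dots> \<le> ennreal C * ennreal (Ct * (V * 2 ^ DIM('a)))"
   proof (intro mult_left_mono Ct(2) allI impI)
    fix R assume R: "\<delta> \<le> R"
    have sub: "ball x R \<subseteq> ball \<xi> (2 * R)"
    proof
     fix w assume "w \<in> ball x R"
     moreover have "dist \<xi> x \<le> \<delta>" using dcube_norm_diff[OF xi x(1)] by (simp add: dist_norm \<delta>_def)
     ultimately show "w \<in> ball \<xi> (2 * R)" using R dist_triangle[of \<xi> w x] by simp
    qed
    have "(NR z\<in>ball x R. norm (f z)) \<le> (NR z\<in>ball \<xi> (2 * R). norm (f z))"
     using sub by (intro nn_integral_mono) (auto simp: indicator_def)
    also have "\<dots> \<le> ennreal (V * (2 * R) ^ DIM('a))" using R \<delta> by (intro bd[rule_format]) auto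
    finally show "(NR z\<in>ball x R. norm (f z)) \<le> ennreal (V * 2 ^ DIM('a) * R ^ DIM('a))"
     by (simp add: power_mult_distrib mult.assoc)
   qed (use \<delta> V in auto)
   also have "\<dots> = ennreal (C * (Ct * 2 ^ DIM('a)) * V)"
    using e Ct V by (simp add: ennreal_mult[symmetric] mult_ac)
   finally show ?thesis using e Ct V by (simp add: ennreal_le_iff)
  qed
  show "\<exists>G. (AE x in lebesgue. x \<in> dcube m y \<longrightarrow> x \<in> G) \<and>
   (\<forall>x\<in>G. \<forall>x'\<in>G. x \<in> dcube m y \<longrightarrow> x' \<in> dcube m y \<longrightarrow> norm (T f x - T f x') \<le> C * (Ct * 2 ^ DIM('a)) * V)"
   using G1 G2 by blast
 qed
qed

text \<open>The selected cubes are maximal with density of \<open>U\<close> above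
  \<open>2^(-(d+1))\<close>. The parent fails this condition and is \<open>2^d\<close> times as
  large, so \<open>U\<close> fills at most half of a selected cube. Summation bounds their total
  measure by \<open>2^(d+1)\<close> times that of \<open>U\<close>, hence by half of the initial
  cube. As \<open>U\<close> is open, small cubes around its points lie in \<open>U\<close> and
  satisfy the condition.\<close>

lemma local_density_stopping:
 fixes U :: "'a::euclidean_space set"
 assumes U: "open U" and small: "ennreal (2 ^ (DIM('a) + 2)) * \<mu> U \<le> \<mu> (dcube n x0)"
 obtains \<Q> where "countable \<Q>" "disjoint \<Q>"
  "\<And>Q. Q \<in> \<Q> \<Longrightarrow> \<exists>m y. n \<le> m \<and> Q = dcube m y \<and> Q \<subseteq> dcube n x0 \<and> 2 * \<mu> (Q \<inter> U) \<le> \<mu> Q"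
  "2 * \<mu> (\<Union>\<Q>) \<le> \<mu> (dcube n x0)" "dcube n x0 \<inter> U \<subseteq> \<Union>\<Q>"
proof -
 have [measurable]: "U \<in> \<L>" using U by simp
 define S where "S m y \<longleftrightarrow> n \<le> m \<and> y \<in> dcube n x0 \<and> \<mu> (dcube m y) < ennreal (2 ^ (DIM('a) + 1)) * \<mu> (dcube m y \<inter> U)" for m y
 have sub: "dcube m y \<subseteq> dcube n x0" if "n \<le> m" "y \<in> dcube n x0" for m y
  using dcube_mono[OF that(1), of y] dcube_eq[OF that(2)] by simp
 have inv: "S m z" if "S m y" "z \<in> dcube m y" for m y z
  using that(1) sub[of m y] that(2) unfolding S_def dcube_eq[OF that(2)] by auto
 have bdd: "\<exists>N. \<forall>m<N. \<not> S m y" for y by (intro exI[of _ n]) (auto simp: S_def)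
 obtain \<Q> where Q: "countable \<Q>" "disjoint \<Q>" "\<Union>\<Q> = {x. \<exists>n. S n x}"
  "\<And>Q. Q \<in> \<Q> \<Longrightarrow> \<exists>n x. Q = dcube n x \<and> S n x \<and> (\<forall>m<n. \<not> S m x)"
  by (rule dyadic_stopping[of S]) (erule inv, assumption, rule bdd, rule that)
 have Qs: "Q \<in> \<L>" if "Q \<in> \<Q>" for Q using Q(4)[OF that] by auto
 have h2: "ennreal (2 ^ (DIM('a) + 1)) * X \<le> Y" if "ennreal (2 ^ (DIM('a) + 2)) * X \<le> Y" for X Y
 proof -
  have "ennreal (2 ^ (DIM('a) + 1)) * X \<le> ennreal (2 ^ (DIM('a) + 2)) * X"
   by (intro mult_right_mono ennreal_leI power_increasing) auto
  then show ?thesis using that by simp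
 qed
 \<comment> \<open>The initial cube itself does not stop, so the parent of every selected cube still
   lies inside it.\<close>
 have notn: "\<not> S n y" for y
 proof
  assume S: "S n y"
  then have y: "y \<in> dcube n x0" by (simp add: S_def)
  have "ennreal (2 ^ (DIM('a) + 1)) * \<mu> (dcube n y \<inter> U) \<le> ennreal (2 ^ (DIM('a) + 1)) * \<mu> U"
   by (intro mult_left_mono emeasure_mono) auto
  also have "\<dots> \<le> \<mu> (dcube n x0)" using small by (rule h2)
  finally show False using S dcube_eq[OF y] unfolding S_def by (simp add: not_less[symmetric] del: emeasure_completion)
 qed
 show thesis
 proof (rule that[of \<Q>])
  fix QQ assume QQ: "QQ \<in> \<Q>"
  obtain m y where my: "QQ = dcube m y" "S m y" "\<forall>k<m. \<not> S k y" using Q(4)[OF QQ] by blast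
  have mn: "n \<le> m" "y \<in> dcube n x0" using my(2) by (auto simp: S_def)
  have "m \<noteq> n" using my(2) notn by auto
  then have m1: "n \<le> m - 1" using mn by simp
  have "\<not> S (m - 1) y" using my(3) by simp
  then have "ennreal (2 ^ (DIM('a) + 1)) * \<mu> (dcube (m - 1) y \<inter> U) \<le> \<mu> (dcube (m - 1) y)"
   using m1 mn by (simp add: S_def not_less del: emeasure_completion)
  also have "\<mu> (dcube (m - 1) y) = ennreal (2 ^ DIM('a)) * \<mu> QQ"
   unfolding my(1) by (simp add: emeasure_dcube dside_Suc power_mult_distrib ennreal_mult del: emeasure_completion)
  finally have "ennreal (2 ^ (DIM('a) + 1)) * \<mu> (dcube (m - 1) y \<inter> U) \<le> ennreal (2 ^ DIM('a)) * \<mu> QQ" .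
  moreover have "\<mu> (QQ \<inter> U) \<le> \<mu> (dcube (m - 1) y \<inter> U)"
   using dcube_mono[of "m - 1" m y] my(1) by (intro emeasure_mono) auto
  ultimately have "ennreal (2 ^ (DIM('a) + 1)) * \<mu> (QQ \<inter> U) \<le> ennreal (2 ^ DIM('a)) * \<mu> QQ"
   by (meson mult_left_mono order_trans zero_le)
  then have "ennreal (2 ^ DIM('a)) * (2 * \<mu> (QQ \<inter> U)) \<le> ennreal (2 ^ DIM('a)) * \<mu> QQ"
   by (simp add: ennreal_mult mult_ac del: emeasure_completion)
  then have "2 * \<mu> (QQ \<inter> U) \<le> \<mu> QQ"
   by (subst (asm) ennreal_mult_le_mult_iff) auto
  then show "\<exists>m y. n \<le> m \<and> QQ = dcube m y \<and> QQ \<subseteq> dcube n x0 \<and> 2 * \<mu> (QQ \<inter> U) \<le> \<mu> QQ"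
   using my(1) mn sub[OF mn] by blast
 next
  have "\<mu> (\<Union>Q\<in>\<Q>. Q) = (\<integral>\<^sup>+Q. \<mu> Q \<partial>count_space \<Q>)"
   using Q Qs by (intro emeasure_UN_countable) (auto simp: disjoint_family_on_def disjoint_def)
  also have "\<dots> \<le> (\<integral>\<^sup>+Q. ennreal (2 ^ (DIM('a) + 1)) * (NN x\<in>Q. indicator U x) \<partial>count_space \<Q>)"
  proof (rule nn_integral_mono)
   fix QQ assume "QQ \<in> space (count_space \<Q>)"
   then have QQ: "QQ \<in> \<Q>" by simp
   obtain m y where my: "QQ = dcube m y" "S m y" using Q(4)[OF QQ] by blast
   have "(NN x\<in>QQ. indicator U x) = (NN x. indicator (QQ \<inter> U) x)"
    by (intro nn_integral_cong) (auto simp: indicator_def)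
   also have "\<dots> = \<mu> (QQ \<inter> U)" using Qs[OF QQ] by (intro nn_integral_indicator) auto
   finally show "\<mu> QQ \<le> ennreal (2 ^ (DIM('a) + 1)) * (NN x\<in>QQ. indicator U x)"
    using my unfolding S_def by (simp add: less_imp_le del: emeasure_completion)
  qed
  also have "\<dots> = ennreal (2 ^ (DIM('a) + 1)) * (\<integral>\<^sup>+Q. (NN x\<in>Q. indicator U x) \<partial>count_space \<Q>)"
   by (rule nn_integral_cmult) simp
  also have "\<dots> \<le> ennreal (2 ^ (DIM('a) + 1)) * (NN x. indicator U x)"
   using Q Qs by (intro mult_left_mono nn_integral_disjoint_le) (auto simp: disjoint_family_on_def disjoint_def)
  finally have "2 * \<mu> (\<Union>\<Q>) \<le> 2 * (ennreal (2 ^ (DIM('a) + 1)) * \<mu> U)"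
   by (simp add: mult_left_mono del: emeasure_completion)
  also have "\<dots> = ennreal (2 ^ (DIM('a) + 2)) * \<mu> U"
   by (simp add: ennreal_mult mult.assoc[symmetric] del: emeasure_completion)
  finally show "2 * \<mu> (\<Union>\<Q>) \<le> \<mu> (dcube n x0)" using small by simp
 next
  show "dcube n x0 \<inter> U \<subseteq> \<Union>\<Q>"
  proof
   fix x assume x: "x \<in> dcube n x0 \<inter> U"
   then obtain m where m: "n \<le> m" "dcube m x \<subseteq> U" using dcube_in_open[OF U, of x n] by blast
   have "dcube m x \<inter> U = dcube m x" using m by auto
   moreover have "\<mu> (dcube m x) < ennreal (2 ^ (DIM('a) + 1)) * \<mu> (dcube m x)"
    unfolding emeasure_dcube by (simp add: ennreal_mult[symmetric] ennreal_less_iff del: power_Suc)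
   ultimately have "S m x" using m x by (simp add: S_def del: emeasure_completion)
   then show "x \<in> \<Union>\<Q>" unfolding Q(3) by blast
  qed
 qed (use Q in auto)
qed

text \<open>Only a single generation is recorded. Repeating it on the children builds the usual
  sparse family, in which every cube keeps half of its measure for itself.\<close>

definition sparse_family where
 "sparse_family T f n x0 b \<Q> \<longleftrightarrow> countable \<Q> \<and> disjoint \<Q> \<and> 2 * \<mu> (\<Union>\<Q>) \<le> \<mu> (dcube n x0) \<and>
  (\<forall>Q\<in>\<Q>. \<exists>m y. n \<le> m \<and> Q = dcube m y \<and> Q \<subseteq> dcube n x0 \<and>
   (AE x in lebesgue. x \<in> Q \<longrightarrow> norm (T (cut (star n x0) f) x) \<le> b + norm (T (cut (star m y) f) x))) \<and>
  (AE x in lebesgue. x \<in> dcube n x0 - \<Union>\<Q> \<longrightarrow> norm (T (cut (star n x0) f) x) \<le> b)"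

text \<open>The children cover the points where \<open>T f1\<close> or the maximal function of
  \<open>f1\<close> exceeds a large multiple of the mean \<open>a\<close>. On a child,
  \<open>f1\<close> splits into the part in its star and a rest \<open>\<phi>\<close> that vanishes
  there. The values of \<open>T \<phi>\<close> oscillate little, because the child contains a point
  where all means are small, and \<open>T \<phi>\<close> is small at one further point, where
  \<open>T f1\<close> and the local part are both under control; so it is at most
  \<open>C * a\<close> almost everywhere on the child.\<close>

lemma sparse_step:
 fixes K :: "'a::euclidean_space \<Rightarrow> 'a \<Rightarrow> complex"
 assumes cz: "calderon_zygmund T K"
 shows "\<exists>C\<ge>0. \<forall>f\<in>bcs. \<forall>n x0 a. 0 \<le> a \<longrightarrow> (NR x\<in>star n x0. norm (f x)) = ennreal (a * dside n ^ DIM('a)) \<longrightarrow>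
  (\<exists>\<Q>. sparse_family T f n x0 (C * a) \<Q>)"
proof -
 have T: "bounded_operator 2 T" using cz by (simp add: calderon_zygmund_def)
 obtain W where W: "0 \<le> W" "\<And>f lam. f \<in> bcs \<Longrightarrow> 0 < lam \<Longrightarrow> \<mu> {x. lam < norm (T f x)}
  \<le> ennreal (W / lam) * (NR x. norm (f x))"
  using weak_type_1_1[OF cz] by blast
 obtain Co where Co0: "0 \<le> Co" and Co1: "oscillation_bound T Co"
  using cz_oscillation[OF cz] by (elim exE conjE) (rule that)
 note Co = Co0 Co1[unfolded oscillation_bound_def, THEN bspec, THEN spec, THEN spec, THEN spec, THEN spec, THEN mp, THEN mp, THEN mp, THEN mp]
 define v where "v = unit_ball_vol (DIM('a))"
 have v: "0 \<le> v" by (simp add: v_def)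
 define \<kappa> where "\<kappa> = v * (3 * real DIM('a)) ^ DIM('a)"
 have \<kappa>: "0 \<le> \<kappa>" using v by (simp add: \<kappa>_def)
 define B0 where "B0 = (2 * 5 ^ DIM('a) :: real)"
 have B0: "0 < B0" by (simp add: B0_def)
 \<comment> \<open>Large enough for the three contributions to \<open>U\<close>, namely the set for
   \<open>T\<close>, the set for the maximal function and the excess of the open cover, to add up to
   the fraction \<open>2^(-(d+2))\<close> of the cube.\<close>
 define L where "L = 2 ^ (DIM('a) + 2) * (W + B0 + 1)"
 have L: "0 < L" using W B0 by (simp add: L_def)
 \<comment> \<open>With this factor the weak type inequality confines large values of
   \<open>T f2\<close> to at most a quarter of a child.\<close>
 define L2 where "L2 = 4 * (W * \<kappa> + 1)"
 have L2: "0 < L2" using W \<kappa> by (simp add: L2_def add_nonneg_pos)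
 have Tm: "T h \<in> \<M>" if "h \<in> bcs" for h
  using bounded_operator_measurable[OF T bcs_Lp[OF that]] by simp
 show ?thesis
 proof (intro exI[of _ "L + L2 * L + Co * (L * v)"] conjI ballI allI impI)
  show "0 \<le> L + L2 * L + Co * (L * v)" using L L2 Co v by simp
  fix f :: "'a \<Rightarrow> complex" and n :: int and x0 :: 'a and a :: real
  assume f: "f \<in> bcs" and a0: "0 \<le> a" and a: "(NR x\<in>star n x0. norm (f x)) = ennreal (a * dside n ^ DIM('a))"
  have [measurable]: "f \<in> \<M>" using f by (rule bcs_measurable)
  define C where "C = L + L2 * L + Co * (L * v)"
  have C: "L \<le> C" "0 \<le> C" using L L2 Co v by (auto simp: C_def)
  define f1 where "f1 = cut (star n x0) f"
  have f1: "f1 \<in> bcs" unfolding f1_def by (rule bcs_cut[OF f]) measurable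
  have [measurable]: "f1 \<in> \<M>" using f1 by (rule bcs_measurable)
  define ld where "ld = dside n ^ DIM('a)"
  have ld: "0 < ld" "\<mu> (dcube n x0) = ennreal ld" by (auto simp: ld_def emeasure_dcube simp del: emeasure_completion)
  have I: "(NR x. norm (f1 x)) = ennreal (a * ld)"
   unfolding ld_def a[symmetric] f1_def by (intro nn_integral_cong) (auto simp: indicator_def)
  show "\<exists>\<Q>. sparse_family T f n x0 ((L + L2 * L + Co * (L * v)) * a) \<Q>"
  \<comment> \<open>The level \<open>lam = L * a\<close> has to be positive. If
    \<open>a = 0\<close>, then \<open>f1\<close> vanishes almost everywhere and there are no
    children.\<close>
  proof (cases "a = 0")
   case True
   then have "(NR x. norm (f1 x)) = 0" using I by simp
   then have "AE x in lebesgue. ennreal (norm (f1 x)) = 0" by (subst (asm) nn_integral_0_iff_AE) auto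
   then have "AE x in lebesgue. f1 x = 0" by simp
   then have "AE x in lebesgue. T f1 x = 0" using f1 by (intro bounded_operator_null[OF T]) (auto intro: bcs_Lp)
   then have "AE x in lebesgue. x \<in> dcube n x0 - \<Union>{} \<longrightarrow> norm (T f1 x) \<le> C * a"
    by eventually_elim (simp add: True)
   then show ?thesis unfolding sparse_family_def f1_def[symmetric] C_def[symmetric]
    by (intro exI[of _ "{}"]) simp
  next
   case False
   with a0 have apos: "0 < a" by simp
   define lam where "lam = L * a"
   have lam: "0 < lam" using L apos by (simp add: lam_def)
   define h where "h x = norm (f1 x)" for x
   have [measurable]: "h \<in> \<M>" unfolding h_def by measurable
   have [measurable]: "T f1 \<in> \<M>" by (rule Tm[OF f1])
   define E1 where "E1 = {x \<in> space lebesgue. lam < norm (T f1 x)}"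
   have E1s[measurable]: "E1 \<in> \<L>" unfolding E1_def by measurable
   have E1: "\<mu> E1 \<le> ennreal (W / L * ld)"
   proof -
    have "\<mu> E1 \<le> ennreal (W / lam) * ennreal (a * ld)"
     using W(2)[OF f1 lam] unfolding I E1_def by simp
    also have "\<dots> = ennreal (W / L * ld)"
     using W(1) lam a0 ld apos by (simp add: ennreal_mult[symmetric] lam_def)
    finally show ?thesis .
   qed
   define E2 where "E2 = exceptional_set ennreal h lam"
   have E2o: "open E2" unfolding E2_def by (rule open_exceptional_set)
   have E2: "\<mu> E2 \<le> ennreal (B0 / L * ld)"
   proof -
    have "\<mu> E2 \<le> ennreal (B0 / lam) * (NR x. h x)"
     unfolding E2_def B0_def using lam by (intro maximal_weak_type) (auto simp: h_def)
    also have "\<dots> = ennreal (B0 / lam) * ennreal (a * ld)" unfolding h_def I ..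
    also have "\<dots> = ennreal (B0 / L * ld)"
     using B0 lam a0 ld apos by (simp add: ennreal_mult[symmetric] lam_def)
    finally show ?thesis .
   qed
   have "0 < 1 / L * ld" using L ld by simp
   then obtain U0 where U0: "open U0" "E1 \<subseteq> U0" "U0 - E1 \<in> lmeasurable" "\<mu> (U0 - E1) < ennreal (1 / L * ld)"
    using sets_lebesgue_outer_open[OF E1s] by blast
   have [measurable]: "E2 \<in> \<L>" "U0 \<in> \<L>" using U0 E2o by auto
   define U where "U = U0 \<union> E2"
   have U: "open U" "E1 \<subseteq> U" "E2 \<subseteq> U" using U0 E2o by (auto simp: U_def)
   have "\<mu> U \<le> \<mu> ((E1 \<union> E2) \<union> (U0 - E1))"
    unfolding U_def by (intro emeasure_mono) auto
   also have "\<dots> \<le> \<mu> (E1 \<union> E2) + \<mu> (U0 - E1)"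
    by (rule emeasure_subadditive) measurable
   also have "\<dots> \<le> (\<mu> E1 + \<mu> E2) + \<mu> (U0 - E1)"
    by (intro add_right_mono emeasure_subadditive) measurable
   also have "\<dots> \<le> (ennreal (W / L * ld) + ennreal (B0 / L * ld)) + ennreal (1 / L * ld)"
    using E1 E2 U0(4) by (intro add_mono) (auto intro: less_imp_le)
   also have "\<dots> = ennreal ((W + B0 + 1) / L * ld)"
    using W(1) B0 L ld by (simp add: ennreal_plus[symmetric] add_divide_distrib distrib_right del: ennreal_plus)
   also have "(W + B0 + 1) / L * ld = ld / 2 ^ (DIM('a) + 2)"
   proof -
    have "s / (p * s) * ld = ld / p" if "s \<noteq> 0" for s p :: real using that by simp
    moreover have "W + B0 + 1 \<noteq> 0" using W(1) B0 by linarith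
    ultimately show ?thesis unfolding L_def by blast
   qed
   finally have "\<mu> U \<le> ennreal (ld / 2 ^ (DIM('a) + 2))" .
   then have "ennreal (2 ^ (DIM('a) + 2)) * \<mu> U \<le> ennreal (2 ^ (DIM('a) + 2)) * ennreal (ld / 2 ^ (DIM('a) + 2))"
    by (rule mult_left_mono) simp
   also have "\<dots> = \<mu> (dcube n x0)"
    unfolding ld(2) using ld(1) by (simp add: ennreal_mult[symmetric])
   finally have small: "ennreal (2 ^ (DIM('a) + 2)) * \<mu> U \<le> \<mu> (dcube n x0)" .
   obtain \<Q> where Q: "countable \<Q>" "disjoint \<Q>"
    "\<And>Q. Q \<in> \<Q> \<Longrightarrow> \<exists>m y. n \<le> m \<and> Q = dcube m y \<and> Q \<subseteq> dcube n x0 \<and> 2 * \<mu> (Q \<inter> U) \<le> \<mu> Q"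
    "2 * \<mu> (\<Union>\<Q>) \<le> \<mu> (dcube n x0)" "dcube n x0 \<inter> U \<subseteq> \<Union>\<Q>"
    by (rule local_density_stopping[OF U(1) small]) (rule that)
   have good: "AE x in lebesgue. x \<in> dcube n x0 - \<Union>\<Q> \<longrightarrow> norm (T f1 x) \<le> C * a"
   proof (rule AE_I2, rule impI)
    fix x assume "x \<in> dcube n x0 - \<Union>\<Q>"
    then have "x \<notin> E1" using Q(5) U(2) by blast
    then have "norm (T f1 x) \<le> lam" by (simp add: E1_def)
    also have "\<dots> \<le> C * a" unfolding lam_def using C a0 by (intro mult_right_mono) auto
    finally show "norm (T f1 x) \<le> C * a" .
   qed
   have bad: "\<exists>m y. n \<le> m \<and> Q = dcube m y \<and> Q \<subseteq> dcube n x0 \<and>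
    (AE x in lebesgue. x \<in> Q \<longrightarrow> norm (T f1 x) \<le> C * a + norm (T (cut (star m y) f) x))" if QQ: "Q \<in> \<Q>" for Q
   proof -
    obtain m y where my: "n \<le> m" "Q = dcube m y" "Q \<subseteq> dcube n x0" "2 * \<mu> (Q \<inter> U) \<le> \<mu> Q"
     using Q(3)[OF QQ] by blast
    define lm where "lm = dside m ^ DIM('a)"
    have lm: "0 < lm" "\<mu> Q = ennreal lm" unfolding my(2) by (auto simp: lm_def emeasure_dcube simp del: emeasure_completion)
    have Qs[measurable]: "Q \<in> \<L>" unfolding my(2) by measurable
    have Us[measurable]: "U \<in> \<L>" using U(1) by simp
    have QU: "\<mu> (Q \<inter> U) \<le> ennreal (lm / 2)"
    proof -
     have "2 * \<mu> (Q \<inter> U) \<le> 2 * ennreal (lm / 2)"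
      using my(4) lm by (simp add: ennreal_mult[symmetric] flip: ennreal_numeral del: emeasure_completion)
     then show ?thesis by (subst (asm) ennreal_mult_le_mult_iff) auto
    qed
    obtain \<xi> where xi: "\<xi> \<in> Q" "\<xi> \<notin> U"
    proof (rule ccontr)
     assume "\<not> thesis"
     then have "Q \<inter> U = Q" using that by blast
     then have "ennreal lm \<le> ennreal (lm / 2)" using QU lm(2) by simp
     then show False using lm(1) by (subst (asm) ennreal_le_iff) auto
    qed
    \<comment> \<open>As \<open>\<xi>\<close> avoids \<open>U\<close>, no ball centred at it has a
      mean of \<open>h\<close> above \<open>lam\<close>. This gives both the size of
      \<open>f2\<close> and the bound for the oscillation.\<close>
    have avg: "(NR z\<in>ball \<xi> R. h z) \<le> ennreal ((lam * v) * R ^ DIM('a))" if R: "0 < R" for R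
    proof -
     have "\<xi> \<in> ball \<xi> R" using R by simp
     then have "\<not> \<mu> (ball \<xi> R) < (NR z\<in>ball \<xi> R. h z / lam)"
      using xi(2) U(3) R unfolding E2_def exceptional_set_def by blast
     then have le: "(NR z\<in>ball \<xi> R. h z / lam) \<le> ennreal (v * R ^ DIM('a))"
      using emeasure_lebesgue_ball[of R \<xi>] R by (simp add: not_less v_def del: emeasure_completion)
     have "(NR z\<in>ball \<xi> R. h z) = (NN z. ennreal lam * (ennreal (h z / lam) * indicator (ball \<xi> R) z))"
      using lam by (intro nn_integral_cong) (auto simp: indicator_def ennreal_mult[symmetric] h_def)
     also have "\<dots> = ennreal lam * (NR z\<in>ball \<xi> R. h z / lam)"
      by (rule nn_integral_cmult) measurable
     also have "\<dots> \<le> ennreal lam * ennreal (v * R ^ DIM('a))" by (intro mult_left_mono le) simp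
     also have "\<dots> = ennreal ((lam * v) * R ^ DIM('a))"
      using lam v R by (simp add: ennreal_mult[symmetric] mult.assoc)
     finally show ?thesis .
    qed
    define f2 where "f2 = cut (star m y) f"
    have f2: "f2 \<in> bcs" unfolding f2_def by (rule bcs_cut[OF f]) measurable
    have [measurable]: "T f2 \<in> \<M>" by (rule Tm[OF f2])
    have ss: "star m y \<subseteq> star n x0" using star_mono[OF my(1)] my(2,3) by simp
    have xid: "\<xi> \<in> dcube m y" using xi(1) my(2) by simp
    have f2i: "(NR x. norm (f2 x)) \<le> ennreal (lam * \<kappa> * lm)"
    proof -
     have "(NR x. norm (f2 x)) \<le> (NR z\<in>ball \<xi> (3 * (real DIM('a) * dside m)). h z)"
      using star_subset_ball[OF xid] ss by (intro nn_integral_mono) (auto simp: f2_def h_def f1_def indicator_def subset_iff)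
     also have "\<dots> \<le> ennreal ((lam * v) * (3 * (real DIM('a) * dside m)) ^ DIM('a))"
      by (rule avg) simp
     also have "(lam * v) * (3 * (real DIM('a) * dside m)) ^ DIM('a) = lam * \<kappa> * lm"
      by (simp add: \<kappa>_def lm_def power_mult_distrib)
     finally show ?thesis .
    qed
    define E3 where "E3 = {x \<in> space lebesgue. L2 * lam < norm (T f2 x)}"
    have E3s[measurable]: "E3 \<in> \<L>" unfolding E3_def by measurable
    have E3: "\<mu> E3 \<le> ennreal (lm / 4)"
    proof -
     have "\<mu> E3 \<le> ennreal (W / (L2 * lam)) * (NR x. norm (f2 x))"
      using W(2)[OF f2, of "L2 * lam"] L2 lam unfolding E3_def by simp
     also have "\<dots> \<le> ennreal (W / (L2 * lam)) * ennreal (lam * \<kappa> * lm)"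
      by (intro mult_left_mono f2i) simp
     also have "\<dots> = ennreal (W / (L2 * lam) * (lam * \<kappa> * lm))"
      using W(1) L2 lam \<kappa> lm by (simp add: ennreal_mult[symmetric])
     also have "W / (L2 * lam) * (lam * \<kappa> * lm) = (W * \<kappa> / L2) * lm" using lam by simp
     also have "ennreal \<dots> \<le> ennreal ((1 / 4) * lm)"
     proof (intro ennreal_leI mult_right_mono)
      show "W * \<kappa> / L2 \<le> 1 / 4" using L2 by (simp add: L2_def divide_le_eq)
     qed (use lm in simp)
     finally show ?thesis by simp
    qed
    define \<phi> where "\<phi> = (\<lambda>x. f1 x - f2 x)"
    have phi: "\<phi> \<in> bcs" unfolding \<phi>_def by (rule bcs_diff[OF f1 f2])
    have phin: "norm (\<phi> z) \<le> h z" for z using ss by (auto simp: \<phi>_def f1_def f2_def h_def)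
    have "\<exists>G. (AE x in lebesgue. x \<in> dcube m y \<longrightarrow> x \<in> G) \<and>
      (\<forall>x\<in>G. \<forall>x'\<in>G. x \<in> dcube m y \<longrightarrow> x' \<in> dcube m y \<longrightarrow> norm (T \<phi> x - T \<phi> x') \<le> Co * (lam * v))"
    proof (rule Co(2)[OF phi _ _ xid])
     show "0 \<le> lam * v" using lam v by simp
     show "\<forall>z\<in>star m y. \<phi> z = 0" using ss by (auto simp: \<phi>_def f1_def f2_def)
     show "\<forall>R>0. (NR z\<in>ball \<xi> R. norm (\<phi> z)) \<le> ennreal (lam * v * R ^ DIM('a))"
     proof (intro allI impI)
      fix R :: real assume R: "0 < R"
      have "(NR z\<in>ball \<xi> R. norm (\<phi> z)) \<le> (NR z\<in>ball \<xi> R. h z)"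
       using phin by (intro nn_integral_mono mult_right_mono ennreal_leI) auto
      then show "(NR z\<in>ball \<xi> R. norm (\<phi> z)) \<le> ennreal (lam * v * R ^ DIM('a))"
       using avg[OF R] by simp
     qed
    qed
    then obtain G where G: "AE x in lebesgue. x \<in> dcube m y \<longrightarrow> x \<in> G"
     "\<And>x x'. x \<in> G \<Longrightarrow> x' \<in> G \<Longrightarrow> x \<in> dcube m y \<Longrightarrow> x' \<in> dcube m y \<Longrightarrow> norm (T \<phi> x - T \<phi> x') \<le> Co * (lam * v)"
     by blast
    have Tphi: "AE x in lebesgue. T \<phi> x = T f1 x - T f2 x"
     unfolding \<phi>_def by (rule bounded_operator_diff[OF T _ f1 f2]) simp
    \<comment> \<open>\<open>U\<close> occupies at most half of the child and \<open>E3\<close> at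
      most a quarter, so a point outside both and outside the null sets is left.\<close>
    have "\<exists>x1. x1 \<in> Q \<and> x1 \<in> G \<and> T \<phi> x1 = T f1 x1 - T f2 x1 \<and> x1 \<notin> U \<and> x1 \<notin> E3"
    proof (rule ccontr)
     assume no: "\<not> ?thesis"
     have "\<mu> Q \<le> \<mu> ((Q \<inter> U) \<union> E3)"
     proof (rule emeasure_mono_AE)
      show "AE x in lebesgue. x \<in> Q \<longrightarrow> x \<in> (Q \<inter> U) \<union> E3"
       using G(1) Tphi by eventually_elim (use no my(2) in blast)
     qed measurable
     also have "\<dots> \<le> \<mu> (Q \<inter> U) + \<mu> E3"
      by (rule emeasure_subadditive) measurable
     also have "\<dots> \<le> ennreal (lm / 2) + ennreal (lm / 4)" by (intro add_mono QU E3)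
     also have "\<dots> = ennreal (3 / 4 * lm)" using lm(1) by (simp add: ennreal_plus[symmetric] del: ennreal_plus)
     finally have "lm \<le> 3 / 4 * lm" unfolding lm(2) by (subst (asm) ennreal_le_iff) (use lm(1) in auto)
     then show False using lm(1) by simp
    qed
    then obtain x1 where x1: "x1 \<in> Q" "x1 \<in> G" "T \<phi> x1 = T f1 x1 - T f2 x1" "x1 \<notin> U" "x1 \<notin> E3" by blast
    have "x1 \<notin> E1" using x1(4) U(2) by blast
    then have "norm (T f1 x1) \<le> lam" by (simp add: E1_def)
    moreover have "norm (T f2 x1) \<le> L2 * lam" using x1(5) by (auto simp: E3_def)
    ultimately have Tx1: "norm (T \<phi> x1) \<le> lam + L2 * lam"
     unfolding x1(3) using norm_triangle_ineq4[of "T f1 x1" "T f2 x1"] by linarith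
    have "AE x in lebesgue. x \<in> Q \<longrightarrow> norm (T f1 x) \<le> C * a + norm (T f2 x)"
     using G(1) Tphi
    proof eventually_elim
     case (elim x)
     show ?case
     proof
      assume x: "x \<in> Q"
      have "norm (T \<phi> x - T \<phi> x1) \<le> Co * (lam * v)"
       using elim(1) x x1 my(2) by (intro G(2)) auto
      then have "norm (T \<phi> x) \<le> lam + L2 * lam + Co * (lam * v)"
       using Tx1 norm_triangle_sub[of "T \<phi> x" "T \<phi> x1"] by linarith
      also have "\<dots> = C * a" by (simp add: C_def lam_def algebra_simps)
      finally have "norm (T f1 x - T f2 x) \<le> C * a" using elim(2) by simp
      then show "norm (T f1 x) \<le> C * a + norm (T f2 x)"
       using norm_triangle_sub[of "T f1 x" "T f2 x"] by linarith
     qed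
    qed
    then show ?thesis using my unfolding f2_def by blast
   qed
   show ?thesis unfolding sparse_family_def f1_def[symmetric] C_def[symmetric]
    using Q(1,2,4) bad good by (intro exI[of _ \<Q>]) blast
  qed
 qed
qed

text \<open>The function \<open>G\<close> stands for a product of two maximal functions. With such a
  majorant the sparse family itself never enters the later estimates.\<close>

definition cube_bound :: "int \<Rightarrow> 'a::euclidean_space \<Rightarrow> ('a \<Rightarrow> complex) \<Rightarrow> ('a \<Rightarrow> real) \<Rightarrow> ('a \<Rightarrow> ennreal) \<Rightarrow> bool" where
 "cube_bound n x0 f g G \<longleftrightarrow> (\<forall>m x. n \<le> m \<longrightarrow> x \<in> dcube n x0 \<longrightarrow> (NR z\<in>star m x. norm (f z)) * (NR z\<in>dcube m x. g z)
    \<le> ennreal (dside m ^ DIM('a)) * ennreal (dside m ^ DIM('a)) * G x)"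

definition sparse_bound where
 "sparse_bound T C \<longleftrightarrow> (\<forall>f\<in>bcs. \<forall>g n x0 G M. g \<in> \<M> \<longrightarrow> (\<forall>x. 0 \<le> g x \<and> g x \<le> M) \<longrightarrow> G \<in> \<M> \<longrightarrow>
  cube_bound n x0 f g G \<longrightarrow>
  (NR x\<in>dcube n x0. norm (T (cut (star n x0) f) x) * g x) \<le> ennreal C * (NN x\<in>dcube n x0. G x))"

text \<open>Induction over generations. The part \<open>D\<close> of a cube outside its children has
  at least half of the measure, so the product of the two means, times the measure of the cube, is
  at most twice the integral of \<open>G\<close> over \<open>D\<close>. The sets \<open>D\<close> of
  different cubes are disjoint, and the cubes left after \<open>k\<close> generations have total
  measure at most \<open>2^(-k)\<close> times the initial one, for which a crude bound
  suffices.\<close>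

lemma sparse_domination:
 fixes K :: "'a::euclidean_space \<Rightarrow> 'a \<Rightarrow> complex"
 assumes cz: "calderon_zygmund T K"
 shows "\<exists>C\<ge>0. sparse_bound T C"
proof -
 have T: "bounded_operator 2 T" using cz by (simp add: calderon_zygmund_def)
 obtain A where A: "0 \<le> A" "\<And>f. f \<in> Lp 2 UNIV \<Longrightarrow> (NR x. norm (T f x) powr 2) \<le> ennreal A * (NR x. norm (f x) powr 2)"
  using bounded_operator_nn[OF T] by auto
 have Tm: "T h \<in> \<M>" if "h \<in> bcs" for h
  using bounded_operator_measurable[OF T bcs_Lp[OF that]] by simp
 obtain C where C0: "0 \<le> C" and C1: "\<forall>f\<in>bcs. \<forall>n x0 a. 0 \<le> a \<longrightarrow>
  (NR x\<in>star n x0. norm (f x)) = ennreal (a * dside n ^ DIM('a)) \<longrightarrow> (\<exists>\<Q>. sparse_family T f n x0 (C * a) \<Q>)"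
  using sparse_step[OF cz] by (elim exE conjE) (rule that)
 show ?thesis unfolding sparse_bound_def cube_bound_def
 proof (intro exI[of _ "2 * C"] conjI ballI allI impI)
  show "0 \<le> 2 * C" using C0 by simp
  fix f :: "'a \<Rightarrow> complex" and g :: "'a \<Rightarrow> real" and n :: int and x0 :: 'a and G :: "'a \<Rightarrow> ennreal" and M :: real
  assume f: "f \<in> bcs" and gm[measurable]: "g \<in> \<M>" and g: "\<forall>x. 0 \<le> g x \<and> g x \<le> M"
   and Gm[measurable]: "G \<in> \<M>"
   and H: "\<forall>m x. n \<le> m \<longrightarrow> x \<in> dcube n x0 \<longrightarrow> (NR z\<in>star m x. norm (f z)) * (NR z\<in>dcube m x. g z)
    \<le> ennreal (dside m ^ DIM('a)) * ennreal (dside m ^ DIM('a)) * G x"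
  have [measurable]: "f \<in> \<M>" using f by (rule bcs_measurable)
  obtain Mf where Mf: "0 \<le> Mf" "\<And>x. norm (f x) \<le> Mf" using bcs_bounds[OF f] by metis
  define \<kappa> where "\<kappa> = unit_ball_vol (DIM('a)) * (3 * real DIM('a)) ^ DIM('a)"
  have \<kappa>: "0 \<le> \<kappa>" by (simp add: \<kappa>_def)
  \<comment> \<open>A crude constant from the \<open>L^2\<close> bound that depends on the bounds of
    \<open>f\<close> and \<open>g\<close>; it only multiplies the measure left after
    \<open>k\<close> generations and disappears in the limit.\<close>
  define c0 where "c0 = A * Mf\<^sup>2 * \<kappa> + M\<^sup>2"
  have c0: "0 \<le> c0" using A \<kappa> by (simp add: c0_def)
  define \<Psi> where "\<Psi> m x = (NR z\<in>dcube m x. norm (T (cut (star m x) f) z) * g z)" for m x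
  have cutb: "cut (star m x) f \<in> bcs" for m x by (rule bcs_cut[OF f]) measurable
  have Tcm[measurable]: "T (cut (star m x) f) \<in> \<M>" for m x by (rule Tm[OF cutb])
  have base: "\<Psi> m x \<le> ennreal c0 * \<mu> (dcube m x)" for m x
  proof -
   have "\<Psi> m x \<le> (NN z. ennreal (norm (T (cut (star m x) f) z) powr 2) + ennreal (M\<^sup>2) * indicator (dcube m x) z)"
    unfolding \<Psi>_def
   proof (rule nn_integral_mono)
    fix z
    have "g z ^ 2 \<le> M\<^sup>2" using g by (intro power_mono) auto
    moreover have "2 * (norm (T (cut (star m x) f) z) * g z) \<le> norm (T (cut (star m x) f) z) ^ 2 + g z ^ 2"
     using sum_squares_bound[of "norm (T (cut (star m x) f) z)" "g z"] by (simp add: mult.assoc)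
    moreover have "0 \<le> norm (T (cut (star m x) f) z) * g z" using g by simp
    ultimately have "norm (T (cut (star m x) f) z) * g z \<le> norm (T (cut (star m x) f) z) powr 2 + M\<^sup>2"
     by simp
    then show "ennreal (norm (T (cut (star m x) f) z) * g z) * indicator (dcube m x) z \<le> ennreal (norm (T (cut (star m x) f) z) powr 2) + ennreal (M\<^sup>2) * indicator (dcube m x) z"
     by (auto simp: indicator_def ennreal_plus[symmetric] simp del: ennreal_plus intro!: ennreal_leI)
   qed
   also have "\<dots> = (NR z. norm (T (cut (star m x) f) z) powr 2) + ennreal (M\<^sup>2) * \<mu> (dcube m x)"
    by (subst nn_integral_add) (auto simp: nn_integral_cmult_indicator simp del: emeasure_completion)
   also have "(NR z. norm (T (cut (star m x) f) z) powr 2) \<le> ennreal (A * Mf\<^sup>2 * \<kappa>) * \<mu> (dcube m x)"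
   proof -
    have "(NR z. norm (T (cut (star m x) f) z) powr 2) \<le> ennreal A * (NR z. norm (cut (star m x) f z) powr 2)"
     by (intro A(2) bcs_Lp cutb) simp
    also have "\<dots> \<le> ennreal A * (NN z. ennreal (Mf\<^sup>2) * indicator (ball x (3 * real DIM('a) * dside m)) z)"
    proof (intro mult_left_mono nn_integral_mono)
     fix z
     have "z \<in> ball x (3 * real DIM('a) * dside m)" if "z \<in> star m x"
      using star_subset_ball[of x m x] that by (auto simp: mult.assoc)
     then show "ennreal (norm (cut (star m x) f z) powr 2) \<le> ennreal (Mf\<^sup>2) * indicator (ball x (3 * real DIM('a) * dside m)) z"
      using Mf(2)[of z] by (auto simp: indicator_def intro!: ennreal_leI power_mono)
    qed simp
    also have "\<dots> = ennreal A * (ennreal (Mf\<^sup>2) * (ennreal \<kappa> * \<mu> (dcube m x)))"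
     unfolding \<kappa>_def emeasure_star_le[symmetric]
     by (subst nn_integral_cmult_indicator) auto
    also have "\<dots> = ennreal (A * Mf\<^sup>2 * \<kappa>) * \<mu> (dcube m x)"
     by (simp only: ennreal_mult'[OF A(1)] ennreal_mult'[OF \<kappa>] mult.assoc ennreal_mult''[OF \<kappa>] ennreal_mult'[of "Mf\<^sup>2", OF zero_le_power2])
    finally show ?thesis .
   qed
   finally have "\<Psi> m x \<le> ennreal (A * Mf\<^sup>2 * \<kappa>) * \<mu> (dcube m x) + ennreal (M\<^sup>2) * \<mu> (dcube m x)"
    by (simp add: add_right_mono)
   also have "\<dots> = ennreal c0 * \<mu> (dcube m x)"
    unfolding c0_def using A(1) \<kappa> by (subst ennreal_plus) (auto simp: distrib_right)
   finally show ?thesis .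
  qed
  have claim: "\<Psi> m x \<le> ennreal (2 * C) * (NN z\<in>dcube m x. G z) + ennreal (c0 / 2 ^ k) * \<mu> (dcube m x)"
   if "n \<le> m" "x \<in> dcube n x0" for k m x
   using that
  proof (induction k arbitrary: m x)
   case 0
   then show ?case using base[of m x] by (simp add: add_increasing)
  next
   case (Suc k)
   define ld where "ld = dside m ^ DIM('a)"
   have ld: "0 < ld" "\<mu> (dcube m x) = ennreal ld" by (auto simp: ld_def emeasure_dcube simp del: emeasure_completion)
   define J where "J = (NR z\<in>star m x. norm (f z))"
   have "J \<le> (NR z. norm (f z))" unfolding J_def by (intro nn_integral_mono) (auto simp: indicator_def)
   then have "J < \<infinity>" using bcs_nn_integral_finite[OF f] by simp
   then obtain j where j: "0 \<le> j" "J = ennreal j" by (cases J) auto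
   define a where "a = j / ld"
   have a: "0 \<le> a" "J = ennreal (a * ld)" using j ld by (auto simp: a_def)
   have "\<exists>\<Q>. sparse_family T f m x (C * a) \<Q>"
    by (rule C1[THEN bspec, THEN spec, THEN spec, THEN spec, THEN mp, THEN mp, OF f a(1)]) (use a(2) in \<open>simp add: J_def ld_def\<close>)
   then obtain \<Q> where Q: "countable \<Q>" "disjoint \<Q>" "2 * \<mu> (\<Union>\<Q>) \<le> \<mu> (dcube m x)"
    and Qb: "\<forall>Q\<in>\<Q>. \<exists>m' y. m \<le> m' \<and> Q = dcube m' y \<and> Q \<subseteq> dcube m x \<and>
     (AE z in lebesgue. z \<in> Q \<longrightarrow> norm (T (cut (star m x) f) z) \<le> C * a + norm (T (cut (star m' y) f) z))"
    and Qg: "AE z in lebesgue. z \<in> dcube m x - \<Union>\<Q> \<longrightarrow> norm (T (cut (star m x) f) z) \<le> C * a"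
    unfolding sparse_family_def by (elim exE conjE) (rule that)
   have Qs: "Q \<in> \<L>" if "Q \<in> \<Q>" for Q using Qb that by force
   have Us[measurable]: "\<Union>\<Q> \<in> \<L>" using Q(1) Qs by (intro sets.countable_Union) auto
   have Usub: "\<Union>\<Q> \<subseteq> dcube m x" using Qb by blast
   define D where "D = dcube m x - \<Union>\<Q>"
   have Ds[measurable]: "D \<in> \<L>" unfolding D_def by measurable
   have dQ: "dcube m x = D \<union> \<Union>\<Q>" "D \<inter> \<Union>\<Q> = {}" using Usub by (auto simp: D_def)
   have split: "(NN z\<in>dcube m x. u z) = (NN z\<in>D. u z) + (\<integral>\<^sup>+Q. (NN z\<in>Q. u z) \<partial>count_space \<Q>)"
    if [measurable]: "u \<in> \<M>" for u :: "'a \<Rightarrow> ennreal"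
   proof -
    have "(NN z\<in>dcube m x. u z) = (NN z. u z * indicator D z + u z * indicator (\<Union>\<Q>) z)"
     using dQ by (intro nn_integral_cong) (auto simp: indicator_def)
    also have "\<dots> = (NN z\<in>D. u z) + (NN z\<in>\<Union>\<Q>. u z)"
     by (rule nn_integral_add) measurable
    finally show ?thesis using nn_integral_countable_Union[OF Q(1,2) Qs that] by simp
   qed
   have Dm: "ennreal ld \<le> 2 * \<mu> D"
   proof -
    have "\<mu> (dcube m x) = \<mu> D + \<mu> (\<Union>\<Q>)"
     unfolding dQ(1) using dQ(2) by (intro plus_emeasure[symmetric]) auto
    moreover obtain d where d: "0 \<le> d" "\<mu> D = ennreal d"
    proof -
     have "\<mu> D \<le> ennreal ld" unfolding ld(2)[symmetric] D_def by (intro emeasure_mono) auto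
     then show thesis using that by (cases "\<mu> D") (auto simp: top_unique)
    qed
    moreover obtain b where b: "0 \<le> b" "\<mu> (\<Union>\<Q>) = ennreal b"
    proof -
     have "\<mu> (\<Union>\<Q>) \<le> ennreal ld" unfolding ld(2)[symmetric] using Usub by (intro emeasure_mono) auto
     then show thesis using that by (cases "\<mu> (\<Union>\<Q>)") (auto simp: top_unique)
    qed
    ultimately have e: "ennreal ld = ennreal (d + b)" "ennreal (2 * b) \<le> ennreal ld"
     using Q(3) ld by (auto simp: ennreal_mult simp del: emeasure_completion)
    have "ld = d + b" using e(1) ld(1) d(1) b(1) by (subst (asm) ennreal_inj) auto
    moreover have "2 * b \<le> ld" using e(2) ld(1) by (subst (asm) ennreal_le_iff) auto
    ultimately have "ennreal ld \<le> ennreal (2 * d)" by (intro ennreal_leI) linarith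
    then show ?thesis using d by (simp add: ennreal_mult)
   qed
   define gq where "gq = (NR z\<in>dcube m x. g z)"
   have ag: "ennreal a * gq \<le> 2 * (NN z\<in>D. G z)"
   proof -
    have Gz: "ennreal a * gq \<le> ennreal ld * G z" if z: "z \<in> dcube m x" for z
    proof -
     have "z \<in> dcube n x0" using z dcube_mono[OF Suc.prems(1), of x] dcube_eq[OF Suc.prems(2)] by auto
     then have "(NR z\<in>star m z. norm (f z)) * (NR z\<in>dcube m z. g z)
      \<le> ennreal (dside m ^ DIM('a)) * ennreal (dside m ^ DIM('a)) * G z"
      using H Suc.prems(1) by blast
     then have "J * gq \<le> ennreal ld * ennreal ld * G z"
      unfolding star_eq[OF z] dcube_eq[OF z] J_def gq_def ld_def .
     then have "ennreal ld * (ennreal a * gq) \<le> ennreal ld * (ennreal ld * G z)"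
      unfolding a(2) using a(1) ld(1) by (simp add: ennreal_mult mult_ac)
     then show ?thesis using ld(1) by (subst (asm) ennreal_mult_le_mult_iff) auto
    qed
    have "ennreal ld * (ennreal a * gq) \<le> 2 * \<mu> D * (ennreal a * gq)" by (intro mult_right_mono Dm) simp
    also have "\<dots> = 2 * (NN z. (ennreal a * gq) * indicator D z)"
     by (subst nn_integral_cmult_indicator) (auto simp: mult_ac simp del: emeasure_completion)
    also have "\<dots> \<le> 2 * (NN z. ennreal ld * (G z * indicator D z))"
     using Gz by (intro mult_left_mono nn_integral_mono) (auto simp: indicator_def D_def)
    also have "\<dots> = 2 * (ennreal ld * (NN z\<in>D. G z))"
     by (subst nn_integral_cmult) auto
    finally have "ennreal ld * (ennreal a * gq) \<le> ennreal ld * (2 * (NN z\<in>D. G z))"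
     by (simp add: mult_ac)
    then show ?thesis using ld(1) by (subst (asm) ennreal_mult_le_mult_iff) auto
   qed
   have pD: "(NR z\<in>D. norm (T (cut (star m x) f) z) * g z) \<le> (NN z\<in>D. ennreal (C * a) * ennreal (g z))"
   proof (rule nn_integral_mono_AE)
    show "AE z in lebesgue. ennreal (norm (T (cut (star m x) f) z) * g z) * indicator D z \<le> ennreal (C * a) * ennreal (g z) * indicator D z"
     using Qg
    proof eventually_elim
     case (elim z)
     show ?case
     proof (cases "z \<in> D")
      case True
      then have "norm (T (cut (star m x) f) z) * g z \<le> (C * a) * g z" using elim g by (intro mult_right_mono) (auto simp: D_def)
      then have "ennreal (norm (T (cut (star m x) f) z) * g z) \<le> ennreal ((C * a) * g z)" by (rule ennreal_leI)
      also have "\<dots> = ennreal (C * a) * ennreal (g z)" using C0 a(1) g by (simp add: ennreal_mult)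
      finally show ?thesis using True by simp
     qed simp
    qed
   qed
   have pQ: "(NR z\<in>Q. norm (T (cut (star m x) f) z) * g z) \<le> (NN z\<in>Q. ennreal (C * a) * ennreal (g z))
     + (ennreal (2 * C) * (NN z\<in>Q. G z) + ennreal (c0 / 2 ^ k) * \<mu> Q)" if QQ: "Q \<in> \<Q>" for Q
   proof -
    obtain m' y where my: "m \<le> m'" "Q = dcube m' y" "Q \<subseteq> dcube m x"
     and ae: "AE z in lebesgue. z \<in> Q \<longrightarrow> norm (T (cut (star m x) f) z) \<le> C * a + norm (T (cut (star m' y) f) z)"
     using Qb[THEN bspec, OF QQ] by (elim exE conjE) (rule that)
    have [measurable]: "Q \<in> \<L>" by (rule Qs[OF QQ])
    have "(NR z\<in>Q. norm (T (cut (star m x) f) z) * g z) \<le>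
      (NN z. ennreal (C * a) * ennreal (g z) * indicator Q z + ennreal (norm (T (cut (star m' y) f) z) * g z) * indicator Q z)"
    proof (rule nn_integral_mono_AE)
     show "AE z in lebesgue. ennreal (norm (T (cut (star m x) f) z) * g z) * indicator Q z \<le> ennreal (C * a) * ennreal (g z) * indicator Q z + ennreal (norm (T (cut (star m' y) f) z) * g z) * indicator Q z"
      using ae
     proof eventually_elim
      case (elim z)
      show ?case
      proof (cases "z \<in> Q")
       case True
       then have "norm (T (cut (star m x) f) z) * g z \<le> (C * a + norm (T (cut (star m' y) f) z)) * g z" using elim g by (intro mult_right_mono) auto
       then have "ennreal (norm (T (cut (star m x) f) z) * g z) \<le> ennreal ((C * a) * g z + norm (T (cut (star m' y) f) z) * g z)" by (intro ennreal_leI) (simp add: distrib_right)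
       also have "\<dots> = ennreal (C * a) * ennreal (g z) + ennreal (norm (T (cut (star m' y) f) z) * g z)"
        using C0 a(1) g by (subst ennreal_plus) (auto simp: ennreal_mult)
       finally show ?thesis using True by simp
      qed simp
     qed
    qed
    also have "\<dots> = (NN z\<in>Q. ennreal (C * a) * ennreal (g z)) + \<Psi> m' y"
     unfolding \<Psi>_def my(2)[symmetric] by (rule nn_integral_add) measurable
    also have "\<Psi> m' y \<le> ennreal (2 * C) * (NN z\<in>Q. G z) + ennreal (c0 / 2 ^ k) * \<mu> Q"
     unfolding my(2)
    proof (rule Suc.IH)
     show "n \<le> m'" using my(1) Suc.prems(1) by simp
     have "y \<in> dcube m x" using my(2,3) by auto
     then show "y \<in> dcube n x0" using dcube_mono[OF Suc.prems(1), of x] dcube_eq[OF Suc.prems(2)] by auto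
    qed
    finally show ?thesis by (simp add: add_left_mono)
   qed
   have "\<Psi> m x = (NR z\<in>D. norm (T (cut (star m x) f) z) * g z) + (\<integral>\<^sup>+Q. (NR z\<in>Q. norm (T (cut (star m x) f) z) * g z) \<partial>count_space \<Q>)"
    unfolding \<Psi>_def by (rule split) measurable
   also have "\<dots> \<le> (NN z\<in>D. ennreal (C * a) * ennreal (g z)) + (\<integral>\<^sup>+Q. (NN z\<in>Q. ennreal (C * a) * ennreal (g z))
     + (ennreal (2 * C) * (NN z\<in>Q. G z) + ennreal (c0 / 2 ^ k) * \<mu> Q) \<partial>count_space \<Q>)"
    using pQ by (intro add_mono pD nn_integral_mono) auto
   also have "\<dots> = ((NN z\<in>D. ennreal (C * a) * ennreal (g z)) + (\<integral>\<^sup>+Q. (NN z\<in>Q. ennreal (C * a) * ennreal (g z)) \<partial>count_space \<Q>))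
     + (ennreal (2 * C) * (\<integral>\<^sup>+Q. (NN z\<in>Q. G z) \<partial>count_space \<Q>) + ennreal (c0 / 2 ^ k) * (\<integral>\<^sup>+Q. \<mu> Q \<partial>count_space \<Q>))"
    by (simp add: nn_integral_add nn_integral_cmult add.assoc del: emeasure_completion)
   also have "(NN z\<in>D. ennreal (C * a) * ennreal (g z)) + (\<integral>\<^sup>+Q. (NN z\<in>Q. ennreal (C * a) * ennreal (g z)) \<partial>count_space \<Q>) = (NN z\<in>dcube m x. ennreal (C * a) * ennreal (g z))"
    by (rule split[symmetric]) measurable
   also have "\<dots> = ennreal C * (ennreal a * gq)"
    unfolding gq_def using C0 a(1) by (simp add: nn_integral_cmult ennreal_mult mult.assoc)
   also have "(\<integral>\<^sup>+Q. \<mu> Q \<partial>count_space \<Q>) = \<mu> (\<Union>Q\<in>\<Q>. Q)"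
    using Q Qs by (intro emeasure_UN_countable[symmetric]) (auto simp: disjoint_family_on_def disjoint_def)
   finally have "\<Psi> m x \<le> ennreal C * (ennreal a * gq) + (ennreal (2 * C) * (\<integral>\<^sup>+Q. (NN z\<in>Q. G z) \<partial>count_space \<Q>) + ennreal (c0 / 2 ^ k) * \<mu> (\<Union>\<Q>))"
    by simp
   also have "\<dots> \<le> ennreal C * (2 * (NN z\<in>D. G z)) + (ennreal (2 * C) * (\<integral>\<^sup>+Q. (NN z\<in>Q. G z) \<partial>count_space \<Q>) + ennreal (c0 / 2 ^ Suc k) * \<mu> (dcube m x))"
   proof (intro add_mono mult_left_mono ag order_refl)
    have "ennreal (c0 / 2 ^ k) * \<mu> (\<Union>\<Q>) = ennreal (c0 / 2 ^ Suc k) * (2 * \<mu> (\<Union>\<Q>))"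
    proof -
     have "ennreal (c0 / 2 ^ k) = ennreal (c0 / 2 ^ Suc k * 2)" by simp
     also have "\<dots> = ennreal (c0 / 2 ^ Suc k) * 2" using c0 by (subst ennreal_mult) auto
     finally show ?thesis by (simp only: mult.assoc)
    qed
    also have "\<dots> \<le> ennreal (c0 / 2 ^ Suc k) * \<mu> (dcube m x)" by (intro mult_left_mono Q(3)) simp
    finally show "ennreal (c0 / 2 ^ k) * \<mu> (\<Union>\<Q>) \<le> ennreal (c0 / 2 ^ Suc k) * \<mu> (dcube m x)" .
   qed simp_all
   also have "\<dots> = ennreal (2 * C) * ((NN z\<in>D. G z) + (\<integral>\<^sup>+Q. (NN z\<in>Q. G z) \<partial>count_space \<Q>)) + ennreal (c0 / 2 ^ Suc k) * \<mu> (dcube m x)"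
   proof -
    have "ennreal (2 * C) = ennreal C * 2" using C0 by (simp add: ennreal_mult mult.commute)
    then show ?thesis by (simp only: distrib_left mult.assoc add.assoc)
   qed
   finally show ?case unfolding split[OF Gm] .
  qed
  have "\<Psi> n x0 \<le> ennreal (2 * C) * (NN z\<in>dcube n x0. G z)"
  proof (rule ennreal_le_epsilon)
   fix e :: real assume e: "0 < e"
   obtain k where k: "c0 * dside n ^ DIM('a) / e < 2 ^ k" using real_arch_pow[of 2] by auto
   have "ennreal (c0 / 2 ^ k) * \<mu> (dcube n x0) = ennreal (c0 / 2 ^ k * dside n ^ DIM('a))"
    using c0 by (simp add: emeasure_dcube ennreal_mult[symmetric] del: emeasure_completion)
   also have "\<dots> \<le> ennreal e" using k e by (intro ennreal_leI) (simp add: field_simps)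
   finally show "\<Psi> n x0 \<le> ennreal (2 * C) * (NN z\<in>dcube n x0. G z) + ennreal e"
    using claim[of n x0 k] by (meson add_left_mono dcube_self order_refl order_trans)
  qed
  then show "(NR x\<in>dcube n x0. norm (T (cut (star n x0) f) x) * g x) \<le> ennreal (2 * C) * (NN x\<in>dcube n x0. G x)"
   unfolding \<Psi>_def .
 qed
qed

section \<open>Operators with comparable kernels\<close>

text \<open>The exponents of \<open>e\<close> and \<open>e'\<close> add up to 1. For
  \<open>e = e'\<close> the bound is proportional to \<open>e\<close> whatever \<open>q\<close> is,
  so operators bounded for different exponents can be combined.\<close>

definition set_bound where
 "set_bound q T A \<longleftrightarrow> (\<forall>f\<in>bcs. \<forall>E E' M e e'. E \<in> \<L> \<longrightarrow> E' \<in> \<L> \<longrightarrow>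
  \<mu> E = ennreal e \<longrightarrow> \<mu> E' = ennreal e' \<longrightarrow> 0 \<le> e \<longrightarrow> 0 \<le> e' \<longrightarrow> 0 \<le> M \<longrightarrow>
  (\<forall>x. norm (f x) \<le> M * indicator E x) \<longrightarrow>
  (NR x\<in>E'. norm (T f x)) \<le> ennreal (A * M * (e powr (1 / q) * e' powr (1 - 1 / q))))"

lemma operator_set_bound:
 fixes T :: "('a::euclidean_space \<Rightarrow> complex) \<Rightarrow> ('a \<Rightarrow> complex)"
 assumes T: "bounded_operator q T" and q: "1 < q"
 shows "\<exists>A\<ge>0. set_bound q T A"
proof -
 obtain A where A: "0 \<le> A" "\<And>f. f \<in> Lp q UNIV \<Longrightarrow> (NR x. norm (T f x) powr q) \<le> ennreal A * (NR x. norm (f x) powr q)"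
  using bounded_operator_nn[OF T] q by auto
 show ?thesis unfolding set_bound_def
 proof (intro exI[of _ "A powr (1 / q)"] conjI ballI allI impI)
  fix f :: "'a \<Rightarrow> complex" and E E' :: "'a set" and M e e' :: real
  assume f: "f \<in> bcs" and [measurable]: "E \<in> \<L>" "E' \<in> \<L>"
   and e: "\<mu> E = ennreal e" "\<mu> E' = ennreal e'" "0 \<le> e" "0 \<le> e'" and M: "0 \<le> M"
   and fM: "\<forall>x. norm (f x) \<le> M * indicator E x"
  have [measurable]: "f \<in> \<M>" using f by (rule bcs_measurable)
  have [measurable]: "T f \<in> \<M>"
   using bounded_operator_measurable[OF T bcs_Lp[OF f]] q by simp
  define q' where "q' = q / (q - 1)"
  have q': "1 / q + 1 / q' = 1" "1 / q' = 1 - 1 / q" using q by (auto simp: q'_def field_simps)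
  have 1: "(NR x. norm (f x) powr q) \<le> ennreal (M powr q * e)"
  proof -
   have "(NR x. norm (f x) powr q) \<le> (NN x. ennreal (M powr q) * indicator E x)"
   proof (rule nn_integral_mono)
    fix x
    show "ennreal (norm (f x) powr q) \<le> ennreal (M powr q) * indicator E x"
     using fM[rule_format, of x] q by (cases "x \<in> E") (auto intro!: ennreal_leI powr_mono2)
   qed
   also have "\<dots> = ennreal (M powr q) * ennreal e" using e(1) by (subst nn_integral_cmult_indicator) auto
   finally show ?thesis using e by (simp add: ennreal_mult)
  qed
  have 2: "(NR x. norm (T f x) powr q) \<le> ennreal (A * (M powr q * e))"
  proof -
   have "(NR x. norm (T f x) powr q) \<le> ennreal A * (NR x. norm (f x) powr q)"
    using q by (intro A(2) bcs_Lp f) simp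
   also have "\<dots> \<le> ennreal A * ennreal (M powr q * e)" by (intro mult_left_mono 1) simp
   finally show ?thesis using A(1) e by (simp add: ennreal_mult)
  qed
  have 3: "(NR x. (indicator E' x :: real) powr q') \<le> ennreal e'"
  proof -
   have "(NR x. (indicator E' x :: real) powr q') = (NN x. indicator E' x)"
    by (intro nn_integral_cong) (auto simp: indicator_def)
   then show ?thesis using e(2) by (simp del: emeasure_completion)
  qed
  have "(NR x\<in>E'. norm (T f x)) = (NR x. norm (T f x) * indicator E' x)"
   by (intro nn_integral_cong) (auto simp: indicator_def)
  also have "\<dots> \<le> ennreal ((A * (M powr q * e)) powr (1 / q) * e' powr (1 / q'))"
   by (rule Holder_nn_integral[OF q q'(1) _ _ _ _ 2 _ 3]) (use A e in auto)
  also have "(A * (M powr q * e)) powr (1 / q) * e' powr (1 / q') = A powr (1 / q) * M * (e powr (1 / q) * e' powr (1 - 1 / q))"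
   using A(1) M e q unfolding q'(2) by (simp add: powr_mult powr_powr)
  finally show "(NR x\<in>E'. norm (T f x)) \<le> ennreal (A powr (1 / q) * M * (e powr (1 / q) * e' powr (1 - 1 / q)))" .
 qed simp
qed

lemma borel_measurable_kernel_product:
 fixes K :: "'a::euclidean_space \<Rightarrow> 'a \<Rightarrow> complex"
 assumes "has_kernel T K"
 shows "(\<lambda>z. K (fst z) (snd z)) \<in> \<M>"
 using assms unfolding has_kernel_def by (simp add: case_prod_beta')

text \<open>Off the support of \<open>f\<close> the difference of the operators is given by the difference of the
 kernels. Approximating a set from inside by closed sets shows that the remaining part of the
 difference is local, and a local operator satisfying \<open>L\<^sup>q\<close>-bounds on sets is dominated by a
 multiplication operator.\<close>

lemma operator_difference_bound:
 fixes K K0 :: "'a::euclidean_space \<Rightarrow> 'a \<Rightarrow> complex"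
 assumes T: "bounded_operator q T" "1 < q" "has_kernel T K"
  and T0: "bounded_operator q0 T0" "1 < q0" "has_kernel T0 K0"
 shows "\<exists>C\<ge>0. \<forall>f\<in>bcs. AE x in lebesgue. ennreal (norm (T f x - T0 f x))
  \<le> ennreal (C * norm (f x)) + (NR y. norm (K x y - K0 x y) * norm (f y))"
proof -
 obtain A where A0: "0 \<le> A" and A1: "set_bound q T A"
  using operator_set_bound[OF T(1,2)] by (elim exE conjE) (rule that)
 obtain A' where A0': "0 \<le> A'" and A1': "set_bound q0 T0 A'"
  using operator_set_bound[OF T0(1,2)] by (elim exE conjE) (rule that)
 note A1 = A1[unfolded set_bound_def] and A1' = A1'[unfolded set_bound_def]
 define S where "S f x = T f x - T0 f x" for f x
 define P where "P f x = (NR y. norm (K x y - K0 x y) * norm (f y))" for f :: "'a \<Rightarrow> complex" and x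
 have Tm: "T h \<in> \<M>" "T0 h \<in> \<M>" if "h \<in> bcs" for h
  using bounded_operator_measurable[OF T(1) bcs_Lp[OF that]] bounded_operator_measurable[OF T0(1) bcs_Lp[OF that]] T(2) T0(2) by auto
 have Sm: "S h \<in> \<M>" if "h \<in> bcs" for h
  unfolding S_def[abs_def] using Tm[OF that] by measurable
 have Pm: "P h \<in> \<M>" if "h \<in> bcs" for h
 proof -
  note [measurable] = bcs_measurable[OF that] borel_measurable_kernel_product[OF T(3)] borel_measurable_kernel_product[OF T0(3)]
  have "(\<lambda>z. ennreal (norm (K (fst z) (snd z) - K0 (fst z) (snd z)) * norm (h (snd z)))) \<in> \<M>"
   by measurable
  from lebesgue_Tonelli(2)[OF this] show ?thesis unfolding P_def[abs_def] by simp
 qed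
 have Sbound: "(NR x\<in>E'. norm (S f x)) \<le> ennreal (A * M * (e powr (1 / q) * e' powr (1 - 1 / q)) + A' * M * (e powr (1 / q0) * e' powr (1 - 1 / q0)))"
  if f: "f \<in> bcs" and [measurable]: "E \<in> \<L>" "E' \<in> \<L>"
   and e: "\<mu> E = ennreal e" "\<mu> E' = ennreal e'" "0 \<le> e" "0 \<le> e'" and M: "0 \<le> M"
   and fM: "\<forall>x. norm (f x) \<le> M * indicator E x" for f E E' e e' M
 proof -
  note [measurable] = Tm[OF f]
  have "(NR x\<in>E'. norm (S f x)) \<le> (NN x. ennreal (norm (T f x)) * indicator E' x + ennreal (norm (T0 f x)) * indicator E' x)"
   by (intro nn_integral_mono) (auto simp: indicator_def S_def ennreal_plus[symmetric] norm_triangle_ineq4 simp del: ennreal_plus intro!: ennreal_leI)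
  also have "\<dots> = (NR x\<in>E'. norm (T f x)) + (NR x\<in>E'. norm (T0 f x))"
   by (rule nn_integral_add) measurable
  also have "\<dots> \<le> ennreal (A * M * (e powr (1 / q) * e' powr (1 - 1 / q))) + ennreal (A' * M * (e powr (1 / q0) * e' powr (1 - 1 / q0)))"
  proof (rule add_mono)
   show "(NR x\<in>E'. norm (T f x)) \<le> ennreal (A * M * (e powr (1 / q) * e' powr (1 - 1 / q)))"
    using A1[THEN bspec, OF f, THEN spec[of _ E], THEN spec[of _ E'], THEN spec[of _ M], THEN spec[of _ e], THEN spec[of _ e']] that by simp
   show "(NR x\<in>E'. norm (T0 f x)) \<le> ennreal (A' * M * (e powr (1 / q0) * e' powr (1 - 1 / q0)))"
    using A1'[THEN bspec, OF f, THEN spec[of _ E], THEN spec[of _ E'], THEN spec[of _ M], THEN spec[of _ e], THEN spec[of _ e']] that by simp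
  qed
  finally show ?thesis using A0 A0' M by (simp add: ennreal_plus)
 qed
 have Sadd: "AE x in lebesgue. S f x = S g x + S h x" if "g \<in> bcs" "h \<in> bcs" "f = (\<lambda>x. g x + h x)" for f g h
 proof -
  have "AE x in lebesgue. T f x = T g x + T h x" unfolding that(3)
   using that T(2) by (intro bounded_operator_add[OF T(1)] bcs_Lp) auto
  moreover have "AE x in lebesgue. T0 f x = T0 g x + T0 h x" unfolding that(3)
   using that T0(2) by (intro bounded_operator_add[OF T0(1)] bcs_Lp) auto
  ultimately show ?thesis by eventually_elim (simp add: S_def)
 qed
 \<comment> \<open>For closed \<open>F\<close> the support of \<open>cut F f\<close> stays in
   \<open>F\<close>, so off \<open>F\<close> both operators are given by their kernels.\<close>
 have off: "AE x in lebesgue. x \<notin> F \<longrightarrow> ennreal (norm (S (cut F f) x)) \<le> P f x"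
  if f: "f \<in> bcs" and F: "closed F" for f F
 proof -
  have [measurable]: "F \<in> \<L>" using F by simp
  have c: "cut F f \<in> bcs" by (rule bcs_cut[OF f]) measurable
  have cl: "closure {y. cut F f y \<noteq> 0} \<subseteq> F" using F by (intro closure_minimal) auto
  show ?thesis using has_kernel_bcs[OF T(3) c] has_kernel_bcs[OF T0(3) c]
  proof eventually_elim
   case (elim x)
   show ?case
   proof
    assume "x \<notin> F"
    then have nx: "x \<notin> closure {y. cut F f y \<noteq> 0}" using cl by blast
    have i: "integrable lebesgue (\<lambda>y. K x y * cut F f y)" "integrable lebesgue (\<lambda>y. K0 x y * cut F f y)"
     and v: "T (cut F f) x = (\<integral>y. K x y * cut F f y \<partial>lebesgue)" "T0 (cut F f) x = (\<integral>y. K0 x y * cut F f y \<partial>lebesgue)"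
     using elim(1)[THEN mp, OF nx] elim(2)[THEN mp, OF nx] by simp_all
    have "S (cut F f) x = (\<integral>y. K x y * cut F f y - K0 x y * cut F f y \<partial>lebesgue)"
     unfolding S_def v by (rule Bochner_Integration.integral_diff[OF i, symmetric])
    then have "ennreal (norm (S (cut F f) x)) \<le> (NN y. norm (K x y * cut F f y - K0 x y * cut F f y))"
     using integral_norm_bound_ennreal[OF Bochner_Integration.integrable_diff[OF i]] by simp
    also have "\<dots> \<le> P f x"
     unfolding P_def by (intro nn_integral_mono ennreal_leI) (simp add: left_diff_distrib[symmetric] norm_mult)
    finally show "ennreal (norm (S (cut F f) x)) \<le> P f x" .
   qed
  qed
 qed
 \<comment> \<open>A point outside a measurable \<open>E\<close> may lie in the closure of the
   support, where the kernels say nothing. A closed \<open>F\<close> inside \<open>E\<close> leaves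
   a set of measure below \<open>\<epsilon>\<close>, whose contribution tends to 0 by the set
   bounds; the ball keeps \<open>E'\<close> of finite measure.\<close>
 have local: "AE x in lebesgue. x \<in> ball 0 R - E \<longrightarrow> ennreal (norm (S (cut E f) x)) \<le> P f x"
  if f: "f \<in> bcs" and [measurable]: "E \<in> \<L>" for f E and R :: real
 proof -
  obtain M where M: "0 \<le> M" "\<And>x. norm (f x) \<le> M" using bcs_bounds[OF f] by metis
  have cE: "cut E f \<in> bcs" by (rule bcs_cut[OF f]) measurable
  note [measurable] = Sm[OF cE] Pm[OF f]
  define E' where "E' = ball 0 R - E"
  have [measurable]: "E' \<in> \<L>" by (simp add: E'_def)
  have "\<mu> E' \<le> \<mu> (ball (0::'a) \<bar>R\<bar>)" by (intro emeasure_mono) (auto simp: E'_def)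
  also have "\<dots> < \<infinity>" using emeasure_lebesgue_ball[of "\<bar>R\<bar>" "0::'a"] by simp
  finally obtain e' where e': "0 \<le> e'" "\<mu> E' = ennreal e'" by (cases "\<mu> E'") auto
  have le: "(NN x\<in>E'. ennreal (norm (S (cut E f) x)) - P f x) \<le> ennreal (A * M * (\<epsilon> powr (1 / q) * e' powr (1 - 1 / q)) + A' * M * (\<epsilon> powr (1 / q0) * e' powr (1 - 1 / q0)))"
   if \<epsilon>: "0 < \<epsilon>" for \<epsilon>
  proof -
   obtain F where F: "closed F" "F \<subseteq> E" "E - F \<in> lmeasurable" "\<mu> (E - F) < ennreal \<epsilon>"
    using sets_lebesgue_inner_closed[of E \<epsilon>] \<epsilon> by auto
   have [measurable]: "F \<in> \<L>" using F by simp
   have cF: "cut F f \<in> bcs" "cut (E - F) f \<in> bcs" by (rule bcs_cut[OF f]; measurable)+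
   obtain d where d: "0 \<le> d" "\<mu> (E - F) = ennreal d" using F(4) by (cases "\<mu> (E - F)") auto
   have d\<epsilon>: "d \<le> \<epsilon>" using F(4) d \<epsilon> by (simp add: ennreal_less_iff)
   have "AE x in lebesgue. S (cut E f) x = S (cut F f) x + S (cut (E - F) f) x"
    using F(2) by (intro Sadd cF) (auto simp: fun_eq_iff)
   with off[OF f F(1)] have "AE x in lebesgue. (ennreal (norm (S (cut E f) x)) - P f x) * indicator E' x \<le> ennreal (norm (S (cut (E - F) f) x)) * indicator E' x"
   proof eventually_elim
    case (elim x)
    show ?case
    proof (cases "x \<in> E'")
     case True
     then have "x \<notin> F" using F(2) by (auto simp: E'_def)
     then have 1: "ennreal (norm (S (cut F f) x)) \<le> P f x" using elim by simp
     have "ennreal (norm (S (cut E f) x)) \<le> ennreal (norm (S (cut F f) x) + norm (S (cut (E - F) f) x))"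
      unfolding elim(2) by (intro ennreal_leI norm_triangle_ineq)
     also have "\<dots> = ennreal (norm (S (cut F f) x)) + ennreal (norm (S (cut (E - F) f) x))" by simp
     also have "\<dots> \<le> P f x + ennreal (norm (S (cut (E - F) f) x))" using 1 by (rule add_right_mono)
     finally show ?thesis using True by (simp add: ennreal_minus_le_iff)
    qed simp
   qed
   then have "(NN x\<in>E'. ennreal (norm (S (cut E f) x)) - P f x) \<le> (NR x\<in>E'. norm (S (cut (E - F) f) x))"
    by (rule nn_integral_mono_AE)
   also have "\<dots> \<le> ennreal (A * M * (d powr (1 / q) * e' powr (1 - 1 / q)) + A' * M * (d powr (1 / q0) * e' powr (1 - 1 / q0)))"
    using M by (intro Sbound[OF cF(2) _ _ d(2) e'(2) d(1) e'(1) M(1)]) (auto simp: indicator_def)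
   also have "\<dots> \<le> ennreal (A * M * (\<epsilon> powr (1 / q) * e' powr (1 - 1 / q)) + A' * M * (\<epsilon> powr (1 / q0) * e' powr (1 - 1 / q0)))"
    using A0 A0' M(1) d d\<epsilon> T(2) T0(2) by (intro ennreal_leI add_mono mult_left_mono mult_right_mono powr_mono2) auto
   finally show ?thesis .
  qed
  define c where "c \<epsilon> = A * M * (\<epsilon> powr (1 / q) * e' powr (1 - 1 / q)) + A' * M * (\<epsilon> powr (1 / q0) * e' powr (1 - 1 / q0))" for \<epsilon> :: real
  have lim: "(c \<longlongrightarrow> 0) (at_right 0)"
  proof -
   have p0: "((\<lambda>\<epsilon>::real. \<epsilon> powr s) \<longlongrightarrow> 0) (at_right 0)" if "0 < s" for s
   proof (rule tendsto_zero_powrI[where b = s])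
    show "((\<lambda>x::real. x) \<longlongrightarrow> 0) (at_right 0)" by (rule tendsto_ident_at)
   qed (use that in \<open>auto simp: eventually_at_right_less intro: eventually_mono[OF eventually_at_right_less]\<close>)
   have "(c \<longlongrightarrow> A * M * (0 * e' powr (1 - 1 / q)) + A' * M * (0 * e' powr (1 - 1 / q0))) (at_right 0)"
    unfolding c_def[abs_def] by (intro tendsto_intros p0) (use T(2) T0(2) in auto)
   then show ?thesis by simp
  qed
  have "(NN x\<in>E'. ennreal (norm (S (cut E f) x)) - P f x) \<le> 0 + ennreal \<eta>" if "0 < \<eta>" for \<eta>
  proof -
   have "\<forall>\<^sub>F \<epsilon> in at_right 0. c \<epsilon> < \<eta>" using lim that by (rule order_tendstoD(2))
   moreover have "\<forall>\<^sub>F \<epsilon>::real in at_right 0. 0 < \<epsilon>" by (rule eventually_at_right_less)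
   ultimately have "\<forall>\<^sub>F \<epsilon> in at_right 0. c \<epsilon> < \<eta> \<and> 0 < \<epsilon>" by (rule eventually_conj)
   then have "\<exists>\<epsilon>. c \<epsilon> < \<eta> \<and> 0 < \<epsilon>" by (rule eventually_happens'[OF trivial_limit_at_right_real])
   then obtain \<epsilon> where "c \<epsilon> < \<eta>" "0 < \<epsilon>" by blast
   then show ?thesis using le[of \<epsilon>] unfolding c_def[symmetric] by (meson add_increasing ennreal_leI less_imp_le order_trans zero_le)
  qed
  then have "(NN x\<in>E'. ennreal (norm (S (cut E f) x)) - P f x) \<le> 0" by (rule ennreal_le_epsilon)
  then have "(NN x\<in>E'. ennreal (norm (S (cut E f) x)) - P f x) = 0" by simp
  then have "AE x in lebesgue. (ennreal (norm (S (cut E f) x)) - P f x) * indicator E' x = 0"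
   by (subst (asm) nn_integral_0_iff_AE) auto
  then show ?thesis
  proof eventually_elim
   case (elim x)
   then show ?case by (auto simp: E'_def indicator_def diff_eq_0_iff_ennreal split: if_splits)
  qed
 qed
 \<comment> \<open>The strict excess over \<open>A + A'\<close> forces the exceptional sets below to
   be null.\<close>
 define C where "C = A + A' + 1"
 have C: "0 < C" using A0 A0' by (simp add: C_def)
 show ?thesis
 proof (intro exI[of _ C] conjI ballI)
  show "0 \<le> C" using C by simp
  fix f :: "'a \<Rightarrow> complex" assume f: "f \<in> bcs"
  note [measurable] = Sm[OF f] Pm[OF f] bcs_measurable[OF f]
  \<comment> \<open>Points where the claim fails even with \<open>norm (f x)\<close> raised to a
    level \<open>t\<close>. Rational levels suffice, and on such a set \<open>f\<close> is bounded
    by \<open>t\<close>, as the set bound requires.\<close>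
  define Et where "Et t R = {x \<in> space lebesgue. x \<in> ball 0 R \<and> norm (f x) \<le> t \<and> ennreal (C * t) + P f x < ennreal (norm (S f x))}" for t R :: real
  have Et[measurable]: "Et t R \<in> \<L>" for t R unfolding Et_def by measurable
  have null: "Et t R \<in> null_sets lebesgue" if t: "0 < t" for t R
  proof -
   let ?E = "Et t R"
   have Ec: "- ?E \<in> \<L>" using Et Compl_in_sets_lebesgue by blast
   note cE = bcs_cut[OF f Et[of t R]] bcs_cut[OF f Ec]
   note [measurable] = Sm[OF cE(1)]
   have "\<mu> ?E \<le> \<mu> (ball (0::'a) \<bar>R\<bar>)" by (intro emeasure_mono) (auto simp: Et_def)
   also have "\<dots> < \<infinity>" using emeasure_lebesgue_ball[of "\<bar>R\<bar>" "0::'a"] by simp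
   finally obtain e where e: "0 \<le> e" "\<mu> ?E = ennreal e" by (cases "\<mu> ?E") auto
   have "AE x in lebesgue. S f x = S (cut ?E f) x + S (cut (- ?E) f) x"
    by (rule Sadd[OF cE]) (auto simp: fun_eq_iff)
   moreover have "AE x in lebesgue. x \<in> ball 0 R - (- ?E) \<longrightarrow> ennreal (norm (S (cut (- ?E) f) x)) \<le> P f x"
    by (rule local[OF f Ec])
   ultimately have "AE x in lebesgue. ennreal (C * t) * indicator ?E x \<le> ennreal (norm (S (cut ?E f) x)) * indicator ?E x"
   proof eventually_elim
    case (elim x)
    show ?case
    proof (cases "x \<in> ?E")
     case True
     then have Px: "ennreal (norm (S (cut (- ?E) f) x)) \<le> P f x" using elim(2) by (auto simp: Et_def)
     have "ennreal (C * t) + P f x < ennreal (norm (S f x))" using True by (simp add: Et_def)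
     also have "\<dots> \<le> ennreal (norm (S (cut ?E f) x) + norm (S (cut (- ?E) f) x))"
      unfolding elim(1) by (intro ennreal_leI norm_triangle_ineq)
     also have "\<dots> = ennreal (norm (S (cut ?E f) x)) + ennreal (norm (S (cut (- ?E) f) x))" by simp
     also have "\<dots> \<le> ennreal (norm (S (cut ?E f) x)) + P f x" using Px by (rule add_left_mono)
     finally have "ennreal (C * t) \<le> ennreal (norm (S (cut ?E f) x))"
      by (metis add_right_mono leD le_less_linear order_less_imp_le)
     then show ?thesis using True by simp
    qed simp
   qed
   then have "(NN x. ennreal (C * t) * indicator ?E x) \<le> (NR x\<in>?E. norm (S (cut ?E f) x))"
    by (rule nn_integral_mono_AE)
   also have "\<dots> \<le> ennreal (A * t * (e powr (1 / q) * e powr (1 - 1 / q)) + A' * t * (e powr (1 / q0) * e powr (1 - 1 / q0)))"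
    by (rule Sbound[OF cE(1) Et Et e(2) e(2) e(1) e(1)]) (use t in \<open>auto simp: indicator_def Et_def\<close>)
   also have "A * t * (e powr (1 / q) * e powr (1 - 1 / q)) + A' * t * (e powr (1 / q0) * e powr (1 - 1 / q0)) = (A + A') * t * e"
    using e(1) by (simp add: powr_add[symmetric] distrib_right)
   finally have "ennreal (C * t) * \<mu> ?E \<le> ennreal ((A + A') * t * e)"
    by (simp add: nn_integral_cmult_indicator del: emeasure_completion)
   then have "ennreal (C * t * e) \<le> ennreal ((A + A') * t * e)"
    unfolding e(2) using C t e(1) by (simp add: ennreal_mult)
   then have "C * t * e \<le> (A + A') * t * e"
    by (subst (asm) ennreal_le_iff) (use A0 A0' t e in auto)
   then have "t * e \<le> 0" by (simp add: C_def algebra_simps)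
   then have "e = 0" using t e(1) by (simp add: mult_le_0_iff)
   then show ?thesis using e(2) by (intro null_setsI) (auto simp del: emeasure_completion)
  qed
  have "(\<Union>t\<in>{t \<in> \<rat>. 0 < t}. \<Union>k::nat. Et t (real k)) \<in> null_sets lebesgue"
   using null by (intro null_sets_UN' null_sets_UN) (auto intro: countable_subset[OF _ countable_rat])
  moreover have "{x \<in> space lebesgue. \<not> ennreal (norm (T f x - T0 f x))
   \<le> ennreal (C * norm (f x)) + (NR y. norm (K x y - K0 x y) * norm (f y))} \<subseteq> (\<Union>t\<in>{t \<in> \<rat>. 0 < t}. \<Union>k::nat. Et t (real k))"
  proof
   fix x assume "x \<in> {x \<in> space lebesgue. \<not> ennreal (norm (T f x - T0 f x))
   \<le> ennreal (C * norm (f x)) + (NR y. norm (K x y - K0 x y) * norm (f y))}"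
   then have less: "ennreal (C * norm (f x)) + P f x < ennreal (norm (S f x))"
    by (auto simp: P_def S_def not_le)
   then have "P f x < \<infinity>" by (auto simp: ennreal_add_eq_top less_top[symmetric] dest: order_less_trans)
   then obtain p where p: "0 \<le> p" "P f x = ennreal p" by (cases "P f x") auto
   have "C * norm (f x) + p < norm (S f x)"
    using less p C by (simp add: ennreal_plus[symmetric] ennreal_less_iff del: ennreal_plus)
   then have "norm (f x) < (norm (S f x) - p) / C" using C by (simp add: field_simps)
   then obtain t where t: "t \<in> \<rat>" "norm (f x) < t" "t < (norm (S f x) - p) / C" using Rats_dense_in_real by blast
   have t0: "0 < t" using t(2) by (meson norm_ge_zero order_le_less_trans)
   have "C * t + p < norm (S f x)" using t(3) C by (simp add: field_simps)
   then have "ennreal (C * t) + P f x < ennreal (norm (S f x))"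
    using p C t0 by (simp add: ennreal_plus[symmetric] ennreal_less_iff del: ennreal_plus)
   moreover obtain k :: nat where "norm x < real k" using reals_Archimedean2 by blast
   ultimately have "x \<in> Et t (real k)" using t(2) by (simp add: Et_def)
   then show "x \<in> (\<Union>t\<in>{t \<in> \<rat>. 0 < t}. \<Union>k::nat. Et t (real k))" using t(1) t0 by blast
  qed
  ultimately show "AE x in lebesgue. ennreal (norm (T f x - T0 f x))
   \<le> ennreal (C * norm (f x)) + (NR y. norm (K x y - K0 x y) * norm (f y))"
   by (rule AE_I')
 qed
qed

declare borel_measurable_lebesgue_id [measurable del]

section \<open>A two-weight estimate\<close>

text \<open>Differentiation with a bound that varies from point to point: \<open>W\<close> is
  compared with rational levels \<open>t\<close>, and the generation \<open>N\<close> from which the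
  means are controlled is fixed, which leaves countably many sets with a constant bound.\<close>

lemma ae_le_of_cube_averages:
 fixes w :: "'a::euclidean_space \<Rightarrow> ennreal" and W :: "'a \<Rightarrow> real"
 assumes [measurable]: "w \<in> \<M>" "W \<in> \<M>" and W0: "\<And>y. 0 \<le> W y"
  and avg: "\<And>y. \<exists>N. \<forall>n\<ge>N. (NN z\<in>dcube n y. w z) \<le> ennreal (W y) * \<mu> (dcube n y)"
 shows "AE y in lebesgue. w y \<le> ennreal (W y)"
proof -
 define good where "good t n = {y. (NN z\<in>dcube n y. w z) \<le> ennreal t * \<mu> (dcube n y)}" for t n
 have [measurable]: "good t n \<in> \<L>" for t n
 proof -
  have "dcube n x \<subseteq> good t n" if "x \<in> good t n" for x
  proof
   fix y assume "y \<in> dcube n x"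
   from dcube_eq[OF this] that show "y \<in> good t n" by (simp add: good_def del: emeasure_completion)
  qed
  then have "good t n \<in> sets borel" by (rule dcube_saturated_borel)
  then show ?thesis by auto
 qed
 define E where "E t N = {y \<in> space lebesgue. W y \<le> t \<and> (\<forall>n. N \<le> n \<longrightarrow> y \<in> good t n)}" for t :: real and N :: int
 have Em: "E t N \<in> \<L>" for t N unfolding E_def by measurable
 have "AE y in lebesgue. \<forall>t\<in>{t \<in> \<rat>. 0 < t}. \<forall>N. y \<in> E t N \<longrightarrow> w y \<le> ennreal t"
 proof (rule AE_ball_countable')
  fix t :: real assume t: "t \<in> {t \<in> \<rat>. 0 < t}"
  have "AE y in lebesgue. y \<in> E t N \<longrightarrow> w y \<le> ennreal t" for N
   by (rule dyadic_differentiation[of w "E t N" t N]) (use Em t in \<open>auto simp: E_def good_def simp del: emeasure_completion\<close>)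
  then show "AE y in lebesgue. \<forall>N. y \<in> E t N \<longrightarrow> w y \<le> ennreal t" unfolding AE_all_countable by blast
 qed (auto intro: countable_subset[OF _ countable_rat])
 then show ?thesis
 proof eventually_elim
  case (elim y)
  show ?case
  proof (rule ccontr)
   assume "\<not> ?thesis"
   then have "ennreal (W y) < w y" by simp
   then obtain s where s: "ennreal (W y) < s" "s < w y" using dense by blast
   then obtain s' where s': "s = ennreal s'" "0 \<le> s'" by (cases s) auto
   have "W y < s'" using s(1) s' W0[of y] by (simp add: ennreal_less_iff)
   then obtain t where t: "t \<in> \<rat>" "W y < t" "t < s'" using Rats_dense_in_real by blast
   have t0: "0 < t" using t(2) W0[of y] by linarith
   obtain N where N: "\<forall>n\<ge>N. (NN z\<in>dcube n y. w z) \<le> ennreal (W y) * \<mu> (dcube n y)"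
    using avg by blast
   have "(NN z\<in>dcube n y. w z) \<le> ennreal t * \<mu> (dcube n y)" if "N \<le> n" for n
   proof -
    have "ennreal (W y) * \<mu> (dcube n y) \<le> ennreal t * \<mu> (dcube n y)"
     using t(2) by (intro mult_right_mono ennreal_leI) auto
    then show ?thesis using N that by (meson order_trans)
   qed
   then have "y \<in> E t N" using t(2) by (simp add: E_def good_def del: emeasure_completion)
   then have "w y \<le> ennreal t" using elim t(1) t0 by blast
   also have "\<dots> \<le> s" using t(3) s' by (simp add: ennreal_leI)
   finally show False using s(2) by simp
  qed
 qed
qed

section \<open>Young functions and Luxemburg norms\<close>

lemma young_nonneg: "young_function A \<Longrightarrow> 0 \<le> t \<Longrightarrow> 0 \<le> A t"
 unfolding young_function_def mono_on_def by (metis atLeast_iff order_refl)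

text \<open>Convexity together with \<open>A 0 = 0\<close> makes \<open>A t / t\<close>
  nondecreasing; multiplied out, this needs no case distinction on the denominators.\<close>

lemma young_quotient_mono:
 assumes A: "young_function A" and uv: "0 < u" "u \<le> v"
 shows "A u * v \<le> A v * u"
proof -
 have "A ((1 - u / v) *\<^sub>R 0 + (u / v) *\<^sub>R v) \<le> (1 - u / v) * A 0 + (u / v) * A v"
  using A uv by (intro convex_onD[of "{0..}" A]) (auto simp: young_function_def)
 then have "A u \<le> (u / v) * A v" using A uv by (simp add: young_function_def)
 then show ?thesis using uv by (simp add: field_simps)
qed

text \<open>A lower bound for a Luxemburg norm is tested at every admissible \<open>l\<close>;
  admissibility is restated here without the quotient of extended reals.\<close>

lemma luxemburg_lower:
 fixes w :: "'a::euclidean_space \<Rightarrow> real"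
 assumes "\<And>l. 0 < l \<Longrightarrow> (NR x\<in>ball c r. A (\<bar>w x\<bar> / l)) \<le> \<mu> (ball c r) \<Longrightarrow> z \<le> ennreal l"
  and r: "0 < r"
 shows "z \<le> luxemburg A (ball c r) w"
 unfolding luxemburg_def
proof (rule Inf_greatest)
 fix u assume "u \<in> {ennreal l |l. 0 < l \<and> (NR x\<in>ball c r. A (\<bar>w x\<bar> / l)) / \<mu> (ball c r) \<le> 1}"
 then obtain l where l: "u = ennreal l" "0 < l" "(NR x\<in>ball c r. A (\<bar>w x\<bar> / l)) / \<mu> (ball c r) \<le> 1"
  by blast
 define b where "b = unit_ball_vol (DIM('a)) * r ^ DIM('a)"
 have b: "0 < b" "\<mu> (ball c r) = ennreal b"
  using r emeasure_lebesgue_ball[of r c] by (auto simp: b_def)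
 have "(NR x\<in>ball c r. A (\<bar>w x\<bar> / l)) \<le> \<mu> (ball c r)"
  using l(3) b(1) unfolding b(2)
  by (cases "(NR x\<in>ball c r. A (\<bar>w x\<bar> / l))") (auto simp: divide_ennreal ennreal_top_divide ennreal_le_1 top_unique intro: ennreal_leI)
 then show "z \<le> u" unfolding l(1) using l(2) assms(1) by blast
qed

text \<open>Beyond a point \<open>v0\<close> with \<open>A v0 > 0\<close> a Young function grows at
  least linearly, so \<open>t \<le> v0 + v0 / A v0 * A t\<close> for all \<open>t \<ge> 0\<close>.
  Inserting \<open>t = w x / l\<close> and integrating bounds the ordinary mean by a multiple of
  every admissible \<open>l\<close>.\<close>

lemma young_average_bound:
 fixes A :: "real \<Rightarrow> real"
 assumes A: "A \<in> class_D p"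
 shows "\<exists>C\<ge>0. \<forall>(w :: 'a::euclidean_space \<Rightarrow> real) c r. w \<in> \<M> \<longrightarrow> (\<forall>x. 0 \<le> w x) \<longrightarrow> 0 < r \<longrightarrow>
  (NR x\<in>ball c r. w x) \<le> ennreal C * \<mu> (ball c r) * luxemburg A (ball c r) w"
proof -
 have Y: "young_function A" using A by (simp add: class_D_def)
 obtain c0 where c0: "0 < c0" "\<forall>t>c0. 0 < A t" using A by (auto simp: class_D_def)
 define v0 where "v0 = c0 + 1"
 have v0: "0 < v0" "0 < A v0" using c0 by (auto simp: v0_def)
 define C where "C = v0 + v0 / A v0"
 have C: "0 < C" using v0 by (simp add: C_def add_pos_pos)
 have key: "t \<le> v0 + v0 / A v0 * A t" if "0 \<le> t" for t
 proof (cases "t \<le> v0")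
  case True
  have "0 \<le> v0 / A v0 * A t" using v0 young_nonneg[OF Y that] by simp
  then show ?thesis using True by linarith
 next
  case False
  then have "A v0 * t \<le> A t * v0" using v0 by (intro young_quotient_mono[OF Y]) auto
  then have "t \<le> v0 / A v0 * A t" using v0 by (simp add: field_simps)
  then show ?thesis using v0 by linarith
 qed
 have "continuous_on {0..} A" using Y by (simp add: young_function_def)
 then have Am: "(\<lambda>t. if t \<in> {0..} then A t else 0) \<in> borel_measurable borel"
  by (intro borel_measurable_continuous_on_if) auto
 show ?thesis
 proof (intro exI[of _ C] conjI allI impI)
  show "0 \<le> C" using C by simp
  fix w :: "'a \<Rightarrow> real" and c :: 'a and r :: real
  assume wm[measurable]: "w \<in> \<M>" and w0: "\<forall>x. 0 \<le> w x" and r: "0 < r"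
  define b where "b = unit_ball_vol (DIM('a)) * r ^ DIM('a)"
  have b: "0 < b" "\<mu> (ball c r) = ennreal b"
   using r emeasure_lebesgue_ball[of r c] by (auto simp: b_def)
  define I where "I = (NR x\<in>ball c r. w x)"
  have "I / ennreal (C * b) \<le> luxemburg A (ball c r) w"
  proof (rule luxemburg_lower[OF _ r])
   fix l :: real assume l: "0 < l" "(NR x\<in>ball c r. A (\<bar>w x\<bar> / l)) \<le> \<mu> (ball c r)"
   have [measurable]: "(\<lambda>x. A (\<bar>w x\<bar> / l)) \<in> \<M>"
   proof -
    have "(\<lambda>x. A (\<bar>w x\<bar> / l)) = (\<lambda>x. (\<lambda>t. if t \<in> {0..} then A t else 0) (\<bar>w x\<bar> / l))" using l(1) by (auto simp: fun_eq_iff)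
    also have "\<dots> \<in> \<M>" by (rule measurable_compose[OF _ Am]) measurable
    finally show ?thesis .
   qed
   define X Z where "X = l * v0" and "Z = l * (v0 / A v0)"
   have XZ: "0 \<le> X" "0 \<le> Z" using l(1) v0 by (auto simp: X_def Z_def)
   have "I \<le> (NN x. ennreal X * indicator (ball c r) x + ennreal Z * (ennreal (A (\<bar>w x\<bar> / l)) * indicator (ball c r) x))"
    unfolding I_def
   proof (rule nn_integral_mono)
    fix x
    have "w x / l \<le> v0 + v0 / A v0 * A (\<bar>w x\<bar> / l)" using key[of "w x / l"] w0 l(1) by simp
    then have "l * (w x / l) \<le> l * (v0 + v0 / A v0 * A (\<bar>w x\<bar> / l))" using l(1) by (intro mult_left_mono) auto
    then have "w x \<le> l * v0 + l * (v0 / A v0) * A (\<bar>w x\<bar> / l)" using l(1) by (simp add: distrib_left mult.assoc)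
    then have "ennreal (w x) \<le> ennreal (X + Z * A (\<bar>w x\<bar> / l))" unfolding X_def Z_def by (rule ennreal_leI)
    also have "\<dots> = ennreal X + ennreal Z * ennreal (A (\<bar>w x\<bar> / l))"
     using XZ young_nonneg[OF Y, of "\<bar>w x\<bar> / l"] l(1) by (simp add: ennreal_plus ennreal_mult)
    finally have "ennreal (w x) \<le> ennreal X + ennreal Z * ennreal (A (\<bar>w x\<bar> / l))" .
    then show "ennreal (w x) * indicator (ball c r) x \<le> ennreal X * indicator (ball c r) x + ennreal Z * (ennreal (A (\<bar>w x\<bar> / l)) * indicator (ball c r) x)"
     by (auto simp: indicator_def)
   qed
   also have "\<dots> = ennreal X * ennreal b + ennreal Z * (NR x\<in>ball c r. A (\<bar>w x\<bar> / l))"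
    using b(2) by (subst nn_integral_add) (auto simp: nn_integral_cmult_indicator nn_integral_cmult simp del: emeasure_completion)
   also have "\<dots> \<le> ennreal X * ennreal b + ennreal Z * ennreal b"
    using l(2) unfolding b(2) by (intro add_left_mono mult_left_mono) auto
   also have "\<dots> = ennreal (X * b + Z * b)"
    using XZ b(1) by (simp add: ennreal_plus ennreal_mult)
   also have "X * b + Z * b = l * (C * b)" by (simp add: C_def X_def Z_def algebra_simps)
   finally have "I \<le> ennreal (l * (C * b))" .
   then have "I / ennreal (C * b) \<le> ennreal (l * (C * b)) / ennreal (C * b)" by (rule divide_right_mono_ennreal)
   also have "\<dots> = ennreal l" using l(1) C b by (simp add: divide_ennreal)
   finally show "I / ennreal (C * b) \<le> ennreal l" .
  qed
  then have "ennreal (C * b) * (I / ennreal (C * b)) \<le> ennreal (C * b) * luxemburg A (ball c r) w" by (rule mult_left_mono) simp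
  moreover have "ennreal (C * b) * (I / ennreal (C * b)) = I"
   using C b by (simp add: ennreal_times_divide mult.commute[of "ennreal (C * b)"] mult_divide_eq_ennreal)
  ultimately show "(NR x\<in>ball c r. w x) \<le> ennreal C * \<mu> (ball c r) * luxemburg A (ball c r) w"
   unfolding I_def[symmetric] b(2) using C b by (simp add: ennreal_mult)
 qed
qed

text \<open>Here \<open>m\<close> is the density of \<open>v powr (1 / p)\<close>, and
  \<open>\<alpha> v = A v / v powr (1 / p)\<close> for large \<open>v\<close>. If
  \<open>h v powr (1 / p)\<close> exceeds \<open>A v\<close>, all layers below \<open>v\<close> are
  active at height \<open>h\<close>, since \<open>\<alpha>\<close> is nondecreasing beyond
  \<open>c\<close>, and they add up to this product; so Young's inequality for a complementary
  function is replaced. Beyond \<open>c\<close> the integral of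
  \<open>m \<alpha> powr (1 - p')\<close> is \<open>1 / p\<close> times the one in the definition of
  \<open>class_D\<close>.\<close>

lemma class_D_orlicz:
 assumes p: "1 < p" and A: "A \<in> class_D p"
 obtains m \<alpha> \<kappa> B where "m \<in> borel_measurable borel" "\<alpha> \<in> borel_measurable borel" "0 < \<kappa>" "orlicz_phi m \<alpha> \<kappa> \<le> 1 / 2"
  "(\<integral>\<^sup>+v. m v * ennreal (max \<kappa> (\<alpha> v) powr (1 - p / (p - 1))) \<partial>lborel) \<le> ennreal B" "0 \<le> B"
  "\<And>h v. 0 \<le> h \<Longrightarrow> 0 \<le> v \<Longrightarrow> ennreal (h * v powr (1 / p)) \<le> ennreal (A v) + orlicz_phi m \<alpha> h"
proof -
 have Y: "young_function A" using A by (simp add: class_D_def)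
 obtain c where c: "0 < c" "\<forall>t>c. 0 < A t" and int: "set_integrable lebesgue {c<..} (\<lambda>t. (t / A t) powr (conj_exp p - 1) / t)"
  using A by (auto simp: class_D_def)
 define p' where "p' = p / (p - 1)"
 have p': "1 < p'" "conj_exp p = p'" "p' / p = p' - 1" using p by (auto simp: p'_def conj_exp_def field_simps)
 \<comment> \<open>Up to \<open>c\<close> the integral condition says nothing, so the layers there
   are always active; their total mass is finite. The inner test confines \<open>A\<close> to the
   half-line where it is continuous, for the sake of measurability.\<close>
 define \<alpha> where "\<alpha> v = (if v \<le> c then 0 else (if v \<in> {0..} then A v else 0) * v powr (- 1 / p))" for v
 define m where "m v = (if 0 < v then ennreal (1 / p * v powr (1 / p - 1)) else 0)" for v
 have "continuous_on {0..} A" using Y by (simp add: young_function_def)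
 then have [measurable]: "(\<lambda>t. if t \<in> {0..} then A t else 0) \<in> borel_measurable borel"
  by (intro borel_measurable_continuous_on_if) auto
 have mm[measurable]: "m \<in> borel_measurable borel" unfolding m_def[abs_def] by measurable
 have am[measurable]: "\<alpha> \<in> borel_measurable borel" unfolding \<alpha>_def[abs_def] by measurable
 have avc: "\<alpha> v = A v * v powr (- 1 / p)" if "c < v" for v using that c by (simp add: \<alpha>_def)
 have mint: "(\<integral>\<^sup>+v. m v * indicator {..X} v \<partial>lborel) = ennreal (X powr (1 / p))" if "0 \<le> X" for X
 proof -
  have "(\<integral>\<^sup>+v. m v * indicator {..X} v \<partial>lborel) = (\<integral>\<^sup>+v. ennreal (1 / p) * (ennreal (v powr (1 / p - 1)) * indicator {0..X} v) \<partial>lborel)"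
   using p by (intro nn_integral_cong) (auto simp: m_def indicator_def ennreal_mult[symmetric])
  also have "\<dots> = ennreal (1 / p) * (\<integral>\<^sup>+v. ennreal (v powr (1 / p - 1)) * indicator {0..X} v \<partial>lborel)"
   by (rule nn_integral_cmult) measurable
  also have "(\<integral>\<^sup>+v. ennreal (v powr (1 / p - 1)) * indicator {0..X} v \<partial>lborel) = ennreal (X powr (1 / p - 1 + 1) / (1 / p - 1 + 1))"
   using p that by (intro nn_integral_powr_0) auto
  also have "ennreal (1 / p) * \<dots> = ennreal (X powr (1 / p))" using p by (simp add: ennreal_mult[symmetric])
  finally show ?thesis .
 qed
 define J where "J \<kappa> = (\<integral>\<^sup>+v. m v * ennreal (max \<kappa> (\<alpha> v) powr (1 - p')) \<partial>lborel)" for \<kappa>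
 have Jfin: "J \<kappa> < \<infinity>" if \<kappa>: "0 < \<kappa>" for \<kappa>
 proof -
  define D where "D t = norm (indicator {c<..} t *\<^sub>R ((t / A t) powr (conj_exp p - 1) / t))" for t
  have "integrable lebesgue (\<lambda>t. indicator {c<..} t *\<^sub>R ((t / A t) powr (conj_exp p - 1) / t))"
   using int by (simp add: set_integrable_def)
  then have Dfin: "(NR t. D t) < \<infinity>" unfolding integrable_iff_bounded D_def by simp
  have Dm: "(\<lambda>t. ennreal (D t)) \<in> \<M>"
   using int unfolding D_def set_integrable_def by measurable
  have "J \<kappa> \<le> (NN v. ennreal (\<kappa> powr (1 - p')) * (m v * indicator {..c} v) + ennreal (D v))"
   unfolding J_def nn_integral_completion[symmetric, of lborel]
  proof (rule nn_integral_mono)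
   fix v
   show "m v * ennreal (max \<kappa> (\<alpha> v) powr (1 - p')) \<le> ennreal (\<kappa> powr (1 - p')) * (m v * indicator {..c} v) + ennreal (D v)"
   proof (cases "v \<le> c")
    case True
    then show ?thesis using \<kappa> by (simp add: \<alpha>_def mult.commute add_increasing2)
   next
    case False
    then have v: "c < v" "0 < v" "0 < A v" using c by auto
    have a0: "0 < \<alpha> v" using v by (simp add: avc)
    have "max \<kappa> (\<alpha> v) powr (1 - p') \<le> \<alpha> v powr (1 - p')"
     using a0 p' by (intro powr_mono2') auto
    then have "m v * ennreal (max \<kappa> (\<alpha> v) powr (1 - p')) \<le> m v * ennreal (\<alpha> v powr (1 - p'))"
     by (intro mult_left_mono ennreal_leI) auto
    also have "\<dots> = ennreal (1 / p * v powr (1 / p - 1) * \<alpha> v powr (1 - p'))"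
     using v p by (simp add: m_def ennreal_mult[symmetric])
    \<comment> \<open>The exponents match because \<open>p' / p = p' - 1\<close>.\<close>
    also have "1 / p * v powr (1 / p - 1) * \<alpha> v powr (1 - p') = 1 / p * D v"
    proof -
     have "\<alpha> v powr (1 - p') = A v powr (1 - p') * v powr (- 1 / p * (1 - p'))"
      using v by (simp add: avc powr_mult powr_powr)
     moreover have "D v = v powr (p' - 1) * A v powr (1 - p') * v powr (-1)"
     proof -
      have "A v powr (1 - p') = 1 / A v powr (p' - 1)" using powr_minus_divide[of "A v" "p' - 1"] by simp
      moreover have "v powr (-1) = 1 / v" using v by (simp add: powr_minus_divide)
      ultimately show ?thesis using v p' by (simp add: D_def powr_divide)
     qed
     moreover have "v powr (1 / p - 1) * v powr (- 1 / p * (1 - p')) = v powr (p' - 1) * v powr (-1)"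
     proof -
      have "1 / p - 1 + - 1 / p * (1 - p') = p' / p - 1" using p by (simp add: field_simps)
      then have "1 / p - 1 + - 1 / p * (1 - p') = (p' - 1) + (-1)" using p'(3) by simp
      then show ?thesis by (simp only: powr_add[symmetric])
     qed
     ultimately show ?thesis by (simp add: mult_ac)
    qed
    also have "ennreal (1 / p * D v) \<le> ennreal (1 * D v)" using p by (intro ennreal_leI mult_right_mono) (auto simp: D_def)
    finally show ?thesis using False by (simp add: add_increasing)
   qed
  qed
  also have "\<dots> = ennreal (\<kappa> powr (1 - p')) * (NN v. m v * indicator {..c} v) + (NR v. D v)"
  proof -
   have "(\<lambda>v. m v * indicator {..c} v) \<in> \<M>" by (rule measurable_completion) measurable
   then show ?thesis using Dm by (simp add: nn_integral_add nn_integral_cmult)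
  qed
  also have "\<dots> < \<infinity>" using Dfin c mint[of c] by (simp add: nn_integral_completion ennreal_mult_less_top)
  finally show ?thesis .
 qed
 \<comment> \<open>For \<open>\<kappa> \<le> 1\<close> the layers active at \<open>\<kappa>\<close>
   satisfy \<open>max 1 (\<alpha> v) = 1\<close>, so their mass is at most \<open>J 1\<close>. A
   small \<open>\<kappa>\<close> then brings the value below \<open>1 / 2\<close>.\<close>
 have phi_J: "orlicz_phi m \<alpha> \<kappa> \<le> ennreal \<kappa> * J 1" if "0 < \<kappa>" "\<kappa> \<le> 1" for \<kappa>
 proof -
  have "max 1 (\<alpha> v) = 1" if "\<alpha> v \<le> \<kappa>" for v using that \<open>\<kappa> \<le> 1\<close> by simp
  then show ?thesis unfolding orlicz_phi_def J_def
   by (intro mult_left_mono nn_integral_mono) (auto simp: indicator_def)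
 qed
 obtain j where j: "0 \<le> j" "J 1 = ennreal j" using Jfin[of 1] by (cases "J 1") auto
 define \<kappa> where "\<kappa> = 1 / (2 * j + 2)"
 have \<kappa>: "0 < \<kappa>" "\<kappa> \<le> 1" "\<kappa> * j \<le> 1 / 2" using j by (auto simp: \<kappa>_def field_simps)
 obtain B where B: "0 \<le> B" "J \<kappa> = ennreal B" using Jfin[OF \<kappa>(1)] by (cases "J \<kappa>") auto
 show thesis
 proof (rule that[of m \<alpha> \<kappa> B])
  have "orlicz_phi m \<alpha> \<kappa> \<le> ennreal (\<kappa> * j)" using phi_J[OF \<kappa>(1,2)] j \<kappa> by (simp add: ennreal_mult)
  also have "\<dots> \<le> ennreal (1 / 2)" using \<kappa>(3) by (rule ennreal_leI)
  finally show "orlicz_phi m \<alpha> \<kappa> \<le> 1 / 2" using divide_ennreal[of 1 2] by simp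
  show "(\<integral>\<^sup>+v. m v * ennreal (max \<kappa> (\<alpha> v) powr (1 - p / (p - 1))) \<partial>lborel) \<le> ennreal B"
   using B unfolding J_def p'_def by simp
  fix h v :: real assume h: "0 \<le> h" and v: "0 \<le> v"
  show "ennreal (h * v powr (1 / p)) \<le> ennreal (A v) + orlicz_phi m \<alpha> h"
  proof (cases "h * v powr (1 / p) \<le> A v")
   case True
   then show ?thesis by (simp add: add_increasing2 ennreal_leI)
  next
   case False
   then have less: "A v < h * v powr (1 / p)" by simp
   have au: "\<alpha> u \<le> h" if u: "u \<le> v" for u
   proof (cases "u \<le> c")
    case False
    then have cu: "c < u" "0 < u" "c < v" "0 < v" using u c by auto
    have "\<alpha> u \<le> \<alpha> v"
    proof -
     have "A u * v \<le> A v * u" using young_quotient_mono[OF Y cu(2) u] .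
     then have "A u \<le> A v * u / v" using cu by (simp add: field_simps)
     then have "A u * u powr (- 1 / p) \<le> A v * u / v * u powr (- 1 / p)" by (rule mult_right_mono) simp
     then have "\<alpha> u \<le> A v * u / v * u powr (- 1 / p)" using cu by (simp add: avc)
     also have "\<dots> = A v / v * u powr (1 - 1 / p)"
      using cu by (simp add: powr_diff powr_minus_divide field_simps)
     also have "\<dots> \<le> A v / v * v powr (1 - 1 / p)"
      using cu u p young_nonneg[OF Y, of v] by (intro mult_left_mono powr_mono2) auto
     also have "\<dots> = \<alpha> v" using cu by (simp add: avc powr_diff powr_minus_divide field_simps)
     finally show ?thesis .
    qed
    also have "\<alpha> v \<le> h"
    proof -
     have "A v * v powr (- 1 / p) \<le> h * v powr (1 / p) * v powr (- 1 / p)" using less by (intro mult_right_mono) auto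
     also have "\<dots> = h" using cu by (simp add: mult.assoc powr_add[symmetric])
     finally show ?thesis using cu by (simp add: avc)
    qed
    finally show ?thesis .
   qed (use h in \<open>simp add: \<alpha>_def\<close>)
   have "ennreal (h * v powr (1 / p)) = ennreal h * (\<integral>\<^sup>+u. m u * indicator {..v} u \<partial>lborel)"
    using mint[OF v] h by (simp add: ennreal_mult)
   also have "\<dots> \<le> orlicz_phi m \<alpha> h"
    unfolding orlicz_phi_def using au by (intro mult_left_mono nn_integral_mono) (auto simp: indicator_def)
   finally show ?thesis by (simp add: add_increasing)
  qed
 qed (use mm am \<kappa> B in auto)
qed

definition product_bound where
 "product_bound S f g G \<longleftrightarrow> (\<forall>x r. 0 < r \<longrightarrow> S x r \<longrightarrow>
  (NR y\<in>ball x r. f y) * (NR y\<in>ball x r. g y) \<le> \<mu> (ball x r) * \<mu> (ball x r) * G x)"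

text \<open>On a ball where \<open>w\<close> has Luxemburg norm \<open>lam0\<close>, the key
  inequality bounds the mean of \<open>h w powr (1 / p)\<close> by \<open>lam0 powr (1 / p)\<close>
  times an Orlicz mean of \<open>h\<close>. As \<open>lam0 \<le> W\<close> on the ball, this factor
  can be moved to \<open>f\<close>, whose mean becomes one of \<open>f W powr (1 / p)\<close>. The
  product is then controlled by two maximal functions, bounded on \<open>L^p\<close> and on
  \<open>L^p'\<close>, and Young's inequality separates them.\<close>

lemma two_weight_maximal:
 fixes A :: "real \<Rightarrow> real"
 assumes p: "1 < p" and A: "A \<in> class_D p"
 shows "\<exists>C\<ge>0. \<forall>(f :: 'a::euclidean_space \<Rightarrow> real) h w W M.
  f \<in> \<M> \<longrightarrow> h \<in> \<M> \<longrightarrow> w \<in> \<M> \<longrightarrow> W \<in> \<M> \<longrightarrow>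
  (\<forall>x. 0 \<le> f x \<and> f x \<le> M \<and> 0 \<le> h x \<and> h x \<le> M \<and> 0 \<le> w x \<and> w x \<le> M \<and> 0 \<le> W x) \<longrightarrow>
  (\<exists>G\<in>\<M>.
   (NN x. G x) \<le> ennreal C * ((NR x. f x powr p * W x) + (NR x. h x powr (p / (p - 1)))) \<and>
   product_bound (\<lambda>x r. \<forall>y\<in>ball x r. luxemburg A (ball x r) w \<le> ennreal (W y)) f (\<lambda>y. h y * w y powr (1 / p)) G)"
proof -
 have Y: "young_function A" using A by (simp add: class_D_def)
 define p' where "p' = p / (p - 1)"
 have p': "1 < p'" "1 / p + 1 / p' = 1" using p by (auto simp: p'_def field_simps)
 obtain m \<alpha> \<kappa> B where ma: "m \<in> borel_measurable borel" "\<alpha> \<in> borel_measurable borel" and \<kappa>: "0 < \<kappa>" "orlicz_phi m \<alpha> \<kappa> \<le> 1 / 2"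
  and B: "(\<integral>\<^sup>+v. m v * ennreal (max \<kappa> (\<alpha> v) powr (1 - p / (p - 1))) \<partial>lborel) \<le> ennreal B" "0 \<le> B"
  and key: "\<And>h v. 0 \<le> h \<Longrightarrow> 0 \<le> v \<Longrightarrow> ennreal (h * v powr (1 / p)) \<le> ennreal (A v) + orlicz_phi m \<alpha> h"
  by (rule class_D_orlicz[OF p A]) (rule that)
 have Phim[measurable]: "orlicz_phi m \<alpha> \<in> borel_measurable borel" by (rule orlicz_phi_measurable[OF ma])
 have "continuous_on {0..} A" using Y by (simp add: young_function_def)
 then have Am: "(\<lambda>t. if t \<in> {0..} then A t else 0) \<in> borel_measurable borel"
  by (intro borel_measurable_continuous_on_if) auto
 obtain C2 where C2: "0 \<le> C2" and max2: "\<forall>h::'a \<Rightarrow> real. h \<in> \<M> \<longrightarrow> (\<forall>x. 0 \<le> h x) \<longrightarrow>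
  (\<exists>S\<in>\<M>.
   (NN x. S x) \<le> ennreal C2 * (NR x. h x powr p') \<and>
   (\<forall>x y. 0 \<le> y \<longrightarrow> (\<forall>t. 0 < t \<longrightarrow> t < y \<longrightarrow> (\<exists>r>0. \<mu> (ball x r)
     < (NN z\<in>ball x r. orlicz_phi m \<alpha> (h z / t)))) \<longrightarrow> ennreal (y powr p') \<le> S x))"
  using maximal_bound[where 'a='a, OF ma p'(1) \<kappa> B[folded p'_def]] by (elim exE conjE) (rule that)
 obtain C1 where C1: "0 \<le> C1" and max1: "\<forall>h::'a \<Rightarrow> real. h \<in> \<M> \<longrightarrow> (\<forall>x. 0 \<le> h x) \<longrightarrow>
  (\<exists>S\<in>\<M>.
   (NN x. S x) \<le> ennreal C1 * (NR x. h x powr p) \<and>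
   (\<forall>x y r. 0 \<le> y \<longrightarrow> 0 < r \<longrightarrow> ennreal y * \<mu> (ball x r) \<le> (NR z\<in>ball x r. h z)
     \<longrightarrow> ennreal (y powr p) \<le> S x))"
  using Hardy_Littlewood_maximal[where 'a='a, OF p] by (elim exE conjE) (rule that)
 define C where "C = 2 * max C1 C2"
 show ?thesis
 proof (intro exI[of _ C] conjI allI impI)
  show "0 \<le> C" using C1 by (simp add: C_def)
  fix f h w W :: "'a \<Rightarrow> real" and M :: real
  assume [measurable]: "f \<in> \<M>" "h \<in> \<M>" "w \<in> \<M>" "W \<in> \<M>"
   and bd: "\<forall>x. 0 \<le> f x \<and> f x \<le> M \<and> 0 \<le> h x \<and> h x \<le> M \<and> 0 \<le> w x \<and> w x \<le> M \<and> 0 \<le> W x"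
  define F where "F x = f x * W x powr (1 / p)" for x
  have [measurable]: "F \<in> \<M>" unfolding F_def by measurable
  obtain S1 where S1m[measurable]: "S1 \<in> \<M>"
   and S1i: "(NN x. S1 x) \<le> ennreal C1 * (NR x. F x powr p)"
   and S1: "\<forall>x y r. 0 \<le> y \<longrightarrow> 0 < r \<longrightarrow> ennreal y * \<mu> (ball x r) \<le> (NR z\<in>ball x r. F z)
     \<longrightarrow> ennreal (y powr p) \<le> S1 x"
  proof -
   have "F \<in> \<M>" "\<forall>x. 0 \<le> F x" using bd by (auto simp: F_def)
   from max1[THEN spec, THEN mp, THEN mp, OF this] show thesis by (elim bexE conjE) (rule that)
  qed
  obtain S2 where S2m[measurable]: "S2 \<in> \<M>"
   and S2i: "(NN x. S2 x) \<le> ennreal C2 * (NR x. h x powr p')"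
   and S2: "\<forall>x y. 0 \<le> y \<longrightarrow> (\<forall>t. 0 < t \<longrightarrow> t < y \<longrightarrow> (\<exists>r>0. \<mu> (ball x r)
     < (NN z\<in>ball x r. orlicz_phi m \<alpha> (h z / t)))) \<longrightarrow> ennreal (y powr p') \<le> S2 x"
  proof -
   have "h \<in> \<M>" "\<forall>x. 0 \<le> h x" using bd by auto
   from max2[THEN spec, THEN mp, THEN mp, OF this] show thesis by (elim bexE conjE) (rule that)
  qed
  define G where "G x = 2 * (S1 x + S2 x)" for x
  have Gi: "(NN x. G x) \<le> ennreal C * ((NR x. f x powr p * W x) + (NR x. h x powr p'))"
  proof -
   have Fe: "F x powr p = f x powr p * W x" for x using bd p by (simp add: F_def powr_mult powr_powr)
   have "(NN x. G x) = 2 * ((NN x. S1 x) + (NN x. S2 x))"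
    unfolding G_def by (simp add: nn_integral_cmult nn_integral_add)
   also have "\<dots> \<le> 2 * (ennreal (max C1 C2) * (NR x. F x powr p) + ennreal (max C1 C2) * (NR x. h x powr p'))"
   proof (intro mult_left_mono add_mono)
    show "(NN x. S1 x) \<le> ennreal (max C1 C2) * (NR x. F x powr p)"
     by (rule order_trans[OF S1i]) (intro mult_right_mono ennreal_leI; simp)
    show "(NN x. S2 x) \<le> ennreal (max C1 C2) * (NR x. h x powr p')"
     by (rule order_trans[OF S2i]) (intro mult_right_mono ennreal_leI; simp)
   qed simp
   also have "\<dots> = ennreal C * ((NR x. F x powr p) + (NR x. h x powr p'))"
   proof -
    have "ennreal C = 2 * ennreal (max C1 C2)" unfolding C_def using C1 by (simp add: ennreal_mult)
    then show ?thesis by (simp only: distrib_left mult.assoc)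
   qed
   finally show ?thesis unfolding Fe .
  qed
  have Gb: "(NR y\<in>ball x r. f y) * (NR y\<in>ball x r. h y * w y powr (1 / p))
      \<le> \<mu> (ball x r) * \<mu> (ball x r) * G x"
   if r: "0 < r" and lux: "\<forall>y\<in>ball x r. luxemburg A (ball x r) w \<le> ennreal (W y)" for x r
  proof -
   have M0: "0 \<le> M" using bd[rule_format, of x] by linarith
   define b where "b = unit_ball_vol (DIM('a)) * r ^ DIM('a)"
   have b: "0 < b" "\<mu> (ball x r) = ennreal b"
    using r emeasure_lebesgue_ball[of r x] by (auto simp: b_def)
   have fin: "\<exists>i\<ge>0. (NR y\<in>ball x r. u y) = ennreal i" if "\<And>y. u y \<le> N" "0 \<le> N" for u N
   proof -
    have "(NR y\<in>ball x r. u y) \<le> (NN y. ennreal N * indicator (ball x r) y)"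
     using that by (intro nn_integral_mono mult_right_mono ennreal_leI) auto
    also have "\<dots> = ennreal N * ennreal b" using b(2) by (subst nn_integral_cmult_indicator) auto
    also have "\<dots> < \<infinity>" by (simp add: ennreal_mult_less_top)
    finally show ?thesis by (cases "(NR y\<in>ball x r. u y)") auto
   qed
   obtain I1 where I1: "0 \<le> I1" "(NR y\<in>ball x r. f y) = ennreal I1"
    using fin[of f M] bd M0 by auto
   obtain I2 where I2: "0 \<le> I2" "(NR y\<in>ball x r. h y * w y powr (1 / p)) = ennreal I2"
   proof -
    have "h y * w y powr (1 / p) \<le> M * M powr (1 / p)" for y
     using bd[rule_format, of y] p by (intro mult_mono powr_mono2) auto
    then show thesis using fin[of "\<lambda>y. h y * w y powr (1 / p)" "M * M powr (1 / p)"] M0 that by auto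
   qed
   have "x \<in> ball x r" using r by simp
   then have "luxemburg A (ball x r) w \<le> ennreal (W x)" using lux by blast
   then obtain lam0 where l0: "0 \<le> lam0" "luxemburg A (ball x r) w = ennreal lam0"
    by (cases "luxemburg A (ball x r) w") (auto simp: top_unique)
   have lW: "lam0 \<le> W y" if "y \<in> ball x r" for y using lux that l0 bd by (auto simp: ennreal_le_iff)
   \<comment> \<open>If the Orlicz mean at level \<open>t\<close> were at most 1, every admissible
     \<open>l\<close> for \<open>w\<close> would satisfy
     \<open>I2 \<le> 2 b t l powr (1 / p)\<close>; the same would hold for the infimum
     \<open>lam0\<close>, contrary to the choice of \<open>t\<close>.\<close>
   have Phi_large: "\<mu> (ball x r) < (NN z\<in>ball x r. orlicz_phi m \<alpha> (h z / t))"
    if t: "0 < t" and big: "2 * b * t * lam0 powr (1 / p) < I2" for t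
   proof (rule ccontr)
    assume "\<not> ?thesis"
    then have small: "(NN z\<in>ball x r. orlicz_phi m \<alpha> (h z / t)) \<le> ennreal b" unfolding b(2) by simp
    have "ennreal ((I2 / (2 * b * t)) powr p) \<le> luxemburg A (ball x r) w"
    proof (rule luxemburg_lower[OF _ r])
     fix l :: real assume l: "0 < l" "(NR x\<in>ball x r. A (\<bar>w x\<bar> / l)) \<le> \<mu> (ball x r)"
     have Alm[measurable]: "(\<lambda>x. A (\<bar>w x\<bar> / l)) \<in> \<M>"
     proof -
      have "(\<lambda>x. A (\<bar>w x\<bar> / l)) = (\<lambda>x. (\<lambda>t. if t \<in> {0..} then A t else 0) (\<bar>w x\<bar> / l))" using l(1) by (auto simp: fun_eq_iff)
      also have "\<dots> \<in> \<M>" by (rule measurable_compose[OF _ Am]) measurable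
      finally show ?thesis .
     qed
     define s where "s = t * l powr (1 / p)"
     have s: "0 < s" using t l(1) by (simp add: s_def)
     have "ennreal I2 \<le> (NN y. ennreal s * (ennreal (A (\<bar>w y\<bar> / l)) * indicator (ball x r) y + orlicz_phi m \<alpha> (h y / t) * indicator (ball x r) y))"
      unfolding I2(2)[symmetric]
     proof (rule nn_integral_mono)
      fix y
      have aw: "\<bar>w y\<bar> = w y" using bd by simp
      have hw: "h y * w y powr (1 / p) = s * ((h y / t) * (w y / l) powr (1 / p))"
       using t l(1) bd by (simp add: s_def powr_divide)
      have "ennreal ((h y / t) * (w y / l) powr (1 / p)) \<le> ennreal (A (w y / l)) + orlicz_phi m \<alpha> (h y / t)"
       using bd t l(1) by (intro key) auto
      then have "ennreal s * ennreal ((h y / t) * (w y / l) powr (1 / p)) \<le> ennreal s * (ennreal (A (w y / l)) + orlicz_phi m \<alpha> (h y / t))"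
       by (rule mult_left_mono) simp
      then have "ennreal (h y * w y powr (1 / p)) \<le> ennreal s * (ennreal (A (\<bar>w y\<bar> / l)) + orlicz_phi m \<alpha> (h y / t))"
       unfolding hw aw ennreal_mult'[OF less_imp_le[OF s]] .
      then show "ennreal (h y * w y powr (1 / p)) * indicator (ball x r) y \<le> ennreal s * (ennreal (A (\<bar>w y\<bar> / l)) * indicator (ball x r) y + orlicz_phi m \<alpha> (h y / t) * indicator (ball x r) y)"
       by (auto simp: indicator_def)
     qed
     also have "\<dots> = ennreal s * ((NR y\<in>ball x r. A (\<bar>w y\<bar> / l)) + (NN y\<in>ball x r. orlicz_phi m \<alpha> (h y / t)))"
      by (simp add: nn_integral_cmult nn_integral_add)
     also have "\<dots> \<le> ennreal s * (ennreal b + ennreal b)"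
      using l(2) small unfolding b(2) by (intro mult_left_mono add_mono) auto
     also have "\<dots> = ennreal (s * (b + b))"
      using ennreal_mult'[OF less_imp_le[OF s], of "b + b"] ennreal_plus[of b b] b(1) by (simp only: less_imp_le)
     finally have "I2 \<le> s * (b + b)" by (subst (asm) ennreal_le_iff) (use s b in auto)
     then have "I2 / (2 * b * t) \<le> l powr (1 / p)" using t b by (simp add: s_def field_simps)
     then have "(I2 / (2 * b * t)) powr p \<le> (l powr (1 / p)) powr p" using I2 b t p by (intro powr_mono2) auto
     also have "\<dots> = l" using p l(1) by (simp add: powr_powr)
     finally show "ennreal ((I2 / (2 * b * t)) powr p) \<le> ennreal l" by (rule ennreal_leI)
    qed
    then have "(I2 / (2 * b * t)) powr p \<le> lam0" unfolding l0(2) using l0(1) by (simp add: ennreal_le_iff)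
    then have "((I2 / (2 * b * t)) powr p) powr (1 / p) \<le> lam0 powr (1 / p)" using p by (intro powr_mono2) auto
    then have "I2 / (2 * b * t) \<le> lam0 powr (1 / p)" using I2 b t p by (simp add: powr_powr)
    then show False using big b t by (simp add: field_simps)
   qed
   have yS2: "ennreal (y powr p') \<le> S2 x" if y: "0 \<le> y" "\<And>t. 0 < t \<Longrightarrow> t < y \<Longrightarrow> 2 * b * t * lam0 powr (1 / p) < I2" for y
    using S2[THEN spec[of _ x], THEN spec[of _ y], THEN mp, OF y(1)] Phi_large y(2) r by blast
   have "ennreal I1 * ennreal I2 \<le> ennreal b * ennreal b * G x"
   proof (cases "I1 = 0 \<or> I2 = 0")
    case False
    then have pos: "0 < I1" "0 < I2" using I1 I2 by auto
    show ?thesis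
    proof (cases "lam0 = 0")
     case True
     \<comment> \<open>With \<open>lam0 = 0\<close> every level is exceeded, so \<open>S2 x\<close>
       lies above every power. The level is taken large enough to dominate the product, and at least
       1 so that \<open>y \<le> y powr p'\<close>.\<close>
     define y where "y = max 1 (I1 * I2 / (b * b))"
     have "2 * b * t * lam0 powr (1 / p) < I2" for t using True pos by simp
     then have "ennreal (y powr p') \<le> S2 x" by (intro yS2) (auto simp: y_def)
     moreover have "y powr 1 \<le> y powr p'" using p' by (intro powr_mono) (auto simp: y_def)
     then have "ennreal y \<le> ennreal (y powr p')" by (intro ennreal_leI) (simp add: y_def)
     ultimately have "ennreal y \<le> S2 x" by (rule order_trans[rotated])
     also have "\<dots> \<le> G x" unfolding G_def by (simp add: mult_2 add_increasing add_increasing2)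
     finally have yG: "ennreal y \<le> G x" .
     have "I1 * I2 \<le> b * b * y" using b by (simp add: y_def max_def field_simps)
     then have "ennreal I1 * ennreal I2 \<le> ennreal (b * b * y)" using I1 I2 by (simp add: ennreal_mult[symmetric] ennreal_leI)
     also have "\<dots> = ennreal b * ennreal b * ennreal y" using b by (simp add: ennreal_mult y_def)
     also have "\<dots> \<le> ennreal b * ennreal b * G x" using yG by (rule mult_left_mono) simp
     finally show ?thesis .
    next
     case False
     then have lpos: "0 < lam0" using l0 by simp
     define k where "k = lam0 powr (1 / p)"
     have k: "0 < k" using lpos by (simp add: k_def)
     \<comment> \<open>The supremum of the levels allowed by \<open>Phi_large\<close>. With
       \<open>y1\<close>, a lower bound for the mean of \<open>F\<close>, it satisfies
       \<open>I1 * I2 = 2 b^2 y1 y2\<close>.\<close>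
     define y2 where "y2 = I2 / (2 * b * k)"
     have y2: "0 \<le> y2" using pos b k by (simp add: y2_def)
     have "2 * b * t * lam0 powr (1 / p) < I2" if "t < y2" for t
      using that b k unfolding k_def[symmetric] y2_def by (simp add: field_simps)
     then have s2: "ennreal (y2 powr p') \<le> S2 x" using y2 by (intro yS2) auto
     define y1 where "y1 = I1 * k / b"
     have y1: "0 \<le> y1" using pos b k by (simp add: y1_def)
     have "ennreal k * ennreal I1 = (NN z. ennreal k * (ennreal (f z) * indicator (ball x r) z))"
      unfolding I1(2)[symmetric] by (rule nn_integral_cmult[symmetric]) measurable
     also have "\<dots> \<le> (NR z\<in>ball x r. F z)"
     proof (rule nn_integral_mono)
      fix z
      show "ennreal k * (ennreal (f z) * indicator (ball x r) z) \<le> ennreal (F z) * indicator (ball x r) z"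
      proof (cases "z \<in> ball x r")
       case True
       have "k \<le> W z powr (1 / p)" unfolding k_def using lW[OF True] l0 p by (intro powr_mono2) auto
       then have "k * f z \<le> W z powr (1 / p) * f z" by (rule mult_right_mono) (use bd in simp)
       then have "k * f z \<le> F z" by (simp add: F_def mult.commute)
       then show ?thesis using True bd k by (simp add: ennreal_mult[symmetric] ennreal_leI)
      qed simp
     qed
     finally have "ennreal y1 * \<mu> (ball x r) \<le> (NR z\<in>ball x r. F z)"
      unfolding b(2) using b(1) k I1(1) by (simp add: y1_def ennreal_mult[symmetric] mult.commute)
     then have s1: "ennreal (y1 powr p) \<le> S1 x"
      using S1[THEN spec[of _ x], THEN spec[of _ y1], THEN spec[of _ r], THEN mp, THEN mp, THEN mp, OF y1 r] by simp
     have "y1 * y2 \<le> y1 powr p / p + y2 powr p' / p'" using Youngs_inequality[OF p p'] y1 y2 by simp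
     also have "\<dots> \<le> y1 powr p / 1 + y2 powr p' / 1"
      using p p' by (intro add_mono divide_left_mono) auto
     finally have "ennreal (y1 * y2) \<le> ennreal (y1 powr p) + ennreal (y2 powr p')"
      by (simp add: ennreal_plus[symmetric] ennreal_leI del: ennreal_plus)
     also have "\<dots> \<le> S1 x + S2 x" using s1 s2 by (rule add_mono)
     finally have le: "2 * ennreal (y1 * y2) \<le> G x" unfolding G_def by (rule mult_left_mono) simp
     have "I1 * I2 = b * b * (2 * (y1 * y2))" using b k by (simp add: y1_def y2_def)
     then have "ennreal I1 * ennreal I2 = ennreal (b * b * (2 * (y1 * y2)))" using I1 I2 by (simp add: ennreal_mult[symmetric])
     also have "\<dots> = ennreal b * ennreal b * (2 * ennreal (y1 * y2))" using b y1 y2 by (simp add: ennreal_mult)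
     also have "\<dots> \<le> ennreal b * ennreal b * G x" using le by (rule mult_left_mono) simp
     finally show ?thesis .
    qed
   qed auto
   then show ?thesis unfolding I1(2) I2(2) b(2) .
  qed
  show "\<exists>G\<in>\<M>.
   (NN x. G x) \<le> ennreal C * ((NR x. f x powr p * W x) + (NR x. h x powr (p / (p - 1)))) \<and>
   product_bound (\<lambda>x r. \<forall>y\<in>ball x r. luxemburg A (ball x r) w \<le> ennreal (W y)) f (\<lambda>y. h y * w y powr (1 / p)) G"
   unfolding product_bound_def
  proof (intro bexI[of _ G] conjI allI impI)
   show "G \<in> \<M>" unfolding G_def[abs_def] by measurable
   show "(NN x. G x) \<le> ennreal C * ((NR x. f x powr p * W x) + (NR x. h x powr (p / (p - 1))))"
    using Gi unfolding p'_def .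
  qed (rule Gb)
 qed
qed

section \<open>The critical scale\<close>

text \<open>The exponent \<open>N / (N + 1)\<close> is weakened to 1 and the lower bound is solved
  for \<open>\<rho> x\<close>. Comparing a point with itself shows that the constant is at least
  1.\<close>

lemma critical_radius_bounds:
 fixes \<rho> :: "'a::euclidean_space \<Rightarrow> real"
 assumes "critical_radius_function \<rho>"
 obtains C N where "1 \<le> C" "1 \<le> N" "\<And>x. 0 < \<rho> x"
  "\<And>x y. \<rho> y \<le> C * \<rho> x * (1 + norm (x - y) / \<rho> x)"
  "\<And>x y. \<rho> x \<le> C * \<rho> y * (1 + norm (x - y) / \<rho> x) powr N"
proof -
 obtain C N where pos: "\<And>x. 0 < \<rho> x" and C: "0 < C" and N: "1 \<le> N"
  and le: "\<And>x y. inverse C * \<rho> x * (1 + norm (x - y) / \<rho> x) powr (- N) \<le> \<rho> y"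
   "\<And>x y. \<rho> y \<le> C * \<rho> x * (1 + norm (x - y) / \<rho> x) powr (N / (N + 1))"
  using assms unfolding critical_radius_function_def by blast
 have one: "1 \<le> 1 + norm (x - y) / \<rho> x" for x y using pos[of x] by simp
 show thesis
 proof (rule that[of C N])
  show "1 \<le> C" using le(2)[of undefined undefined] pos[of undefined] by simp
  show "\<rho> y \<le> C * \<rho> x * (1 + norm (x - y) / \<rho> x)" for x y
  proof -
   have "(1 + norm (x - y) / \<rho> x) powr (N / (N + 1)) \<le> (1 + norm (x - y) / \<rho> x) powr 1"
    using N one by (intro powr_mono) auto
   then have "C * \<rho> x * (1 + norm (x - y) / \<rho> x) powr (N / (N + 1)) \<le> C * \<rho> x * (1 + norm (x - y) / \<rho> x)"
    using C pos[of x] one[of x y] by (intro mult_left_mono) (auto simp: less_imp_le)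
   then show ?thesis using le(2)[of y x] by linarith
  qed
  show "\<rho> x \<le> C * \<rho> y * (1 + norm (x - y) / \<rho> x) powr N" for x y
  proof -
   define t where "t = (1 + norm (x - y) / \<rho> x) powr N"
   have t: "0 < t" unfolding t_def using one[of x y] by simp
   have "inverse C * \<rho> x * (1 / t) \<le> \<rho> y"
    using le(1)[of x y] by (simp add: t_def powr_minus_divide)
   then show ?thesis using C t unfolding t_def[symmetric] by (simp add: field_simps)
  qed
 qed (use N pos in auto)
qed

section \<open>Cubes of critical size\<close>

lemma dside_small:
 assumes "0 < \<epsilon>"
 obtains n where "dside n \<le> \<epsilon>"
proof -
 obtain k :: nat where "(1 / 2) ^ k < \<epsilon>" using real_arch_pow_inv[of \<epsilon> "1/2"] assms by auto
 then have "dside (int k) \<le> \<epsilon>" by (simp add: dside_def powr_minus powr_realpow power_divide inverse_eq_divide)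
 then show thesis by (rule that)
qed

lemma dside_bounded_below: "\<exists>N. \<forall>n<N. \<not> dside n \<le> M"
proof -
 obtain k :: nat where k: "M < 2 ^ k" using real_arch_pow[of 2 M] by auto
 have "M < dside n" if "n < - int k" for n
 proof -
  have "(2::real) ^ k = 2 powr real k" by (simp add: powr_realpow)
  also have "\<dots> \<le> dside n" unfolding dside_def using that by simp
  finally show ?thesis using k by simp
 qed
 then show ?thesis by (intro exI[of _ "- int k"]) (auto simp: not_le)
qed

text \<open>The cubes are maximal with side at most \<open>c \<rho>\<close> at all their points. The
  parent violates this at some point, which by \<open>2 * DIM('a) * c \<le> 1\<close> lies within
  \<open>\<rho> x\<close> of \<open>x\<close>, where \<open>\<rho>\<close> is comparable; so the
  side is also bounded below by a multiple of \<open>\<rho>\<close>.\<close>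

lemma critical_cubes:
 fixes \<rho> :: "'a::euclidean_space \<Rightarrow> real" and \<beta> c :: real
 assumes pos: "\<And>x. 0 < \<rho> x" and beta: "1 \<le> \<beta>" "\<And>x y. norm (x - y) \<le> \<rho> x \<Longrightarrow> \<rho> x \<le> \<beta> * \<rho> y"
  and c: "0 < c" "2 * real DIM('a) * c \<le> 1"
 obtains \<P> \<sigma> where "countable \<P>" "disjoint \<P>" "\<Union>\<P> = UNIV" "\<sigma> \<in> \<M>"
  "\<And>P. P \<in> \<P> \<Longrightarrow> \<exists>n x. P = dcube n x \<and> (\<forall>y\<in>P. \<sigma> y = dside n)"
  "\<And>x. 0 < \<sigma> x" "\<And>x. \<sigma> x \<le> c * \<rho> x" "\<And>x. c * \<rho> x \<le> 2 * \<beta> * \<sigma> x"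
proof -
 define S where "S n x \<longleftrightarrow> (\<forall>y\<in>dcube n x. dside n \<le> c * \<rho> y)" for n x
 have inv: "S n y" if "S n x" "y \<in> dcube n x" for n x y
  using that(1) unfolding S_def dcube_eq[OF that(2)] .
 have bdd: "\<exists>N. \<forall>n<N. \<not> S n x" for x
 proof -
  obtain N where "\<forall>n<N. \<not> dside n \<le> c * \<rho> x" using dside_bounded_below by blast
  then have "\<forall>n<N. \<not> S n x" unfolding S_def using dcube_self by blast
  then show ?thesis by blast
 qed
 have ex: "\<exists>n. S n x" for x
 proof -
  \<comment> \<open>The first entry keeps the cube within \<open>\<rho> x\<close> of
    \<open>x\<close>, so that comparability applies; the second then gives the side condition at all
    its points.\<close>
  have "0 < min (\<rho> x / DIM('a)) (c * \<rho> x / \<beta>)" using pos[of x] c beta(1) by simp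
  then obtain n where n: "dside n \<le> min (\<rho> x / DIM('a)) (c * \<rho> x / \<beta>)" by (rule dside_small)
  have "dside n \<le> c * \<rho> y" if "y \<in> dcube n x" for y
  proof -
   have "norm (x - y) \<le> DIM('a) * dside n" using dcube_norm_diff[OF dcube_self that] .
   also have "\<dots> \<le> \<rho> x" using n by (simp add: field_simps)
   finally have "\<rho> x \<le> \<beta> * \<rho> y" by (rule beta(2))
   then have "c * \<rho> x / \<beta> \<le> c * \<rho> y" using c beta(1) by (simp add: field_simps)
   then show ?thesis using n by simp
  qed
  then show ?thesis unfolding S_def by blast
 qed
 obtain \<Q> where Q: "countable \<Q>" "disjoint \<Q>" "\<Union>\<Q> = {x. \<exists>n. S n x}"
  "\<And>Q. Q \<in> \<Q> \<Longrightarrow> \<exists>n x. Q = dcube n x \<and> S n x \<and> (\<forall>m<n. \<not> S m x)"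
  by (rule dyadic_stopping[of S]) (erule inv, assumption, rule bdd, rule that)
 have U: "\<Union>\<Q> = UNIV" unfolding Q(3) using ex by blast
 define \<tau> where "\<tau> x = (THE n. S n x \<and> (\<forall>m<n. \<not> S m x))" for x
 define \<sigma> where "\<sigma> x = dside (\<tau> x)" for x
 have tau: "\<tau> x = n" if "S n x" "\<forall>m<n. \<not> S m x" for x n
  unfolding \<tau>_def
 proof (rule the_equality)
  show "S n x \<and> (\<forall>m<n. \<not> S m x)" using that by blast
  show "k = n" if "S k x \<and> (\<forall>m<k. \<not> S m x)" for k
   using that \<open>S n x\<close> \<open>\<forall>m<n. \<not> S m x\<close> by (meson linorder_neqE)
 qed
 have QS: "\<exists>n x. Q = dcube n x \<and> (\<forall>y\<in>Q. S n y \<and> (\<forall>m<n. \<not> S m y) \<and> \<sigma> y = dside n)" if QQ: "Q \<in> \<Q>" for Q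
 proof -
  obtain n x where nx: "Q = dcube n x" "S n x" "\<forall>m<n. \<not> S m x" using Q(4)[OF QQ] by blast
  have "S n y \<and> (\<forall>m<n. \<not> S m y) \<and> \<sigma> y = dside n" if y: "y \<in> Q" for y
  proof -
   have yd: "y \<in> dcube n x" using y nx(1) by simp
   have 1: "S n y" by (rule inv[OF nx(2) yd])
   have 2: "\<not> S m y" if m: "m < n" for m
   proof
    assume "S m y"
    moreover have "x \<in> dcube m y" using dcube_mono[of m n y] m dcube_sym[OF yd] by auto
    ultimately have "S m x" by (rule inv)
    then show False using nx(3) m by blast
   qed
   show ?thesis using 1 2 tau[of n y] by (auto simp: \<sigma>_def)
  qed
  then show ?thesis using nx(1) by blast
 qed
 show thesis
 proof (rule that[of \<Q> \<sigma>])
  show "\<sigma> \<in> \<M>"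
  proof (rule measurableI)
   fix A :: "real set" assume "A \<in> sets borel"
   have "\<sigma> -` A \<inter> space lebesgue = \<Union>{Q \<in> \<Q>. \<forall>y\<in>Q. \<sigma> y \<in> A}"
   proof
    show "\<Union>{Q \<in> \<Q>. \<forall>y\<in>Q. \<sigma> y \<in> A} \<subseteq> \<sigma> -` A \<inter> space lebesgue" by auto
    show "\<sigma> -` A \<inter> space lebesgue \<subseteq> \<Union>{Q \<in> \<Q>. \<forall>y\<in>Q. \<sigma> y \<in> A}"
    proof
     fix x assume x: "x \<in> \<sigma> -` A \<inter> space lebesgue"
     obtain Q' where Q': "Q' \<in> \<Q>" "x \<in> Q'" using U by auto
     have "\<forall>y\<in>Q'. \<sigma> y = \<sigma> x" using QS[OF Q'(1)] Q'(2) by fastforce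
     moreover have "\<sigma> x \<in> A" using x by simp
     ultimately have "\<forall>y\<in>Q'. \<sigma> y \<in> A" by simp
     then show "x \<in> \<Union>{Q \<in> \<Q>. \<forall>y\<in>Q. \<sigma> y \<in> A}" using Q' by blast
    qed
   qed
   moreover have "\<Union>{Q \<in> \<Q>. \<forall>y\<in>Q. \<sigma> y \<in> A} \<in> \<L>"
   proof (rule sets.countable_Union)
    show "countable {Q \<in> \<Q>. \<forall>y\<in>Q. \<sigma> y \<in> A}" using Q(1) by (rule countable_subset[rotated]) auto
    show "{Q \<in> \<Q>. \<forall>y\<in>Q. \<sigma> y \<in> A} \<subseteq> \<L>" using QS by fastforce
   qed
   ultimately show "\<sigma> -` A \<inter> space lebesgue \<in> \<L>" by simp
  qed simp
  show "\<exists>n x. P = dcube n x \<and> (\<forall>y\<in>P. \<sigma> y = dside n)" if "P \<in> \<Q>" for P using QS[OF that] by blast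
  show "0 < \<sigma> x" for x by (simp add: \<sigma>_def)
  fix x
  obtain Q' where Q': "Q' \<in> \<Q>" "x \<in> Q'" using U by auto
  obtain n x0 where n: "Q' = dcube n x0" "S n x" "\<forall>m<n. \<not> S m x" "\<sigma> x = dside n" using QS[OF Q'(1)] Q'(2) by blast
  show sx: "\<sigma> x \<le> c * \<rho> x" using n(2) unfolding n(4) S_def by simp
  have "\<not> S (n - 1) x" using n(3) by simp
  then obtain y where y: "y \<in> dcube (n - 1) x" "c * \<rho> y < dside (n - 1)" unfolding S_def by auto
  have "norm (x - y) \<le> DIM('a) * dside (n - 1)" using dcube_norm_diff[OF dcube_self y(1)] .
  also have "\<dots> = 2 * DIM('a) * \<sigma> x" by (simp add: n(4) dside_Suc)
  also have "\<dots> \<le> 2 * DIM('a) * (c * \<rho> x)" using sx by (intro mult_left_mono) auto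
  also have "\<dots> = (2 * real DIM('a) * c) * \<rho> x" by simp
  also have "\<dots> \<le> 1 * \<rho> x" using c pos[of x] by (intro mult_right_mono) auto
  finally have "\<rho> x \<le> \<beta> * \<rho> y" by (intro beta(2)) simp
  then have "c * \<rho> x \<le> \<beta> * (c * \<rho> y)" using c by (simp add: mult_left_mono mult.left_commute)
  also have "\<dots> \<le> \<beta> * (2 * \<sigma> x)" using y(2) beta(1) by (intro mult_left_mono) (auto simp: n(4) dside_Suc)
  finally show "c * \<rho> x \<le> 2 * \<beta> * \<sigma> x" by simp
 qed (use Q U in auto)
qed

text \<open>For a power the Luxemburg norm is the \<open>L^s\<close> mean, by homogeneity. If the
  integral is infinite, no \<open>l\<close> is admissible and the norm is infinite as well.\<close>

lemma luxemburg_powr_bound: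
 fixes w :: "'a::euclidean_space \<Rightarrow> real" and s r L :: real
 assumes s: "1 \<le> s" and r: "0 < r" and w0: "\<And>x. 0 \<le> w x" and [measurable]: "w \<in> \<M>"
  and L: "luxemburg (\<lambda>t. t powr s) (ball c r) w \<le> ennreal L" "0 \<le> L"
 shows "(NR x\<in>ball c r. w x powr s) \<le> ennreal (L powr s) * \<mu> (ball c r)"
proof -
 define b where "b = unit_ball_vol (DIM('a)) * r ^ DIM('a)"
 have b: "0 < b" "\<mu> (ball c r) = ennreal b"
  using r emeasure_lebesgue_ball[of r c] by (auto simp: b_def)
 define I where "I = (NR x\<in>ball c r. w x powr s)"
 have Il: "I \<le> ennreal (l powr s) * ennreal b" if l: "0 < l" "(NR x\<in>ball c r. (\<bar>w x\<bar> / l) powr s) \<le> \<mu> (ball c r)" for l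
 proof -
  have "I = (NN x. ennreal (l powr s) * (ennreal ((\<bar>w x\<bar> / l) powr s) * indicator (ball c r) x))"
   unfolding I_def using l(1) w0 by (intro nn_integral_cong) (auto simp: indicator_def ennreal_mult[symmetric] powr_divide)
  also have "\<dots> = ennreal (l powr s) * (NR x\<in>ball c r. (\<bar>w x\<bar> / l) powr s)"
   by (rule nn_integral_cmult) measurable
  finally show ?thesis using l(2) unfolding b(2) by (simp add: mult_left_mono)
 qed
 have "I \<le> ennreal (L powr s) * ennreal b"
 proof (cases I)
  case (real i)
  have "ennreal ((i / b) powr (1 / s)) \<le> luxemburg (\<lambda>t. t powr s) (ball c r) w"
  proof (rule luxemburg_lower[OF _ r])
   fix l assume l: "0 < l" "(NR x\<in>ball c r. (\<bar>w x\<bar> / l) powr s) \<le> \<mu> (ball c r)"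
   have "ennreal i \<le> ennreal (l powr s * b)" using Il[OF l] real b by (simp add: ennreal_mult)
   then have "i \<le> l powr s * b" by (subst (asm) ennreal_le_iff) (use b in auto)
   then have "i / b \<le> l powr s" using b by (simp add: field_simps)
   then have "(i / b) powr (1 / s) \<le> (l powr s) powr (1 / s)" using real b s by (intro powr_mono2) auto
   then show "ennreal ((i / b) powr (1 / s)) \<le> ennreal l" using s l(1) by (intro ennreal_leI) (simp add: powr_powr)
  qed
  then have "(i / b) powr (1 / s) \<le> L" using L by (meson ennreal_le_iff order_trans)
  then have "((i / b) powr (1 / s)) powr s \<le> L powr s" using s by (intro powr_mono2) auto
  then have "i / b \<le> L powr s" using s real b by (simp add: powr_powr)
  then have "i \<le> L powr s * b" using b by (simp add: field_simps)
  then show ?thesis using real b by (simp add: ennreal_mult[symmetric] ennreal_leI)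
 next
  case top
  have "top \<le> luxemburg (\<lambda>t. t powr s) (ball c r) w"
  proof (rule luxemburg_lower[OF _ r])
   fix l assume l: "0 < l" "(NR x\<in>ball c r. (\<bar>w x\<bar> / l) powr s) \<le> \<mu> (ball c r)"
   show "top \<le> ennreal l" using Il[OF l] top by (simp add: ennreal_mult[symmetric] b less_imp_le top_unique)
  qed
  then show ?thesis using L(1) by (simp add: top_unique)
 qed
 then show ?thesis unfolding I_def b(2) .
qed

lemma luxemburg_le:
 fixes w :: "'a::euclidean_space \<Rightarrow> real" and l r :: real
 assumes "0 < l" "0 < r" "\<And>x. A (\<bar>w x\<bar> / l) \<le> 1"
 shows "luxemburg A (ball c r) w \<le> ennreal l"
proof -
 define b where "b = unit_ball_vol (DIM('a)) * r ^ DIM('a)"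
 have b: "0 < b" "\<mu> (ball c r) = ennreal b"
  using assms emeasure_lebesgue_ball[of r c] by (auto simp: b_def)
 have "(NR x\<in>ball c r. A (\<bar>w x\<bar> / l)) \<le> (NN x. indicator (ball c r) x)"
 proof (rule nn_integral_mono)
  fix x
  have "ennreal (A (\<bar>w x\<bar> / l)) \<le> ennreal 1" using assms(3) by (rule ennreal_leI)
  then show "ennreal (A (\<bar>w x\<bar> / l)) * indicator (ball c r) x \<le> indicator (ball c r) x"
   by (auto simp: indicator_def)
 qed
 also have "\<dots> = ennreal b" using b(2) by (subst nn_integral_indicator) auto
 finally have "(NR x\<in>ball c r. A (\<bar>w x\<bar> / l)) / \<mu> (ball c r) \<le> ennreal b / ennreal b"
  unfolding b(2) by (rule divide_right_mono_ennreal)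
 also have "\<dots> = 1" using b(1) by (simp add: divide_ennreal)
 finally show ?thesis unfolding luxemburg_def using assms(1) by (intro Inf_lower) auto
qed

text \<open>The powers of \<open>1 + \<tau>\<close> come from the polynomial comparability of \<open>\<rho>\<close> at distance \<open>\<tau> \<sigma>\<close>.\<close>

lemma critical_annulus_comparable:
 fixes \<rho> \<sigma> :: "'a::euclidean_space \<Rightarrow> real" and C N c \<beta> t :: real
 assumes C: "1 \<le> C" and N: "1 \<le> N" and pos: "\<And>x. 0 < \<rho> x"
  and c1: "\<And>x y. \<rho> y \<le> C * \<rho> x * (1 + norm (x - y) / \<rho> x)"
  and c2: "\<And>x y. \<rho> x \<le> C * \<rho> y * (1 + norm (x - y) / \<rho> x) powr N"
  and s: "\<And>x. 0 < \<sigma> x" "\<And>x. \<sigma> x \<le> c * \<rho> x" "\<And>x. c * \<rho> x \<le> 2 * \<beta> * \<sigma> x"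
  and c: "0 < c" "2 * c \<le> 1" and b: "1 \<le> \<beta>" and t: "0 < t"
  and xy: "norm (x - y) < 2 * (t * \<sigma> y)"
 defines "R \<equiv> t * C * (1 + t) powr N * \<rho> x"
 shows "y \<in> ball x R" "1 / (t * \<sigma> y) ^ DIM('a) \<le> (2 * \<beta> * C\<^sup>2 / c) ^ DIM('a) * (1 + t) powr ((N + 1) * DIM('a)) / R ^ DIM('a)"
proof -
 have n: "norm (y - x) = norm (x - y)" by (rule norm_minus_commute)
 have "norm (x - y) / \<rho> y < 2 * (t * \<sigma> y) / \<rho> y" using xy pos[of y] by (simp add: divide_strict_right_mono)
 also have "\<dots> \<le> 2 * (t * (c * \<rho> y)) / \<rho> y" using s(2)[of y] t pos[of y] by (intro divide_right_mono mult_left_mono) auto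
 also have "\<dots> = (2 * c) * t" using pos[of y] by simp
 also have "\<dots> \<le> 1 * t" using c t by (intro mult_right_mono) auto
 finally have q: "norm (y - x) / \<rho> y \<le> t" using n by simp
 have q0: "0 \<le> norm (y - x) / \<rho> y" using pos[of y] by simp
 have rx: "\<rho> x \<le> C * \<rho> y * (1 + t)"
 proof -
  have "\<rho> x \<le> C * \<rho> y * (1 + norm (y - x) / \<rho> y)" by (rule c1)
  also have "\<dots> \<le> C * \<rho> y * (1 + t)" using q C pos[of y] by (intro mult_left_mono) auto
  finally show ?thesis .
 qed
 have ry: "\<rho> y \<le> C * \<rho> x * (1 + t) powr N"
 proof -
  have "\<rho> y \<le> C * \<rho> x * (1 + norm (y - x) / \<rho> y) powr N" by (rule c2)
  also have "\<dots> \<le> C * \<rho> x * (1 + t) powr N" using q q0 C N pos[of x] by (intro mult_left_mono powr_mono2) auto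
  finally show ?thesis .
 qed
 have R0: "0 < R" unfolding R_def using t C pos[of x] by simp
 have "norm (x - y) < 2 * (t * (c * \<rho> y))" using xy s(2)[of y] t by (smt (verit) mult_left_mono)
 also have "\<dots> = (2 * c) * (t * \<rho> y)" by simp
 also have "\<dots> \<le> 1 * (t * \<rho> y)" using c t pos[of y] by (intro mult_right_mono) auto
 also have "\<dots> \<le> t * (C * \<rho> x * (1 + t) powr N)" using ry t by simp
 also have "\<dots> = R" by (simp add: R_def)
 finally show "y \<in> ball x R" by (simp add: dist_norm)
 define q where "q = (2 * \<beta> * C\<^sup>2 / c) * (1 + t) powr (N + 1)"
 have "R * c = t * (1 + t) powr N * C * (c * \<rho> x)" by (simp add: R_def)
 also have "\<dots> \<le> t * (1 + t) powr N * C * (c * (C * \<rho> y * (1 + t)))"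
  using rx t C c by (intro mult_left_mono) auto
 also have "\<dots> = t * (1 + t) powr (N + 1) * C\<^sup>2 * (c * \<rho> y)"
  using t by (simp add: powr_add power2_eq_square)
 also have "\<dots> \<le> t * (1 + t) powr (N + 1) * C\<^sup>2 * (2 * \<beta> * \<sigma> y)"
  using s(3)[of y] t by (intro mult_left_mono) auto
 finally have "R \<le> q * (t * \<sigma> y)" using c by (simp add: q_def field_simps)
 then have "R ^ DIM('a) \<le> (q * (t * \<sigma> y)) ^ DIM('a)" using R0 by (intro power_mono) auto
 also have "\<dots> = q ^ DIM('a) * (t * \<sigma> y) ^ DIM('a)" by (rule power_mult_distrib)
 finally have "R ^ DIM('a) \<le> q ^ DIM('a) * (t * \<sigma> y) ^ DIM('a)" .
 then have "1 / (t * \<sigma> y) ^ DIM('a) \<le> q ^ DIM('a) / R ^ DIM('a)"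
  using R0 t s(1)[of y] by (simp add: field_simps)
 also have "q ^ DIM('a) = (2 * \<beta> * C\<^sup>2 / c) ^ DIM('a) * (1 + t) powr ((N + 1) * DIM('a))"
 proof -
  have "((1 + t) powr (N + 1)) ^ DIM('a) = (1 + t) powr ((N + 1) * DIM('a))"
   using t by (simp add: powr_realpow[symmetric] powr_powr)
  then show ?thesis unfolding q_def power_mult_distrib by simp
 qed
 finally show "1 / (t * \<sigma> y) ^ DIM('a) \<le> (2 * \<beta> * C\<^sup>2 / c) ^ DIM('a) * (1 + t) powr ((N + 1) * DIM('a)) / R ^ DIM('a)" .
qed

section \<open>Bilinear estimates on annuli of critical scale\<close>

lemma annulus_subset_ball: "annulus y R \<subseteq> ball y (2 * R)"
 by (auto simp: annulus_def dist_norm)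

lemma annulus_sets [measurable]: "annulus y R \<in> \<L>"
proof -
 have "annulus y R = ball y (2 * R) - cball y R" by (auto simp: annulus_def dist_norm)
 then show ?thesis by simp
qed

text \<open>Hoelder's inequality with exponents \<open>s / t\<close> and \<open>s / (s - t)\<close>.
  The second one is \<open>(s / t)'\<close>, the origin of the exponent \<open>r\<close> in the
  first weighted inequality. The powers of \<open>R\<close> from the kernel bound and from the
  volume combine to \<open>R powr (d (1 - t))\<close>.\<close>

lemma annulus_Holder:
 fixes k w :: "'a::euclidean_space \<Rightarrow> real" and t s R b L :: real
 assumes ts: "1 < t" "t < s" and R: "0 < R"
  and km: "(\<lambda>x. k x * indicator (annulus y R) x) \<in> \<M>" and wm: "w \<in> \<M>"
  and k0: "\<And>x. 0 \<le> k x" and w0: "\<And>x. 0 \<le> w x" and b: "0 \<le> b" and L: "0 \<le> L"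
  and kb: "(NR x\<in>annulus y R. k x powr s) \<le> ennreal ((b * R powr (- (DIM('a) * (s - 1) / s))) powr s)"
  and wb: "(NR x\<in>ball y (2 * R). w x powr (s / (s - t))) \<le> ennreal (L powr (s / (s - t))) * \<mu> (ball y (2 * R))"
 shows "(NR x\<in>annulus y R. k x powr t * w x) \<le>
  ennreal ((unit_ball_vol (DIM('a)) * 2 ^ DIM('a)) powr ((s - t) / s) * b powr t * L * R powr (DIM('a) * (1 - t)))"
proof -
 define r where "r = s / (s - t)"
 define v where "v = unit_ball_vol (DIM('a))"
 have v: "0 \<le> v" by (simp add: v_def)
 have e: "1 / (s / t) + 1 / r = 1" "1 < s / t" "0 < r" using ts by (auto simp: r_def field_simps)
 define k' where "k' x = (k x * indicator (annulus y R) x) powr t" for x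
 define w' where "w' x = w x * indicator (annulus y R) x" for x
 have k'm: "k' \<in> \<M>" unfolding k'_def[abs_def] using km by measurable
 have w'm: "w' \<in> \<M>" unfolding w'_def[abs_def] using wm by measurable
 have 1: "(NR x. k' x powr (s / t)) \<le> ennreal ((b * R powr (- (DIM('a) * (s - 1) / s))) powr s)"
 proof -
  have "(NR x. k' x powr (s / t)) = (NR x\<in>annulus y R. k x powr s)"
   using ts by (intro nn_integral_cong) (auto simp: k'_def indicator_def powr_powr)
  then show ?thesis using kb by simp
 qed
 have 2: "(NR x. w' x powr r) \<le> ennreal (L powr r * (v * (2 * R) ^ DIM('a)))"
 proof -
  have "(NR x. w' x powr r) \<le> (NR x\<in>ball y (2 * R). w x powr r)"
   using annulus_subset_ball[of y R] e by (intro nn_integral_mono) (auto simp: w'_def indicator_def)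
  also have "\<dots> \<le> ennreal (L powr r) * ennreal (v * (2 * R) ^ DIM('a))"
   using wb emeasure_lebesgue_ball[of "2 * R" y] R unfolding r_def v_def by (simp del: emeasure_completion)
  finally show ?thesis using v R by (simp add: ennreal_mult)
 qed
 have "(NR x\<in>annulus y R. k x powr t * w x) = (NR x. k' x * w' x)"
  by (intro nn_integral_cong) (auto simp: k'_def w'_def indicator_def)
 also have "\<dots> \<le> ennreal (((b * R powr (- (DIM('a) * (s - 1) / s))) powr s) powr (1 / (s / t)) * (L powr r * (v * (2 * R) ^ DIM('a))) powr (1 / r))"
  by (rule Holder_nn_integral[OF e(2,1) k'm w'm _ _ 1 _ 2]) (use v R w0 in \<open>auto simp: k'_def w'_def\<close>)
 also have "((b * R powr (- (DIM('a) * (s - 1) / s))) powr s) powr (1 / (s / t)) * (L powr r * (v * (2 * R) ^ DIM('a))) powr (1 / r)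
   = (v * 2 ^ DIM('a)) powr ((s - t) / s) * b powr t * L * R powr (DIM('a) * (1 - t))"
 proof -
  have r1: "1 / r = (s - t) / s" by (simp add: r_def)
  have a1: "((b * R powr (- (DIM('a) * (s - 1) / s))) powr s) powr (1 / (s / t)) = b powr t * R powr (- (DIM('a) * (s - 1) / s) * t)"
   using b R ts by (simp add: powr_powr powr_mult)
  have a2: "(L powr r) powr (1 / r) = L" using L e(3) by (simp add: powr_powr)
  have v2: "v * (2 * R) ^ DIM('a) = (v * 2 ^ DIM('a)) * R powr DIM('a)"
   using R by (simp add: power_mult_distrib powr_realpow)
  have a3: "(v * (2 * R) ^ DIM('a)) powr (1 / r) = (v * 2 ^ DIM('a)) powr ((s - t) / s) * R powr (DIM('a) * ((s - t) / s))"
   unfolding v2 r1 by (simp only: powr_mult powr_powr)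
  have a4: "R powr (- (DIM('a) * (s - 1) / s) * t) * R powr (DIM('a) * ((s - t) / s)) = R powr (DIM('a) * (1 - t))"
  proof -
   have "- (DIM('a) * (s - 1) / s) * t + DIM('a) * ((s - t) / s) = DIM('a) * (1 - t)"
    using ts by (simp add: field_simps)
   then show ?thesis by (simp only: powr_add[symmetric])
  qed
  have "(L powr r * (v * (2 * R) ^ DIM('a))) powr (1 / r) = L * ((v * 2 ^ DIM('a)) powr ((s - t) / s) * R powr (DIM('a) * ((s - t) / s)))"
   unfolding powr_mult[of "L powr r"] a2 a3 ..
  then show ?thesis unfolding a1 a4[symmetric] by (simp add: mult_ac)
 qed
 finally show ?thesis unfolding v_def .
qed

text \<open>Young's inequality splits the integrand into a term with \<open>k powr t\<close> and
  \<open>w1\<close>, integrated first in \<open>x\<close> by Hoelder's inequality on the annulus,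
  and a term without the kernel, integrated first in \<open>y\<close>. A power of the radius is
  exchanged between them so that both are invariant under scaling.\<close>

lemma kernel_annulus_bilinear:
 fixes k :: "'a::euclidean_space \<Rightarrow> 'a \<Rightarrow> real" and \<sigma> u v w1 w2 W1 W2 :: "'a \<Rightarrow> real" and t t' s \<tau> e B P H :: real
 assumes ts: "1 < t" "t < s" and t': "t' = t / (t - 1)" and \<tau>: "0 < \<tau>" and \<sigma>: "\<And>y. 0 < \<sigma> y"
  and m[measurable]: "\<sigma> \<in> \<M>" "u \<in> \<M>" "v \<in> \<M>"
   "w1 \<in> \<M>" "w2 \<in> \<M>" "W1 \<in> \<M>" "W2 \<in> \<M>"
  and nn: "\<And>x y. 0 \<le> k x y" "\<And>x. 0 \<le> u x" "\<And>x. 0 \<le> v x" "\<And>x. 0 \<le> w1 x" "\<And>x. 0 \<le> w2 x" "\<And>x. 0 \<le> W1 x" "\<And>x. 0 \<le> W2 x"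
   "0 \<le> B" "0 \<le> P" "0 \<le> H"
  and km[measurable]: "(\<lambda>z. k (fst z) (snd z)) \<in> \<M>"
  and kmy: "\<And>y. (\<lambda>x. k x y * indicator (annulus y (\<tau> * \<sigma> y)) x) \<in> \<M>"
  and kb: "\<And>y. (NR x\<in>annulus y (\<tau> * \<sigma> y). k x y powr s)
   \<le> ennreal ((B * \<tau> powr e * (\<tau> * \<sigma> y) powr (- (DIM('a) * (s - 1) / s))) powr s)"
  and w1b: "\<And>y. (NR x\<in>ball y (2 * (\<tau> * \<sigma> y)). w1 x powr (s / (s - t)))
   \<le> ennreal ((P * W1 y) powr (s / (s - t))) * \<mu> (ball y (2 * (\<tau> * \<sigma> y)))"
  and w2b: "\<And>x. (NN y. ennreal (w2 y / (\<tau> * \<sigma> y) ^ DIM('a)) * indicator {y. norm (x - y) < 2 * (\<tau> * \<sigma> y)} y) \<le> ennreal (H * W2 x)"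
 shows "(NN x. NN y. ennreal (k x y * u y * v x * w1 x powr (1 / t) * w2 y powr (1 / t')) * indicator (annulus y (\<tau> * \<sigma> y)) x)
  \<le> ennreal ((unit_ball_vol (DIM('a)) * 2 ^ DIM('a)) powr ((s - t) / s) * B powr t * P * \<tau> powr (e * t / 2)) * (NR y. u y powr t * W1 y)
   + ennreal (H * \<tau> powr (e * t' / 2)) * (NR x. v x powr t' * W2 x)"
proof -
 define R where "R y = \<tau> * \<sigma> y" for y
 have R: "0 < R y" for y using \<tau> \<sigma> by (simp add: R_def)
 have Rm[measurable]: "R \<in> \<M>" unfolding R_def[abs_def] by measurable
 have t'1: "1 < t'" "1 / t + 1 / t' = 1" "t / t' = t - 1" using ts unfolding t' by (auto simp: field_simps)
 \<comment> \<open>Shares the gain \<open>\<tau> powr e\<close> of the kernel: the first term keeps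
   \<open>\<tau> powr (e t / 2)\<close>, and the second, which contains no kernel, receives
   \<open>\<tau> powr (e t' / 2)\<close>.\<close>
 define a where "a = \<tau> powr (- e / 2)"
 have a: "0 < a" using \<tau> by (simp add: a_def)
 define E where "E = (unit_ball_vol (DIM('a)) * 2 ^ DIM('a)) powr ((s - t) / s)"
 have E: "0 \<le> E" by (simp add: E_def)
 define F1 where "F1 z = (if R (snd z) < norm (snd z - fst z) \<and> norm (snd z - fst z) < 2 * R (snd z) then
   ennreal (a powr t * u (snd z) powr t * R (snd z) powr (DIM('a) * (t - 1))) * ennreal (k (fst z) (snd z) powr t * w1 (fst z)) else 0)" for z :: "'a \<times> 'a"
 define F2 where "F2 z = (if norm (fst z - snd z) < 2 * R (snd z) then
   ennreal (a powr (- t') * v (fst z) powr t') * ennreal (w2 (snd z) / R (snd z) ^ DIM('a)) else 0)" for z :: "'a \<times> 'a"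
 have F1m: "F1 \<in> \<M>" unfolding F1_def[abs_def] by measurable
 have F2m: "F2 \<in> \<M>" unfolding F2_def[abs_def] by measurable
 have point: "ennreal (k x y * u y * v x * w1 x powr (1 / t) * w2 y powr (1 / t')) * indicator (annulus y (\<tau> * \<sigma> y)) x \<le> F1 (x, y) + F2 (x, y)" for x y
 proof (cases "x \<in> annulus y (R y)")
  case True
  then have an: "R y < norm (y - x)" "norm (y - x) < 2 * R y" by (auto simp: annulus_def)
  define X where "X = a * k x y * u y * w1 x powr (1 / t) * R y powr (DIM('a) / t')"
  define Z where "Z = v x * w2 y powr (1 / t') * R y powr (- (DIM('a) / t')) / a"
  have X0: "0 \<le> X" "0 \<le> Z" using a nn R[of y] by (auto simp: X_def Z_def)
  have XZ: "X * Z = k x y * u y * v x * w1 x powr (1 / t) * w2 y powr (1 / t')"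
   using a R[of y] by (simp add: X_def Z_def powr_minus field_simps)
  have Xt: "X powr t = a powr t * u y powr t * R y powr (DIM('a) * (t - 1)) * (k x y powr t * w1 x)"
  proof -
   have "(R y powr (DIM('a) / t')) powr t = R y powr (DIM('a) * (t / t'))" by (simp add: powr_powr)
   moreover have "(w1 x powr (1 / t)) powr t = w1 x" using ts nn by (simp add: powr_powr)
   ultimately show ?thesis unfolding X_def using a nn t'1(3) by (simp add: powr_mult mult_ac)
  qed
  have Zt: "Z powr t' = a powr (- t') * v x powr t' * (w2 y / R y ^ DIM('a))"
  proof -
   have "(R y powr (- (DIM('a) / t'))) powr t' = 1 / R y ^ DIM('a)"
   proof -
    have "- (DIM('a) / t') * t' = - DIM('a)" using t'1(1) by simp
    then have "(R y powr (- (DIM('a) / t'))) powr t' = R y powr (- DIM('a))" by (simp only: powr_powr)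
    then show ?thesis using R[of y] by (simp add: powr_minus_divide powr_realpow)
   qed
   moreover have "(w2 y powr (1 / t')) powr t' = w2 y" using t'1(1) nn by (simp add: powr_powr)
   ultimately show ?thesis unfolding Z_def using a nn
    by (simp add: powr_mult powr_divide powr_minus_divide)
  qed
  have "X * Z \<le> X powr t / t + Z powr t' / t'" by (rule Youngs_inequality[OF ts(1) t'1(1,2) X0])
  also have "\<dots> \<le> X powr t / 1 + Z powr t' / 1" using ts t'1 by (intro add_mono divide_left_mono) auto
  finally have "ennreal (X * Z) \<le> ennreal (X powr t) + ennreal (Z powr t')"
   by (simp add: ennreal_plus[symmetric] ennreal_leI del: ennreal_plus)
  also have "ennreal (X powr t) = F1 (x, y)" unfolding Xt F1_def using an nn by (simp add: ennreal_mult'[symmetric])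
  also have "ennreal (Z powr t') = F2 (x, y)" unfolding Zt F2_def using an nn R[of y] by (simp add: norm_minus_commute ennreal_mult'[symmetric])
  finally show ?thesis unfolding XZ using True by (simp add: R_def)
 qed (simp add: R_def)
 have I1: "(NN y. NN x. F1 (x, y)) \<le> ennreal (E * B powr t * P * \<tau> powr (e * t / 2)) * (NR y. u y powr t * W1 y)"
 proof -
  have "(NN x. F1 (x, y)) \<le> ennreal (E * B powr t * P * \<tau> powr (e * t / 2)) * ennreal (u y powr t * W1 y)" for y
  proof -
   define q where "q = a powr t * u y powr t * R y powr (DIM('a) * (t - 1))"
   have q: "0 \<le> q" by (simp add: q_def)
   have km': "(\<lambda>x. ennreal (k x y powr t * w1 x) * indicator (annulus y (R y)) x) \<in> \<M>"
   proof -
    note [measurable] = kmy[of y]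
    have "(\<lambda>x. ennreal (k x y powr t * w1 x) * indicator (annulus y (R y)) x) = (\<lambda>x. ennreal ((k x y * indicator (annulus y (\<tau> * \<sigma> y)) x) powr t * w1 x))"
     by (auto simp: fun_eq_iff indicator_def R_def)
    also have "\<dots> \<in> \<M>" by measurable
    finally show ?thesis .
   qed
   have "(NN x. F1 (x, y)) = (NN x. ennreal q * (ennreal (k x y powr t * w1 x) * indicator (annulus y (R y)) x))"
    by (intro nn_integral_cong) (auto simp: F1_def q_def annulus_def)
   also have "\<dots> = ennreal q * (NR x\<in>annulus y (R y). k x y powr t * w1 x)"
    by (rule nn_integral_cmult[OF km'])
   also have "\<dots> \<le> ennreal q * ennreal (E * (B * \<tau> powr e) powr t * (P * W1 y) * R y powr (DIM('a) * (1 - t)))"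
   proof (rule mult_left_mono)
    show "(NR x\<in>annulus y (R y). k x y powr t * w1 x) \<le> ennreal (E * (B * \<tau> powr e) powr t * (P * W1 y) * R y powr (DIM('a) * (1 - t)))"
     unfolding E_def by (rule annulus_Holder[OF ts R _ m(4)]) (use kmy kb w1b nn in \<open>auto simp: R_def\<close>)
   qed simp
   also have "\<dots> = ennreal (q * (E * (B * \<tau> powr e) powr t * (P * W1 y) * R y powr (DIM('a) * (1 - t))))"
    by (rule ennreal_mult'[symmetric, OF q])
   also have "q * (E * (B * \<tau> powr e) powr t * (P * W1 y) * R y powr (DIM('a) * (1 - t))) = (E * B powr t * P * \<tau> powr (e * t / 2)) * (u y powr t * W1 y)"
   proof -
    have 1: "R y powr (DIM('a) * (t - 1)) * R y powr (DIM('a) * (1 - t)) = 1"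
     using R[of y] by (simp add: powr_add[symmetric] right_diff_distrib)
    have 2: "a powr t * (\<tau> powr e) powr t = \<tau> powr (e * t / 2)"
    proof -
     have "- e / 2 * t + e * t = e * t / 2" by simp
     then show ?thesis unfolding a_def powr_powr by (simp only: powr_add[symmetric])
    qed
    have "q * (E * (B * \<tau> powr e) powr t * (P * W1 y) * R y powr (DIM('a) * (1 - t)))
     = (E * B powr t * P * (a powr t * (\<tau> powr e) powr t)) * (u y powr t * W1 y) * (R y powr (DIM('a) * (t - 1)) * R y powr (DIM('a) * (1 - t)))"
     unfolding q_def using nn \<tau> by (simp add: powr_mult mult_ac)
    then show ?thesis unfolding 1 2 by simp
   qed
   also have "ennreal \<dots> = ennreal (E * B powr t * P * \<tau> powr (e * t / 2)) * ennreal (u y powr t * W1 y)"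
    using E nn by (intro ennreal_mult') auto
   finally show ?thesis .
  qed
  then have "(NN y. NN x. F1 (x, y)) \<le> (NN y. ennreal (E * B powr t * P * \<tau> powr (e * t / 2)) * ennreal (u y powr t * W1 y))"
   by (rule nn_integral_mono)
  also have "\<dots> = ennreal (E * B powr t * P * \<tau> powr (e * t / 2)) * (NR y. u y powr t * W1 y)"
   by (rule nn_integral_cmult) measurable
  finally show ?thesis .
 qed
 have I2: "(NN x. NN y. F2 (x, y)) \<le> ennreal (H * \<tau> powr (e * t' / 2)) * (NR x. v x powr t' * W2 x)"
 proof -
  have "(NN y. F2 (x, y)) \<le> ennreal (H * \<tau> powr (e * t' / 2)) * ennreal (v x powr t' * W2 x)" for x
  proof -
   have [measurable]: "{y. norm (x - y) < 2 * (\<tau> * \<sigma> y)} \<in> \<L>"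
   proof -
    note borel_measurable_lebesgue_id[measurable]
    have "{y \<in> space lebesgue. norm (x - y) < 2 * (\<tau> * \<sigma> y)} \<in> \<L>" by measurable
    then show ?thesis by simp
   qed
   have "(NN y. F2 (x, y)) = (NN y. ennreal (a powr (- t') * v x powr t') * (ennreal (w2 y / (\<tau> * \<sigma> y) ^ DIM('a)) * indicator {y. norm (x - y) < 2 * (\<tau> * \<sigma> y)} y))"
    by (intro nn_integral_cong) (auto simp: F2_def R_def indicator_def)
   also have "\<dots> = ennreal (a powr (- t') * v x powr t') * (NN y. ennreal (w2 y / (\<tau> * \<sigma> y) ^ DIM('a)) * indicator {y. norm (x - y) < 2 * (\<tau> * \<sigma> y)} y)"
    by (rule nn_integral_cmult) measurable
   also have "\<dots> \<le> ennreal (a powr (- t') * v x powr t') * ennreal (H * W2 x)"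
    by (intro mult_left_mono w2b) simp
   also have "\<dots> = ennreal ((a powr (- t') * v x powr t') * (H * W2 x))"
    by (rule ennreal_mult'[symmetric]) simp
   also have "(a powr (- t') * v x powr t') * (H * W2 x) = (H * \<tau> powr (e * t' / 2)) * (v x powr t' * W2 x)"
    by (simp add: a_def powr_powr)
   also have "ennreal \<dots> = ennreal (H * \<tau> powr (e * t' / 2)) * ennreal (v x powr t' * W2 x)"
    using nn by (intro ennreal_mult') auto
   finally show ?thesis .
  qed
  then have "(NN x. NN y. F2 (x, y)) \<le> (NN x. ennreal (H * \<tau> powr (e * t' / 2)) * ennreal (v x powr t' * W2 x))"
   by (rule nn_integral_mono)
  also have "\<dots> = ennreal (H * \<tau> powr (e * t' / 2)) * (NR x. v x powr t' * W2 x)"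
   by (rule nn_integral_cmult) measurable
  finally show ?thesis .
 qed
 have "(NN x. NN y. ennreal (k x y * u y * v x * w1 x powr (1 / t) * w2 y powr (1 / t')) * indicator (annulus y (\<tau> * \<sigma> y)) x)
   \<le> (NN x. (NN y. F1 (x, y)) + (NN y. F2 (x, y)))"
 proof (rule nn_integral_mono_AE)
  show "AE x in lebesgue. (NN y. ennreal (k x y * u y * v x * w1 x powr (1 / t) * w2 y powr (1 / t')) * indicator (annulus y (\<tau> * \<sigma> y)) x) \<le> (NN y. F1 (x, y)) + (NN y. F2 (x, y))"
   using lebesgue_sections_measurable[OF F1m] lebesgue_sections_measurable[OF F2m]
  proof eventually_elim
   case (elim x)
   have "(NN y. ennreal (k x y * u y * v x * w1 x powr (1 / t) * w2 y powr (1 / t')) * indicator (annulus y (\<tau> * \<sigma> y)) x) \<le> (NN y. F1 (x, y) + F2 (x, y))"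
    by (rule nn_integral_mono) (rule point)
   also have "\<dots> = (NN y. F1 (x, y)) + (NN y. F2 (x, y))"
    using elim by (rule nn_integral_add)
   finally show ?case .
  qed
 qed
 also have "\<dots> = (NN x. NN y. F1 (x, y)) + (NN x. NN y. F2 (x, y))"
  by (rule nn_integral_add) (rule lebesgue_Tonelli(2)[OF F1m], rule lebesgue_Tonelli(2)[OF F2m])
 also have "(NN x. NN y. F1 (x, y)) = (NN y. NN x. F1 (x, y))"
  by (rule lebesgue_Tonelli(1)[OF F1m])
 also have "\<dots> + (NN x. NN y. F2 (x, y)) \<le> ennreal (E * B powr t * P * \<tau> powr (e * t / 2)) * (NR y. u y powr t * W1 y) + ennreal (H * \<tau> powr (e * t' / 2)) * (NR x. v x powr t' * W2 x)"
  using I1 I2 by (rule add_mono)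
 finally show ?thesis unfolding E_def .
qed

lemma Lp_annulus:
 fixes k :: "'a::euclidean_space \<Rightarrow> complex" and s b :: real
 assumes k: "k \<in> Lp s (annulus y R)" and s: "0 < s" and b: "Lp_norm s (annulus y R) k \<le> b"
 shows "(\<lambda>x. norm (k x) * indicator (annulus y R) x) \<in> \<M>"
  and "(NR x\<in>annulus y R. norm (k x) powr s) \<le> ennreal (b powr s)"
proof -
 have km: "k \<in> borel_measurable (lebesgue_on (annulus y R))" using k by (simp add: Lp_def)
 then have nm: "(\<lambda>x. norm (k x)) \<in> borel_measurable (lebesgue_on (annulus y R))" by measurable
 have "(\<lambda>x. indicator (annulus y R) x *\<^sub>R norm (k x)) \<in> \<M>"
  using nm borel_measurable_restrict_space_iff[of "annulus y R" lebesgue "\<lambda>x. norm (k x)"] annulus_sets by auto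
 then show "(\<lambda>x. norm (k x) * indicator (annulus y R) x) \<in> \<M>" by (simp add: mult.commute)
 have "(NR x\<in>annulus y R. norm (k x) powr s) = (\<integral>\<^sup>+x. ennreal (norm (k x) powr s) \<partial>lebesgue_on (annulus y R))"
  by (rule nn_integral_restrict_space[symmetric]) (use annulus_sets in auto)
 also have "\<dots> = ennreal (Lp_norm s (annulus y R) k powr s)" by (rule Lp_nn_integral[OF k s])
 also have "\<dots> \<le> ennreal (b powr s)" using b s by (intro ennreal_leI powr_mono2) (auto simp: Lp_norm_def)
 finally show "(NR x\<in>annulus y R. norm (k x) powr s) \<le> ennreal (b powr s)" .
qed

text \<open>For almost every \<open>x\<close> the sections in \<open>y\<close> are measurable for
  all \<open>j\<close> at once, which justifies exchanging the sum with both integrals.\<close>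

lemma nn_integral_geometric_sum:
 fixes G :: "nat \<Rightarrow> 'a::euclidean_space \<times> 'a \<Rightarrow> ennreal" and D q :: real
 assumes G: "\<And>j. G j \<in> \<M>" and q: "0 \<le> q" "q < 1" and D: "0 \<le> D"
  and le: "\<And>j. (NN x. NN y. G j (x, y)) \<le> ennreal (D * q ^ j) * Z"
  and F: "\<And>x y. F x y \<le> (\<Sum>j. G j (x, y))"
 shows "(NN x. NN y. F x y) \<le> ennreal (D / (1 - q)) * Z"
proof -
 have "(NN x. NN y. F x y) \<le> (NN x. (\<Sum>j. NN y. G j (x, y)))"
 proof (rule nn_integral_mono_AE)
  have "AE x in lebesgue. \<forall>j. (\<lambda>y. G j (x, y)) \<in> \<M>"
   unfolding AE_all_countable using lebesgue_sections_measurable[OF G] by blast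
  then show "AE x in lebesgue. (NN y. F x y) \<le> (\<Sum>j. NN y. G j (x, y))"
  proof eventually_elim
   case (elim x)
   have "(NN y. F x y) \<le> (NN y. (\<Sum>j. G j (x, y)))" by (intro nn_integral_mono F)
   also have "\<dots> = (\<Sum>j. NN y. G j (x, y))" using elim by (intro nn_integral_suminf) auto
   finally show ?case .
  qed
 qed
 also have "\<dots> = (\<Sum>j. NN x. NN y. G j (x, y))"
  by (rule nn_integral_suminf) (rule lebesgue_Tonelli(2)[OF G])
 also have "\<dots> \<le> (\<Sum>j. ennreal (D * q ^ j) * Z)" by (intro suminf_le le) auto
 also have "\<dots> = (\<Sum>j. ennreal (D * q ^ j)) * Z" by simp
 also have "(\<Sum>j. ennreal (D * q ^ j)) = ennreal (\<Sum>j. D * q ^ j)"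
  using q D by (intro suminf_ennreal2 summable_mult summable_geometric) auto
 also have "(\<Sum>j. D * q ^ j) = D / (1 - q)" using q by (subst suminf_mult) (auto simp: suminf_geometric intro: summable_geometric)
 finally show ?thesis .
qed

text \<open>The annuli are open at both ends, so radii growing by the factor 2 would miss the
  spheres between them; with \<open>3 / 2\<close> consecutive annuli overlap.\<close>

lemma far_annuli_cover:
 fixes d r :: real
 assumes "0 < r" "r < d"
 shows "\<exists>j::nat. r * (3 / 2) ^ j < d \<and> d < 2 * (r * (3 / 2) ^ j)"
proof -
 obtain k :: nat where k: "d / r < (3 / 2) ^ k" using real_arch_pow[of "3/2" "d / r"] by auto
 define P where "P k \<longleftrightarrow> d \<le> r * (3 / 2) ^ k" for k :: nat
 have "P k" unfolding P_def using k assms by (simp add: field_simps)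
 moreover have "\<not> P 0" unfolding P_def using assms by simp
 ultimately obtain j where j: "\<not> P j" "P (Suc j)" using ex_least_nat_less[of P k] by blast
 then show ?thesis unfolding P_def using assms by (intro exI[of _ j]) (auto simp: not_le)
qed

text \<open>The same overlap with ratio \<open>2 / 3\<close>, down to arbitrarily small distances;
  those between \<open>r\<close> and \<open>2 r\<close> belong to the first annulus.\<close>

lemma near_annuli_cover:
 fixes d r :: real
 assumes "0 < d" "d < 2 * r"
 shows "\<exists>j::nat. r * (2 / 3) ^ j < d \<and> d < 2 * (r * (2 / 3) ^ j)"
proof (cases "r < d")
 case True
 then show ?thesis using assms by (intro exI[of _ 0]) simp
next
 case False
 have r: "0 < r" using False assms by simp
 obtain k :: nat where k: "(2 / 3) ^ k < d / r" using real_arch_pow_inv[of "d / r" "2/3"] assms r by auto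
 define P where "P k \<longleftrightarrow> r * (2 / 3) ^ k < d" for k :: nat
 have "P k" unfolding P_def using k r by (simp add: field_simps)
 moreover have "\<not> P 0" unfolding P_def using False by simp
 ultimately obtain j where j: "\<not> P j" "P (Suc j)" using ex_least_nat_less[of P k] by blast
 then show ?thesis unfolding P_def using r by (intro exI[of _ "Suc j"]) (auto simp: not_less)
qed

text \<open>The two inequalities correspond to \<open>w2 = W2 = 1\<close> and to \<open>w1 = W1 = 1\<close>.\<close>

definition admissible where
 "admissible \<rho> \<theta> s t u v w1 w2 W1 W2 \<longleftrightarrow>
  {u, v, w1, w2, W1, W2} \<subseteq> \<M> \<and>
  (\<forall>x. 0 \<le> u x \<and> 0 \<le> v x \<and> 0 \<le> w1 x \<and> 0 \<le> w2 x \<and> 0 \<le> W1 x \<and> 0 \<le> W2 x) \<and>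
  (\<forall>x R. 0 < R \<longrightarrow> (NR y\<in>ball x R. w1 y powr (s / (s - t)))
   \<le> ennreal (((1 + R / \<rho> x) powr \<theta> * W1 x) powr (s / (s - t))) * \<mu> (ball x R)) \<and>
  (\<forall>x R. 0 < R \<longrightarrow> (NR y\<in>ball x R. w2 y)
   \<le> ennreal ((1 + R / \<rho> x) powr \<theta> * W2 x) * \<mu> (ball x R))"

locale critical_scale =
 fixes \<rho> \<sigma> :: "'a::euclidean_space \<Rightarrow> real" and C N c \<beta> \<theta> s t t' :: real
 assumes C: "1 \<le> C" and N: "1 \<le> N" and pos: "\<And>x. 0 < \<rho> x"
  and c1: "\<And>x y. \<rho> y \<le> C * \<rho> x * (1 + norm (x - y) / \<rho> x)"
  and c2: "\<And>x y. \<rho> x \<le> C * \<rho> y * (1 + norm (x - y) / \<rho> x) powr N"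
  and sigma: "\<And>x. 0 < \<sigma> x" "\<And>x. \<sigma> x \<le> c * \<rho> x" "\<And>x. c * \<rho> x \<le> 2 * \<beta> * \<sigma> x"
  and sigma_measurable [measurable]: "\<sigma> \<in> \<M>"
  and c: "0 < c" "2 * c \<le> 1" and b: "1 \<le> \<beta>" and theta: "0 \<le> \<theta>"
  and ts: "1 < t" "t < s" and t': "t' = t / (t - 1)"
begin

definition form where
 "form k u v w1 w2 x y = ennreal (k x y * u y * v x * w1 x powr (1 / t) * w2 y powr (1 / t'))"

text \<open>The power of \<open>1 + \<tau>\<close> lost on one annulus: comparing radii through
  \<open>\<rho>\<close> costs \<open>N + 1\<close>, which is raised to \<open>DIM('a)\<close> by the
  volume and to \<open>\<theta>\<close> by the maximal function.\<close>

definition exponent :: real where "exponent = (N + 1) * (DIM('a) + \<theta>)"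

text \<open>The first entry is the constant of Hoelder's inequality for the kernel, the second comes
  from enclosing the relevant \<open>y\<close> in one ball around \<open>x\<close>.\<close>

definition coefficient where
 "coefficient B = max ((unit_ball_vol (DIM('a)) * 2 ^ DIM('a)) powr ((s - t) / s) * B powr t)
   ((2 * \<beta> * C\<^sup>2 / c) ^ DIM('a) * unit_ball_vol (DIM('a)) * C powr \<theta>)"

definition form_bound where
 "form_bound k S D \<longleftrightarrow> (\<forall>u v w1 w2 W1 W2. admissible \<rho> \<theta> s t u v w1 w2 W1 W2 \<longrightarrow>
  (NN x. NN y. form k u v w1 w2 x y * indicator {y. S x y} y)
   \<le> ennreal D * ((NR y. u y powr t * W1 y) + (NR x. v x powr t' * W2 x)))"

text \<open>The power of the radius has exponent \<open>- d / s'\<close>, written out. The factor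
  \<open>\<tau> powr e\<close> is a gain over a standard kernel, with \<open>e < 0\<close> on large
  annuli and \<open>e > 0\<close> on small ones.\<close>

definition annular where
 "annular k B e \<tau> \<longleftrightarrow> (\<forall>y. (\<lambda>x. k x y * indicator (annulus y (\<tau> * \<sigma> y)) x) \<in> \<M> \<and>
  (NR x\<in>annulus y (\<tau> * \<sigma> y). k x y powr s) \<le> ennreal ((B * \<tau> powr e * (\<tau> * \<sigma> y) powr (- (DIM('a) * (s - 1) / s))) powr s))"

lemma annularI:
 fixes K :: "'a \<Rightarrow> 'a \<Rightarrow> complex"
 assumes "\<And>y. (\<lambda>x. K x y) \<in> Lp s (annulus y (\<tau> * \<sigma> y)) \<and>
  Lp_norm s (annulus y (\<tau> * \<sigma> y)) (\<lambda>x. K x y) \<le> A y * (\<tau> * \<sigma> y) powr (- (DIM('a) / conj_exp s)) * b y"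
  and "\<And>y. A y \<le> A'" "\<And>y. b y \<le> b' * \<tau> powr e" "\<And>y. 0 \<le> b y" "0 \<le> A'"
 shows "annular (\<lambda>x y. norm (K x y)) (A' * b') e \<tau>"
 unfolding annular_def
proof
 fix y
 have ce: "real DIM('a) / conj_exp s = DIM('a) * (s - 1) / s" using ts by (simp add: conj_exp_def)
 have "Lp_norm s (annulus y (\<tau> * \<sigma> y)) (\<lambda>x. K x y) \<le> A y * (\<tau> * \<sigma> y) powr (- (DIM('a) / conj_exp s)) * b y" using assms(1) by blast
 also have "\<dots> \<le> A' * (\<tau> * \<sigma> y) powr (- (DIM('a) / conj_exp s)) * (b' * \<tau> powr e)"
  using assms(2-5) by (intro mult_mono) auto
 finally have "Lp_norm s (annulus y (\<tau> * \<sigma> y)) (\<lambda>x. K x y) \<le> A' * b' * \<tau> powr e * (\<tau> * \<sigma> y) powr (- (DIM('a) * (s - 1) / s))"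
  unfolding ce by (simp only: mult_ac)
 then show "(\<lambda>x. norm (K x y) * indicator (annulus y (\<tau> * \<sigma> y)) x) \<in> \<M> \<and>
  (NR x\<in>annulus y (\<tau> * \<sigma> y). norm (K x y) powr s) \<le> ennreal ((A' * b' * \<tau> powr e * (\<tau> * \<sigma> y) powr (- (DIM('a) * (s - 1) / s))) powr s)"
  using assms(1)[of y] ts by (intro conjI Lp_annulus) auto
qed

lemma t'1: "1 < t'" using ts by (simp add: t')

lemma coefficient_nonneg: "0 \<le> coefficient B" unfolding coefficient_def by (rule max.coboundedI1) simp

lemma exponent_ge: "\<theta> \<le> exponent" "0 \<le> exponent"
proof -
 have "1 * \<theta> \<le> (N + 1) * (DIM('a) + \<theta>)" using N theta by (intro mult_mono) auto
 then show "\<theta> \<le> exponent" by (simp add: exponent_def)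
 then show "0 \<le> exponent" using theta by simp
qed

text \<open>The two weight conditions behave differently. For \<open>w1\<close> the ball is centred
  at \<open>y\<close> with radius at most \<open>\<tau> \<rho> y\<close>. For \<open>w2\<close> the
  centre is \<open>x\<close> while the radius depends on \<open>y\<close>, so all these
  \<open>y\<close> are put into one ball around \<open>x\<close> and the radii are compared through
  \<open>\<rho>\<close>.\<close>

lemma scale_annulus:
 fixes \<tau> e B :: real and k :: "'a \<Rightarrow> 'a \<Rightarrow> real"
 assumes adm: "admissible \<rho> \<theta> s t u v w1 w2 W1 W2" and \<tau>: "0 < \<tau>" and B: "0 \<le> B" and k0: "\<And>x y. 0 \<le> k x y"
  and km: "(\<lambda>z. k (fst z) (snd z)) \<in> \<M>"
  and ann: "annular k B e \<tau>"
 shows "(NN x. NN y. form k u v w1 w2 x y * indicator (annulus y (\<tau> * \<sigma> y)) x)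
  \<le> ennreal (coefficient B * (1 + \<tau>) powr exponent * \<tau> powr (e * t / 2)) * (NR y. u y powr t * W1 y)
   + ennreal (coefficient B * (1 + \<tau>) powr exponent * \<tau> powr (e * t' / 2)) * (NR x. v x powr t' * W2 x)"
proof -
 define H0 where "H0 = (2 * \<beta> * C\<^sup>2 / c) ^ DIM('a) * unit_ball_vol (DIM('a)) * C powr \<theta>"
 have H0: "0 \<le> H0" unfolding H0_def using b c by simp
 have M: "u \<in> \<M>" "v \<in> \<M>" "w1 \<in> \<M>"
  "w2 \<in> \<M>" "W1 \<in> \<M>" "W2 \<in> \<M>"
  and nn: "\<And>x. 0 \<le> u x" "\<And>x. 0 \<le> v x" "\<And>x. 0 \<le> w1 x" "\<And>x. 0 \<le> w2 x" "\<And>x. 0 \<le> W1 x" "\<And>x. 0 \<le> W2 x"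
  and H1: "\<And>x R. 0 < R \<Longrightarrow> (NR y\<in>ball x R. w1 y powr (s / (s - t)))
   \<le> ennreal (((1 + R / \<rho> x) powr \<theta> * W1 x) powr (s / (s - t))) * \<mu> (ball x R)"
  and H2: "\<And>x R. 0 < R \<Longrightarrow> (NR y\<in>ball x R. w2 y)
   \<le> ennreal ((1 + R / \<rho> x) powr \<theta> * W2 x) * \<mu> (ball x R)"
  using adm unfolding admissible_def by auto
 note [measurable] = M
 have one: "1 \<le> 1 + \<tau>" using \<tau> by simp
 have w1b: "(NR x\<in>ball y (2 * (\<tau> * \<sigma> y)). w1 x powr (s / (s - t)))
   \<le> ennreal (((1 + \<tau>) powr exponent * W1 y) powr (s / (s - t))) * \<mu> (ball y (2 * (\<tau> * \<sigma> y)))" for y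
 proof -
  have "2 * (\<tau> * \<sigma> y) \<le> 2 * (\<tau> * (c * \<rho> y))" using sigma(2)[of y] \<tau> by simp
  also have "\<dots> = (2 * c) * (\<tau> * \<rho> y)" by simp
  also have "\<dots> \<le> 1 * (\<tau> * \<rho> y)" using c \<tau> pos[of y] by (intro mult_right_mono) auto
  finally have q: "2 * (\<tau> * \<sigma> y) / \<rho> y \<le> \<tau>" using pos[of y] by (simp add: field_simps)
  have q0: "0 \<le> 2 * (\<tau> * \<sigma> y) / \<rho> y" using \<tau> sigma(1)[of y] pos[of y] by simp
  have "(1 + 2 * (\<tau> * \<sigma> y) / \<rho> y) powr \<theta> \<le> (1 + \<tau>) powr \<theta>" using q q0 theta by (intro powr_mono2) auto
  also have "\<dots> \<le> (1 + \<tau>) powr exponent" using one exponent_ge by (intro powr_mono) auto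
  finally have "((1 + 2 * (\<tau> * \<sigma> y) / \<rho> y) powr \<theta> * W1 y) powr (s / (s - t)) \<le> ((1 + \<tau>) powr exponent * W1 y) powr (s / (s - t))"
   using nn(5)[of y] ts by (intro powr_mono2 mult_right_mono) auto
  then have "ennreal (((1 + 2 * (\<tau> * \<sigma> y) / \<rho> y) powr \<theta> * W1 y) powr (s / (s - t))) * \<mu> (ball y (2 * (\<tau> * \<sigma> y)))
   \<le> ennreal (((1 + \<tau>) powr exponent * W1 y) powr (s / (s - t))) * \<mu> (ball y (2 * (\<tau> * \<sigma> y)))"
   by (intro mult_right_mono ennreal_leI) auto
  moreover have "0 < 2 * (\<tau> * \<sigma> y)" using \<tau> sigma(1)[of y] by simp
  ultimately show ?thesis using H1[of "2 * (\<tau> * \<sigma> y)" y] by (meson order_trans)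
 qed
 have w2b: "(NN y. ennreal (w2 y / (\<tau> * \<sigma> y) ^ DIM('a)) * indicator {y. norm (x - y) < 2 * (\<tau> * \<sigma> y)} y) \<le> ennreal ((H0 * (1 + \<tau>) powr exponent) * W2 x)" for x
 proof -
  define R where "R = \<tau> * C * (1 + \<tau>) powr N * \<rho> x"
  define Q where "Q = (2 * \<beta> * C\<^sup>2 / c) ^ DIM('a) * (1 + \<tau>) powr ((N + 1) * DIM('a))"
  have Q: "0 \<le> Q" unfolding Q_def using b c by simp
  have R: "0 < R" unfolding R_def using \<tau> C pos[of x] by simp
  have "(NN y. ennreal (w2 y / (\<tau> * \<sigma> y) ^ DIM('a)) * indicator {y. norm (x - y) < 2 * (\<tau> * \<sigma> y)} y)
   \<le> (NN y. ennreal (Q / R ^ DIM('a)) * (ennreal (w2 y) * indicator (ball x R) y))"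
  proof (rule nn_integral_mono)
   fix y
   show "ennreal (w2 y / (\<tau> * \<sigma> y) ^ DIM('a)) * indicator {y. norm (x - y) < 2 * (\<tau> * \<sigma> y)} y \<le> ennreal (Q / R ^ DIM('a)) * (ennreal (w2 y) * indicator (ball x R) y)"
   proof (cases "norm (x - y) < 2 * (\<tau> * \<sigma> y)")
    case True
    have "y \<in> ball x R" "1 / (\<tau> * \<sigma> y) ^ DIM('a) \<le> Q / R ^ DIM('a)"
     unfolding R_def Q_def by (rule critical_annulus_comparable[OF C N pos c1 c2 sigma c b \<tau> True])+
    then have "w2 y * (1 / (\<tau> * \<sigma> y) ^ DIM('a)) \<le> w2 y * (Q / R ^ DIM('a))" using nn(4)[of y] by (intro mult_left_mono)
    then have "ennreal (w2 y / (\<tau> * \<sigma> y) ^ DIM('a)) \<le> ennreal (Q / R ^ DIM('a)) * ennreal (w2 y)"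
     using Q R nn(4)[of y] by (subst ennreal_mult[symmetric]) (auto intro!: ennreal_leI simp: mult.commute)
    then show ?thesis using \<open>y \<in> ball x R\<close> True by simp
   qed simp
  qed
  also have "\<dots> = ennreal (Q / R ^ DIM('a)) * (NR y\<in>ball x R. w2 y)"
   by (rule nn_integral_cmult) measurable
  also have "\<dots> \<le> ennreal (Q / R ^ DIM('a)) * (ennreal ((1 + R / \<rho> x) powr \<theta> * W2 x) * ennreal (unit_ball_vol (DIM('a)) * R ^ DIM('a)))"
   using H2[OF R, of x] emeasure_lebesgue_ball[of R x] R by (intro mult_left_mono) auto
  also have "\<dots> = ennreal (Q / R ^ DIM('a) * ((1 + R / \<rho> x) powr \<theta> * W2 x * (unit_ball_vol (DIM('a)) * R ^ DIM('a))))"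
   using Q R nn(6)[of x] by (simp add: ennreal_mult[symmetric])
  also have "Q / R ^ DIM('a) * ((1 + R / \<rho> x) powr \<theta> * W2 x * (unit_ball_vol (DIM('a)) * R ^ DIM('a))) = Q * unit_ball_vol (DIM('a)) * W2 x * (1 + R / \<rho> x) powr \<theta>"
   using R by simp
  also have "\<dots> \<le> Q * unit_ball_vol (DIM('a)) * W2 x * (C powr \<theta> * (1 + \<tau>) powr ((N + 1) * \<theta>))"
  proof (rule mult_left_mono)
   have "R / \<rho> x = \<tau> * (C * (1 + \<tau>) powr N)" using pos[of x] by (simp add: R_def)
   moreover have "1 \<le> C * (1 + \<tau>) powr N" using C N one mult_mono[of 1 C 1 "(1 + \<tau>) powr N"] ge_one_powr_ge_zero[of "1 + \<tau>" N] by simp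
   ultimately have "1 + R / \<rho> x \<le> C * (1 + \<tau>) powr N + \<tau> * (C * (1 + \<tau>) powr N)" by simp
   also have "\<dots> = C * (1 + \<tau>) powr (N + 1)" using \<tau> by (simp add: powr_add algebra_simps)
   finally have "(1 + R / \<rho> x) powr \<theta> \<le> (C * (1 + \<tau>) powr (N + 1)) powr \<theta>"
    using theta R pos[of x] by (intro powr_mono2) auto
   also have "\<dots> = C powr \<theta> * (1 + \<tau>) powr ((N + 1) * \<theta>)" by (simp only: powr_mult powr_powr)
   finally show "(1 + R / \<rho> x) powr \<theta> \<le> C powr \<theta> * (1 + \<tau>) powr ((N + 1) * \<theta>)" .
   show "0 \<le> Q * unit_ball_vol (DIM('a)) * W2 x" using Q nn(6)[of x] by simp
  qed
  also have "Q * unit_ball_vol (DIM('a)) * W2 x * (C powr \<theta> * (1 + \<tau>) powr ((N + 1) * \<theta>)) = (H0 * (1 + \<tau>) powr exponent) * W2 x"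
  proof -
   have "(1 + \<tau>) powr exponent = (1 + \<tau>) powr ((N + 1) * DIM('a)) * (1 + \<tau>) powr ((N + 1) * \<theta>)"
    unfolding exponent_def by (simp only: distrib_left powr_add)
   then show ?thesis unfolding Q_def H0_def by simp
  qed
  finally show ?thesis by (simp add: ennreal_leI)
 qed
 have "(NN x. NN y. form k u v w1 w2 x y * indicator (annulus y (\<tau> * \<sigma> y)) x)
  \<le> ennreal ((unit_ball_vol (DIM('a)) * 2 ^ DIM('a)) powr ((s - t) / s) * B powr t * (1 + \<tau>) powr exponent * \<tau> powr (e * t / 2)) * (NR y. u y powr t * W1 y)
   + ennreal (H0 * (1 + \<tau>) powr exponent * \<tau> powr (e * t' / 2)) * (NR x. v x powr t' * W2 x)"
  unfolding form_def
  by (rule kernel_annulus_bilinear[OF ts t' \<tau> sigma(1) sigma_measurable M k0 nn B _ _ km ann[unfolded annular_def, THEN spec, THEN conjunct1] ann[unfolded annular_def, THEN spec, THEN conjunct2] w1b w2b]) (use H0 in auto)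
 also have "\<dots> \<le> ennreal (coefficient B * (1 + \<tau>) powr exponent * \<tau> powr (e * t / 2)) * (NR y. u y powr t * W1 y)
   + ennreal (coefficient B * (1 + \<tau>) powr exponent * \<tau> powr (e * t' / 2)) * (NR x. v x powr t' * W2 x)"
  by (intro add_mono mult_right_mono ennreal_leI) (auto simp: coefficient_def H0_def)
 finally show ?thesis .
qed

text \<open>The loss \<open>(1 + \<tau>) powr exponent\<close>, bounded by
  \<open>L \<tau> powr a\<close>, competes with the gain of the kernel; the conditions on
  \<open>lam\<close> say that both terms decay geometrically in \<open>j\<close>. The far part uses
  \<open>lam > 1\<close> with \<open>e < 0\<close>, the near part \<open>lam < 1\<close> with
  \<open>e > 0\<close>.\<close>

lemma scale_sum:
 fixes e B L a c0 lam :: real and k :: "'a \<Rightarrow> 'a \<Rightarrow> real"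
 assumes c0: "0 < c0" and lam: "0 < lam" and B: "0 \<le> B" and k0: "\<And>x y. 0 \<le> k x y"
  and km: "(\<lambda>z. k (fst z) (snd z)) \<in> \<M>"
  and ann: "\<And>j. annular k B e (c0 * lam ^ j)"
  and L: "0 \<le> L" "\<And>j. (1 + c0 * lam ^ j) powr exponent \<le> L * (c0 * lam ^ j) powr a"
  and q: "lam powr (a + e * t / 2) < 1" "lam powr (a + e * t' / 2) < 1"
  and cov: "\<And>x y. S x y \<Longrightarrow> \<exists>j. x \<in> annulus y (c0 * lam ^ j * \<sigma> y)"
 shows "\<exists>D\<ge>0. form_bound k S D"
proof -
 define a1 where "a1 = a + e * t / 2"
 define a2 where "a2 = a + e * t' / 2"
 define Q where "Q = max (lam powr a1) (lam powr a2)"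
 define D where "D = coefficient B * L * (c0 powr a1 + c0 powr a2)"
 have D: "0 \<le> D" unfolding D_def using coefficient_nonneg L by simp
 have Q: "0 \<le> Q" "Q < 1" using q by (auto simp: Q_def a1_def a2_def le_max_iff_disj)
 show ?thesis unfolding form_bound_def
 proof (intro exI[of _ "D / (1 - Q)"] conjI allI impI)
 show "0 \<le> D / (1 - Q)" using D Q by simp
 fix u v w1 w2 W1 W2 assume adm: "admissible \<rho> \<theta> s t u v w1 w2 W1 W2"
 define X where "X = (NR y. u y powr t * W1 y)"
 define Y where "Y = (NR x. v x powr t' * W2 x)"
 define G where "G j z = (if c0 * lam ^ j * \<sigma> (snd z) < norm (snd z - fst z) \<and> norm (snd z - fst z) < 2 * (c0 * lam ^ j * \<sigma> (snd z))
  then form k u v w1 w2 (fst z) (snd z) else 0)" for j and z :: "'a \<times> 'a"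
 have Geq: "G j (x, y) = form k u v w1 w2 x y * indicator (annulus y (c0 * lam ^ j * \<sigma> y)) x" for j x y
  by (simp add: G_def annulus_def)
 have [measurable]: "u \<in> \<M>" "v \<in> \<M>" "w1 \<in> \<M>"
  "w2 \<in> \<M>" using adm unfolding admissible_def by auto
 note km[measurable]
 have Gm: "G j \<in> \<M>" for j unfolding G_def[abs_def] form_def by measurable
 have "(NN x. NN y. form k u v w1 w2 x y * indicator {y. S x y} y) \<le> ennreal (D / (1 - Q)) * (X + Y)"
 proof (rule nn_integral_geometric_sum[OF Gm Q D])
  fix j
  define \<tau> where "\<tau> = c0 * lam ^ j"
  have \<tau>: "0 < \<tau>" using c0 lam by (simp add: \<tau>_def)
  have pw: "coefficient B * (1 + \<tau>) powr exponent * \<tau> powr (b - a) \<le> D * Q ^ j" if b: "b = a1 \<or> b = a2" for b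
  proof -
   have "coefficient B * (1 + \<tau>) powr exponent * \<tau> powr (b - a) \<le> coefficient B * (L * \<tau> powr a) * \<tau> powr (b - a)"
    using L(2)[of j] coefficient_nonneg by (intro mult_right_mono mult_left_mono) (auto simp: \<tau>_def)
   also have "\<dots> = coefficient B * L * \<tau> powr b" using \<tau> by (simp add: powr_diff)
   also have "\<tau> powr b = c0 powr b * (lam powr b) ^ j"
    using c0 lam by (simp add: \<tau>_def powr_mult powr_realpow[symmetric] powr_powr mult.commute)
   also have "coefficient B * L * (c0 powr b * (lam powr b) ^ j) \<le> coefficient B * L * ((c0 powr a1 + c0 powr a2) * Q ^ j)"
    using b coefficient_nonneg L(1) by (intro mult_left_mono mult_mono power_mono) (auto simp: Q_def)
   finally show ?thesis by (simp add: D_def mult.assoc)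
  qed
  have "(NN x. NN y. G j (x, y)) \<le> ennreal (coefficient B * (1 + \<tau>) powr exponent * \<tau> powr (e * t / 2)) * X
    + ennreal (coefficient B * (1 + \<tau>) powr exponent * \<tau> powr (e * t' / 2)) * Y"
   unfolding Geq X_def Y_def \<tau>_def using \<tau> unfolding \<tau>_def by (intro scale_annulus[OF adm _ B k0 km ann])
  also have "\<dots> \<le> ennreal (D * Q ^ j) * X + ennreal (D * Q ^ j) * Y"
   using pw[of a1] pw[of a2] by (intro add_mono mult_right_mono ennreal_leI) (auto simp: a1_def a2_def)
  also have "\<dots> = ennreal (D * Q ^ j) * (X + Y)" by (simp add: distrib_left)
  finally show "(NN x. NN y. G j (x, y)) \<le> ennreal (D * Q ^ j) * (X + Y)" .
 next
  fix x y
  show "form k u v w1 w2 x y * indicator {y. S x y} y \<le> (\<Sum>j. G j (x, y))"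
  proof (cases "S x y")
   case True
   then obtain j where j: "x \<in> annulus y (c0 * lam ^ j * \<sigma> y)" using cov by blast
   have "form k u v w1 w2 x y * indicator {y. S x y} y = G j (x, y)" using j True by (simp add: Geq)
   also have "\<dots> \<le> (\<Sum>j. G j (x, y))" using sum_le_suminf[of "\<lambda>j. G j (x, y)" "{j}"] by simp
   finally show ?thesis .
  qed simp
 qed
 then show "(NN x. NN y. form k u v w1 w2 x y * indicator {y. S x y} y) \<le> ennreal (D / (1 - Q)) * ((NR y. u y powr t * W1 y) + (NR x. v x powr t' * W2 x))"
  unfolding X_def Y_def .
 qed
qed

lemma far_estimate:
 fixes K :: "'a \<Rightarrow> 'a \<Rightarrow> complex" and c0 :: real
 assumes K: "kernel_decay \<rho> s K" and km: "(\<lambda>z. K (fst z) (snd z)) \<in> \<M>" and c0: "0 < c0"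
 shows "\<exists>D\<ge>0. form_bound (\<lambda>x y. norm (K x y)) (\<lambda>x y. c0 * \<sigma> y < norm (x - y)) D"
proof -
 \<comment> \<open>One fixed order of decay is enough: half of it, multiplied by \<open>t\<close> or
   \<open>t'\<close>, outweighs the growth \<open>exponent\<close>, since both factors exceed
   1.\<close>
 define n where "n = 2 * (exponent + 1)"
 have n: "0 < n" using exponent_ge by (simp add: n_def)
 obtain Cn where Cn: "\<And>x0 y R. 0 < R \<Longrightarrow> norm (y - x0) < R / 2 \<Longrightarrow> (\<lambda>x. K x y) \<in> Lp s (annulus x0 R) \<and>
    Lp_norm s (annulus x0 R) (\<lambda>x. K x y) \<le> Cn * R powr (- (real DIM('a) / conj_exp s)) * (1 + R / \<rho> x0) powr (- n)"
  using K n unfolding kernel_decay_def by blast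
 have kn: "annular (\<lambda>x y. norm (K x y)) (max 0 Cn * (2 * \<beta> / c) powr n) (- n) \<tau>" if \<tau>: "0 < \<tau>" for \<tau>
 proof (rule annularI)
  fix y
  have R: "0 < \<tau> * \<sigma> y" using \<tau> sigma(1)[of y] by simp
  then show "(\<lambda>x. K x y) \<in> Lp s (annulus y (\<tau> * \<sigma> y)) \<and>
   Lp_norm s (annulus y (\<tau> * \<sigma> y)) (\<lambda>x. K x y) \<le> Cn * (\<tau> * \<sigma> y) powr (- (DIM('a) / conj_exp s)) * (1 + \<tau> * \<sigma> y / \<rho> y) powr (- n)"
   by (intro Cn) simp_all
  \<comment> \<open>As \<open>\<sigma>\<close> is comparable with \<open>\<rho>\<close>, decay in
    \<open>R / \<rho> y\<close> becomes decay in \<open>\<tau>\<close>.\<close>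
  have "\<tau> * (c * \<rho> y) \<le> \<tau> * (2 * \<beta> * \<sigma> y)" using sigma(3)[of y] \<tau> by simp
  then have "\<tau> * (c / (2 * \<beta>)) \<le> \<tau> * \<sigma> y / \<rho> y" using b pos[of y] by (simp add: field_simps)
  then have "\<tau> * (c / (2 * \<beta>)) \<le> 1 + \<tau> * \<sigma> y / \<rho> y" by simp
  moreover have "0 < \<tau> * (c / (2 * \<beta>))" using \<tau> b c by simp
  ultimately have "(1 + \<tau> * \<sigma> y / \<rho> y) powr (- n) \<le> (\<tau> * (c / (2 * \<beta>))) powr (- n)"
   using n by (intro powr_mono2') auto
  also have "\<dots> = (2 * \<beta> / c) powr n * \<tau> powr (- n)"
  proof -
   have "(c / (2 * \<beta>)) powr (- n) = (2 * \<beta> / c) powr n" using b c by (simp add: powr_minus powr_divide)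
   then show ?thesis by (simp only: powr_mult mult.commute)
  qed
  finally show "(1 + \<tau> * \<sigma> y / \<rho> y) powr (- n) \<le> (2 * \<beta> / c) powr n * \<tau> powr (- n)" .
 qed auto
 have \<tau>j: "0 < c0 * (3 / 2) ^ j" for j :: nat using c0 by simp
 have ex: "exponent + - n * t / 2 < 0" "exponent + - n * t' / 2 < 0"
 proof -
  have "exponent + - n * x / 2 < 0" if x: "1 < x" for x
  proof -
   have "(exponent + 1) * 1 < (exponent + 1) * x" using x exponent_ge by (intro mult_strict_left_mono) auto
   moreover have "exponent + 1 = n / 2" by (simp add: n_def)
   ultimately have "exponent + 1 < n / 2 * x" by simp
   then show ?thesis by simp
  qed
  from this[OF ts(1)] this[OF t'1] show "exponent + - n * t / 2 < 0" "exponent + - n * t' / 2 < 0" .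
 qed
 have q: "(3 / 2) powr (exponent + - n * t / 2) < (1 :: real)" "(3 / 2) powr (exponent + - n * t' / 2) < (1 :: real)"
  using ex by (simp_all add: powr_less_one)
 show ?thesis
 proof (rule scale_sum[OF c0 _ _ _ _ kn[OF \<tau>j] _ _ q])
   show "(\<lambda>z. norm (K (fst z) (snd z))) \<in> \<M>" using km by measurable
   fix j :: nat
   have "c0 \<le> c0 * (3 / 2) ^ j" using c0 by (simp add: one_le_power)
   then have "1 + c0 * (3 / 2) ^ j \<le> (1 + 1 / c0) * (c0 * (3 / 2) ^ j)" using c0 by (simp add: field_simps)
   then have "(1 + c0 * (3 / 2) ^ j) powr exponent \<le> ((1 + 1 / c0) * (c0 * (3 / 2) ^ j)) powr exponent"
    using exponent_ge c0 by (intro powr_mono2) auto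
   then show "(1 + c0 * (3 / 2) ^ j) powr exponent \<le> (1 + 1 / c0) powr exponent * (c0 * (3 / 2) ^ j) powr exponent"
    by (simp only: powr_mult)
  next
   fix x y assume "c0 * \<sigma> y < norm (x - y)"
   then show "\<exists>j. x \<in> annulus y (c0 * (3 / 2) ^ j * \<sigma> y)"
    using far_annuli_cover[of "c0 * \<sigma> y" "norm (x - y)"] c0 sigma(1)[of y] by (simp add: annulus_def norm_minus_commute mult_ac)
 qed auto
qed

text \<open>All radii are at most \<open>c0 \<sigma> y\<close>, hence at most
  \<open>\<rho> y\<close>, so the comparison with \<open>K0\<close> applies on every annulus and
  \<open>(1 + \<tau>) powr exponent\<close> stays bounded. The series converges by the gain
  \<open>\<tau> powr \<delta>\<close> alone, with \<open>a = 0\<close>.\<close>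

lemma near_estimate:
 fixes K K0 :: "'a \<Rightarrow> 'a \<Rightarrow> complex" and c0 :: real
 assumes K: "kernel_close \<rho> s K K0" and km: "(\<lambda>z. K (fst z) (snd z) - K0 (fst z) (snd z)) \<in> \<M>"
  and c0: "0 < c0" "c0 * c \<le> 1"
 shows "\<exists>D\<ge>0. form_bound (\<lambda>x y. norm (K x y - K0 x y)) (\<lambda>x y. 0 < norm (x - y) \<and> norm (x - y) < 2 * (c0 * \<sigma> y)) D"
proof -
 obtain Cn \<delta> where \<delta>: "0 < \<delta>" and Cn: "\<And>x0 y R. 0 < R \<Longrightarrow> norm (y - x0) < R / 2 \<Longrightarrow> R \<le> \<rho> x0 \<Longrightarrow> (\<lambda>x. K x y - K0 x y) \<in> Lp s (annulus x0 R) \<and>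
    Lp_norm s (annulus x0 R) (\<lambda>x. K x y - K0 x y) \<le> Cn * R powr (- (real DIM('a) / conj_exp s)) * (R / \<rho> x0) powr \<delta>"
  using K unfolding kernel_close_def by blast
 have kn: "annular (\<lambda>x y. norm (K x y - K0 x y)) (max 0 Cn * c powr \<delta>) \<delta> \<tau>" if \<tau>: "0 < \<tau>" "\<tau> \<le> c0" for \<tau>
 proof (rule annularI)
  fix y
  have R: "0 < \<tau> * \<sigma> y" using \<tau> sigma(1)[of y] by simp
  have tc: "\<tau> * \<sigma> y \<le> \<tau> * (c * \<rho> y)" using sigma(2)[of y] \<tau> by simp
  also have "\<dots> = (\<tau> * c) * \<rho> y" by simp
  also have "\<dots> \<le> (c0 * c) * \<rho> y" using \<tau> c pos[of y] by (intro mult_right_mono) auto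
  also have "\<dots> \<le> 1 * \<rho> y" using c0 pos[of y] by (intro mult_right_mono) auto
  finally show "(\<lambda>x. K x y - K0 x y) \<in> Lp s (annulus y (\<tau> * \<sigma> y)) \<and>
   Lp_norm s (annulus y (\<tau> * \<sigma> y)) (\<lambda>x. K x y - K0 x y) \<le> Cn * (\<tau> * \<sigma> y) powr (- (DIM('a) / conj_exp s)) * (\<tau> * \<sigma> y / \<rho> y) powr \<delta>"
   using R by (intro Cn) simp_all
  have "\<tau> * \<sigma> y / \<rho> y \<le> c * \<tau>" using tc pos[of y] by (simp add: field_simps)
  then have "(\<tau> * \<sigma> y / \<rho> y) powr \<delta> \<le> (c * \<tau>) powr \<delta>" using R pos[of y] \<delta> by (intro powr_mono2) auto
  then show "(\<tau> * \<sigma> y / \<rho> y) powr \<delta> \<le> c powr \<delta> * \<tau> powr \<delta>" by (simp only: powr_mult)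
 qed auto
 have \<tau>j: "0 < c0 * (2 / 3) ^ j" "c0 * (2 / 3) ^ j \<le> c0" for j :: nat using c0 power_le_one[of "2/3::real" j] by (auto simp: mult_left_le)
 have q: "(2 / 3) powr (0 + \<delta> * t / 2) < (1 :: real)" "(2 / 3) powr (0 + \<delta> * t' / 2) < (1 :: real)"
  using \<delta> ts t'1 powr_less_mono2[of "\<delta> * t / 2" "2/3" 1] powr_less_mono2[of "\<delta> * t' / 2" "2/3" 1] by auto
 show ?thesis
 proof (rule scale_sum[OF c0(1) _ _ _ _ kn[OF \<tau>j] _ _ q])
   show "(\<lambda>z. norm (K (fst z) (snd z) - K0 (fst z) (snd z))) \<in> \<M>" using km by measurable
   fix j :: nat
   have "(1 + c0 * (2 / 3) ^ j) powr exponent \<le> (1 + c0) powr exponent"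
    using exponent_ge c0 \<tau>j[of j] by (intro powr_mono2) auto
   then show "(1 + c0 * (2 / 3) ^ j) powr exponent \<le> (1 + c0) powr exponent * (c0 * (2 / 3) ^ j) powr 0"
    using \<tau>j(1)[of j] c0 by simp
  next
   fix x y assume "0 < norm (x - y) \<and> norm (x - y) < 2 * (c0 * \<sigma> y)"
   then show "\<exists>j. x \<in> annulus y (c0 * (2 / 3) ^ j * \<sigma> y)"
    using near_annuli_cover[of "norm (x - y)" "c0 * \<sigma> y"] by (simp add: annulus_def norm_minus_commute mult_ac)
 qed auto
qed

end

lemma lebesgue_sets_Compl: "A \<in> \<L> \<Longrightarrow> - A \<in> \<L>"
 using sets.compl_sets[of A lebesgue] by (simp add: Compl_eq_Diff_UNIV)

section \<open>Weights and duality\<close>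

text \<open>A supremum over balls that contain \<open>x\<close> is lower semicontinuous, as its
  superlevel sets are unions of open balls.\<close>

lemma borel_measurable_SUP_balls:
 fixes v :: "'a::euclidean_space \<Rightarrow> real \<Rightarrow> ennreal"
 shows "(\<lambda>x. SUP (x0, r0)\<in>{(x0, r0). P x0 r0 \<and> x \<in> ball x0 r0}. v x0 r0) \<in> \<M>"
proof (rule measurable_completion, rule borel_measurableI_greater)
 fix y
 have eq: "{x \<in> space lborel. y < (SUP (x0, r0)\<in>{(x0, r0). P x0 r0 \<and> x \<in> ball x0 r0}. v x0 r0)}
   = (\<Union>p\<in>{p. P (fst p) (snd p) \<and> y < v (fst p) (snd p)}. ball (fst p) (snd p))"
  by (auto simp: less_SUP_iff) blast+
 have "open (\<Union>p\<in>{p. P (fst p) (snd p) \<and> y < v (fst p) (snd p)}. ball (fst p) (snd p))" by (intro open_UN ballI open_ball)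
 then have "(\<Union>p\<in>{p. P (fst p) (snd p) \<and> y < v (fst p) (snd p)}. ball (fst p) (snd p)) \<in> sets lborel" by simp
 then show "{x \<in> space lborel. y < (SUP (x0, r0)\<in>{(x0, r0). P x0 r0 \<and> x \<in> ball x0 r0}. v x0 r0)} \<in> sets lborel" unfolding eq .
qed

lemma max_loc_measurable: "max_loc \<rho> A w \<in> \<M>"
 using borel_measurable_SUP_balls[where P = "\<lambda>x0 r0. 0 < r0 \<and> r0 \<le> \<rho> x0" and v = "\<lambda>x0 r0. luxemburg A (ball x0 r0) w"]
 by (simp add: max_loc_def[abs_def] conj_assoc)

lemma max_theta_measurable: "max_theta \<rho> \<theta> A w \<in> \<M>"
 using borel_measurable_SUP_balls[where P = "\<lambda>x0 r0. 0 < r0" and v = "\<lambda>x0 r0. ennreal ((1 + r0 / \<rho> x0) powr (- \<theta>)) * luxemburg A (ball x0 r0) w"]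
 by (simp add: max_theta_def[abs_def])

section \<open>Monotonicity and finiteness of the maximal functions\<close>

lemma luxemburg_mono:
 assumes A: "young_function A" and w: "\<And>x. 0 \<le> w x" "\<And>x. w x \<le> w' x"
 shows "luxemburg A B w \<le> luxemburg A B w'"
 unfolding luxemburg_def
proof (rule Inf_superset_mono, safe)
 fix l :: real
 assume l: "0 < l" "(NR x\<in>B. A (\<bar>w' x\<bar> / l)) / \<mu> B \<le> 1"
 have "A (\<bar>w x\<bar> / l) \<le> A (\<bar>w' x\<bar> / l)" for x
 proof -
  have "\<bar>w x\<bar> / l \<le> \<bar>w' x\<bar> / l" using w[of x] l(1) by (simp add: divide_right_mono)
  then show ?thesis using A l(1) unfolding young_function_def by (auto intro!: mono_onD[of "{0..}" A])
 qed
 then have "(NR x\<in>B. A (\<bar>w x\<bar> / l)) \<le> (NR x\<in>B. A (\<bar>w' x\<bar> / l))"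
  by (intro nn_integral_mono mult_right_mono ennreal_leI) auto
 then have "(NR x\<in>B. A (\<bar>w x\<bar> / l)) / \<mu> B \<le> (NR x\<in>B. A (\<bar>w' x\<bar> / l)) / \<mu> B"
  by (rule divide_right_mono_ennreal)
 then have "(NR x\<in>B. A (\<bar>w x\<bar> / l)) / \<mu> B \<le> 1" using l(2) by (rule order_trans)
 then show "\<exists>l'. ennreal l = ennreal l' \<and> 0 < l' \<and> (NR x\<in>B. A (\<bar>w x\<bar> / l')) / \<mu> B \<le> 1"
  using l(1) by blast
qed

text \<open>By continuity \<open>A\<close> is at most 1 near 0, so a bounded weight divided by a
  large \<open>L\<close> is admissible on every ball. Maximal functions of truncated weights are
  thus finite and can be treated as real functions.\<close>

lemma luxemburg_bounded:
 fixes M :: real and w :: "'a::euclidean_space \<Rightarrow> real"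
 assumes A: "young_function A" and w: "\<And>x. 0 \<le> w x" "\<And>x. w x \<le> M"
 obtains L where "0 < L" "\<And>c r. 0 < r \<Longrightarrow> luxemburg A (ball c r) w \<le> ennreal L"
proof -
 have "continuous_on {0..} A" "A 0 = 0" using A by (auto simp: young_function_def)
 then obtain \<delta> where \<delta>: "0 < \<delta>" "\<And>t. 0 \<le> t \<Longrightarrow> dist t 0 < \<delta> \<Longrightarrow> dist (A t) 0 < 1"
  unfolding continuous_on_iff by (metis atLeast_iff order_refl zero_less_one)
 define L where "L = 2 * (\<bar>M\<bar> + 1) / \<delta>"
 have L: "0 < L" using \<delta>(1) by (simp add: L_def)
 have "A (\<bar>w x\<bar> / L) \<le> 1" for x
 proof -
  have "\<bar>w x\<bar> < \<delta> * L" using w[of x] \<delta>(1) by (simp add: L_def)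
  then have "\<bar>w x\<bar> / L < \<delta>" using L by (simp add: divide_less_eq)
  then have "dist (A (\<bar>w x\<bar> / L)) 0 < 1" using L by (intro \<delta>(2)) auto
  then show ?thesis by (simp add: dist_norm)
 qed
 then show thesis using L by (intro that[of L] luxemburg_le) auto
qed

lemma max_loc_mono:
 assumes "young_function A" "\<And>x. 0 \<le> w x" "\<And>x. w x \<le> w' x"
 shows "max_loc \<rho> A w x \<le> max_loc \<rho> A w' x"
 unfolding max_loc_def by (intro SUP_mono) (auto intro!: luxemburg_mono[OF assms] bexI)

lemma max_theta_mono:
 assumes "young_function A" "\<And>x. 0 \<le> w x" "\<And>x. w x \<le> w' x"
 shows "max_theta \<rho> \<theta> A w x \<le> max_theta \<rho> \<theta> A w' x"
 unfolding max_theta_def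
proof (rule SUP_mono)
 fix p assume p: "p \<in> {(x0, r0). 0 < r0 \<and> x \<in> ball x0 r0}"
 show "\<exists>m\<in>{(x0, r0). 0 < r0 \<and> x \<in> ball x0 r0}. (case p of (x0, r0) \<Rightarrow> ennreal ((1 + r0 / \<rho> x0) powr (- \<theta>)) * luxemburg A (ball x0 r0) w)
   \<le> (case m of (x0, r0) \<Rightarrow> ennreal ((1 + r0 / \<rho> x0) powr (- \<theta>)) * luxemburg A (ball x0 r0) w')"
  using p by (intro bexI[of _ p]) (auto intro!: mult_left_mono luxemburg_mono[OF assms])
qed

lemma max_loc_finite:
 fixes M :: real and w :: "'a::euclidean_space \<Rightarrow> real"
 assumes "young_function A" "\<And>x. 0 \<le> w x" "\<And>x. w x \<le> M"
 shows "max_loc \<rho> A w x < \<infinity>"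
proof -
 obtain L where L: "0 < L" "\<And>c r. 0 < r \<Longrightarrow> luxemburg A (ball (c::'a) r) w \<le> ennreal L"
  by (rule luxemburg_bounded[OF assms]) (rule that)
 have "max_loc \<rho> A w x \<le> ennreal L" unfolding max_loc_def by (rule SUP_least) (auto intro: L(2))
 then show ?thesis using order_le_less_trans by fastforce
qed

lemma max_theta_finite:
 fixes M :: real and w :: "'a::euclidean_space \<Rightarrow> real"
 assumes "young_function A" "\<And>x. 0 \<le> w x" "\<And>x. w x \<le> M" and \<rho>: "\<And>x. 0 < \<rho> x" and \<theta>: "0 \<le> \<theta>"
 shows "max_theta \<rho> \<theta> A w x < \<infinity>"
proof -
 obtain L where L: "0 < L" "\<And>c r. 0 < r \<Longrightarrow> luxemburg A (ball (c::'a) r) w \<le> ennreal L"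
  by (rule luxemburg_bounded[OF assms(1-3)]) (rule that)
 have "max_theta \<rho> \<theta> A w x \<le> ennreal L" unfolding max_theta_def
 proof (rule SUP_least, clarify)
  fix x0 :: 'a and r0 :: real assume r: "0 < r0"
  have "1 \<le> (1 + r0 / \<rho> x0) powr \<theta>" using r \<rho>[of x0] \<theta> by (intro ge_one_powr_ge_zero) auto
  then have "(1 + r0 / \<rho> x0) powr (- \<theta>) \<le> 1" by (simp add: powr_minus_divide divide_le_eq)
  then have "ennreal ((1 + r0 / \<rho> x0) powr (- \<theta>)) * luxemburg A (ball x0 r0) w \<le> ennreal 1 * ennreal L"
   by (intro mult_mono ennreal_leI L(2)[OF r]) auto
  then show "ennreal ((1 + r0 / \<rho> x0) powr (- \<theta>)) * luxemburg A (ball x0 r0) w \<le> ennreal L" by simp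
 qed
 then show ?thesis using order_le_less_trans by fastforce
qed

lemma luxemburg_le_max_theta:
 assumes r: "0 < r" "y \<in> ball x r" and \<rho>: "0 < \<rho> x" and W: "max_theta \<rho> \<theta> A w y \<le> ennreal W" "0 \<le> W"
 shows "luxemburg A (ball x r) w \<le> ennreal ((1 + r / \<rho> x) powr \<theta> * W)"
proof -
 have p: "0 < 1 + r / \<rho> x" using r \<rho> by (simp add: add_pos_pos)
 have "ennreal ((1 + r / \<rho> x) powr (- \<theta>)) * luxemburg A (ball x r) w \<le> max_theta \<rho> \<theta> A w y"
  unfolding max_theta_def using r by (intro SUP_upper2[of "(x, r)"]) auto
 also note W(1)
 finally have "ennreal ((1 + r / \<rho> x) powr \<theta>) * (ennreal ((1 + r / \<rho> x) powr (- \<theta>)) * luxemburg A (ball x r) w) \<le> ennreal ((1 + r / \<rho> x) powr \<theta>) * ennreal W"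
  by (rule mult_left_mono) simp
 moreover have "ennreal ((1 + r / \<rho> x) powr \<theta>) * ennreal ((1 + r / \<rho> x) powr (- \<theta>)) = 1"
  using p by (simp add: ennreal_mult[symmetric] powr_add[symmetric])
 ultimately show ?thesis using W(2) by (simp add: mult.assoc[symmetric] ennreal_mult)
qed

lemma luxemburg_le_max_loc:
 assumes "0 < r" "r \<le> \<rho> x" "y \<in> ball x r"
 shows "luxemburg A (ball x r) w \<le> max_loc \<rho> A w y"
 unfolding max_loc_def using assms by (intro SUP_upper2[of "(x, r)"]) auto

lemma young_function_powr:
 assumes r: "1 \<le> r"
 shows "young_function (\<lambda>t. t powr r)"
 unfolding young_function_def
proof (intro conjI)
 show "continuous_on {0..} (\<lambda>t::real. t powr r)" using r by (intro continuous_on_powr') (auto intro: continuous_intros)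
 show "convex_on {0..} (\<lambda>t::real. t powr r)"
 proof (rule convex_onI)
  fix t x y :: real assume t: "0 < t" "t < 1" and xy: "x \<in> {0..}" "y \<in> {0..}"
  \<comment> \<open>If one endpoint is 0, convexity reduces to this inequality for the coefficient
    of the other endpoint.\<close>
  have le: "a powr r \<le> a" if "0 < a" "a < 1" for a :: real using that r powr_mono'[of 1 r a] by simp
  consider "x = 0" | "y = 0" | "x \<in> {0<..}" "y \<in> {0<..}" using xy by fastforce
  then show "((1 - t) *\<^sub>R x + t *\<^sub>R y) powr r \<le> (1 - t) * x powr r + t * y powr r"
  proof cases
   case 1
   then show ?thesis using le[of t] t by (simp add: powr_mult mult_right_mono)
  next
   case 2
   then show ?thesis using le[of "1 - t"] t by (simp add: powr_mult mult_right_mono)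
  next
   case 3
   then show ?thesis using convex_onD[OF powr_convex[OF r], of t x y] t by simp
  qed
 qed (rule convex_real_interval)
 show "mono_on {0..} (\<lambda>t::real. t powr r)" using r by (intro mono_onI powr_mono2) auto
 show "(0::real) powr r = 0" by simp
qed

text \<open>The integrand is the power \<open>t powr ((1 - r) (p' - 1) - 1)\<close>, integrable at
  infinity because \<open>r > 1\<close>. So the inequality for \<open>T\<close> can use the same
  two-weight estimate as the one for the adjoint, with \<open>A t = t powr r\<close>.\<close>

lemma class_D_powr:
 assumes p: "1 < p" and r: "1 < r"
 shows "(\<lambda>t. t powr r) \<in> class_D p"
proof -
 define e where "e = (1 - r) * (conj_exp p - 1) - 1"
 have e: "e < -1" using p r by (simp add: e_def conj_exp_def mult_neg_pos)
 have "(\<lambda>x. x powr e) integrable_on {1::real..}" using has_integral_powr_to_inf[OF e, of 1] by auto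
 then have "(\<lambda>x. x powr e) absolutely_integrable_on {1::real..}"
  by (rule nonnegative_absolutely_integrable_1) simp
 then have "set_integrable lebesgue {1::real<..} (\<lambda>x. x powr e)"
  by (rule set_integrable_subset) auto
 also have "set_integrable lebesgue {1::real<..} (\<lambda>x. x powr e) \<longleftrightarrow> set_integrable lebesgue {1<..} (\<lambda>t. (t / t powr r) powr (conj_exp p - 1) / t)"
 proof (rule set_integrable_cong)
  fix t :: real assume "t \<in> {1<..}"
  then have t: "1 < t" by simp
  have "(t / t powr r) powr (conj_exp p - 1) / t = (t powr (1 - r)) powr (conj_exp p - 1) / t powr 1" using t by (simp add: powr_diff)
  also have "\<dots> = t powr ((1 - r) * (conj_exp p - 1)) / t powr 1" by (simp only: powr_powr)
  also have "\<dots> = t powr e" unfolding e_def by (rule powr_diff[symmetric])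
  finally show "t powr e = (t / t powr r) powr (conj_exp p - 1) / t" by simp
 qed auto
 finally have "set_integrable lebesgue {1<..} (\<lambda>t. (t / t powr r) powr (conj_exp p - 1) / t)" .
 then show ?thesis unfolding class_D_def using young_function_powr[of r] r by (auto intro!: exI[of _ 1])
qed

text \<open>Stated as a condition on \<open>W\<close> so that the local maximal function and, up to
  a factor \<open>2 powr \<theta>\<close>, the global one can both serve as majorants.\<close>

definition controls where
 "controls \<rho> A w W \<longleftrightarrow> (\<forall>x r. 0 < r \<longrightarrow> r \<le> \<rho> x \<longrightarrow> (\<forall>y\<in>ball x r. luxemburg A (ball x r) w \<le> ennreal (W y)))"

text \<open>Means of \<open>w\<close> over small cubes are at most a multiple of Luxemburg norms
  over slightly larger balls, which \<open>W\<close> controls, and differentiation gives the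
  pointwise bound. It serves the multiplication operator that may be hidden in
  \<open>T - T0\<close>.\<close>

lemma young_ae_bound:
 fixes \<rho> :: "'a::euclidean_space \<Rightarrow> real"
 assumes A: "A \<in> class_D p" and \<rho>: "\<And>x. 0 < \<rho> x"
 shows "\<exists>C\<ge>0. \<forall>w W. w \<in> \<M> \<longrightarrow> W \<in> \<M> \<longrightarrow> (\<forall>x. 0 \<le> w x \<and> 0 \<le> W x) \<longrightarrow>
  controls \<rho> A w W \<longrightarrow>
  (AE y in lebesgue. ennreal (w y) \<le> ennreal (C * W y))"
proof -
 obtain C where C: "0 \<le> C" "\<forall>(w :: 'a \<Rightarrow> real) c r. w \<in> \<M> \<longrightarrow> (\<forall>x. 0 \<le> w x) \<longrightarrow> 0 < r \<longrightarrow>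
  (NR x\<in>ball c r. w x) \<le> ennreal C * \<mu> (ball c r) * luxemburg A (ball c r) w"
  using young_average_bound[OF A] by (elim exE conjE) (rule that)
 define d where "d = real DIM('a)"
 have d: "0 < d" by (simp add: d_def)
 define V where "V = unit_ball_vol d * (2 * d) ^ DIM('a)"
 have V: "0 \<le> V" using d by (simp add: V_def)
 show ?thesis
 proof (intro exI[of _ "C * V"] conjI allI impI)
  show "0 \<le> C * V" using C(1) V by simp
  fix w W :: "'a \<Rightarrow> real"
  assume wm[measurable]: "w \<in> \<M>" and Wm[measurable]: "W \<in> \<M>" and nn: "\<forall>x. 0 \<le> w x \<and> 0 \<le> W x"
   and L: "controls \<rho> A w W"
  show "AE y in lebesgue. ennreal (w y) \<le> ennreal (C * V * W y)"
  proof (rule ae_le_of_cube_averages)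
   show "0 \<le> C * V * W y" for y using C(1) V nn by simp
   fix y
   \<comment> \<open>From this generation on, the ball of radius \<open>r\<close> that contains the
     cube is within the critical size.\<close>
   obtain N where N: "dside N \<le> \<rho> y / (2 * d)" using dside_small[of "\<rho> y / (2 * d)"] \<rho>[of y] d by auto
   show "\<exists>N. \<forall>n\<ge>N. (NR z\<in>dcube n y. w z) \<le> ennreal (C * V * W y) * \<mu> (dcube n y)"
   proof (intro exI[of _ N] allI impI)
    fix n assume n: "N \<le> n"
    define r where "r = 2 * (d * dside n)"
    have r0: "0 < r" using d by (simp add: r_def)
    have "dside n \<le> \<rho> y / (2 * d)" using dside_antimono[OF n] N by simp
    then have r: "r \<le> \<rho> y" using d by (simp add: r_def field_simps)
    have sub: "dcube n y \<subseteq> ball y r"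
    proof
     fix z assume "z \<in> dcube n y"
     then have "norm (y - z) \<le> d * dside n" unfolding d_def by (intro dcube_norm_diff[of y n y z]) simp
     moreover have "d * dside n < r" using d by (simp add: r_def)
     ultimately show "z \<in> ball y r" by (simp add: dist_norm)
    qed
    have "(NR z\<in>dcube n y. w z) \<le> (NR z\<in>ball y r. w z)"
     using sub by (intro nn_integral_mono) (auto simp: indicator_def)
    also have "\<dots> \<le> ennreal C * \<mu> (ball y r) * luxemburg A (ball y r) w" using C(2) nn r0 wm by blast
    also have "\<dots> \<le> ennreal C * \<mu> (ball y r) * ennreal (W y)"
     using L[unfolded controls_def] r0 r by (intro mult_left_mono) auto
    also have "\<mu> (ball y r) = ennreal (V * dside n ^ DIM('a))"
     using emeasure_lebesgue_ball[of r y] r0 by (simp add: V_def r_def d_def power_mult_distrib mult_ac)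
    also have "ennreal C * ennreal (V * dside n ^ DIM('a)) * ennreal (W y) = ennreal (C * V * W y) * \<mu> (dcube n y)"
     unfolding emeasure_dcube using C(1) V nn by (simp add: ennreal_mult[symmetric] mult_ac)
    finally show "(NR z\<in>dcube n y. w z) \<le> ennreal (C * V * W y) * \<mu> (dcube n y)" .
   qed
  qed measurable
 qed
qed

definition two_weight_bound where
 "two_weight_bound \<rho> p A C \<longleftrightarrow> (\<forall>f h w W M. f \<in> \<M> \<longrightarrow> h \<in> \<M> \<longrightarrow> w \<in> \<M> \<longrightarrow> W \<in> \<M> \<longrightarrow>
  (\<forall>x. 0 \<le> f x \<and> f x \<le> M \<and> 0 \<le> h x \<and> h x \<le> M \<and> 0 \<le> w x \<and> w x \<le> M \<and> 0 \<le> W x) \<longrightarrow>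
  controls \<rho> A w W \<longrightarrow>
  (\<exists>G\<in>\<M>.
   (NN x. G x) + (NR x. f x * (h x * w x powr (1 / p)))
    \<le> ennreal C * ((NR x. f x powr p * W x) + (NR x. h x powr (p / (p - 1)))) \<and>
   product_bound (\<lambda>x r. r \<le> \<rho> x) f (\<lambda>y. h y * w y powr (1 / p)) G))"

text \<open>The diagonal term is added to the integral of \<open>G\<close>: Young's inequality
  separates its factors, and \<open>w\<close> is replaced by \<open>W\<close> through the almost
  everywhere bound.\<close>

lemma local_two_weight:
 fixes \<rho> :: "'a::euclidean_space \<Rightarrow> real"
 assumes p: "1 < p" and A: "A \<in> class_D p" and \<rho>: "\<And>x. 0 < \<rho> x"
 shows "\<exists>C\<ge>0. two_weight_bound \<rho> p A C"
proof -
 define p' where "p' = p / (p - 1)"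
 have p': "1 < p'" "1 / p + 1 / p' = 1" using p by (auto simp: p'_def field_simps)
 obtain C1 where C1: "0 \<le> C1" "\<forall>(f :: 'a::euclidean_space \<Rightarrow> real) h w W M.
  f \<in> \<M> \<longrightarrow> h \<in> \<M> \<longrightarrow> w \<in> \<M> \<longrightarrow> W \<in> \<M> \<longrightarrow>
  (\<forall>x. 0 \<le> f x \<and> f x \<le> M \<and> 0 \<le> h x \<and> h x \<le> M \<and> 0 \<le> w x \<and> w x \<le> M \<and> 0 \<le> W x) \<longrightarrow>
  (\<exists>G\<in>\<M>.
   (NN x. G x) \<le> ennreal C1 * ((NR x. f x powr p * W x) + (NR x. h x powr (p / (p - 1)))) \<and>
   product_bound (\<lambda>x r. \<forall>y\<in>ball x r. luxemburg A (ball x r) w \<le> ennreal (W y)) f (\<lambda>y. h y * w y powr (1 / p)) G)"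
  using two_weight_maximal[OF p A] by (elim exE conjE) (rule that)
 obtain C2 where C2: "0 \<le> C2" "\<forall>w W. w \<in> \<M> \<longrightarrow> W \<in> \<M> \<longrightarrow> (\<forall>x. 0 \<le> w x \<and> 0 \<le> W x) \<longrightarrow>
  controls \<rho> A w W \<longrightarrow>
  (AE y in lebesgue. ennreal (w y) \<le> ennreal (C2 * W y))"
  using young_ae_bound[of A p \<rho>, OF A \<rho>] by (elim exE conjE) (rule that)
 show ?thesis unfolding two_weight_bound_def
 proof (intro exI[of _ "C1 + (C2 + 1)"] conjI allI impI)
  show "0 \<le> C1 + (C2 + 1)" using C1 C2 by simp
  fix f h w W :: "'a \<Rightarrow> real" and M :: real
  assume m[measurable]: "f \<in> \<M>" "h \<in> \<M>" "w \<in> \<M>" "W \<in> \<M>"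
   and nn: "\<forall>x. 0 \<le> f x \<and> f x \<le> M \<and> 0 \<le> h x \<and> h x \<le> M \<and> 0 \<le> w x \<and> w x \<le> M \<and> 0 \<le> W x"
   and L: "controls \<rho> A w W"
  define X where "X = (NR x. f x powr p * W x)"
  define Y where "Y = (NR x. h x powr p')"
  obtain G where G: "G \<in> \<M>" "(NN x. G x) \<le> ennreal C1 * (X + Y)"
   "product_bound (\<lambda>x r. \<forall>y\<in>ball x r. luxemburg A (ball x r) w \<le> ennreal (W y)) f (\<lambda>y. h y * w y powr (1 / p)) G"
   using C1(2)[rule_format, OF m, of M] nn unfolding X_def Y_def p'_def by blast
  have wW: "AE y in lebesgue. ennreal (w y) \<le> ennreal (C2 * W y)" using C2(2)[rule_format, OF m(3,4)] nn L by blast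
  have "(NR x. f x * (h x * w x powr (1 / p))) \<le> (NN x. ennreal (C2 + 1) * ennreal (f x powr p * W x) + ennreal (C2 + 1) * ennreal (h x powr p'))"
  proof (rule nn_integral_mono_AE, use wW in eventually_elim)
   case (elim x)
   have n: "0 \<le> f x" "0 \<le> h x" "0 \<le> w x" "0 \<le> W x" using nn by auto
   have w: "w x \<le> C2 * W x" using elim n C2(1) by (simp add: ennreal_le_iff)
   have "f x * (h x * w x powr (1 / p)) = (f x * w x powr (1 / p)) * h x" by simp
   also have "\<dots> \<le> (f x * w x powr (1 / p)) powr p / p + h x powr p' / p'"
    using n by (intro Youngs_inequality[OF p p']) auto
   also have "\<dots> \<le> (f x * w x powr (1 / p)) powr p / 1 + h x powr p' / 1" using p p' by (intro add_mono divide_left_mono) auto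
   also have "(f x * w x powr (1 / p)) powr p / 1 = f x powr p * w x" using n p by (simp add: powr_mult powr_powr)
   also have "f x powr p * w x + h x powr p' / 1 \<le> f x powr p * (C2 * W x) + 1 * h x powr p'" using w by (intro add_mono mult_left_mono) auto
   also have "\<dots> \<le> (C2 + 1) * (f x powr p * W x) + (C2 + 1) * h x powr p'"
    using C2(1) n by (intro add_mono mult_right_mono) (auto simp: distrib_right)
   finally show ?case using C2(1) n by (simp add: ennreal_mult[symmetric] ennreal_plus[symmetric] ennreal_leI del: ennreal_plus)
  qed
  also have "\<dots> = ennreal (C2 + 1) * X + ennreal (C2 + 1) * Y" unfolding X_def Y_def by (simp add: nn_integral_add nn_integral_cmult)
  finally have fh: "(NR x. f x * (h x * w x powr (1 / p))) \<le> ennreal (C2 + 1) * (X + Y)" by (simp add: distrib_left)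
  have "(NN x. G x) + (NR x. f x * (h x * w x powr (1 / p))) \<le> ennreal C1 * (X + Y) + ennreal (C2 + 1) * (X + Y)"
   using G(2) fh by (rule add_mono)
  also have "\<dots> = ennreal (C1 + (C2 + 1)) * (X + Y)"
   using C1(1) C2(1) by (simp add: ennreal_plus[of C1 "C2 + 1"] distrib_right del: ennreal_plus)
  finally have GI: "(NN x. G x) + (NR x. f x * (h x * w x powr (1 / p))) \<le> ennreal (C1 + (C2 + 1)) * (X + Y)" .
  show "\<exists>G\<in>\<M>.
   (NN x. G x) + (NR x. f x * (h x * w x powr (1 / p)))
    \<le> ennreal (C1 + (C2 + 1)) * ((NR x. f x powr p * W x) + (NR x. h x powr (p / (p - 1)))) \<and>
   product_bound (\<lambda>x r. r \<le> \<rho> x) f (\<lambda>y. h y * w y powr (1 / p)) G"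
  proof (intro bexI[of _ G] conjI)
   show "product_bound (\<lambda>x r. r \<le> \<rho> x) f (\<lambda>y. h y * w y powr (1 / p)) G"
    using G(3) L unfolding product_bound_def controls_def by blast
  qed (rule GI[unfolded X_def Y_def p'_def], rule G(1))
 qed
qed

section \<open>Duality and the passage from test functions to general functions\<close>

definition pairing_bound where
 "pairing_bound p C0 S w \<Phi> \<longleftrightarrow> (\<forall>h M B. h \<in> \<M> \<longrightarrow> 0 \<le> M \<longrightarrow> (\<forall>x. 0 \<le> h x \<and> h x \<le> B) \<longrightarrow> (\<forall>x. M < norm x \<longrightarrow> h x = 0) \<longrightarrow>
   (NR x. S x * (h x * min (w x) M powr (1 / p))) \<le> ennreal C0 * (\<Phi> + (NR x. h x powr (p / (p - 1)))))"

text \<open>In the additive form of the pairing bound, replacing \<open>h\<close> by \<open>\<epsilon> h\<close> makes the term with \<open>h\<close>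
 of higher order, so that it is absorbed. The truncations keep all quantities finite.\<close>

lemma duality_bound:
 fixes p C0 :: real
 assumes p: "1 < p" and C0: "0 \<le> C0"
 shows "\<exists>C1\<ge>0. \<forall>(S :: 'a::euclidean_space \<Rightarrow> real) w \<Phi>. S \<in> \<M> \<longrightarrow> w \<in> \<M> \<longrightarrow> (\<forall>x. 0 \<le> S x \<and> 0 \<le> w x) \<longrightarrow>
  pairing_bound p C0 S w \<Phi> \<longrightarrow>
  (NR x. S x powr p * w x) \<le> ennreal C1 * \<Phi>"
proof -
 define p' where "p' = p / (p - 1)"
 have p': "1 < p'" "1 / p + 1 / p' = 1" "(p - 1) * p' = p" using p by (auto simp: p'_def field_simps)
 \<comment> \<open>The solution of \<open>2 (C0 + 1) \<epsilon> powr (p' - 1) = 1\<close>, for which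
   \<open>C0 \<epsilon> powr p'\<close> is at most \<open>\<epsilon> / 2\<close>.\<close>
 define \<epsilon> where "\<epsilon> = (1 / (2 * (C0 + 1))) powr (1 / (p' - 1))"
 have \<epsilon>: "0 < \<epsilon>" unfolding \<epsilon>_def using C0 by simp
 have ep: "C0 * \<epsilon> powr p' \<le> \<epsilon> / 2"
 proof -
  have "\<epsilon> powr (p' - 1) = (1 / (2 * (C0 + 1))) powr 1" unfolding \<epsilon>_def using p' by (simp only: powr_powr) simp
  also have "\<dots> = 1 / (2 * (C0 + 1))" using C0 by simp
  finally have "\<epsilon> powr (p' - 1) = 1 / (2 * (C0 + 1))" .
  then have "\<epsilon> powr p' = \<epsilon> * (1 / (2 * (C0 + 1)))" using \<epsilon> powr_add[of \<epsilon> 1 "p' - 1"] by simp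
  moreover have "C0 * (1 / (2 * (C0 + 1))) \<le> 1 / 2" using C0 by (simp add: field_simps)
  then have "\<epsilon> * (C0 * (1 / (2 * (C0 + 1)))) \<le> \<epsilon> * (1 / 2)" using \<epsilon> by (intro mult_left_mono) auto
  ultimately show ?thesis by (simp add: mult_ac)
 qed
 show ?thesis
 proof (intro exI[of _ "2 / \<epsilon> * C0"] conjI allI impI)
  show "0 \<le> 2 / \<epsilon> * C0" using \<epsilon> C0 by simp
  fix S w :: "'a \<Rightarrow> real" and \<Phi>
  assume Sm[measurable]: "S \<in> \<M>" and wm[measurable]: "w \<in> \<M>" and nn: "\<forall>x. 0 \<le> S x \<and> 0 \<le> w x"
   and bil: "pairing_bound p C0 S w \<Phi>"
  define E where "E n = {x. norm x \<le> real n \<and> S x \<le> real n}" for n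
  have Em[measurable]: "E n \<in> \<L>" for n
  proof -
   note borel_measurable_lebesgue_id[measurable]
   have "{x \<in> space lebesgue. norm x \<le> real n \<and> S x \<le> real n} \<in> \<L>" by measurable
   then show ?thesis by (simp add: E_def)
  qed
  define \<phi> where "\<phi> n x = S x powr p * min (w x) (real n) * indicator (E n) x" for n x
  have \<phi>m[measurable]: "\<phi> n \<in> \<M>" for n unfolding \<phi>_def[abs_def] by measurable
  have le: "(NR x. \<phi> n x) \<le> ennreal (2 / \<epsilon> * C0) * \<Phi>" for n
  proof -
   define v where "v x = min (w x) (real n)" for x
   have v: "0 \<le> v x" "v x \<le> real n" for x using nn by (auto simp: v_def)
   have [measurable]: "v \<in> \<M>" unfolding v_def[abs_def] by measurable
   \<comment> \<open>The extremal function of the duality: up to powers of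
     \<open>\<epsilon>\<close>, both its weighted product with \<open>S\<close> and its own
     \<open>p'\<close>-th power equal the truncated integrand \<open>\<phi> n\<close>.\<close>
   define h where "h x = \<epsilon> * S x powr (p - 1) * v x powr (1 / p') * indicator (E n) x" for x
   have hm[measurable]: "h \<in> \<M>" unfolding h_def[abs_def] by measurable
   have h: "0 \<le> h x \<and> h x \<le> \<epsilon> * real n powr (p - 1) * real n powr (1 / p')" for x
   proof (cases "x \<in> E n")
    case True
    have "\<epsilon> * S x powr (p - 1) * v x powr (1 / p') \<le> \<epsilon> * real n powr (p - 1) * real n powr (1 / p')"
     using True nn v \<epsilon> p p' by (intro mult_mono powr_mono2) (auto simp: E_def)
    then show ?thesis using True \<epsilon> by (simp add: h_def)
   qed (use \<epsilon> in \<open>simp add: h_def\<close>)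
   have h1: "S x * (h x * min (w x) (real n) powr (1 / p)) = \<epsilon> * \<phi> n x" for x
   proof -
    have "S x * S x powr (p - 1) = S x powr p" using powr_add[of "S x" 1 "p - 1"] nn by simp
    moreover have "v x powr (1 / p') * v x powr (1 / p) = v x"
     using powr_add[of "v x" "1 / p'" "1 / p"] p'(2) v(1)[of x] by (simp add: add.commute)
    ultimately have "\<epsilon> * (S x * S x powr (p - 1)) * (v x powr (1 / p') * v x powr (1 / p)) * indicator (E n) x = \<epsilon> * S x powr p * v x * indicator (E n) x"
     by simp
    then show ?thesis by (simp add: h_def \<phi>_def v_def mult_ac)
   qed
   have h2: "h x powr p' = \<epsilon> powr p' * \<phi> n x" for x
   proof (cases "x \<in> E n")
    case True
    have "(S x powr (p - 1)) powr p' = S x powr p" by (simp only: powr_powr p'(3))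
    moreover have "(v x powr (1 / p')) powr p' = v x" using p'(1) v(1)[of x] by (simp add: powr_powr)
    moreover have "h x powr p' = \<epsilon> powr p' * (S x powr (p - 1)) powr p' * (v x powr (1 / p')) powr p'"
     using True by (simp add: h_def powr_mult)
    ultimately show ?thesis using True by (simp add: \<phi>_def v_def)
   qed (simp add: h_def \<phi>_def)
   define I where "I = (NR x. \<phi> n x)"
   have "I \<le> (NN x. ennreal (real n powr p * real n) * indicator (cball (0::'a) (real n)) x)"
    unfolding I_def
   proof (rule nn_integral_mono)
    fix x
    show "ennreal (\<phi> n x) \<le> ennreal (real n powr p * real n) * indicator (cball 0 (real n)) x"
    proof (cases "x \<in> E n")
     case True
     have "\<phi> n x \<le> real n powr p * real n" unfolding \<phi>_def using True nn p by (auto simp: E_def intro!: mult_mono powr_mono2)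
     then show ?thesis using True by (simp add: E_def ennreal_leI)
    qed (simp add: \<phi>_def)
   qed
   also have "\<dots> = ennreal (real n powr p * real n) * \<mu> (cball (0::'a) (real n))"
    by (rule nn_integral_cmult_indicator) simp
   also have "\<dots> < \<infinity>" using emeasure_bounded_finite[of "cball (0::'a) (real n)"] by (simp add: ennreal_mult_less_top)
   finally have "I < \<infinity>" .
   then obtain i where i: "0 \<le> i" "I = ennreal i" by (cases I) auto
   have "ennreal \<epsilon> * I = (NR x. S x * (h x * min (w x) (real n) powr (1 / p)))"
    unfolding h1 I_def using \<epsilon> by (simp add: nn_integral_cmult[symmetric] ennreal_mult')
   also have "\<dots> \<le> ennreal C0 * (\<Phi> + (NR x. h x powr (p / (p - 1))))"
    by (rule bil[unfolded pairing_bound_def, rule_format, OF hm _ h]) (auto simp: h_def E_def)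
   also have "(NR x. h x powr (p / (p - 1))) = ennreal (\<epsilon> powr p') * I"
    unfolding p'_def[symmetric] h2 I_def by (simp add: nn_integral_cmult[symmetric] ennreal_mult')
   finally have key: "ennreal (\<epsilon> * i) \<le> ennreal C0 * \<Phi> + ennreal (C0 * \<epsilon> powr p' * i)"
    using i \<epsilon> C0 by (simp add: distrib_left ennreal_mult mult.assoc)
   have "ennreal (\<epsilon> / 2 * i) \<le> ennreal C0 * \<Phi>"
   proof (cases "ennreal C0 * \<Phi>")
    case (real z)
    have "\<epsilon> * i \<le> z + C0 * \<epsilon> powr p' * i"
     using key real i C0 by (simp add: ennreal_plus[symmetric] ennreal_le_iff del: ennreal_plus)
    moreover have "C0 * \<epsilon> powr p' * i \<le> \<epsilon> / 2 * i" using ep i(1) by (rule mult_right_mono)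
    ultimately have "\<epsilon> / 2 * i \<le> z" by simp
    then show ?thesis using real by (simp add: ennreal_leI)
   qed simp
   then have "ennreal (2 / \<epsilon>) * ennreal (\<epsilon> / 2 * i) \<le> ennreal (2 / \<epsilon>) * (ennreal C0 * \<Phi>)" by (rule mult_left_mono) simp
   then show ?thesis unfolding I_def[symmetric] i(2) using \<epsilon> i(1) C0 by (simp add: ennreal_mult[symmetric] mult.assoc[symmetric])
  qed
  have mono: "incseq (\<lambda>n x. ennreal (\<phi> n x))"
  proof (rule incseq_SucI, rule le_funI)
   fix n x
   have "\<phi> n x \<le> \<phi> (Suc n) x"
    unfolding \<phi>_def using nn by (intro mult_mono) (auto simp: E_def indicator_def)
   then show "ennreal (\<phi> n x) \<le> ennreal (\<phi> (Suc n) x)" by (rule ennreal_leI)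
  qed
  have "(NR x. S x powr p * w x) \<le> (NN x. (SUP n. ennreal (\<phi> n x)))"
  proof (rule nn_integral_mono)
   fix x
   obtain n :: nat where n: "max (norm x) (max (S x) (w x)) \<le> real n" using real_arch_simple by blast
   then have "S x powr p * w x = \<phi> n x" by (simp add: \<phi>_def E_def min_absorb1)
   then show "ennreal (S x powr p * w x) \<le> (SUP n. ennreal (\<phi> n x))" by (metis SUP_upper UNIV_I)
  qed
  also have "\<dots> = (SUP n. NR x. \<phi> n x)" by (rule nn_integral_monotone_convergence_SUP[OF mono]) measurable
  also have "\<dots> \<le> ennreal (2 / \<epsilon> * C0) * \<Phi>" by (intro SUP_least le)
  finally show "(NR x. S x powr p * w x) \<le> ennreal (2 / \<epsilon> * C0) * \<Phi>" .
 qed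
qed

lemma weight_measurable:
 fixes w :: "'a::euclidean_space \<Rightarrow> real"
 assumes "weight w"
 shows "w \<in> \<M>"
proof (rule borel_measurable_LIMSEQ_real)
 show "(\<lambda>x. indicator (cball (0::'a) (real n)) x * w x) \<in> \<M>" for n
 proof -
  have "w absolutely_integrable_on cball (0::'a) (real n)"
   by (rule conjunct2[OF assms[unfolded weight_def], rule_format]) (rule compact_cball)
  then have "(\<lambda>x. indicator (cball (0::'a) (real n)) x *\<^sub>R w x) \<in> \<M>" unfolding set_integrable_def by (rule borel_measurable_integrable)
  then show ?thesis by simp
 qed
 fix x :: 'a
 obtain N :: nat where N: "norm x \<le> real N" using real_arch_simple by blast
 have "eventually (\<lambda>n. indicator (cball (0::'a) (real n)) x * w x = w x) sequentially"
  using eventually_ge_at_top[of N] by eventually_elim (use N in auto)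
 then show "(\<lambda>n. indicator (cball (0::'a) (real n)) x * w x) \<longlonglongrightarrow> w x" by (rule tendsto_eventually)
qed

lemma nn_integral_monotone_cut:
 fixes F :: "'a::euclidean_space \<Rightarrow> ennreal" and f :: "'a \<Rightarrow> complex"
 assumes [measurable]: "F \<in> \<M>" "f \<in> \<M>"
  and le: "\<And>n::nat. (NN x\<in>{x. norm x \<le> real n \<and> norm (f x) \<le> real n}. F x) \<le> Z"
 shows "(NN x. F x) \<le> Z"
proof -
 define E where "E n = {x. norm x \<le> real n \<and> norm (f x) \<le> real n}" for n
 have [measurable]: "E n \<in> \<L>" for n
 proof -
  note borel_measurable_lebesgue_id[measurable]
  have "{x \<in> space lebesgue. norm x \<le> real n \<and> norm (f x) \<le> real n} \<in> \<L>" by measurable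
  then show ?thesis by (simp add: E_def)
 qed
 have "(NN x. F x) \<le> (NN x. (SUP n. F x * indicator (E n) x))"
 proof (rule nn_integral_mono)
  fix x
  obtain n :: nat where "max (norm x) (norm (f x)) \<le> real n" using real_arch_simple by blast
  then have "F x = F x * indicator (E n) x" by (simp add: E_def)
  then show "F x \<le> (SUP n. F x * indicator (E n) x)" by (metis SUP_upper UNIV_I)
 qed
 also have "\<dots> = (SUP n. NN x\<in>E n. F x)"
 proof (rule nn_integral_monotone_convergence_SUP)
  show "incseq (\<lambda>n x. F x * indicator (E n) x)"
   by (rule incseq_SucI, rule le_funI) (auto simp: E_def indicator_def)
 qed measurable
 also have "\<dots> \<le> Z" unfolding E_def by (intro SUP_least le)
 finally show ?thesis .
qed

lemma cut_bcs_Lp: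
 fixes f :: "'a::euclidean_space \<Rightarrow> complex" and n :: nat
 assumes f: "f \<in> Lp q UNIV" and q: "0 < q"
 defines "E \<equiv> {x. norm x \<le> real n \<and> norm (f x) \<le> real n}"
 shows "E \<in> \<L>" "cut E f \<in> bcs" "cut (- E) f \<in> Lp q UNIV"
proof -
 have fm[measurable]: "f \<in> \<M>" by (rule Lp_measurable[OF f])
 show E[measurable]: "E \<in> \<L>"
 proof -
  note borel_measurable_lebesgue_id[measurable]
  have "{x \<in> space lebesgue. norm x \<le> real n \<and> norm (f x) \<le> real n} \<in> \<L>" by measurable
  then show ?thesis by (simp add: E_def)
 qed
 show "cut E f \<in> bcs"
  by (rule bcsI[of _ "real n" "real n"]) (auto simp: E_def[symmetric], auto simp: E_def)
 have "integrable lebesgue (\<lambda>x. norm (f x) powr q)" using f by (simp add: Lp_def lebesgue_on_UNIV_eq)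
 then have "integrable lebesgue (\<lambda>x. norm (cut (- E) f x) powr q)"
  by (rule Bochner_Integration.integrable_bound) (use q in auto)
 then show "cut (- E) f \<in> Lp q UNIV" by (simp add: Lp_def lebesgue_on_UNIV_eq)
qed

lemma Lp_tail_small:
 fixes f :: "'a::euclidean_space \<Rightarrow> complex" and \<delta> :: real
 assumes f: "f \<in> Lp q UNIV" and q: "0 < q" and \<delta>: "0 < \<delta>"
 shows "\<exists>n::nat. (NR x. norm (cut (- {x. norm x \<le> real n \<and> norm (f x) \<le> real n}) f x) powr q) \<le> ennreal \<delta>"
proof -
 define E where "E n = {x. norm x \<le> real n \<and> norm (f x) \<le> real n}" for n :: nat
 have fm[measurable]: "f \<in> \<M>" by (rule Lp_measurable[OF f])
 have [measurable]: "E n \<in> \<L>" for n unfolding E_def by (rule cut_bcs_Lp(1)[OF f q])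
 have "(\<lambda>n. NR x. norm (cut (- E n) f x) powr q) \<longlonglongrightarrow> (\<integral>\<^sup>+x. 0 \<partial>(lebesgue :: 'a measure))"
 proof (rule nn_integral_dominated_convergence[where w = "\<lambda>x. ennreal (norm (f x) powr q)"])
  show "(NR x. norm (f x) powr q) < \<infinity>"
   using Lp_nn_integral[OF f q] by (simp add: lebesgue_on_UNIV_eq)
  show "AE x in lebesgue. (\<lambda>n. ennreal (norm (cut (- E n) f x) powr q)) \<longlonglongrightarrow> 0"
  proof (rule AE_I2)
   fix x
   obtain N :: nat where N: "max (norm x) (norm (f x)) \<le> real N" using real_arch_simple by blast
   have "eventually (\<lambda>n. ennreal (norm (cut (- E n) f x) powr q) = 0) sequentially"
    using eventually_ge_at_top[of N] by eventually_elim (use N q in \<open>auto simp: E_def\<close>)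
   then show "(\<lambda>n. ennreal (norm (cut (- E n) f x) powr q)) \<longlonglongrightarrow> 0" by (rule tendsto_eventually)
  qed
  show "AE x in lebesgue. ennreal (norm (cut (- E n) f x) powr q) \<le> ennreal (norm (f x) powr q)" for n
   by (rule AE_I2) simp
 qed measurable
 then have "eventually (\<lambda>n. (NR x. norm (cut (- E n) f x) powr q) < ennreal \<delta>) sequentially"
  using \<delta> by (intro order_tendstoD(2)) auto
 then show ?thesis unfolding E_def eventually_sequentially by (meson less_imp_le order_refl)
qed

text \<open>A function in \<open>L^q\<close> differs from its truncation by a part small in
  \<open>L^q\<close>. As \<open>g\<close> is bounded with bounded support, it lies in
  \<open>L^q'\<close>, and the pairing with the error is small by Hoelder's inequality and the
  boundedness of \<open>T\<close>.\<close>

lemma bounded_pairing_extend: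
 fixes T :: "('a::euclidean_space \<Rightarrow> complex) \<Rightarrow> ('a \<Rightarrow> complex)" and g :: "'a \<Rightarrow> real"
 assumes T: "bounded_operator q T" and q: "1 < q" and gm[measurable]: "g \<in> \<M>"
  and g: "\<And>x. 0 \<le> g x" "\<And>x. g x \<le> B" "\<And>x. M < norm x \<Longrightarrow> g x = 0" and M: "0 \<le> M"
  and f: "f \<in> Lp q UNIV"
  and le: "\<And>n::nat. (NR x. norm (T (cut {x. norm x \<le> real n \<and> norm (f x) \<le> real n} f) x) * g x) \<le> Z"
 shows "(NR x. norm (T f x) * g x) \<le> Z"
proof (rule ennreal_le_epsilon)
 fix e :: real assume e: "0 < e"
 have q0: "0 < q" using q by simp
 define q' where "q' = q / (q - 1)"
 have q': "1 < q'" "1 / q + 1 / q' = 1" using q by (auto simp: q'_def field_simps)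
 have fm[measurable]: "f \<in> \<M>" by (rule Lp_measurable[OF f])
 define Y where "Y = B powr q' * (unit_ball_vol (DIM('a)) * (M + 1) ^ DIM('a))"
 have Y: "0 \<le> Y" using M by (simp add: Y_def)
 have gY: "(NR x. g x powr q') \<le> ennreal Y"
 proof -
  have "(NR x. g x powr q') \<le> (NN x. ennreal (B powr q') * indicator (ball (0::'a) (M + 1)) x)"
  proof (rule nn_integral_mono)
   fix x
   show "ennreal (g x powr q') \<le> ennreal (B powr q') * indicator (ball (0::'a) (M + 1)) x"
   proof (cases "M < norm x")
    case False
    have "g x powr q' \<le> B powr q'" using g(1,2)[of x] q' by (intro powr_mono2) auto
    then show ?thesis using False by (simp add: ennreal_leI)
   qed (simp add: g(3))
  qed
  also have "\<dots> = ennreal (B powr q') * \<mu> (ball (0::'a) (M + 1))" by (rule nn_integral_cmult_indicator) simp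
  also have "\<dots> = ennreal Y" using emeasure_lebesgue_ball[of "M + 1" "0::'a"] M by (simp add: Y_def ennreal_mult' del: emeasure_completion)
  finally show ?thesis .
 qed
 obtain A where A: "0 \<le> A" "\<forall>f\<in>Lp q UNIV. (NR x. norm (T f x) powr q) \<le> ennreal A * (NR x. norm (f x) powr q)"
  using bounded_operator_nn[OF T q0] by (elim exE conjE) (rule that)
 define k where "k = Y powr (1 / q')"
 have k: "0 \<le> k" by (simp add: k_def)
 \<comment> \<open>Chosen so that the \<open>q\<close>-th root of \<open>A * \<delta>\<close> is at
   most \<open>e / (k + 1)\<close>; its product with the bound \<open>k\<close> for the norm of
   \<open>g\<close> stays below \<open>e\<close>.\<close>
 define \<delta> where "\<delta> = (e / (k + 1)) powr q / (A + 1)"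
 have \<delta>: "0 < \<delta>" using e k A(1) by (simp add: \<delta>_def)
 obtain n :: nat where n: "(NR x. norm (cut (- {x. norm x \<le> real n \<and> norm (f x) \<le> real n}) f x) powr q) \<le> ennreal \<delta>"
  using Lp_tail_small[OF f q0 \<delta>] by blast
 define E where "E = {x. norm x \<le> real n \<and> norm (f x) \<le> real n}"
 have f1: "cut E f \<in> bcs" and f2: "cut (- E) f \<in> Lp q UNIV" unfolding E_def by (rule cut_bcs_Lp[OF f q0])+
 have fe: "f = (\<lambda>y. cut E f y + cut (- E) f y)" by (auto simp: fun_eq_iff)
 have T1m[measurable]: "T (cut E f) \<in> \<M>" by (rule bounded_operator_measurable[OF T bcs_Lp[OF f1 q0]])
 have T2m[measurable]: "T (cut (- E) f) \<in> \<M>" by (rule bounded_operator_measurable[OF T f2])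
 have T2: "(NR x. norm (T (cut (- E) f) x) powr q) \<le> ennreal (A * \<delta>)"
 proof -
  have "(NR x. norm (T (cut (- E) f) x) powr q) \<le> ennreal A * (NR x. norm (cut (- E) f x) powr q)"
   using A(2) f2 by blast
  also have "\<dots> \<le> ennreal A * ennreal \<delta>" using n unfolding E_def[symmetric] by (rule mult_left_mono) simp
  finally show ?thesis using A(1) by (simp add: ennreal_mult')
 qed
 have "(NR x. norm (T (cut (- E) f) x) * g x) \<le> ennreal ((A * \<delta>) powr (1 / q) * Y powr (1 / q'))"
  by (rule Holder_nn_integral[OF q q'(2) measurable_compose[OF T2m borel_measurable_norm] gm _ g(1) T2 _ gY Y]) (use A(1) \<delta> in auto)
 also have "\<dots> \<le> ennreal e"
 proof (rule ennreal_leI)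
  have "A * \<delta> \<le> (A + 1) * \<delta>" using \<delta> by simp
  also have "\<dots> = (e / (k + 1)) powr q" using A(1) by (simp add: \<delta>_def)
  finally have "(A * \<delta>) powr (1 / q) \<le> ((e / (k + 1)) powr q) powr (1 / q)" using A(1) \<delta> q by (intro powr_mono2) auto
  also have "\<dots> = e / (k + 1)" using e k q by (simp add: powr_powr)
  finally have "(A * \<delta>) powr (1 / q) * k \<le> e / (k + 1) * k" using k by (rule mult_right_mono)
  also have "\<dots> \<le> e" using e k by (simp add: field_simps)
  finally show "(A * \<delta>) powr (1 / q) * Y powr (1 / q') \<le> e" by (simp add: k_def)
 qed
 finally have small: "(NR x. norm (T (cut (- E) f) x) * g x) \<le> ennreal e" .
 have "(NR x. norm (T f x) * g x) \<le> (NN x. ennreal (norm (T (cut E f) x) * g x) + ennreal (norm (T (cut (- E) f) x) * g x))"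
 proof (rule nn_integral_mono_AE, use bounded_operator_add[OF T bcs_Lp[OF f1 q0] f2] in eventually_elim)
  case (elim x)
  have "norm (T f x) \<le> norm (T (cut E f) x) + norm (T (cut (- E) f) x)" using elim norm_triangle_ineq unfolding fe[symmetric] by simp
  then have "norm (T f x) * g x \<le> norm (T (cut E f) x) * g x + norm (T (cut (- E) f) x) * g x"
   using g(1)[of x] by (simp add: distrib_right[symmetric] mult_right_mono)
  then show ?case using g(1)[of x] by (simp add: ennreal_plus[symmetric] ennreal_leI del: ennreal_plus)
 qed
 also have "\<dots> = (NR x. norm (T (cut E f) x) * g x) + (NR x. norm (T (cut (- E) f) x) * g x)"
  by (rule nn_integral_add) measurable
 also have "\<dots> \<le> Z + ennreal e" using le[of n] small unfolding E_def by (rule add_mono)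
 finally show "(NR x. norm (T f x) * g x) \<le> Z + ennreal e" .
qed

text \<open>With the phase of \<open>Tstar f\<close> absorbed into \<open>g\<close> the integrand is
  real and nonnegative, and the duality relation moves the operator: the adjoint, for which no
  kernel is given, is replaced by \<open>T\<close> acting on a test function.\<close>

lemma adjoint_pairing:
 fixes T Tstar :: "('a::euclidean_space \<Rightarrow> complex) \<Rightarrow> ('a \<Rightarrow> complex)"
 assumes adj: "is_adjoint q T Tstar" and q: "1 < q" and T: "bounded_operator q T" and f: "f \<in> Lp (conj_exp q) UNIV"
  and gm[measurable]: "g \<in> \<M>"
  and g: "\<And>x. 0 \<le> g x" "\<And>x. g x \<le> B" "\<And>x. M < norm x \<Longrightarrow> g x = 0"
 obtains F where "F \<in> bcs" "\<And>x. norm (F x) = g x"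
  "(NR x. norm (Tstar f x) * g x) \<le> (NR x. norm (T F x) * norm (f x))"
proof -
 define q' where "q' = conj_exp q"
 have q0: "0 < q" using q by simp
 have q': "1 < q'" "1 / q' + 1 / q = 1" using q by (auto simp: q'_def conj_exp_def field_simps)
 have S: "Tstar f \<in> Lp q' UNIV" using adj f unfolding is_adjoint_def q'_def by blast
 \<comment> \<open>The value 1 at the zeros keeps \<open>norm (F x) = g x\<close>
   everywhere.\<close>
 define s where "s x = (if Tstar f x = 0 then 1 else sgn (Tstar f x))" for x
 have [measurable]: "Tstar f \<in> \<M>" by (rule Lp_measurable[OF S])
 have [measurable]: "f \<in> \<M>" by (rule Lp_measurable[OF f])
 have [measurable]: "s \<in> \<M>" unfolding s_def[abs_def] sgn_div_norm by measurable
 have s1: "norm (s x) = 1" for x by (simp add: s_def norm_sgn)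
 define F where "F x = s x * of_real (g x)" for x
 have nF: "norm (F x) = g x" for x using g(1)[of x] by (simp add: F_def norm_mult s1)
 have Fm[measurable]: "F \<in> \<M>" unfolding F_def[abs_def] by measurable
 have F: "F \<in> bcs"
 proof (rule bcsI[OF Fm])
  show "norm (F x) \<le> B" for x using nF g(2)[of x] by simp
  show "F x = 0" if "M < norm x" for x using g(3)[OF that] by (simp add: F_def)
 qed
 have FL: "F \<in> Lp q UNIV" by (rule bcs_Lp[OF F q0])
 have pt: "F x * cnj (Tstar f x) = complex_of_real (norm (Tstar f x) * g x)" for x
 proof (cases "Tstar f x = 0")
  case False
  have "sgn (Tstar f x) * cnj (Tstar f x) = (Tstar f x * cnj (Tstar f x)) / of_real (norm (Tstar f x))"
   by (simp add: sgn_eq)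
  also have "\<dots> = of_real (norm (Tstar f x))" using False by (simp add: complex_norm_square[symmetric] power2_eq_square)
  finally show ?thesis using False by (simp add: F_def s_def mult_ac)
 qed simp
 have fin: "(NR x. norm (Tstar f x) * g x) < \<infinity>"
 proof -
  have "(NR x. norm (Tstar f x) powr q') = ennreal (Lp_norm q' UNIV (Tstar f) powr q')"
   using Lp_nn_integral[OF S] q' by (simp add: lebesgue_on_UNIV_eq)
  moreover have "(NR x. g x powr q) = ennreal (Lp_norm q UNIV F powr q)"
   using Lp_nn_integral[OF FL q0] nF by (simp add: lebesgue_on_UNIV_eq)
  ultimately have "(NR x. norm (Tstar f x) * g x)
    \<le> ennreal ((Lp_norm q' UNIV (Tstar f) powr q') powr (1 / q') * (Lp_norm q UNIV F powr q) powr (1 / q))"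
   by (intro Holder_nn_integral[OF q']) (use g in auto)
  then show ?thesis using order_le_less_trans by fastforce
 qed
 have int: "integrable lebesgue (\<lambda>x. norm (Tstar f x) * g x)"
  by (rule integrableI_nonneg) (use g(1) fin in auto)
 have "(\<integral>\<^sup>+x. ennreal (norm (Tstar f x) * g x) \<partial>lebesgue) = ennreal (\<integral>x. norm (Tstar f x) * g x \<partial>lebesgue)"
  by (rule nn_integral_eq_integral[OF int]) (use g(1) in auto)
 also have "(\<integral>x. norm (Tstar f x) * g x \<partial>lebesgue) = norm (\<integral>x. F x * cnj (Tstar f x) \<partial>lebesgue)"
  unfolding pt integral_complex_of_real norm_of_real using g(1) by (simp add: integral_nonneg_AE)
 also have "(\<integral>x. F x * cnj (Tstar f x) \<partial>lebesgue) = (\<integral>x. T F x * cnj (f x) \<partial>lebesgue)"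
  using adj FL f unfolding is_adjoint_def by simp
 also have "ennreal (norm (\<integral>x. T F x * cnj (f x) \<partial>lebesgue)) \<le> (\<integral>\<^sup>+x. ennreal (norm (T F x) * norm (f x)) \<partial>lebesgue)"
 \<comment> \<open>A non-integrable function has integral 0 by convention, and the inequality is
   trivial.\<close>
 proof (cases "integrable lebesgue (\<lambda>x. T F x * cnj (f x))")
  case True
  then show ?thesis using integral_norm_bound_ennreal[OF True] by (simp add: norm_mult)
 qed (simp add: not_integrable_integral_eq)
 finally show thesis using F nF by (intro that)
qed

text \<open>The maximal function at \<open>x\<close> controls the norm over a ball centred at
  \<open>x\<close> up to \<open>(1 + R / \<rho> x) powr \<theta>\<close>. The constant weight
  satisfies its condition because this factor is at least 1.\<close>

lemma admissible_left:
 fixes \<rho> :: "'a::euclidean_space \<Rightarrow> real"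
 assumes \<rho>: "\<And>x. 0 < \<rho> x" and \<theta>: "0 \<le> \<theta>" and ts: "1 < t" "t < s"
  and m: "u \<in> \<M>" "v \<in> \<M>" "w \<in> \<M>" "W \<in> \<M>"
  and nn: "\<And>x. 0 \<le> u x \<and> 0 \<le> v x \<and> 0 \<le> w x \<and> 0 \<le> W x"
  and W: "\<And>x. max_theta \<rho> \<theta> (\<lambda>z. z powr (s / (s - t))) w x \<le> ennreal (W x)"
 shows "admissible \<rho> \<theta> s t u v w (\<lambda>_. 1) W (\<lambda>_. 1)"
 unfolding admissible_def
proof (intro conjI allI impI)
 have r: "1 \<le> s / (s - t)" using ts by simp
 fix x :: 'a and R :: real assume R: "0 < R"
 show "(NR y\<in>ball x R. w y powr (s / (s - t)))
   \<le> ennreal (((1 + R / \<rho> x) powr \<theta> * W x) powr (s / (s - t))) * \<mu> (ball x R)"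
 proof (rule luxemburg_powr_bound[OF r R _ m(3)])
  show "luxemburg (\<lambda>z. z powr (s / (s - t))) (ball x R) w \<le> ennreal ((1 + R / \<rho> x) powr \<theta> * W x)"
   by (rule luxemburg_le_max_theta[of R x x \<rho> \<theta>]) (use R \<rho> W nn in auto)
 qed (use nn in auto)
 have "1 \<le> (1 + R / \<rho> x) powr \<theta>" using R \<rho>[of x] \<theta> by (intro ge_one_powr_ge_zero) auto
 then have "ennreal 1 * \<mu> (ball x R) \<le> ennreal ((1 + R / \<rho> x) powr \<theta> * 1) * \<mu> (ball x R)"
  by (intro mult_right_mono ennreal_leI) auto
 moreover have "(NN y\<in>ball x R. ennreal 1) = \<mu> (ball x R)"
  by (simp add: nn_integral_indicator del: emeasure_completion)
 ultimately show "(NN y\<in>ball x R. ennreal 1) \<le> ennreal ((1 + R / \<rho> x) powr \<theta> * 1) * \<mu> (ball x R)"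
  by (simp only: ennreal_1 mult_1)
qed (use m nn in auto)

lemma admissible_right:
 fixes \<rho> :: "'a::euclidean_space \<Rightarrow> real"
 assumes \<rho>: "\<And>x. 0 < \<rho> x" and \<theta>: "0 \<le> \<theta>" and ts: "1 < t" "t < s"
  and m: "u \<in> \<M>" "v \<in> \<M>" "w \<in> \<M>" "W \<in> \<M>"
  and nn: "\<And>x. 0 \<le> u x \<and> 0 \<le> v x \<and> 0 \<le> w x \<and> 0 \<le> W x"
  and W: "\<And>x. max_theta \<rho> \<theta> (\<lambda>z. z powr 1) w x \<le> ennreal (W x)"
 shows "admissible \<rho> \<theta> s t u v (\<lambda>_. 1) w (\<lambda>_. 1) W"
 unfolding admissible_def
proof (intro conjI allI impI)
 fix x :: 'a and R :: real assume R: "0 < R"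
 have "(NR y\<in>ball x R. w y powr 1) \<le> ennreal (((1 + R / \<rho> x) powr \<theta> * W x) powr 1) * \<mu> (ball x R)"
 proof (rule luxemburg_powr_bound[OF _ R _ m(3)])
  show "luxemburg (\<lambda>z. z powr 1) (ball x R) w \<le> ennreal ((1 + R / \<rho> x) powr \<theta> * W x)"
   by (rule luxemburg_le_max_theta[of R x x \<rho> \<theta>]) (use R \<rho> W nn in auto)
 qed (use nn in auto)
 then show "(NR y\<in>ball x R. w y) \<le> ennreal ((1 + R / \<rho> x) powr \<theta> * W x) * \<mu> (ball x R)"
  using nn by simp
 have "1 \<le> (1 + R / \<rho> x) powr \<theta>" using R \<rho>[of x] \<theta> by (intro ge_one_powr_ge_zero) auto
 then have "1 \<le> ((1 + R / \<rho> x) powr \<theta> * 1) powr (s / (s - t))" using ts by (intro ge_one_powr_ge_zero) auto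
 then have "ennreal 1 * \<mu> (ball x R) \<le> ennreal (((1 + R / \<rho> x) powr \<theta> * 1) powr (s / (s - t))) * \<mu> (ball x R)"
  by (intro mult_right_mono ennreal_leI) auto
 moreover have "(NR y\<in>ball x R. 1 powr (s / (s - t))) = \<mu> (ball x R)"
  by (simp add: nn_integral_indicator del: emeasure_completion)
 ultimately show "(NR y\<in>ball x R. 1 powr (s / (s - t))) \<le> ennreal (((1 + R / \<rho> x) powr \<theta> * 1) powr (s / (s - t))) * \<mu> (ball x R)"
  by (simp only: ennreal_1 mult_1)
qed (use m nn in auto)

section \<open>The weighted inequalities\<close>

locale critical_operator =
 fixes \<rho> :: "'a::euclidean_space \<Rightarrow> real" and T T0 :: "('a \<Rightarrow> complex) \<Rightarrow> ('a \<Rightarrow> complex)"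
  and K K0 :: "'a \<Rightarrow> 'a \<Rightarrow> complex" and q s \<theta> :: real
 assumes rho: "critical_radius_function \<rho>" and q: "1 < q" and T: "bounded_operator q T" and K: "has_kernel T K"
  and s: "1 < s" and decay: "kernel_decay \<rho> s K" and cz: "calderon_zygmund T0 K0" and close: "kernel_close \<rho> s K K0"
  and \<theta>: "0 \<le> \<theta>"
begin

lemma rho_pos: "0 < \<rho> x" using rho unfolding critical_radius_function_def by blast

definition core_bound where
 "core_bound t D \<longleftrightarrow> (\<forall>f\<in>bcs. \<forall>g G M u v w1 w2 W1 W2. admissible \<rho> \<theta> s t u v w1 w2 W1 W2 \<longrightarrow>
  g \<in> \<M> \<longrightarrow> (\<forall>x. 0 \<le> g x \<and> g x \<le> M) \<longrightarrow> G \<in> \<M> \<longrightarrow>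
  (\<forall>x. norm (f x) = u x * w2 x powr (1 / (t / (t - 1)))) \<longrightarrow> (\<forall>x. g x = v x * w1 x powr (1 / t)) \<longrightarrow>
  product_bound (\<lambda>x r. r \<le> \<rho> x) (\<lambda>y. norm (f y)) g G \<longrightarrow>
  (NR x. norm (T f x) * g x) \<le> ennreal D * ((NN x. G x) + (NR x. norm (f x) * g x)
   + (NR x. u x powr t * W1 x) + (NR x. v x powr (t / (t - 1)) * W2 x)))"

text \<open>The splitting of \<open>f\<close> is governed by the cube that contains
  \<open>x\<close>, whereas the annular estimates are centred at \<open>y\<close> and scaled by
  \<open>\<sigma> y\<close>; the constants \<open>r1\<close> and \<open>r2\<close> translate one
  into the other. Every cube contributes an integral over itself, and the cubes partition the space,
  so the local bounds simply add up.\<close>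

lemma core_estimate:
 assumes ts: "1 < t" "t < s"
 shows "\<exists>D\<ge>0. core_bound t D"
proof -
 define t' where "t' = t / (t - 1)"
 have q0: "0 < q" using q by simp
 obtain C N where C: "1 \<le> C" and N: "1 \<le> N" and pos: "\<And>x. 0 < \<rho> x"
  and cr: "\<And>x y. \<rho> y \<le> C * \<rho> x * (1 + norm (x - y) / \<rho> x)"
   "\<And>x y. \<rho> x \<le> C * \<rho> y * (1 + norm (x - y) / \<rho> x) powr N"
  by (rule critical_radius_bounds[OF rho]) (rule that)
 define d where "d = real DIM('a)"
 have d: "1 \<le> d" unfolding d_def using DIM_positive[where 'a='a] by (simp add: Suc_leI)
 \<comment> \<open>Compares \<open>\<rho>\<close> at points within one critical radius, in both
   directions; the base 2 bounds \<open>1 + norm (x - y) / \<rho> x\<close>.\<close>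
 define \<beta> where "\<beta> = C * 2 powr N"
 \<comment> \<open>Small enough for \<open>3 * d * c \<le> 1\<close>, which keeps the balls around
   stars of subcubes within the critical radius, and for \<open>2 * d * c \<le> 1\<close>, which the
   construction of the cubes requires.\<close>
 define c where "c = 1 / (3 * d * \<beta>\<^sup>2)"
 \<comment> \<open>Half the reciprocal of the constant in
   \<open>\<sigma> y \<le> C * (\<beta> + 1) * norm (x - y)\<close>, valid for \<open>y\<close>
   outside the star of the cube of \<open>x\<close>; the half makes the inequality strict.\<close>
 define r1 where "r1 = 1 / (2 * C * (\<beta> + 1))"
 \<comment> \<open>For \<open>y\<close> in the star,
   \<open>norm (x - y) < 2 * (r2 * \<sigma> y)\<close>. At the same time \<open>r2 * c = 1\<close>,
   which is just admissible in the near estimate.\<close>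
 define r2 where "r2 = 3 * d * \<beta>\<^sup>2"
 have b2: "2 * C \<le> \<beta>" using powr_mono[of 1 N 2] N C by (simp add: \<beta>_def)
 have b: "1 \<le> \<beta>" using b2 C by simp
 have bb: "1 \<le> \<beta>\<^sup>2" using b by (simp add: one_le_power)
 have db: "3 \<le> 3 * d * \<beta>\<^sup>2" "d \<le> d * \<beta>\<^sup>2" using d bb mult_mono[of 1 d 1 "\<beta>\<^sup>2"] by auto
 have c: "0 < c" "2 * c \<le> 1" using db by (auto simp: c_def field_simps)
 have dc: "2 * d * c \<le> 1" "3 * d * c = 1 / \<beta>\<^sup>2" "3 * d * c \<le> 1"
 proof -
  have "2 / (3 * \<beta>\<^sup>2) \<le> 1" "1 / \<beta>\<^sup>2 \<le> 1" using bb by (simp_all add: divide_le_eq)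
  then show "2 * d * c \<le> 1" "3 * d * c = 1 / \<beta>\<^sup>2" "3 * d * c \<le> 1" using d by (simp_all add: c_def)
 qed
 have r1: "0 < r1" using C b by (simp add: r1_def)
 have r2: "0 < r2" "r2 * c \<le> 1" using db by (auto simp: r2_def c_def)
 have beta: "\<rho> x \<le> \<beta> * \<rho> y" "\<rho> y \<le> \<beta> * \<rho> x" if xy: "norm (x - y) \<le> \<rho> x" for x y
 proof -
  have n: "norm (x - y) / \<rho> x \<le> 1" "0 \<le> norm (x - y) / \<rho> x" using xy pos[of x] by auto
  have "\<rho> x \<le> C * \<rho> y * (1 + norm (x - y) / \<rho> x) powr N" by (rule cr(2))
  also have "\<dots> \<le> C * \<rho> y * 2 powr N" using n C N pos[of y] by (intro mult_left_mono powr_mono2) auto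
  finally show "\<rho> x \<le> \<beta> * \<rho> y" by (simp add: \<beta>_def mult_ac)
  have "\<rho> y \<le> C * \<rho> x * (1 + norm (x - y) / \<rho> x)" by (rule cr(1))
  also have "\<dots> \<le> C * \<rho> x * 2" using n C pos[of x] by (intro mult_left_mono) auto
  also have "\<dots> = (2 * C) * \<rho> x" by simp
  also have "\<dots> \<le> \<beta> * \<rho> x" using b2 pos[of x] by (intro mult_right_mono) auto
  finally show "\<rho> y \<le> \<beta> * \<rho> x" .
 qed
 obtain \<P> \<sigma> where P: "countable \<P>" "disjoint \<P>" "\<Union>\<P> = UNIV" and \<sigma>m: "\<sigma> \<in> \<M>"
  and Pd: "\<And>P. P \<in> \<P> \<Longrightarrow> \<exists>n x. P = dcube n x \<and> (\<forall>y\<in>P. \<sigma> y = dside n)"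
  and \<sigma>: "\<And>x. 0 < \<sigma> x" "\<And>x. \<sigma> x \<le> c * \<rho> x" "\<And>x. c * \<rho> x \<le> 2 * \<beta> * \<sigma> x"
  by (rule critical_cubes[OF pos b beta(1) c(1) dc(1)[unfolded d_def]]) (assumption, rule that)
 interpret critical_scale \<rho> \<sigma> C N c \<beta> \<theta> s t t'
  by unfold_locales (rule C N pos cr \<sigma> \<sigma>m c b \<theta> ts t'_def)+
 have Km: "(\<lambda>z. K (fst z) (snd z)) \<in> \<M>" by (rule borel_measurable_kernel_product[OF K])
 have T0: "bounded_operator 2 T0" "has_kernel T0 K0" using cz by (auto simp: calderon_zygmund_def)
 have K0m: "(\<lambda>z. K0 (fst z) (snd z)) \<in> \<M>" by (rule borel_measurable_kernel_product[OF T0(2)])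
 have KKm: "(\<lambda>z. K (fst z) (snd z) - K0 (fst z) (snd z)) \<in> \<M>" using Km K0m by measurable
 note [measurable] = \<sigma>m Km K0m
 define far where "far x y \<longleftrightarrow> r1 * \<sigma> y < norm (x - y)" for x y
 define near where "near x y \<longleftrightarrow> 0 < norm (x - y) \<and> norm (x - y) < 2 * (r2 * \<sigma> y)" for x y
 obtain D1 where D1: "0 \<le> D1" "form_bound (\<lambda>x y. norm (K x y)) far D1"
  using far_estimate[OF decay Km r1, folded far_def] by (elim exE conjE) (rule that)
 obtain D2 where D2: "0 \<le> D2" "form_bound (\<lambda>x y. norm (K x y - K0 x y)) near D2"
  using near_estimate[OF close KKm r2, folded near_def] by (elim exE conjE) (rule that)
 have two: "(1::real) < 2" by simp
 obtain D3 where D3: "0 \<le> D3" "\<forall>f\<in>bcs. AE x in lebesgue. ennreal (norm (T f x - T0 f x))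
  \<le> ennreal (D3 * norm (f x)) + (NR y. norm (K x y - K0 x y) * norm (f y))"
  using operator_difference_bound[OF T q K T0(1) two T0(2)] by (elim exE conjE) (rule that)
 obtain D4 where D4: "0 \<le> D4" "sparse_bound T0 D4"
  using sparse_domination[OF cz] by (elim exE conjE) (rule that)
 define V where "V = unit_ball_vol d * (3 * d) ^ DIM('a)"
 have V: "0 \<le> V" using d by (simp add: V_def)
 have farD: "far x y" if "2 * (d * \<sigma> x) \<le> norm (x - y)" for x y
 proof -
  define \<delta> where "\<delta> = norm (x - y)"
  have \<delta>: "0 < \<delta>" using that d \<sigma>(1)[of x] unfolding \<delta>_def[symmetric] by (smt (verit) mult_pos_pos)
  have "\<sigma> x \<le> d * \<sigma> x" using d \<sigma>(1)[of x] by simp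
  then have "2 * \<sigma> x \<le> \<delta>" using that by (simp add: \<delta>_def)
  then have "2 * \<beta> * \<sigma> x \<le> \<beta> * \<delta>" using b by (simp add: mult_left_mono mult.left_commute)
  then have cx: "c * \<rho> x \<le> \<beta> * \<delta>" using \<sigma>(3)[of x] by linarith
  have "\<rho> y \<le> C * \<rho> x * (1 + \<delta> / \<rho> x)" unfolding \<delta>_def by (rule cr(1))
  also have "\<dots> = C * (\<rho> x + \<delta>)" using pos[of x] by (simp add: field_simps)
  finally have "c * \<rho> y \<le> c * (C * (\<rho> x + \<delta>))" using c by (intro mult_left_mono) auto
  also have "\<dots> = C * (c * \<rho> x + c * \<delta>)" by (simp add: algebra_simps)
  also have "\<dots> \<le> C * (\<beta> * \<delta> + 1 * \<delta>)" using cx C c \<delta> by (intro mult_left_mono add_mono mult_right_mono) auto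
  finally have "\<sigma> y \<le> C * (\<beta> + 1) * \<delta>" using \<sigma>(2)[of y] by (simp add: algebra_simps)
  then have "r1 * \<sigma> y \<le> r1 * (C * (\<beta> + 1) * \<delta>)" using r1 by (intro mult_left_mono) auto
  also have "\<dots> = \<delta> / 2"
  proof -
   have "r1 = 1 / (2 * (C * (\<beta> + 1)))" by (simp add: r1_def mult.assoc)
   moreover have "C * (\<beta> + 1) \<noteq> 0" using C b by simp
   ultimately show ?thesis by simp
  qed
  also have "\<dots> < \<delta>" using \<delta> by simp
  finally show ?thesis unfolding far_def \<delta>_def .
 qed
 have nearD: "near x y" if xy: "norm (x - y) < 3 * (d * \<sigma> x)" and "x \<noteq> y" for x y
 proof -
  have "3 * (d * \<sigma> x) \<le> 3 * (d * (c * \<rho> x))" using \<sigma>(2)[of x] d by simp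
  also have "\<dots> = (3 * d * c) * \<rho> x" by simp
  also have "\<dots> \<le> 1 * \<rho> x" using dc pos[of x] by (intro mult_right_mono) auto
  finally have "norm (x - y) \<le> \<rho> x" using xy by simp
  then have "\<rho> x \<le> \<beta> * \<rho> y" by (rule beta)
  then have "c * \<rho> x \<le> \<beta> * (c * \<rho> y)" using c by (simp add: mult_left_mono mult.left_commute)
  also have "\<dots> \<le> \<beta> * (2 * \<beta> * \<sigma> y)" using \<sigma>(3)[of y] b by (intro mult_left_mono) auto
  finally have "\<sigma> x \<le> 2 * \<beta>\<^sup>2 * \<sigma> y" using \<sigma>(2)[of x] by (simp add: power2_eq_square)
  then have "3 * (d * \<sigma> x) \<le> 3 * (d * (2 * \<beta>\<^sup>2 * \<sigma> y))" using d by (intro mult_left_mono) auto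
  also have "\<dots> = 2 * (r2 * \<sigma> y)" by (simp add: r2_def)
  finally show ?thesis using xy that(2) by (simp add: near_def)
 qed
 define D where "D = max (D4 * V\<^sup>2) (max D3 (D1 + D2))"
 show ?thesis unfolding core_bound_def
 proof (intro exI[of _ D] conjI ballI allI impI)
  show "0 \<le> D" using D3(1) by (simp add: D_def le_max_iff_disj)
  fix f :: "'a \<Rightarrow> complex" and g :: "'a \<Rightarrow> real" and G :: "'a \<Rightarrow> ennreal" and M :: real and u v w1 w2 W1 W2 :: "'a \<Rightarrow> real"
  assume f: "f \<in> bcs" and adm: "admissible \<rho> \<theta> s t u v w1 w2 W1 W2" and gm[measurable]: "g \<in> \<M>"
   and g: "\<forall>x. 0 \<le> g x \<and> g x \<le> M" and Gm[measurable]: "G \<in> \<M>"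
   and fu: "\<forall>x. norm (f x) = u x * w2 x powr (1 / (t / (t - 1)))" and gv: "\<forall>x. g x = v x * w1 x powr (1 / t)"
   and avg: "product_bound (\<lambda>x r. r \<le> \<rho> x) (\<lambda>y. norm (f y)) g G"
  have g0: "0 \<le> g x" for x using g by blast
  have fm[measurable]: "f \<in> \<M>" by (rule bcs_measurable[OF f])
  have Tm[measurable]: "T f \<in> \<M>" by (rule bounded_operator_measurable[OF T bcs_Lp[OF f q0]])
  define X where "X = (NR x. u x powr t * W1 x)"
  define Y where "Y = (NR x. v x powr t' * W2 x)"
  have form: "form k u v w1 w2 x y = ennreal (k x y * norm (f y)) * ennreal (g x)" for k x y
  proof -
   have "k x y * u y * v x * w1 x powr (1 / t) * w2 y powr (1 / t') = (k x y * norm (f y)) * g x"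
    using fu gv by (simp add: t'_def mult_ac)
   then show ?thesis unfolding form_def using g0[of x] by (simp only: ennreal_mult'')
  qed
  define E1 where "E1 z = (if r1 * \<sigma> (snd z) < norm (fst z - snd z) then ennreal (norm (K (fst z) (snd z)) * norm (f (snd z))) * ennreal (g (fst z)) else 0)" for z
  define E2 where "E2 z = (if 0 < norm (fst z - snd z) \<and> norm (fst z - snd z) < 2 * (r2 * \<sigma> (snd z)) then ennreal (norm (K (fst z) (snd z) - K0 (fst z) (snd z)) * norm (f (snd z))) * ennreal (g (fst z)) else 0)" for z
  have E1m: "E1 \<in> \<M>" unfolding E1_def[abs_def] by measurable
  have E2m: "E2 \<in> \<M>" unfolding E2_def[abs_def] by measurable
  have E1eq: "E1 (x, y) = form (\<lambda>x y. norm (K x y)) u v w1 w2 x y * indicator {y. far x y} y" for x y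
   unfolding form by (simp add: E1_def far_def)
  have E2eq: "E2 (x, y) = form (\<lambda>x y. norm (K x y - K0 x y)) u v w1 w2 x y * indicator {y. near x y} y" for x y
   unfolding form by (simp add: E2_def near_def)
  define H1 where "H1 x = (NN y. E1 (x, y))" for x
  define H2 where "H2 x = (NN y. E2 (x, y))" for x
  have H1m[measurable]: "H1 \<in> \<M>" unfolding H1_def[abs_def] by (rule lebesgue_Tonelli(2)[OF E1m])
  have H2m[measurable]: "H2 \<in> \<M>" unfolding H2_def[abs_def] by (rule lebesgue_Tonelli(2)[OF E2m])
  have H1i: "(NN x. H1 x) \<le> ennreal D1 * (X + Y)" unfolding H1_def E1eq X_def Y_def by (rule D1(2)[unfolded form_bound_def, rule_format, OF adm])
  have H2i: "(NN x. H2 x) \<le> ennreal D2 * (X + Y)" unfolding H2_def E2eq X_def Y_def by (rule D2(2)[unfolded form_bound_def, rule_format, OF adm])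
  define H where "H x = ennreal (D3 * (norm (f x) * g x)) + H1 x + H2 x" for x
  have Hm[measurable]: "H \<in> \<M>" unfolding H_def[abs_def] by measurable
  define G' where "G' x = ennreal (V\<^sup>2) * G x" for x
  have G'm[measurable]: "G' \<in> \<M>" unfolding G'_def[abs_def] by measurable
  define F where "F x = ennreal D4 * G' x + H x" for x
  have Fm[measurable]: "F \<in> \<M>" unfolding F_def[abs_def] by measurable
  have local_bound: "(NR x\<in>P. norm (T f x) * g x) \<le> (NN x\<in>P. F x)" if PP: "P \<in> \<P>" for P
  proof -
   obtain n x0 where P0: "P = dcube n x0" "\<And>y. y \<in> dcube n x0 \<Longrightarrow> \<sigma> y = dside n" using Pd[OF PP] by blast
   define f1 where "f1 = cut (star n x0) f"
   define f2 where "f2 = cut (- star n x0) f"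
   have f1: "f1 \<in> bcs" unfolding f1_def by (rule bcs_cut[OF f star_sets_lebesgue])
   have f2: "f2 \<in> bcs" unfolding f2_def by (rule bcs_cut[OF f lebesgue_sets_Compl[OF star_sets_lebesgue]])
   have f12: "f = (\<lambda>y. f1 y + f2 y)" by (auto simp: f1_def f2_def fun_eq_iff)
   have [measurable]: "f1 \<in> \<M>" "f2 \<in> \<M>" using f1 f2 by (auto intro: bcs_measurable)
   have [measurable]: "T0 f1 \<in> \<M>" by (rule bounded_operator_measurable[OF T0(1) bcs_Lp[OF f1]]) simp
   define A1 where "A1 z = ennreal (norm (K (fst z) (snd z)) * norm (f2 (snd z)))" for z
   define A2 where "A2 z = ennreal (norm (K (fst z) (snd z) - K0 (fst z) (snd z)) * norm (f1 (snd z)))" for z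
   have A1m: "A1 \<in> \<M>" unfolding A1_def[abs_def] by measurable
   have A2m: "A2 \<in> \<M>" unfolding A2_def[abs_def] by measurable
   have clos: "x \<notin> closure {y. f2 y \<noteq> 0}" if "x \<in> dcube n x0" for x
   proof -
    have "closure {y. f2 y \<noteq> 0} \<subseteq> - star n x0"
     by (rule closure_minimal) (auto simp: f2_def open_star closed_Compl)
    then show ?thesis using that dcube_subset_star by blast
   qed
   \<comment> \<open>\<open>T f\<close> is the sum of \<open>T0 f1\<close>, of
     \<open>T f1 - T0 f1\<close>, bounded by the diagonal term and \<open>H2\<close>, and of
     \<open>T f2\<close>, bounded by \<open>H1\<close>.\<close>
   have ae: "AE x in lebesgue. x \<in> dcube n x0 \<longrightarrow> ennreal (norm (T f x) * g x) \<le> ennreal (norm (T0 f1 x) * g x) + H x"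
    using bounded_operator_add[OF T bcs_Lp[OF f1 q0] bcs_Lp[OF f2 q0]] D3(2)[rule_format, OF f1] has_kernel_bcs[OF K f2]
     lebesgue_sections_measurable[OF A1m] lebesgue_sections_measurable[OF A2m]
   proof eventually_elim
    case (elim x)
    show ?case
    proof
     assume x: "x \<in> dcube n x0"
     have sx: "\<sigma> x = dside n" by (rule P0(2)[OF x])
     have e1: "T f x = T f1 x + T f2 x" using elim(1) f12 by simp
     have k2: "integrable lebesgue (\<lambda>y. K x y * f2 y)" "T f2 x = (\<integral>y. K x y * f2 y \<partial>lebesgue)"
      using elim(3) clos[OF x] by auto
     have B2: "ennreal (norm (T f2 x)) * ennreal (g x) \<le> H1 x"
     proof -
      have "ennreal (norm (T f2 x)) \<le> (NR y. norm (K x y * f2 y))"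
       unfolding k2(2) by (rule integral_norm_bound_ennreal[OF k2(1)])
      also have "\<dots> = (NN y. A1 (x, y))" by (simp add: A1_def norm_mult)
      finally have "ennreal (norm (T f2 x)) * ennreal (g x) \<le> (NN y. A1 (x, y)) * ennreal (g x)"
       by (rule mult_right_mono) simp
      also have "\<dots> = (NN y. A1 (x, y) * ennreal (g x))" by (rule nn_integral_multc[symmetric, OF elim(4)])
      also have "\<dots> \<le> H1 x" unfolding H1_def
      proof (rule nn_integral_mono)
       fix y
       show "A1 (x, y) * ennreal (g x) \<le> E1 (x, y)"
       proof (cases "y \<in> star n x0")
        case True
        then show ?thesis by (simp add: A1_def f2_def)
       next
        case False
        have "2 * (d * \<sigma> x) \<le> norm (x - y)" unfolding sx d_def by (rule not_in_star[OF x False])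
        then have "far x y" by (rule farD)
        then show ?thesis using False by (simp add: A1_def E1_def f2_def far_def)
       qed
      qed
      finally show ?thesis .
     qed
     have B1: "(NN y. A2 (x, y)) * ennreal (g x) \<le> H2 x"
     proof -
      have "(NN y. A2 (x, y)) * ennreal (g x) = (NN y. A2 (x, y) * ennreal (g x))"
       by (rule nn_integral_multc[symmetric, OF elim(5)])
      also have "\<dots> \<le> H2 x" unfolding H2_def
      proof (rule nn_integral_mono_AE)
       \<comment> \<open>The relation \<open>near\<close> excludes the diagonal, where kernels are
         arbitrary; for fixed \<open>x\<close> this is a single point.\<close>
       have "AE y in lebesgue. y \<noteq> x" by (rule AE_completion, rule AE_lborel_singleton)
       then show "AE y in lebesgue. A2 (x, y) * ennreal (g x) \<le> E2 (x, y)"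
       proof eventually_elim
        case (elim y)
        show ?case
        proof (cases "y \<in> star n x0")
         case True
         then have "norm (x - y) < 3 * (d * \<sigma> x)" using star_subset_ball[OF x] unfolding sx d_def by (auto simp: dist_norm)
         then have "near x y" using elim by (intro nearD) auto
         then show ?thesis using True by (simp add: A2_def E2_def f1_def near_def)
        next
         case False
         then show ?thesis by (simp add: A2_def f1_def)
        qed
       qed
      qed
      finally show ?thesis .
     qed
     have B0: "ennreal (norm (T f1 x - T0 f1 x)) * ennreal (g x) \<le> ennreal (D3 * (norm (f x) * g x)) + H2 x"
     proof -
      have "ennreal (norm (T f1 x - T0 f1 x)) * ennreal (g x) \<le> (ennreal (D3 * norm (f1 x)) + (NN y. A2 (x, y))) * ennreal (g x)"
       using elim(2) by (intro mult_right_mono) (auto simp: A2_def)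
      also have "\<dots> = ennreal (D3 * norm (f1 x)) * ennreal (g x) + (NN y. A2 (x, y)) * ennreal (g x)"
       by (rule distrib_right)
      also have "\<dots> \<le> ennreal (D3 * (norm (f x) * g x)) + H2 x"
      proof (intro add_mono B1)
       have "D3 * norm (f1 x) * g x \<le> D3 * norm (f x) * g x"
        using D3(1) g0[of x] by (intro mult_right_mono mult_left_mono) (auto simp: f1_def)
       then show "ennreal (D3 * norm (f1 x)) * ennreal (g x) \<le> ennreal (D3 * (norm (f x) * g x))"
        using g0[of x] D3(1) by (simp add: ennreal_mult''[symmetric] ennreal_leI mult.assoc)
      qed
      finally show ?thesis .
     qed
     have "norm (T f x) \<le> norm (T0 f1 x) + (norm (T f1 x - T0 f1 x) + norm (T f2 x))"
      unfolding e1 by norm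
     then have "ennreal (norm (T f x) * g x) \<le> ennreal ((norm (T0 f1 x) + (norm (T f1 x - T0 f1 x) + norm (T f2 x))) * g x)"
      using g0[of x] by (intro ennreal_leI mult_right_mono)
     also have "\<dots> = ennreal (norm (T0 f1 x) * g x) + (ennreal (norm (T f1 x - T0 f1 x)) * ennreal (g x) + ennreal (norm (T f2 x)) * ennreal (g x))"
      using g0[of x] by (simp add: distrib_right ennreal_mult)
     also have "\<dots> \<le> ennreal (norm (T0 f1 x) * g x) + ((ennreal (D3 * (norm (f x) * g x)) + H2 x) + H1 x)"
      by (intro add_mono B0 B2 order_refl)
     also have "\<dots> = ennreal (norm (T0 f1 x) * g x) + H x" by (simp add: H_def add_ac)
     finally show "ennreal (norm (T f x) * g x) \<le> ennreal (norm (T0 f1 x) * g x) + H x" .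
    qed
   qed
   have sp: "(NR x\<in>dcube n x0. norm (T0 f1 x) * g x) \<le> ennreal D4 * (NN x\<in>dcube n x0. G' x)"
    unfolding f1_def
   proof (rule D4(2)[unfolded sparse_bound_def cube_bound_def, rule_format, OF f gm _ G'm])
    show "0 \<le> g x \<and> g x \<le> M" for x using g by blast
    fix m x assume m: "n \<le> m" and x: "x \<in> dcube n x0"
    \<comment> \<open>A ball of this radius around \<open>x\<close> contains both the star and the
      cube, and the choice of \<open>c\<close> makes it at most \<open>\<rho> x\<close>.\<close>
    define r where "r = 3 * (d * dside m)"
    have r0: "0 < r" using d by (simp add: r_def)
    have "r \<le> 3 * (d * \<sigma> x)" using dside_antimono[OF m] d P0(2)[OF x] by (simp add: r_def)
    also have "\<dots> \<le> 3 * (d * (c * \<rho> x))" using \<sigma>(2)[of x] d by simp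
    also have "\<dots> = (3 * d * c) * \<rho> x" by simp
    also have "\<dots> \<le> 1 * \<rho> x" using dc pos[of x] by (intro mult_right_mono) auto
    finally have r: "r \<le> \<rho> x" by simp
    have sb: "star m x \<subseteq> ball x r" using star_subset_ball[OF dcube_self] by (simp add: r_def d_def)
    have db: "dcube m x \<subseteq> ball x r" using dcube_subset_star sb by blast
    have "(NR z\<in>star m x. norm (f z)) * (NR z\<in>dcube m x. g z)
     \<le> (NR z\<in>ball x r. norm (f z)) * (NR z\<in>ball x r. g z)"
     using sb db by (intro mult_mono nn_integral_mono) (auto simp: indicator_def)
    also have "\<dots> \<le> \<mu> (ball x r) * \<mu> (ball x r) * G x" using avg r0 r unfolding product_bound_def by blast
    also have "\<mu> (ball x r) = ennreal (V * dside m ^ DIM('a))"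
     using emeasure_lebesgue_ball[of r x] r0 by (simp add: V_def r_def d_def power_mult_distrib mult_ac)
    also have "ennreal (V * dside m ^ DIM('a)) * ennreal (V * dside m ^ DIM('a)) * G x
      = ennreal (dside m ^ DIM('a)) * ennreal (dside m ^ DIM('a)) * G' x"
     using V by (simp add: G'_def ennreal_mult power2_eq_square mult_ac)
    finally show "(NR z\<in>star m x. norm (f z)) * (NR z\<in>dcube m x. g z)
     \<le> ennreal (dside m ^ DIM('a)) * ennreal (dside m ^ DIM('a)) * G' x" .
   qed
   have "(NR x\<in>P. norm (T f x) * g x) \<le> (NN x. ennreal (norm (T0 f1 x) * g x) * indicator (dcube n x0) x + H x * indicator (dcube n x0) x)"
    unfolding P0(1) by (rule nn_integral_mono_AE, use ae in eventually_elim) (auto simp: indicator_def)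
   also have "\<dots> = (NR x\<in>dcube n x0. norm (T0 f1 x) * g x) + (NN x\<in>dcube n x0. H x)"
    by (rule nn_integral_add) measurable
   also have "\<dots> \<le> ennreal D4 * (NN x\<in>dcube n x0. G' x) + (NN x\<in>dcube n x0. H x)"
    by (intro add_mono sp order_refl)
   also have "\<dots> = (NN x. ennreal D4 * (G' x * indicator (dcube n x0) x)) + (NN x\<in>dcube n x0. H x)"
    by (subst nn_integral_cmult) simp_all
   also have "\<dots> = (NN x. ennreal D4 * (G' x * indicator (dcube n x0) x) + H x * indicator (dcube n x0) x)"
    by (rule nn_integral_add[symmetric]) measurable
   also have "\<dots> = (NN x\<in>P. F x)" unfolding P0(1) F_def by (intro nn_integral_cong) (simp add: distrib_right mult.assoc)
   finally show ?thesis .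
  qed
  have Ps: "P \<in> \<L>" if "P \<in> \<P>" for P using Pd[OF that] by auto
  have U: "(NN x. \<phi> x) = (\<integral>\<^sup>+P. (NN x\<in>P. \<phi> x) \<partial>count_space \<P>)" if "\<phi> \<in> \<M>" for \<phi> :: "'a \<Rightarrow> ennreal"
   using nn_integral_countable_Union[OF P(1,2) Ps that] unfolding P(3) by simp
  have "(NR x. norm (T f x) * g x) \<le> (NN x. F x)"
   unfolding U[OF Fm] by (subst U, measurable, rule nn_integral_mono) (simp add: local_bound)
  also have "(NN x. F x) = ennreal D4 * (NN x. G' x) + (NN x. H x)"
   unfolding F_def by (simp add: nn_integral_add nn_integral_cmult)
  also have "(NN x. G' x) = ennreal (V\<^sup>2) * (NN x. G x)" unfolding G'_def by (rule nn_integral_cmult) measurable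
  also have "(NN x. H x) = ennreal D3 * (NR x. norm (f x) * g x) + (NN x. H1 x) + (NN x. H2 x)"
   unfolding H_def ennreal_mult'[OF D3(1)] by (simp add: nn_integral_add nn_integral_cmult)
  also have "ennreal D4 * (ennreal (V\<^sup>2) * (NN x. G x)) + (ennreal D3 * (NR x. norm (f x) * g x) + (NN x. H1 x) + (NN x. H2 x))
   \<le> ennreal D * (NN x. G x) + (ennreal D * (NR x. norm (f x) * g x) + ennreal D * (X + Y))"
  proof -
   have "ennreal D4 * (ennreal (V\<^sup>2) * (NN x. G x)) \<le> ennreal D * (NN x. G x)"
    unfolding mult.assoc[symmetric] using D4(1) by (intro mult_right_mono) (auto simp: ennreal_mult[symmetric] D_def intro!: ennreal_leI)
   moreover have "ennreal D3 * (NR x. norm (f x) * g x) \<le> ennreal D * (NR x. norm (f x) * g x)"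
    by (intro mult_right_mono ennreal_leI) (auto simp: D_def)
   moreover have "(NN x. H1 x) + (NN x. H2 x) \<le> ennreal D * (X + Y)"
   proof -
    have "(NN x. H1 x) + (NN x. H2 x) \<le> ennreal D1 * (X + Y) + ennreal D2 * (X + Y)" using H1i H2i by (rule add_mono)
    also have "\<dots> = ennreal (D1 + D2) * (X + Y)" using D1(1) D2(1) by (simp add: distrib_right)
    also have "\<dots> \<le> ennreal D * (X + Y)" by (intro mult_right_mono ennreal_leI) (auto simp: D_def)
    finally show ?thesis .
   qed
   ultimately show ?thesis unfolding add.assoc by (intro add_mono)
  qed
  also have "\<dots> = ennreal D * ((NN x. G x) + (NR x. norm (f x) * g x) + X + Y)"
   by (simp add: distrib_left add_ac)
  finally show "(NR x. norm (T f x) * g x) \<le> ennreal D * ((NN x. G x) + (NR x. norm (f x) * g x)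
   + (NR x. u x powr t * W1 x) + (NR x. v x powr (t / (t - 1)) * W2 x))"
   unfolding X_def Y_def t'_def .
 qed
qed

section \<open>The two inequalities in bilinear form\<close>

definition forward_bound where
 "forward_bound p D \<longleftrightarrow> (\<forall>f\<in>bcs. \<forall>h w M. h \<in> \<M> \<longrightarrow> w \<in> \<M> \<longrightarrow>
  (\<forall>x. 0 \<le> h x \<and> h x \<le> M \<and> 0 \<le> w x \<and> w x \<le> M) \<longrightarrow>
  (NR x. norm (T f x) * (h x * w x powr (1 / p))) \<le> ennreal D *
   ((NN x. ennreal (norm (f x) powr p) * max_theta_pow \<rho> \<theta> (conj_exp (s / p)) w x) + (NR x. h x powr (p / (p - 1)))))"

text \<open>The core estimate with \<open>t = p\<close>; the weight sits on the side of the dual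
  function and becomes \<open>w1\<close>. Balls up to the critical radius satisfy
  \<open>1 + R / \<rho> x \<le> 2\<close>, whence the factor \<open>2 powr \<theta>\<close> between
  the global maximal function and local norms.\<close>

lemma forward_bilinear:
 assumes p: "1 < p" "p < s"
 shows "\<exists>D\<ge>0. forward_bound p D"
proof -
 define r where "r = s / (s - p)"
 have r: "1 < r" "conj_exp (s / p) = r" using p by (auto simp: r_def conj_exp_def field_simps)
 have yr: "young_function (\<lambda>z. z powr r)" using r by (intro young_function_powr) simp
 obtain D1 where D1: "0 \<le> D1" "core_bound p D1"
  using core_estimate[OF p] by (elim exE conjE) (rule that)
 note core = D1(2)[unfolded core_bound_def, rule_format]
 obtain D2 where D2: "0 \<le> D2" "two_weight_bound \<rho> p (\<lambda>z. z powr r) D2"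
  using local_two_weight[of p _ \<rho>, OF p(1) class_D_powr[OF p(1) r(1)] rho_pos] by (elim exE conjE) (rule that)
 show ?thesis unfolding forward_bound_def
 proof (intro exI[of _ "D1 * (D2 * 2 powr \<theta> + 1)"] conjI ballI allI impI)
  have D20: "0 \<le> D2 * 2 powr \<theta>" using D2(1) by simp
  show "0 \<le> D1 * (D2 * 2 powr \<theta> + 1)" using D1(1) D20 by simp
  fix f :: "'a \<Rightarrow> complex" and h w :: "'a \<Rightarrow> real" and M :: real
  assume f: "f \<in> bcs" and hm[measurable]: "h \<in> \<M>" and wm[measurable]: "w \<in> \<M>"
   and nn: "\<forall>x. 0 \<le> h x \<and> h x \<le> M \<and> 0 \<le> w x \<and> w x \<le> M"
  have fm[measurable]: "f \<in> \<M>" by (rule bcs_measurable[OF f])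
  obtain Mf where Mf: "\<And>x. norm (f x) \<le> Mf" using bcs_bounds[OF f] by metis
  define MW where "MW = max_theta_pow \<rho> \<theta> r w"
  have MWm[measurable]: "MW \<in> \<M>" unfolding MW_def max_theta_pow_def by (rule max_theta_measurable)
  have MWf: "MW x < \<infinity>" for x unfolding MW_def max_theta_pow_def
   by (rule max_theta_finite[OF yr, of w M]) (use nn rho_pos \<theta> in auto)
  define W where "W x = enn2real (MW x)" for x
  have W: "MW x = ennreal (W x)" for x unfolding W_def using MWf[of x] by simp
  have W0: "0 \<le> W x" for x by (simp add: W_def)
  have Wm[measurable]: "W \<in> \<M>" unfolding W_def[abs_def] by measurable
  define X where "X = (NR x. norm (f x) powr p * W x)"
  define Y where "Y = (NR x. h x powr (p / (p - 1)))"
  have adm: "admissible \<rho> \<theta> s p (\<lambda>x. norm (f x)) h w (\<lambda>_. 1) W (\<lambda>_. 1)"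
   by (rule admissible_left[OF rho_pos \<theta> p]) (use nn W0 W in \<open>auto simp: MW_def max_theta_pow_def r_def\<close>)
  have loc: "controls \<rho> (\<lambda>z. z powr r) w (\<lambda>y. 2 powr \<theta> * W y)" unfolding controls_def
  proof (intro allI impI ballI)
   fix x y :: 'a and R :: real assume R: "0 < R" "R \<le> \<rho> x" and y: "y \<in> ball x R"
   have "luxemburg (\<lambda>z. z powr r) (ball x R) w \<le> ennreal ((1 + R / \<rho> x) powr \<theta> * W y)"
    by (rule luxemburg_le_max_theta[OF R(1) y rho_pos]) (use W W0 in \<open>auto simp: MW_def max_theta_pow_def\<close>)
   also have "\<dots> \<le> ennreal (2 powr \<theta> * W y)"
    using R rho_pos[of x] \<theta> W0 by (intro ennreal_leI mult_right_mono powr_mono2) auto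
   finally show "luxemburg (\<lambda>z. z powr r) (ball x R) w \<le> ennreal (2 powr \<theta> * W y)" .
  qed
  have bd: "\<forall>x. 0 \<le> norm (f x) \<and> norm (f x) \<le> max M Mf \<and> 0 \<le> h x \<and> h x \<le> max M Mf \<and> 0 \<le> w x \<and> w x \<le> max M Mf \<and> 0 \<le> 2 powr \<theta> * W x"
   using nn Mf W0 by (auto simp: le_max_iff_disj)
  obtain G where G: "G \<in> \<M>"
   "(NN x. G x) + (NR x. norm (f x) * (h x * w x powr (1 / p)))
    \<le> ennreal D2 * ((NR x. norm (f x) powr p * (2 powr \<theta> * W x)) + Y)"
   "product_bound (\<lambda>x r. r \<le> \<rho> x) (\<lambda>y. norm (f y)) (\<lambda>y. h y * w y powr (1 / p)) G"
   using D2(2)[unfolded two_weight_bound_def, rule_format, of "\<lambda>x. norm (f x)" h w "\<lambda>x. 2 powr \<theta> * W x" "max M Mf", OF _ hm wm _ bd[rule_format] loc] unfolding Y_def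
   by auto
  have "(NR x. norm (f x) powr p * (2 powr \<theta> * W x)) = ennreal (2 powr \<theta>) * X"
   unfolding X_def by (subst nn_integral_cmult[symmetric]) (use W0 in \<open>auto intro!: nn_integral_cong simp: ennreal_mult'[symmetric] mult_ac\<close>)
  then have G2: "(NN x. G x) + (NR x. norm (f x) * (h x * w x powr (1 / p))) \<le> ennreal (D2 * 2 powr \<theta>) * (X + Y)"
  proof -
   have "ennreal (2 powr \<theta>) * X + 1 * Y \<le> ennreal (2 powr \<theta>) * X + ennreal (2 powr \<theta>) * Y"
    using ge_one_powr_ge_zero[of 2 \<theta>] \<theta> by (intro add_mono mult_right_mono order_refl) auto
   then have "ennreal D2 * (ennreal (2 powr \<theta>) * X + Y) \<le> ennreal D2 * (ennreal (2 powr \<theta>) * (X + Y))"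
    by (intro mult_left_mono) (simp_all add: distrib_left)
   then show ?thesis using G(2) \<open>_ = ennreal (2 powr \<theta>) * X\<close> D2(1) by (simp add: ennreal_mult mult.assoc)
  qed
  define M' where "M' = \<bar>M\<bar> * \<bar>M\<bar> powr (1 / p)"
  have gb: "\<forall>x. 0 \<le> h x * w x powr (1 / p) \<and> h x * w x powr (1 / p) \<le> M'"
  proof
   fix x
   have "h x * w x powr (1 / p) \<le> \<bar>M\<bar> * \<bar>M\<bar> powr (1 / p)"
    using nn[rule_format, of x] p by (intro mult_mono powr_mono2) auto
   then show "0 \<le> h x * w x powr (1 / p) \<and> h x * w x powr (1 / p) \<le> M'" using nn by (simp add: M'_def)
  qed
  have "(NR x. norm (T f x) * (h x * w x powr (1 / p))) \<le> ennreal D1 * ((NN x. G x)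
    + (NR x. norm (f x) * (h x * w x powr (1 / p)))
   + (NR x. norm (f x) powr p * W x) + (NR x. h x powr (p / (p - 1)) * 1))"
   by (rule core[OF f adm _ gb[rule_format] G(1) _ _ G(3)]) auto
  also have "\<dots> \<le> ennreal D1 * (ennreal (D2 * 2 powr \<theta>) * (X + Y) + (X + Y))"
   using G2 unfolding X_def[symmetric] by (intro mult_left_mono) (auto simp: Y_def[symmetric] add.assoc intro!: add_mono)
  also have "\<dots> = ennreal (D1 * (D2 * 2 powr \<theta> + 1)) * (X + Y)"
   using D1(1) D20 by (simp add: ennreal_mult distrib_right mult.assoc)
  also have "X = (NN x. ennreal (norm (f x) powr p) * max_theta_pow \<rho> \<theta> (conj_exp (s / p)) w x)"
   unfolding X_def r(2) MW_def[symmetric] W using W0 by (intro nn_integral_cong) (simp add: ennreal_mult)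
  finally show "(NR x. norm (T f x) * (h x * w x powr (1 / p))) \<le> ennreal (D1 * (D2 * 2 powr \<theta> + 1)) *
   ((NN x. ennreal (norm (f x) powr p) * max_theta_pow \<rho> \<theta> (conj_exp (s / p)) w x) + (NR x. h x powr (p / (p - 1))))"
   unfolding Y_def .
 qed
qed

definition backward_bound where
 "backward_bound p A D \<longleftrightarrow> (\<forall>F\<in>bcs. \<forall>f h w M. f \<in> \<M> \<longrightarrow> h \<in> \<M> \<longrightarrow> w \<in> \<M> \<longrightarrow>
  (\<forall>x. 0 \<le> f x \<and> f x \<le> M \<and> 0 \<le> h x \<and> h x \<le> M \<and> 0 \<le> w x \<and> w x \<le> M) \<longrightarrow> (\<forall>x. norm (F x) = h x * w x powr (1 / p)) \<longrightarrow>
  (NR x. norm (T F x) * f x) \<le> ennreal D *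
   ((NN x. ennreal (f x powr p) * (max_loc \<rho> A w x + max_theta_pow \<rho> \<theta> 1 w x)) + (NR x. h x powr (p / (p - 1)))))"

text \<open>The test function \<open>F\<close> now carries the weight, which becomes
  \<open>w2\<close>, and \<open>t\<close> is the conjugate exponent of \<open>p\<close>. The
  condition \<open>conj_exp s < p\<close> amounts to \<open>t < s\<close>.\<close>

lemma backward_bilinear:
 assumes p: "conj_exp s < p" and A: "A \<in> class_D p"
 shows "\<exists>D\<ge>0. backward_bound p A D"
proof -
 define t where "t = p / (p - 1)"
 have s': "1 < conj_exp s" using s by (simp add: conj_exp_def)
 have p1: "1 < p" using s' p by simp
 have ts: "1 < t" "t < s"
 proof -
  show "1 < t" using p1 by (simp add: t_def)
  have "s < p * (s - 1)" using p s by (simp add: conj_exp_def divide_less_eq)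
  then show "t < s" using p1 by (simp add: t_def divide_less_eq algebra_simps)
 qed
 have tp: "t / (t - 1) = p" using p1 by (simp add: t_def field_simps)
 have yA: "young_function A" using A by (simp add: class_D_def)
 have y1: "young_function (\<lambda>z. z powr 1)" by (intro young_function_powr) simp
 obtain D1 where D1: "0 \<le> D1" "core_bound t D1"
  using core_estimate[OF ts] by (elim exE conjE) (rule that)
 note core = D1(2)[unfolded core_bound_def tp, rule_format]
 obtain D2 where D2: "0 \<le> D2" "two_weight_bound \<rho> p A D2"
  using local_two_weight[of p A \<rho>, OF p1 A rho_pos] by (elim exE conjE) (rule that)
 show ?thesis unfolding backward_bound_def
 proof (intro exI[of _ "D1 * (D2 + 1)"] conjI ballI allI impI)
  show "0 \<le> D1 * (D2 + 1)" using D1(1) D2(1) by simp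
  fix F :: "'a \<Rightarrow> complex" and f h w :: "'a \<Rightarrow> real" and M :: real
  assume F: "F \<in> bcs" and fm[measurable]: "f \<in> \<M>" and hm[measurable]: "h \<in> \<M>" and wm[measurable]: "w \<in> \<M>"
   and nn: "\<forall>x. 0 \<le> f x \<and> f x \<le> M \<and> 0 \<le> h x \<and> h x \<le> M \<and> 0 \<le> w x \<and> w x \<le> M" and Fh: "\<forall>x. norm (F x) = h x * w x powr (1 / p)"
  have w: "\<And>x. 0 \<le> w x" "\<And>x. w x \<le> M" using nn by auto
  define MW where "MW x = max_loc \<rho> A w x + max_theta_pow \<rho> \<theta> 1 w x" for x
  have MWm[measurable]: "MW \<in> \<M>" unfolding MW_def[abs_def] max_theta_pow_def
   using max_theta_measurable[of \<rho> \<theta> "\<lambda>z. z powr 1" w] max_loc_measurable[of \<rho> A w] by (intro borel_measurable_add)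
  have MWf: "MW x < \<infinity>" for x unfolding MW_def max_theta_pow_def
   using max_theta_finite[of "\<lambda>z. z powr 1" w M \<rho> \<theta> x, OF y1 w rho_pos \<theta>] max_loc_finite[of A w M \<rho> x, OF yA w] by simp
  define W where "W x = enn2real (MW x)" for x
  have W: "MW x = ennreal (W x)" for x unfolding W_def using MWf[of x] by simp
  have W0: "0 \<le> W x" for x by (simp add: W_def)
  have Wm[measurable]: "W \<in> \<M>" unfolding W_def[abs_def] by measurable
  define X where "X = (NR x. f x powr p * W x)"
  define Y where "Y = (NR x. h x powr t)"
  have Wt: "max_theta \<rho> \<theta> (\<lambda>z. z powr 1) w x \<le> ennreal (W x)" for x
   unfolding W[symmetric] by (simp add: MW_def max_theta_pow_def)
  have Wl: "max_loc \<rho> A w x \<le> ennreal (W x)" for x unfolding W[symmetric] by (simp add: MW_def)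
  have adm: "admissible \<rho> \<theta> s t h f (\<lambda>_. 1) w (\<lambda>_. 1) W"
   by (rule admissible_right[OF rho_pos \<theta> ts hm fm wm Wm _ Wt]) (use nn W0 in auto)
  have loc: "controls \<rho> A w W" unfolding controls_def
   using luxemburg_le_max_loc Wl by (metis order_trans)
  have bd: "\<forall>x. 0 \<le> f x \<and> f x \<le> M \<and> 0 \<le> h x \<and> h x \<le> M \<and> 0 \<le> w x \<and> w x \<le> M \<and> 0 \<le> W x"
   using nn W0 by auto
  obtain G where G: "G \<in> \<M>"
   "(NN x. G x) + (NR x. f x * (h x * w x powr (1 / p))) \<le> ennreal D2 * (X + Y)"
   "product_bound (\<lambda>x r. r \<le> \<rho> x) f (\<lambda>y. h y * w y powr (1 / p)) G"
   using D2(2)[unfolded two_weight_bound_def, rule_format, OF fm hm wm Wm bd[rule_format] loc] unfolding X_def Y_def t_def by auto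
  have avg: "product_bound (\<lambda>x r. r \<le> \<rho> x) (\<lambda>y. norm (F y)) f G"
   using G(3) Fh by (simp add: product_bound_def mult.commute)
  have eq: "norm (F x) * f x = f x * (h x * w x powr (1 / p))" for x using Fh by simp
  have "(NR x. norm (T F x) * f x) \<le> ennreal D1 * ((NN x. G x)
    + (NR x. norm (F x) * f x)
   + (NR x. h x powr t * 1) + (NR x. f x powr p * W x))"
   by (rule core[OF F adm fm _ G(1) Fh[rule_format] _ avg]) (use nn in auto)
  also have "\<dots> \<le> ennreal D1 * (ennreal D2 * (X + Y) + (X + Y))"
   using G(2) unfolding X_def[symmetric] eq by (intro mult_left_mono) (auto simp: Y_def[symmetric] add.assoc add.commute[of X] intro!: add_mono)
  also have "\<dots> = ennreal (D1 * (D2 + 1)) * (X + Y)"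
   using D1(1) D2(1) by (simp add: ennreal_mult distrib_right mult.assoc)
  also have "X = (NN x. ennreal (f x powr p) * (max_loc \<rho> A w x + max_theta_pow \<rho> \<theta> 1 w x))"
   unfolding X_def MW_def[symmetric] W using W0 by (intro nn_integral_cong) (simp add: ennreal_mult)
  finally show "(NR x. norm (T F x) * f x) \<le> ennreal (D1 * (D2 + 1)) *
   ((NN x. ennreal (f x powr p) * (max_loc \<rho> A w x + max_theta_pow \<rho> \<theta> 1 w x)) + (NR x. h x powr (p / (p - 1))))"
   unfolding Y_def t_def .
 qed
qed

text \<open>Duality asks only for pairings with truncated weights \<open>v \<le> w\<close>, for
  which the bilinear estimate is available; as the maximal function is monotone, the bound for
  \<open>v\<close> is at most the one for \<open>w\<close>.\<close>

lemma forward_inequality: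
 assumes p: "1 < p" "p < s"
 shows "\<exists>C::real. \<forall>w f. weight w \<and> f \<in> Lp q UNIV \<longrightarrow>
   (NR x. norm (T f x) powr p * w x)
    \<le> ennreal C * (NN x. ennreal (norm (f x) powr p) * max_theta_pow \<rho> \<theta> (conj_exp (s / p)) w x)"
proof -
 have q0: "0 < q" using q by simp
 have r: "1 \<le> conj_exp (s / p)" using p by (simp add: conj_exp_def field_simps)
 have yr: "young_function (\<lambda>z. z powr conj_exp (s / p))" by (rule young_function_powr[OF r])
 obtain D where D: "0 \<le> D" "forward_bound p D"
  using forward_bilinear[OF p] by (elim exE conjE) (rule that)
 obtain C where C: "0 \<le> C" "\<forall>(S :: 'a \<Rightarrow> real) w \<Phi>. S \<in> \<M> \<longrightarrow> w \<in> \<M> \<longrightarrow> (\<forall>x. 0 \<le> S x \<and> 0 \<le> w x) \<longrightarrow>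
  pairing_bound p D S w \<Phi> \<longrightarrow>
  (NR x. S x powr p * w x) \<le> ennreal C * \<Phi>"
  using duality_bound[OF p(1) D(1)] by (elim exE conjE) (rule that)
 show ?thesis
 proof (intro exI[of _ C] allI impI, elim conjE)
  fix w :: "'a \<Rightarrow> real" and f :: "'a \<Rightarrow> complex" assume w: "weight w" and f: "f \<in> Lp q UNIV"
  have w0: "0 \<le> w x" for x using w by (simp add: weight_def)
  have wm[measurable]: "w \<in> \<M>" by (rule weight_measurable[OF w])
  have Sm: "(\<lambda>x. norm (T f x)) \<in> \<M>" using bounded_operator_measurable[OF T f] by measurable
  show "(NR x. norm (T f x) powr p * w x)
    \<le> ennreal C * (NN x. ennreal (norm (f x) powr p) * max_theta_pow \<rho> \<theta> (conj_exp (s / p)) w x)"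
  proof (rule C(2)[rule_format, OF Sm wm]; (unfold pairing_bound_def, intro allI impI)?)
   fix h :: "'a \<Rightarrow> real" and M B :: real
   assume hm[measurable]: "h \<in> \<M>" and M: "0 \<le> M" and h: "\<forall>x. 0 \<le> h x \<and> h x \<le> B" "\<forall>x. M < norm x \<longrightarrow> h x = 0"
   define v where "v x = min (w x) M" for x
   have v: "0 \<le> v x" "v x \<le> M" "v x \<le> w x" for x using w0 M by (auto simp: v_def)
   have vm[measurable]: "v \<in> \<M>" unfolding v_def[abs_def] by measurable
   have gm: "(\<lambda>x. h x * v x powr (1 / p)) \<in> \<M>" by measurable
   show "(NR x. norm (T f x) * (h x * min (w x) M powr (1 / p)))
    \<le> ennreal D * ((NN x. ennreal (norm (f x) powr p) * max_theta_pow \<rho> \<theta> (conj_exp (s / p)) w x) + (NR x. h x powr (p / (p - 1))))"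
    unfolding v_def[symmetric]
   proof (rule bounded_pairing_extend[OF T q gm _ _ _ M f])
    show "0 \<le> h x * v x powr (1 / p)" for x using h(1) by simp
    show "h x * v x powr (1 / p) \<le> \<bar>B\<bar> * M powr (1 / p)" for x
     using h(1)[rule_format, of x] v[of x] p by (intro mult_mono powr_mono2) auto
    show "h x * v x powr (1 / p) = 0" if "M < norm x" for x using h(2) that by simp
    fix n :: nat
    define E where "E = {x. norm x \<le> real n \<and> norm (f x) \<le> real n}"
    have fE: "cut E f \<in> bcs" unfolding E_def by (rule cut_bcs_Lp(2)[OF f q0])
    have "(NR x. norm (T (cut E f) x) * (h x * v x powr (1 / p))) \<le> ennreal D *
     ((NN x. ennreal (norm (cut E f x) powr p) * max_theta_pow \<rho> \<theta> (conj_exp (s / p)) v x) + (NR x. h x powr (p / (p - 1))))"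
     by (rule D(2)[unfolded forward_bound_def, rule_format, OF fE hm vm, of "max B M"]) (use h v in \<open>auto simp: le_max_iff_disj\<close>)
    also have "\<dots> \<le> ennreal D * ((NN x. ennreal (norm (f x) powr p) * max_theta_pow \<rho> \<theta> (conj_exp (s / p)) w x) + (NR x. h x powr (p / (p - 1))))"
    proof (intro mult_left_mono add_mono order_refl nn_integral_mono mult_mono)
     show "ennreal (norm (cut E f x) powr p) \<le> ennreal (norm (f x) powr p)" for x by simp
     show "max_theta_pow \<rho> \<theta> (conj_exp (s / p)) v x \<le> max_theta_pow \<rho> \<theta> (conj_exp (s / p)) w x" for x
      unfolding max_theta_pow_def by (rule max_theta_mono[OF yr v(1,3)])
    qed auto
    finally show "(NR x. norm (T (cut {x. norm x \<le> real n \<and> norm (f x) \<le> real n} f) x) * (h x * v x powr (1 / p)))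
     \<le> ennreal D * ((NN x. ennreal (norm (f x) powr p) * max_theta_pow \<rho> \<theta> (conj_exp (s / p)) w x) + (NR x. h x powr (p / (p - 1))))"
     unfolding E_def .
   qed
  qed (use w0 in auto)
 qed
qed

text \<open>The pairing is moved to \<open>T\<close> on a test function of modulus
  \<open>h v powr (1 / p)\<close>. Here \<open>f\<close> is the factor that may be unbounded; it is
  cut in height and radius for the bilinear estimate and recovered by monotone convergence.\<close>

lemma backward_inequality:
 assumes adj: "is_adjoint q T Tstar" and p: "conj_exp s < p" and A: "A \<in> class_D p"
 shows "\<exists>C::real. \<forall>w f. weight w \<and> f \<in> Lp (conj_exp q) UNIV \<longrightarrow>
   (NR x. norm (Tstar f x) powr p * w x)
    \<le> ennreal C * (NN x. ennreal (norm (f x) powr p) * (max_loc \<rho> A w x + max_theta_pow \<rho> \<theta> 1 w x))"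
proof -
 have q0: "0 < q" using q by simp
 have p1: "1 < p" using p s by (simp add: conj_exp_def less_divide_eq) (smt (verit) divide_le_eq_1)
 have yA: "young_function A" using A by (simp add: class_D_def)
 have y1: "young_function (\<lambda>z. z powr 1)" by (intro young_function_powr) simp
 obtain D where D: "0 \<le> D" "backward_bound p A D"
  using backward_bilinear[OF p A] by (elim exE conjE) (rule that)
 obtain C where C: "0 \<le> C" "\<forall>(S :: 'a \<Rightarrow> real) w \<Phi>. S \<in> \<M> \<longrightarrow> w \<in> \<M> \<longrightarrow> (\<forall>x. 0 \<le> S x \<and> 0 \<le> w x) \<longrightarrow>
  pairing_bound p D S w \<Phi> \<longrightarrow>
  (NR x. S x powr p * w x) \<le> ennreal C * \<Phi>"
  using duality_bound[OF p1 D(1)] by (elim exE conjE) (rule that)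
 show ?thesis
 proof (intro exI[of _ C] allI impI, elim conjE)
  fix w :: "'a \<Rightarrow> real" and f :: "'a \<Rightarrow> complex" assume w: "weight w" and f: "f \<in> Lp (conj_exp q) UNIV"
  define MW where "MW x = max_loc \<rho> A w x + max_theta_pow \<rho> \<theta> 1 w x" for x
  have w0: "0 \<le> w x" for x using w by (simp add: weight_def)
  have wm[measurable]: "w \<in> \<M>" by (rule weight_measurable[OF w])
  have fm[measurable]: "f \<in> \<M>" by (rule Lp_measurable[OF f])
  have "Tstar f \<in> Lp (conj_exp q) UNIV" using adj f unfolding is_adjoint_def by blast
  then have Tm[measurable]: "Tstar f \<in> \<M>" by (rule Lp_measurable)
  then have Sm: "(\<lambda>x. norm (Tstar f x)) \<in> \<M>" by measurable
  have "(NR x. norm (Tstar f x) powr p * w x)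
    \<le> ennreal C * (NN x. ennreal (norm (f x) powr p) * MW x)"
  proof (rule C(2)[rule_format, OF Sm wm]; (unfold pairing_bound_def, intro allI impI)?)
   fix h :: "'a \<Rightarrow> real" and M B :: real
   assume hm[measurable]: "h \<in> \<M>" and M: "0 \<le> M" and h: "\<forall>x. 0 \<le> h x \<and> h x \<le> B" "\<forall>x. M < norm x \<longrightarrow> h x = 0"
   define v where "v x = min (w x) M" for x
   have v: "0 \<le> v x" "v x \<le> M" "v x \<le> w x" for x using w0 M by (auto simp: v_def)
   have vm[measurable]: "v \<in> \<M>" unfolding v_def[abs_def] by measurable
   have gm: "(\<lambda>x. h x * v x powr (1 / p)) \<in> \<M>" by measurable
   have gb: "0 \<le> h x * v x powr (1 / p)" "h x * v x powr (1 / p) \<le> \<bar>B\<bar> * M powr (1 / p)" for x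
   proof -
    show "0 \<le> h x * v x powr (1 / p)" using h(1) by simp
    show "h x * v x powr (1 / p) \<le> \<bar>B\<bar> * M powr (1 / p)"
     using h(1)[rule_format, of x] v[of x] p1 by (intro mult_mono powr_mono2) auto
   qed
   have gs: "h x * v x powr (1 / p) = 0" if "M < norm x" for x using h(2) that by simp
   obtain F where F: "F \<in> bcs" "\<And>x. norm (F x) = h x * v x powr (1 / p)"
    "(NR x. norm (Tstar f x) * (h x * v x powr (1 / p))) \<le> (NR x. norm (T F x) * norm (f x))"
    by (rule adjoint_pairing[OF adj q T f gm gb]) (erule gs, rule that)
   have TFm[measurable]: "T F \<in> \<M>" by (rule bounded_operator_measurable[OF T bcs_Lp[OF F(1) q0]])
   note F(3)
   also have "(NR x. norm (T F x) * norm (f x))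
    \<le> ennreal D * ((NN x. ennreal (norm (f x) powr p) * MW x) + (NR x. h x powr (p / (p - 1))))"
   proof (rule nn_integral_monotone_cut[of _ f])
    fix n :: nat
    define E where "E = {x. norm x \<le> real n \<and> norm (f x) \<le> real n}"
    have fE: "cut E (\<lambda>x. norm (f x)) \<in> \<M>"
    proof -
     have [measurable]: "E \<in> \<L>" unfolding E_def using fm q by (intro cut_bcs_Lp(1)[OF f]) (simp add: conj_exp_def)
     show ?thesis by measurable
    qed
    have "(NR x\<in>E. norm (T F x) * norm (f x)) = (NR x. norm (T F x) * cut E (\<lambda>x. norm (f x)) x)"
     by (intro nn_integral_cong) auto
    also have "\<dots> \<le> ennreal D * ((NN x. ennreal (cut E (\<lambda>x. norm (f x)) x powr p) * (max_loc \<rho> A v x + max_theta_pow \<rho> \<theta> 1 v x)) + (NR x. h x powr (p / (p - 1))))"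
     by (rule D(2)[unfolded backward_bound_def, rule_format, OF F(1) fE hm vm _ F(2), of "max (real n) (max B M)"]) (use h v in \<open>auto simp: le_max_iff_disj E_def\<close>)
    also have "\<dots> \<le> ennreal D * ((NN x. ennreal (norm (f x) powr p) * MW x) + (NR x. h x powr (p / (p - 1))))"
    proof (intro mult_left_mono add_mono order_refl nn_integral_mono mult_mono)
     show "ennreal (cut E (\<lambda>x. norm (f x)) x powr p) \<le> ennreal (norm (f x) powr p)" for x by simp
     show "max_loc \<rho> A v x + max_theta_pow \<rho> \<theta> 1 v x \<le> MW x" for x
      unfolding MW_def max_theta_pow_def by (rule add_mono[OF max_loc_mono[OF yA v(1,3)] max_theta_mono[OF y1 v(1,3)]])
    qed auto
    finally show "(NR x\<in>{x. norm x \<le> real n \<and> norm (f x) \<le> real n}. norm (T F x) * norm (f x))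
     \<le> ennreal D * ((NN x. ennreal (norm (f x) powr p) * MW x) + (NR x. h x powr (p / (p - 1))))"
     unfolding E_def .
   qed measurable
   finally show "(NR x. norm (Tstar f x) * (h x * min (w x) M powr (1 / p)))
    \<le> ennreal D * ((NN x. ennreal (norm (f x) powr p) * MW x) + (NR x. h x powr (p / (p - 1))))"
    unfolding v_def .
  qed (use w0 in auto)
  then show "(NR x. norm (Tstar f x) powr p * w x)
    \<le> ennreal C * (NN x. ennreal (norm (f x) powr p) * (max_loc \<rho> A w x + max_theta_pow \<rho> \<theta> 1 w x))"
   unfolding MW_def .
 qed
qed

end

theorem theorem3:
  fixes \<rho> :: "'a::euclidean_space \<Rightarrow> real"
    and T :: "('a \<Rightarrow> complex) \<Rightarrow> ('a \<Rightarrow> complex)"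
    and K :: "'a \<Rightarrow> 'a \<Rightarrow> complex"
    and q s \<theta> :: real
  assumes "critical_radius_function \<rho>"
    and "1 < q" and "bounded_operator q T" and "has_kernel T K"
    and "1 < s"
    and "kernel_decay \<rho> s K"
    and "\<exists>T0 K0. calderon_zygmund T0 K0 \<and> kernel_close \<rho> s K K0"
    and "0 \<le> \<theta>"
  shows "(\<forall>p. 1 < p \<and> p < s \<longrightarrow>
            (\<exists>C::real. \<forall>w f. weight w \<and> f \<in> Lp q UNIV \<longrightarrow>
               (\<integral>\<^sup>+x. ennreal (norm (T f x) powr p * w x) \<partial>lebesgue)
                 \<le> ennreal C * (\<integral>\<^sup>+x. ennreal (norm (f x) powr p)
                      * max_theta_pow \<rho> \<theta> (conj_exp (s / p)) w x \<partial>lebesgue)))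
       \<and> (\<forall>Tstar. is_adjoint q T Tstar \<longrightarrow>
           (\<forall>p A. conj_exp s < p \<and> A \<in> class_D p \<longrightarrow>
            (\<exists>C::real. \<forall>w f. weight w \<and> f \<in> Lp (conj_exp q) UNIV \<longrightarrow>
               (\<integral>\<^sup>+x. ennreal (norm (Tstar f x) powr p * w x) \<partial>lebesgue)
                 \<le> ennreal C * (\<integral>\<^sup>+x. ennreal (norm (f x) powr p)
                      * (max_loc \<rho> A w x + max_theta_pow \<rho> \<theta> 1 w x) \<partial>lebesgue))))"
proof -
 obtain T0 K0 where cz: "calderon_zygmund T0 K0" and close: "kernel_close \<rho> s K K0" using assms(7) by blast
 interpret critical_operator \<rho> T T0 K K0 q s \<theta>
  by unfold_locales (rule assms(1-6,8) cz close)+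
 show ?thesis
 proof (intro conjI allI impI; (elim conjE)?)
  fix p assume "1 < p" "p < s"
  then show "\<exists>C::real. \<forall>w f. weight w \<and> f \<in> Lp q UNIV \<longrightarrow>
        (NR x. norm (T f x) powr p * w x)
         \<le> ennreal C * (NN x. ennreal (norm (f x) powr p)
           * max_theta_pow \<rho> \<theta> (conj_exp (s / p)) w x)"
   by (rule forward_inequality)
 next
  fix Tstar p A assume "is_adjoint q T Tstar" "conj_exp s < p" "A \<in> class_D p"
  then show "\<exists>C::real. \<forall>w f. weight w \<and> f \<in> Lp (conj_exp q) UNIV \<longrightarrow>
        (NR x. norm (Tstar f x) powr p * w x)
         \<le> ennreal C * (NN x. ennreal (norm (f x) powr p)
           * (max_loc \<rho> A w x + max_theta_pow \<rho> \<theta> 1 w x))"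
   by (rule backward_inequality)
 qed
qed

end
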